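(* Let $n\ge1$, $\omega=1$, $\nu\in\mathbb{N}^n\setminus\{0\}$ and $V\in C^\infty(\mathbb{T}\times\mathbb{T}^n;\mathbb{R}^n)$. Suppose that the vector field $\langle V\rangle_\nu$ on $\mathbb{T}^n$ defined by $$\langle V\rangle_\nu(x):=\frac1{2\pi}\int_0^{2\pi}V(\tau,x-\tau\nu)\,d\tau,\qquad x\in\mathbb{T}^n,$$ is Morse-Smale and, if $n=1$, suppose in addition that $\langle V\rangle_\nu$ has at least one critical point. Then there exists $\delta_0>0$ such that, for every $0\le\sigma\le\delta_0$ and for every $0\le\varepsilon\le\delta_0\sigma^2$, one can find $v_\varepsilon\in\mathcal{H}^\sigma(\mathbb{T}^n)$ and $r=r(\varepsilon,\sigma,v_\varepsilon)>0$ such that $$\|u_\varepsilon(0)-v_\varepsilon\|_\sigma\le r\quad\Longrightarrow\quad\|u_\varepsilon(t)\|_\sigma\ge\delta_0e^{\delta_0\sigma t\varepsilon}\|u_\varepsilon(0)\|_\sigma\quad\text{for any }t>0,$$ where $u_\varepsilon(t)$ is the solution, with initial datum $u_\varepsilon(0)$, of $$\partial_tu_\varepsilon=\big(\nu+\varepsilon V(t,x)\big)\cdot\nabla_xu_\varepsilon+\frac{\varepsilon}{2}\,\mathrm{div}_x(V(t,x))\,u_\varepsilon,\qquad x\in\mathbb{T}^n,\ t\in\mathbb{R}.$$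
   Context: $\mathbb{T}:=\mathbb{R}/2\pi\mathbb{Z}$, and $\mathbb{T}^n$ carries the flat Euclidean metric and volume; $V=V(t,x)$ is a $2\pi$-periodic time-dependent vector field on $\mathbb{T}^n$ and $\mathrm{div}_x$ is the divergence in $x$. $\mathbb{N}$ contains $0$. For $\sigma\in\mathbb{R}$, $\mathcal{H}^\sigma(\mathbb{T}^n)$ is the $L^2$-based complex-valued Sobolev space with norm $\|u\|_\sigma:=\|(1-\Delta)^{\sigma/2}u\|_{L^2(\mathbb{T}^n)}$. For every $u_\varepsilon(0)\in\mathcal{H}^\sigma$, $\sigma\ge0$, the equation has a unique global solution in $C^0(\mathbb{R};\mathcal{H}^\sigma)$. Morse-Smale vector fields. Let $X$ be a smooth vector field on a compact manifold $M$ and $\varphi^t_X$ its flow. A critical point is a point $\Lambda$ with $X(\Lambda)=0$; it is hyperbolic if all eigenvalues of $dX(\Lambda)$ have nonzero real part. A closed orbit is $\Lambda=\{\varphi^t_X(x_0):0\le t\le T_0\}$ with $X(x_0)\ne0$ and $\varphi^{T_0}_X(x_0)=x_0$, $T_0>0$ (the period); it is hyperbolic if $d\varphi^{T_0}_X(x_0)$ has $1$ as a simple eigenvalue and no other eigenvalue of modulus $1$. Critical elements are critical points and closed orbits. For $x\in M$, $\alpha(x)=\bigcap_{T\le0}\overline{\{\varphi^t_X(x):t\le T\}}$ and $\omega(x)=\bigcap_{T\ge0}\overline{\{\varphi^t_X(x):t\ge T\}}$; for a closed invariant set $K$, $W^s(K)=\{x:\omega(x)\subset K\}$ and $W^u(K)=\{x:\alpha(x)\subset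 K\}$. A point $x$ is wandering if there are an open neighborhood $\mathcal{O}$ of $x$ and $T_x>0$ with $\mathcal{O}\cap\bigcup_{|t|>T_x}\varphi^t_X(\mathcal{O})=\emptyset$; $\mathrm{NW}(X)$ is the set of non-wandering points. $X$ is Morse-Smale if: (1) it has finitely many critical elements, all hyperbolic; (2) for any pair $\Lambda_1,\Lambda_2$ of critical elements, $W^s(\Lambda_1)$ and $W^u(\Lambda_2)$ intersect transversally; (3) $\mathrm{NW}(X)$ is the union of the critical elements of $X$. *)

theory Defs
  imports
    "HOL-Analysis.Analysis"
    "HOL-Computational_Algebra.Polynomial"
begin

section \<open>The torus\<close>

quotient_type circle = real / "\<lambda>x y. \<exists>k::int. y = x + 2 * pi * real_of_int k"
proof (rule equivpI)
  show "reflp (\<lambda>x y. \<exists>k::int. y = x + 2 * pi * real_of_int k)"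
    by (rule reflpI, rule exI[of _ 0]) simp
  show "symp (\<lambda>x y. \<exists>k::int. y = x + 2 * pi * real_of_int k)"
  proof (rule sympI)
    fix x y :: real
    assume "\<exists>k::int. y = x + 2 * pi * real_of_int k"
    then obtain k :: int where "y = x + 2 * pi * real_of_int k" ..
    then have "x = y + 2 * pi * real_of_int (- k)" by simp
    then show "\<exists>k::int. x = y + 2 * pi * real_of_int k" ..
  qed
  show "transp (\<lambda>x y. \<exists>k::int. y = x + 2 * pi * real_of_int k)"
  proof (rule transpI)
    fix x y z :: real
    assume "\<exists>k::int. y = x + 2 * pi * real_of_int k" "\<exists>k::int. z = y + 2 * pi * real_of_int k"
    then obtain k l :: int where
      "y = x + 2 * pi * real_of_int k" "z = y + 2 * pi * real_of_int l" by blast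
    then have "z = x + 2 * pi * real_of_int (k + l)" by (simp add: algebra_simps)
    then show "\<exists>k::int. z = x + 2 * pi * real_of_int k" ..
  qed
qed

instantiation circle :: topological_space
begin

definition open_circle :: "circle set \<Rightarrow> bool" where
  "open_circle U \<longleftrightarrow> open (abs_circle -` U)"

instance
proof
  show "open (UNIV :: circle set)"
    by (simp add: open_circle_def)
  show "open (S \<inter> T)" if "open S" "open T" for S T :: "circle set"
    using that by (auto simp: open_circle_def vimage_Int)
  show "open (\<Union>K)" if "\<forall>S\<in>K. open S" for K :: "circle set set"
    using that by (auto simp: open_circle_def vimage_Union)
qed

end

type_synonym 'n torus = "circle ^ 'n"

definition torus_proj :: "real ^ 'n \<Rightarrow> 'n torus" where
  "torus_proj x = (\<chi> i. abs_circle (x $ i))"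

text \<open>
  Functions on the torus are represented by their periodic lifts to the universal cover, and
  tangent spaces are identified with the cover by translation.  Sets of points of the torus,
  and all topological notions for them, live on the quotient itself.
\<close>

definition periodic :: "(real ^ 'n \<Rightarrow> 'b) \<Rightarrow> bool" where
  "periodic f \<longleftrightarrow> (\<forall>x i. f (x + axis i (2 * pi)) = f x)"

fun Ck :: "nat \<Rightarrow> ('a::real_normed_vector \<Rightarrow> 'b::real_normed_vector) \<Rightarrow> bool" where
  "Ck 0 f \<longleftrightarrow> continuous_on UNIV f"
| "Ck (Suc k) f \<longleftrightarrow>
     (\<forall>x. f differentiable (at x)) \<and> (\<forall>v. Ck k (\<lambda>x. frechet_derivative f (at x) v))"

definition smooth :: "('a::real_normed_vector \<Rightarrow> 'b::real_normed_vector) \<Rightarrow> bool" where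
  "smooth f \<longleftrightarrow> (\<forall>k. Ck k f)"


section \<open>Flows on the torus\<close>

definition lifted_flow :: "(real ^ 'n \<Rightarrow> real ^ 'n) \<Rightarrow> real \<Rightarrow> real ^ 'n \<Rightarrow> real ^ 'n" where
  "lifted_flow X t x =
     (THE y. \<exists>\<gamma>. \<gamma> 0 = x \<and> (\<forall>s. (\<gamma> has_vector_derivative X (\<gamma> s)) (at s)) \<and> \<gamma> t = y)"

text \<open>For a periodic field the choice of the preimage is immaterial.\<close>

definition torus_flow :: "(real ^ 'n \<Rightarrow> real ^ 'n) \<Rightarrow> real \<Rightarrow> 'n torus \<Rightarrow> 'n torus" where
  "torus_flow X t p = torus_proj (lifted_flow X t (SOME x. torus_proj x = p))"

definition alpha_limit :: "(real \<Rightarrow> 'a::topological_space \<Rightarrow> 'a) \<Rightarrow> 'a \<Rightarrow> 'a set" where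
  "alpha_limit \<phi> x = (\<Inter>T\<in>{..0}. closure {\<phi> t x | t. t \<le> T})"

definition omega_limit :: "(real \<Rightarrow> 'a::topological_space \<Rightarrow> 'a) \<Rightarrow> 'a \<Rightarrow> 'a set" where
  "omega_limit \<phi> x = (\<Inter>T\<in>{0..}. closure {\<phi> t x | t. t \<ge> T})"

definition stable_set :: "(real \<Rightarrow> 'a::topological_space \<Rightarrow> 'a) \<Rightarrow> 'a set \<Rightarrow> 'a set" where
  "stable_set \<phi> K = {x. omega_limit \<phi> x \<subseteq> K}"

definition unstable_set :: "(real \<Rightarrow> 'a::topological_space \<Rightarrow> 'a) \<Rightarrow> 'a set \<Rightarrow> 'a set" where
  "unstable_set \<phi> K = {x. alpha_limit \<phi> x \<subseteq> K}"

definition wandering :: "(real \<Rightarrow> 'a::topological_space \<Rightarrow> 'a) \<Rightarrow> 'a \<Rightarrow> bool" where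
  "wandering \<phi> x \<longleftrightarrow>
     (\<exists>U T. open U \<and> x \<in> U \<and> T > 0 \<and> U \<inter> (\<Union>t\<in>{t. \<bar>t\<bar> > T}. \<phi> t ` U) = {})"

definition nonwandering_set :: "(real \<Rightarrow> 'a::topological_space \<Rightarrow> 'a) \<Rightarrow> 'a set" where
  "nonwandering_set \<phi> = {x. \<not> wandering \<phi> x}"


section \<open>Hyperbolic critical elements\<close>

definition jacobian :: "(real ^ 'n \<Rightarrow> real ^ 'n) \<Rightarrow> real ^ 'n \<Rightarrow> complex ^ 'n ^ 'n" where
  "jacobian f x = map_matrix complex_of_real (matrix (frechet_derivative f (at x)))"

definition is_eigenvalue :: "complex ^ 'n ^ 'n \<Rightarrow> complex \<Rightarrow> bool" where
  "is_eigenvalue A \<mu> \<longleftrightarrow> (\<exists>v. v \<noteq> 0 \<and> A *v v = \<mu> *s v)"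

definition charpoly :: "complex ^ 'n ^ 'n \<Rightarrow> complex poly" where
  "charpoly A = det (\<chi> i j. (if i = j then [:0, 1:] else 0) - [:A $ i $ j:])"

definition simple_eigenvalue :: "complex ^ 'n ^ 'n \<Rightarrow> complex \<Rightarrow> bool" where
  "simple_eigenvalue A \<mu> \<longleftrightarrow> order \<mu> (charpoly A) = 1"

definition critical_point :: "(real ^ 'n \<Rightarrow> real ^ 'n) \<Rightarrow> 'n torus set \<Rightarrow> real ^ 'n \<Rightarrow> bool" where
  "critical_point X \<Lambda> x \<longleftrightarrow> X x = 0 \<and> \<Lambda> = {torus_proj x}"

definition closed_orbit ::
    "(real ^ 'n \<Rightarrow> real ^ 'n) \<Rightarrow> 'n torus set \<Rightarrow> real ^ 'n \<Rightarrow> real \<Rightarrow> bool" where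
  "closed_orbit X \<Lambda> x T \<longleftrightarrow>
     X x \<noteq> 0 \<and> T > 0 \<and> torus_flow X T (torus_proj x) = torus_proj x \<and>
     \<Lambda> = (\<lambda>t. torus_flow X t (torus_proj x)) ` {0..T}"

definition critical_element :: "(real ^ 'n \<Rightarrow> real ^ 'n) \<Rightarrow> 'n torus set \<Rightarrow> bool" where
  "critical_element X \<Lambda> \<longleftrightarrow> (\<exists>x. critical_point X \<Lambda> x) \<or> (\<exists>x T. closed_orbit X \<Lambda> x T)"

text \<open>
  The conditions do not depend on the lift \<open>x\<close>, on the base point of the orbit, or on the
  choice of \<open>T\<close> among the multiples of the minimal period.
\<close>

definition hyperbolic_element :: "(real ^ 'n \<Rightarrow> real ^ 'n) \<Rightarrow> 'n torus set \<Rightarrow> bool" where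
  "hyperbolic_element X \<Lambda> \<longleftrightarrow>
     (\<exists>x. critical_point X \<Lambda> x \<and> (\<forall>\<mu>. is_eigenvalue (jacobian X x) \<mu> \<longrightarrow> Re \<mu> \<noteq> 0)) \<or>
     (\<exists>x T. closed_orbit X \<Lambda> x T \<and>
        simple_eigenvalue (jacobian (lifted_flow X T) x) 1 \<and>
        (\<forall>\<mu>. is_eigenvalue (jacobian (lifted_flow X T) x) \<mu> \<and> \<mu> \<noteq> 1 \<longrightarrow> cmod \<mu> \<noteq> 1))"


section \<open>Morse-Smale vector fields\<close>

text \<open>
  Stable and unstable sets of hyperbolic critical elements are immersed, a priori not embedded,
  submanifolds.  Their tangent vectors are the velocities of the \<open>C\<^sup>1\<close> curves of the torus that
  stay in the set and are continuous at the base point for the immersed topology.  The latter is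
  expressed by the last conjunct: the curve is attracted uniformly by the element, i.e. the flow
  carries a whole piece of it into any neighbourhood of the element, and hence into the (embedded)
  local stable manifold.
\<close>

definition stable_tangent ::
    "(real ^ 'n \<Rightarrow> real ^ 'n) \<Rightarrow> 'n torus set \<Rightarrow> real ^ 'n \<Rightarrow> (real ^ 'n) set" where
  "stable_tangent X \<Lambda> x =
     {v. \<exists>\<gamma> :: real \<Rightarrow> real ^ 'n. \<gamma> C1_differentiable_on UNIV \<and> \<gamma> 0 = x \<and>
         (\<gamma> has_vector_derivative v) (at 0) \<and>
         (\<forall>s. torus_proj (\<gamma> s) \<in> stable_set (torus_flow X) \<Lambda>) \<and>
         (\<forall>U. open U \<and> \<Lambda> \<subseteq> U \<longrightarrow> (\<exists>T. \<forall>\<^sub>F s in nhds 0. \<forall>t\<ge>T.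
            torus_flow X t (torus_proj (\<gamma> s)) \<in> U))}"

definition unstable_tangent ::
    "(real ^ 'n \<Rightarrow> real ^ 'n) \<Rightarrow> 'n torus set \<Rightarrow> real ^ 'n \<Rightarrow> (real ^ 'n) set" where
  "unstable_tangent X \<Lambda> x =
     {v. \<exists>\<gamma> :: real \<Rightarrow> real ^ 'n. \<gamma> C1_differentiable_on UNIV \<and> \<gamma> 0 = x \<and>
         (\<gamma> has_vector_derivative v) (at 0) \<and>
         (\<forall>s. torus_proj (\<gamma> s) \<in> unstable_set (torus_flow X) \<Lambda>) \<and>
         (\<forall>U. open U \<and> \<Lambda> \<subseteq> U \<longrightarrow> (\<exists>T. \<forall>\<^sub>F s in nhds 0. \<forall>t\<le>T.
            torus_flow X t (torus_proj (\<gamma> s)) \<in> U))}"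

definition transversal ::
    "(real ^ 'n \<Rightarrow> real ^ 'n) \<Rightarrow> 'n torus set \<Rightarrow> 'n torus set \<Rightarrow> bool" where
  "transversal X \<Lambda>1 \<Lambda>2 \<longleftrightarrow>
     (\<forall>x. torus_proj x \<in> stable_set (torus_flow X) \<Lambda>1 \<inter> unstable_set (torus_flow X) \<Lambda>2 \<longrightarrow>
        {a + b | a b. a \<in> stable_tangent X \<Lambda>1 x \<and> b \<in> unstable_tangent X \<Lambda>2 x} = UNIV)"

definition morse_smale :: "(real ^ 'n \<Rightarrow> real ^ 'n) \<Rightarrow> bool" where
  "morse_smale X \<longleftrightarrow>
     finite {\<Lambda>. critical_element X \<Lambda>} \<and>
     (\<forall>\<Lambda>. critical_element X \<Lambda> \<longrightarrow> hyperbolic_element X \<Lambda>) \<and>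
     (\<forall>\<Lambda>1 \<Lambda>2. critical_element X \<Lambda>1 \<and> critical_element X \<Lambda>2 \<longrightarrow> transversal X \<Lambda>1 \<Lambda>2) \<and>
     nonwandering_set (torus_flow X) = \<Union>{\<Lambda>. critical_element X \<Lambda>}"


section \<open>Sobolev spaces on the torus\<close>

definition cell :: "(real ^ 'n) set" where
  "cell = cbox 0 (\<chi> i. 2 * pi)"

definition L2_torus :: "(real ^ 'n \<Rightarrow> complex) set" where
  "L2_torus = {u. periodic u \<and> u \<in> borel_measurable lebesgue \<and>
                  set_integrable lebesgue cell (\<lambda>x. (cmod (u x))\<^sup>2)}"

definition L2_norm_torus :: "(real ^ 'n \<Rightarrow> complex) \<Rightarrow> real" where
  "L2_norm_torus u = sqrt (LINT x:cell|lebesgue. (cmod (u x))\<^sup>2)"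

definition frequency :: "int ^ 'n \<Rightarrow> real ^ 'n" where
  "frequency k = (\<chi> i. real_of_int (k $ i))"

definition fourier_coeff :: "(real ^ 'n \<Rightarrow> complex) \<Rightarrow> int ^ 'n \<Rightarrow> complex" where
  "fourier_coeff u k =
     (LINT x:cell|lebesgue. u x * cis (- (frequency k \<bullet> x))) / complex_of_real ((2 * pi) ^ CARD('n))"

text \<open>
  \<open>is_bessel \<sigma> u w\<close> says \<open>w = (1 - \<Delta>)\<^bsup>\<sigma>/2\<^esup> u\<close> with \<open>w\<close> square integrable: the character
  \<open>x \<mapsto> exp (\<i> k \<bullet> x)\<close> is an eigenfunction of \<open>1 - \<Delta>\<close> with eigenvalue \<open>1 + \<bar>k\<bar>\<^sup>2\<close>.  This
  determines \<open>w\<close> almost everywhere.  Only orders \<open>\<sigma> \<ge> 0\<close> are meant, for which the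
  elements of the Sobolev space are square integrable functions.
\<close>

definition is_bessel ::
    "real \<Rightarrow> (real ^ 'n \<Rightarrow> complex) \<Rightarrow> (real ^ 'n \<Rightarrow> complex) \<Rightarrow> bool" where
  "is_bessel \<sigma> u w \<longleftrightarrow> w \<in> L2_torus \<and>
     (\<forall>k. fourier_coeff w k =
            complex_of_real ((1 + (norm (frequency k))\<^sup>2) powr (\<sigma> / 2)) * fourier_coeff u k)"

definition sobolev :: "real \<Rightarrow> (real ^ 'n \<Rightarrow> complex) set" where
  "sobolev \<sigma> = {u \<in> L2_torus. \<exists>w. is_bessel \<sigma> u w}"

definition sobolev_norm :: "real \<Rightarrow> (real ^ 'n \<Rightarrow> complex) \<Rightarrow> real" where
  "sobolev_norm \<sigma> u = L2_norm_torus (SOME w. is_bessel \<sigma> u w)"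


section \<open>The transport equation\<close>

definition divergence :: "(real ^ 'n \<Rightarrow> real ^ 'n) \<Rightarrow> real ^ 'n \<Rightarrow> real" where
  "divergence X x = (\<Sum>i\<in>UNIV. frechet_derivative X (at x) (axis i 1) $ i)"

definition pairing :: "(real ^ 'n \<Rightarrow> complex) \<Rightarrow> (real ^ 'n \<Rightarrow> real) \<Rightarrow> complex" where
  "pairing u f = (LINT x:cell|lebesgue. u x * complex_of_real (f x))"

text \<open>
  Since \<open>u t\<close> need not be differentiable in space, the equation
  \<open>\<partial>\<^sub>t u = a(t,x) \<bullet> \<nabla>u + c(t,x) u\<close> is understood in the sense of distributions:
  tested against \<open>f\<close>, its right-hand side is \<open>u t\<close> paired with \<open>- div (f a) + c f\<close>.
\<close>

definition solves_transport ::
    "(real \<Rightarrow> real ^ 'n \<Rightarrow> real ^ 'n) \<Rightarrow> (real \<Rightarrow> real ^ 'n \<Rightarrow> real) \<Rightarrow>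
     (real \<Rightarrow> real ^ 'n \<Rightarrow> complex) \<Rightarrow> bool" where
  "solves_transport a c u \<longleftrightarrow>
     (\<forall>f t. smooth f \<and> periodic f \<longrightarrow>
        ((\<lambda>s. pairing (u s) f) has_vector_derivative
           pairing (u t) (\<lambda>x. - divergence (\<lambda>y. f y *\<^sub>R a t y) x + c t x * f x)) (at t))"

definition continuous_in_sobolev :: "real \<Rightarrow> (real \<Rightarrow> real ^ 'n \<Rightarrow> complex) \<Rightarrow> bool" where
  "continuous_in_sobolev \<sigma> u \<longleftrightarrow>
     (\<forall>t. u t \<in> sobolev \<sigma>) \<and>
     (\<forall>t. ((\<lambda>s. sobolev_norm \<sigma> (\<lambda>x. u s x - u t x)) \<longlongrightarrow> 0) (at t))"

definition nat_vec :: "nat ^ 'n \<Rightarrow> real ^ 'n" where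
  "nat_vec \<nu> = (\<chi> i. real (\<nu> $ i))"

definition is_solution ::
    "nat ^ 'n \<Rightarrow> (real \<Rightarrow> real ^ 'n \<Rightarrow> real ^ 'n) \<Rightarrow> real \<Rightarrow> real \<Rightarrow>
     (real \<Rightarrow> real ^ 'n \<Rightarrow> complex) \<Rightarrow> bool" where
  "is_solution \<nu> V \<epsilon> \<sigma> u \<longleftrightarrow>
     continuous_in_sobolev \<sigma> u \<and>
     solves_transport (\<lambda>t x. nat_vec \<nu> + \<epsilon> *\<^sub>R V t x) (\<lambda>t x. \<epsilon> / 2 * divergence (V t) x) u"

definition average ::
    "nat ^ 'n \<Rightarrow> (real \<Rightarrow> real ^ 'n \<Rightarrow> real ^ 'n) \<Rightarrow> real ^ 'n \<Rightarrow> real ^ 'n" where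
  "average \<nu> V x = (1 / (2 * pi)) *\<^sub>R integral {0..2 * pi} (\<lambda>\<tau>. V \<tau> (x - \<tau> *\<^sub>R nat_vec \<nu>))"

end

theory Submission
 imports Defs "HOL-Computational_Algebra.Fundamental_Theorem_Algebra"
begin

text \<open>
 The pairing of a solution \<open>u\<close> with a solution \<open>w\<close> of the adjoint equation is conserved, and \<open>w\<close> is
 transported explicitly along the characteristics \<open>y' = - (\<nu> + \<epsilon> V(t, y))\<close>.  In a moving frame these follow, up to
 errors of higher order, the flow of \<open>- \<epsilon> \<langle>V\<rangle>\<close>, which has an attracting hyperbolic critical point or closed
 orbit: otherwise each critical element would be unstable for it in some direction and attract only a meagre
 set of points, contrary to Baire, as every point is attracted by one of these finitely many elements.
 Let \<open>w\<close> start as a bump near that orbit.  The \<open>L\<^sup>2\<close> norm of \<open>w\<close> is conserved, but the volume of its support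
 and hence its \<open>L\<^sup>1\<close> norm decay like \<open>exp (- c \<epsilon> t)\<close>, so its norm of order \<open>- \<sigma>\<close> decays like
 \<open>exp (- c \<sigma> \<epsilon> t / n)\<close>.  The norm of \<open>u\<close> of order \<open>\<sigma>\<close> must grow accordingly, provided the initial
 pairing does not vanish; this is the case near the constant function \<open>1\<close>.
\<close>

section \<open>Ordinary differential equations\<close>

text \<open>Invariant manifolds are avoided. A convexity argument provides a quadratic form that
  increases strictly under the linearized return map, and two points whose iterates stay near the
  element can only differ in directions where the form is nonpositive. So either these points form a
  thin set, or the form is nowhere positive and the return map contracts. The return map itself
  needs no section: one flows for the period and then slides along the orbit by a time read off from
  a linear functional, which vanishes at critical points, so that these and closed orbits are a
  single case. Contraction of volume needs one eigenvalue of the monodromy different from 1. A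
  closed orbit filling the circle has none; this is the role of the critical point when n = 1. The
  L1 decay comes from the weight 1/2 of the divergence: the density with weight 1 has constant mass,
  and \<open>w\<close> is this density times the square root of a Jacobian that decays on the
  support of \<open>w\<close>. Since solutions are weak and \<open>w\<close> is only C1,
  conservation of the pairing is proved for mollified weights, by a kernel whose Fourier multipliers
  lie in [0, 1].\<close>

definition antider :: "(real => 'b::banach) => real => 'b" where
 "antider f t = (if 0 <= t then integral {0..t} f else - integral {t..0} f)"

lemma antider_0 [simp]: "antider f 0 = 0" by (simp add: antider_def)

lemma antider_has_vector_derivative:
 fixes f :: "real => 'b::banach"
 assumes "continuous_on UNIV f"
 shows "(antider f has_vector_derivative f t) (at t)"
proof -
 define m where "m = \<bar>t\<bar> + 1"
 have int: "f integrable_on {a..b}" for a b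
  by (intro integrable_continuous_interval continuous_on_subset[OF assms]) auto
 have eq: "integral {-m..s} f - integral {-m..0} f = antider f s" if "s \<in> {-m<..<m}" for s
 proof (cases "0 <= s")
  case True
  have "integral {-m..0} f + integral {0..s} f = integral {-m..s} f"
   using that True by (intro Henstock_Kurzweil_Integration.integral_combine int) (auto simp: m_def)
  then show ?thesis using True by (simp add: antider_def algebra_simps)
 next
  case False
  have "integral {-m..s} f + integral {s..0} f = integral {-m..0} f"
   using that False by (intro Henstock_Kurzweil_Integration.integral_combine int) (auto simp: m_def)
  then show ?thesis using False by (simp add: antider_def algebra_simps)
 qed
 have "((%s. integral {-m..s} f) has_vector_derivative f t) (at t within {-m..m})"
  by (rule integral_has_vector_derivative)
   (auto intro: continuous_on_subset[OF assms] simp: m_def)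
 then have "((%s. integral {-m..s} f) has_vector_derivative f t) (at t)"
  by (subst (asm) at_within_interior) (auto simp: m_def)
 then have "((%s. integral {-m..s} f - integral {-m..0} f) has_vector_derivative f t - 0) (at t)"
  by (intro derivative_intros)
 then have "((%s. integral {-m..s} f - integral {-m..0} f) has_vector_derivative f t) (at t)" by simp
 then show ?thesis by (rule has_vector_derivative_transform_within_open[where S="{-m<..<m}"])
   (auto simp: eq, auto simp: m_def)
qed

lemma continuous_on_antider:
 fixes f :: "real => 'b::banach"
 assumes "continuous_on UNIV f"
 shows "continuous_on UNIV (antider f)" by (meson antider_has_vector_derivative assms continuous_at_imp_continuous_on
   has_vector_derivative_continuous)

text \<open>Integration gains the factor \<open>1 / M\<close> against the weight
  \<open>exp (M * \<bar>t\<bar>)\<close>, in both time directions at once. This is the whole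
  contraction estimate for the Picard map.\<close>

lemma norm_antider_le_exp:
 fixes f :: "real => 'b::banach"
 assumes cont: "continuous_on UNIV f" and M: "M > 0"
  and le: "!!s. norm (f s) <= B * exp (M * \<bar>s\<bar>)"
 shows "norm (antider f t) <= B / M * exp (M * \<bar>t\<bar>)"
proof -
 have int: "f integrable_on {a..b}" for a b
  by (intro integrable_continuous_interval continuous_on_subset[OF cont]) auto
 have B: "B >= 0" using le[of 0] norm_ge_zero[of "f 0"] by (simp del: norm_ge_zero)
 show ?thesis
 proof (cases "0 <= t")
  case True
  have I: "((%s. B * exp (M * s)) has_integral B / M * exp (M * t) - B / M * exp (M * 0)) {0..t}"
   using True M by (intro fundamental_theorem_of_calculus)
    (auto intro!: derivative_eq_intros simp: has_real_derivative_iff_has_vector_derivative[symmetric])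
  have "norm (integral {0..t} f) <= B / M * exp (M * t) - B / M * exp (M * 0)"
  proof -
   have "norm (integral {0..t} f) <= integral {0..t} (%s. B * exp (M * s))"
    using le by (intro integral_norm_bound_integral int has_integral_integrable[OF I]) (metis abs_of_nonneg atLeastAtMost_iff)
   then show ?thesis unfolding integral_unique[OF I] .
  qed
  also have "... <= B / M * exp (M * t)" using B M by simp
  finally show ?thesis using True by (simp add: antider_def)
 next
  case False
  have I: "((%s. B * exp (- (M * s))) has_integral - (B / M) * exp (- (M * 0)) - (- (B / M) * exp (- (M * t)))) {t..0}"
   using False M by (intro fundamental_theorem_of_calculus)
    (auto intro!: derivative_eq_intros simp: has_real_derivative_iff_has_vector_derivative[symmetric])
  have "norm (integral {t..0} f) <= - (B / M) * exp (- (M * 0)) - (- (B / M) * exp (- (M * t)))"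
  proof -
   have "norm (f s) <= B * exp (- (M * s))" if "s \<in> {t..0}" for s
    using le[of s] that by (simp add: abs_if split: if_splits)
   then have "norm (integral {t..0} f) <= integral {t..0} (%s. B * exp (- (M * s)))"
    by (intro integral_norm_bound_integral int has_integral_integrable[OF I])
   then show ?thesis unfolding integral_unique[OF I] .
  qed
  also have "... <= B / M * exp (M * \<bar>t\<bar>)" using B M False by (simp add: abs_if)
  finally show ?thesis using False by (simp add: antider_def)
 qed
qed

lemma antider_diff:
 fixes f g :: "real => 'b::banach"
 assumes "continuous_on UNIV f" "continuous_on UNIV g"
 shows "antider (%s. f s - g s) t = antider f t - antider g t"
proof -
 have "f integrable_on {a..b}" "g integrable_on {a..b}" for a b
  by (intro integrable_continuous_interval continuous_on_subset[OF assms(1)]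
    continuous_on_subset[OF assms(2)]; auto)+
 then show ?thesis by (auto simp: antider_def Henstock_Kurzweil_Integration.integral_diff)
qed

lemma gronwall:
 fixes y :: "real => 'b::real_inner"
 assumes y: "!!s. 0 <= s ==> s <= t ==> (y has_vector_derivative y' s) (at s)"
  and le: "!!s. 0 <= s ==> s <= t ==> norm (y' s) <= L * norm (y s) + c"
  and "0 <= t" "0 <= L" "0 <= c"
 shows "norm (y t) <= exp (L * t) * (norm (y 0) + c * t)"
proof (rule field_le_epsilon)
 fix e :: real
 assume "e > 0"
 \<comment> \<open>The norm is not differentiable at zeros of \<open>y\<close>, so it is replaced by
   \<open>sqrt (y s \<bullet> y s + d\<^sup>2)\<close>; after multiplication by
   \<open>exp (L * t)\<close> the error \<open>d\<close> contributes exactly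
   \<open>e\<close>.\<close>
 define d where "d = e / exp (L * t)"
 have d: "d > 0" using \<open>e > 0\<close> by (simp add: d_def)
 define z where "z s = sqrt (y s \<bullet> y s + d\<^sup>2)" for s
 have pos: "y s \<bullet> y s + d\<^sup>2 > 0" for s using d by (intro add_nonneg_pos) auto
 have z_ge: "norm (y s) <= z s" for s unfolding z_def norm_eq_sqrt_inner by (rule real_sqrt_le_mono) simp
 have z_le: "z s <= norm (y s) + d" for s unfolding z_def power2_norm_eq_inner[symmetric] using d
  by (intro real_le_lsqrt) (auto simp: power2_eq_square algebra_simps)
 have zpos: "z s > 0" for s using pos by (simp add: z_def)
 define g where "g s = exp (- L * s) * z s - c * s" for s
 have "g t <= g 0"
 proof (rule DERIV_nonpos_imp_nonincreasing[OF \<open>0 <= t\<close>])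
  fix s assume s: "0 <= s" "s <= t"
  have "((%s. y s \<bullet> y s) has_real_derivative (y s \<bullet> y' s + y' s \<bullet> y s)) (at s)"
   using y[OF s] by (auto simp: has_vector_derivative_def has_real_derivative_iff_has_vector_derivative
     intro!: derivative_eq_intros simp: algebra_simps)
  then have dz: "(z has_real_derivative (y s \<bullet> y' s) / z s) (at s)" unfolding z_def using pos[of s]
   by (auto intro!: derivative_eq_intros simp: inner_commute field_simps)
  have "(g has_real_derivative exp (- L * s) * ((y s \<bullet> y' s) / z s) - L * exp (- L * s) * z s - c) (at s)"
   unfolding g_def by (rule derivative_eq_intros dz refl)+ (simp add: algebra_simps)
  moreover have "exp (- L * s) * ((y s \<bullet> y' s) / z s) - L * exp (- L * s) * z s - c <= 0"
  proof -
   have "y s \<bullet> y' s <= norm (y s) * norm (y' s)" by (rule norm_cauchy_schwarz)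
   also have "... <= z s * (L * z s + c)"
   proof (rule mult_mono)
    show "norm (y' s) <= L * z s + c" using le[OF s] mult_left_mono[OF z_ge[of s] \<open>0 <= L\<close>] by linarith
   qed (use z_ge zpos[of s] in \<open>auto simp: less_imp_le\<close>)
   finally have "(y s \<bullet> y' s) / z s <= L * z s + c" using zpos[of s] by (simp add: divide_le_eq mult.commute)
   then have "exp (- L * s) * ((y s \<bullet> y' s) / z s) <= exp (- L * s) * (L * z s + c)"
    by (intro mult_left_mono) auto
   also have "... <= L * exp (- L * s) * z s + 1 * c"
    using mult_right_mono[of "exp (- L * s)" 1 c] s assms by (simp add: algebra_simps)
   finally show ?thesis by simp
  qed
  ultimately show "\<exists>y. (g has_real_derivative y) (at s) & y <= 0" by blast
 qed
 then have "exp (- L * t) * z t <= norm (y 0) + d + c * t" using z_le[of 0] by (simp add: g_def)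
 then have "exp (L * t) * (exp (- L * t) * z t) <= exp (L * t) * (norm (y 0) + d + c * t)"
  by (intro mult_left_mono) auto
 then have "z t <= exp (L * t) * (norm (y 0) + d + c * t)" by (simp add: mult.assoc[symmetric] exp_add[symmetric])
 with z_ge[of t] show "norm (y t) <= exp (L * t) * (norm (y 0) + c * t) + e" by (simp add: d_def algebra_simps)
qed

lemma gronwall_abs:
 fixes y :: "real => 'b::real_inner"
 assumes y: "!!s. \<bar>s\<bar> <= \<bar>t\<bar> ==> (y has_vector_derivative y' s) (at s)"
  and le: "!!s. \<bar>s\<bar> <= \<bar>t\<bar> ==> norm (y' s) <= L * norm (y s) + c"
  and "0 <= L" "0 <= c"
 shows "norm (y t) <= exp (L * \<bar>t\<bar>) * (norm (y 0) + c * \<bar>t\<bar>)"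
proof (cases "0 <= t")
 case True
 then show ?thesis using gronwall[of t y y' L c] assms by auto
next
 case False
 have 1: "((%s. y (- s)) has_vector_derivative - y' (- s)) (at s)" if "0 <= s" "s <= - t" for s
 proof -
  have "((%s. y (- s)) has_vector_derivative (-1) *\<^sub>R y' (- s)) (at s)"
  proof -
   have "(uminus has_real_derivative -1) (at s)" by (auto intro!: derivative_eq_intros)
   then show ?thesis using vector_diff_chain_at[of uminus "-1" s y "y' (- s)"] y[of "- s"] that False
    by (simp add: o_def has_real_derivative_iff_has_vector_derivative)
  qed
  then show ?thesis by simp
 qed
 show ?thesis using gronwall[of "- t" "%s. y (- s)" "%s. - y' (- s)" L c] 1 False assms by auto
qed

text \<open>The unknown is the bounded function \<open>g\<close> in
  \<open>x0 + E s *\<^sub>R g s\<close>. With the weight \<open>exp (2 * L * \<bar>t\<bar>)\<close>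
  the integral operator has Lipschitz constant 1/2 on the whole line, so one fixed point gives a
  global solution and no local pieces have to be glued.\<close>

lemma picard_exists:
 fixes f :: "real => 'b::banach => 'b"
 assumes cont: "!!\<gamma>. continuous_on UNIV \<gamma> ==> continuous_on UNIV (%s. f s (\<gamma> s))"
  and lip: "!!s x y. norm (f s x - f s y) <= L * norm (x - y)"
  and K: "!!s. norm (f s x0) <= K"
  and L: "L > 0"
 shows "\<exists>\<gamma>. \<gamma> 0 = x0 & (\<forall>t. (\<gamma> has_vector_derivative f t (\<gamma> t)) (at t))"
proof -
 define E where "E t = exp (2 * L * \<bar>t\<bar>)" for t
 have E: "E t > 0" "E t >= 1" for t using L by (auto simp: E_def)
 have contE: "continuous_on UNIV E" unfolding E_def by (intro continuous_intros)
 define F where "F g s = f s (x0 + E s *\<^sub>R apply_bcontfun g s)" for g s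
 have contg: "continuous_on UNIV (%s. x0 + E s *\<^sub>R apply_bcontfun g s)" for g
  by (intro continuous_intros contE continuous_on_apply_bcontfun)
 have contF: "continuous_on UNIV (F g)" for g unfolding F_def by (rule cont[OF contg])
 have K0: "K >= 0" using K[of 0] norm_ge_zero order_trans by blast
 define H where "H g t = (1 / E t) *\<^sub>R antider (F g) t" for g t
 have FK: "norm (F g s) <= (K + L * norm g) * exp ((2 * L) * \<bar>s\<bar>)" for g s
 proof -
  have "norm (F g s) <= norm (f s x0) + norm (F g s - f s x0)" by norm
  also have "norm (F g s - f s x0) <= L * norm (E s *\<^sub>R apply_bcontfun g s)"
   using lip[of s "x0 + E s *\<^sub>R apply_bcontfun g s" x0] by (simp add: F_def)
  also have "... <= L * (E s * norm g)"
   using E[of s] L norm_bounded[of g s] by (auto intro!: mult_left_mono simp: less_imp_le)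
  also have "norm (f s x0) <= K * E s" using K[of s] mult_left_mono[OF E(2)[of s] K0] by simp
  finally show ?thesis by (simp add: E_def algebra_simps)
 qed
 have Hb: "H g \<in> bcontfun" for g
 proof (rule bcontfun_normI)
  show "continuous_on UNIV (H g)" unfolding H_def using E(1)
   by (intro continuous_intros contE continuous_on_antider contF) (simp add: less_imp_neq[THEN not_sym])
  fix t
  have "norm (antider (F g) t) <= (K + L * norm g) / (2 * L) * exp (2 * L * \<bar>t\<bar>)"
   using L by (intro norm_antider_le_exp[OF contF _ FK]) auto
  then show "norm (H g t) <= (K + L * norm g) / (2 * L)"
   using E(1)[of t] by (simp add: H_def E_def[symmetric] divide_le_eq)
 qed
 have "\<exists>!g. Bcontfun (H g) = g"
 proof (rule banach_fix_type[where c="1/2"])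
  show "\<forall>g h. dist (Bcontfun (H g)) (Bcontfun (H h)) <= 1/2 * dist g h"
  proof (intro allI dist_bound)
   fix g h t
   have "antider (F g) t - antider (F h) t = antider (%s. F g s - F h s) t" by (simp add: antider_diff contF)
   also have "norm ... <= (L * dist g h) / (2 * L) * exp (2 * L * \<bar>t\<bar>)"
   proof (rule norm_antider_le_exp)
    fix s
    have "norm (F g s - F h s) <= L * norm (E s *\<^sub>R apply_bcontfun g s - E s *\<^sub>R apply_bcontfun h s)"
     using lip[of s "x0 + E s *\<^sub>R apply_bcontfun g s" "x0 + E s *\<^sub>R apply_bcontfun h s"] by (simp add: F_def)
    also have "... = L * (E s * dist (apply_bcontfun g s) (apply_bcontfun h s))"
     using E(1)[of s] by (simp add: scaleR_diff_right[symmetric] dist_norm)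
    also have "... <= L * (E s * dist g h)" using E(1)[of s] L by (intro mult_left_mono dist_bounded) auto
    finally show "norm (F g s - F h s) <= L * dist g h * exp (2 * L * \<bar>s\<bar>)" by (simp add: E_def mult_ac)
   qed (use L contF in \<open>auto intro!: continuous_intros\<close>)
   finally show "dist (apply_bcontfun (Bcontfun (H g)) t) (apply_bcontfun (Bcontfun (H h)) t) <= 1/2 * dist g h"
    using L E(1)[of t] unfolding Bcontfun_inverse[OF Hb] H_def dist_norm scaleR_diff_right[symmetric] norm_scaleR E_def[symmetric]
    by (simp add: divide_simps mult_ac)
  qed
 qed auto
 then obtain g where g: "Bcontfun (H g) = g" by blast
 have Hg: "apply_bcontfun g t = H g t" for t using Bcontfun_inverse[OF Hb, of g] g by simp
 define \<gamma> where "\<gamma> t = x0 + antider (F g) t" for t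
 have \<gamma>: "x0 + E t *\<^sub>R apply_bcontfun g t = \<gamma> t" for t
  using E(1)[of t] by (simp add: Hg H_def \<gamma>_def)
 have "(\<gamma> has_vector_derivative f t (\<gamma> t)) (at t)" for t
 proof -
  have "(\<gamma> has_vector_derivative 0 + F g t) (at t)"
   unfolding \<gamma>_def by (intro derivative_intros antider_has_vector_derivative contF)
  then show ?thesis by (simp add: F_def \<gamma>)
 qed
 then show ?thesis by (intro exI[of _ \<gamma>]) (simp add: \<gamma>_def)
qed

section \<open>Flows of fields with bounded and Lipschitz derivative\<close>

lemma blinfun_vector_derivative:
 fixes D :: "real => 'a::real_normed_vector \<Rightarrow>\<^sub>L 'b::real_normed_vector"
 assumes "(D has_vector_derivative D') (at t)"
 shows "((%s. D s v) has_vector_derivative D' v) (at t)"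
 by (rule bounded_linear.has_vector_derivative[OF blinfun.bounded_linear_left assms])

text \<open>A single constant bounds the derivative and its Lipschitz modulus. Derivatives are
  \<open>blinfun\<close> values so that their dependence on the point is measured in the operator
  norm; the global bounds will come from periodicity.\<close>

definition C11_field :: "('a::real_normed_vector => 'b::real_normed_vector) => ('a => 'a \<Rightarrow>\<^sub>L 'b) => real => bool" where
 "C11_field X X' L \<longleftrightarrow> L > 0 & (\<forall>x. (X has_derivative X' x) (at x)) &
  (\<forall>x. norm (X' x) <= L) & (\<forall>x y. norm (X' x - X' y) <= L * norm (x - y))"

lemma C11_field_lipschitz:
 assumes "C11_field X X' L"
 shows "norm (X x - X y) <= L * norm (x - y)"
proof -
 have "norm (X x - X y) <= L * norm (x - y)" using assms by (intro differentiable_bound[where S=UNIV and f'=X'])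
   (auto simp: C11_field_def norm_blinfun.rep_eq[symmetric])
 then show ?thesis .
qed

lemma C11_field_taylor:
 assumes "C11_field X X' L"
 shows "norm (X y - X x - X' x (y - x)) <= L * norm (y - x) ^ 2"
proof -
 have "norm (X y - X x - X' x (y - x)) <= norm (y - x) * (L * norm (y - x))"
 proof (rule differentiable_bound_linearization[where S="closed_segment x y" and f'=X'])
  show "x + t *\<^sub>R (y - x) \<in> closed_segment x y" if "t \<in> {0..1}" for t
   using that by (auto simp: in_segment algebra_simps intro!: exI[of _ t])
  show "(X has_derivative X' z) (at z within closed_segment x y)" for z
   using assms by (auto simp: C11_field_def intro: has_derivative_at_withinI)
  fix z assume z: "z \<in> closed_segment x y"
  have "onorm (blinfun_apply (X' z) - blinfun_apply (X' x)) = norm (X' z - X' x)"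
   by (simp add: norm_blinfun.rep_eq minus_blinfun.rep_eq fun_diff_def)
  also have "... <= L * norm (z - x)" using assms by (auto simp: C11_field_def)
  also have "... <= L * norm (y - x)"
   using assms segment_bound1[OF z] by (auto simp: C11_field_def intro!: mult_left_mono)
  finally show "onorm (blinfun_apply (X' z) - blinfun_apply (X' x)) <= L * norm (y - x)" .
 qed auto
 then show ?thesis by (simp add: power2_eq_square algebra_simps)
qed

lemma continuous_on_lipschitz:
 fixes f :: "'a::real_normed_vector => 'b::real_normed_vector"
 assumes "!!x y. norm (f x - f y) <= L * norm (x - y)"
 shows "continuous_on S f"
proof -
 have "(\<bar>L\<bar>)-lipschitz_on S f"
 proof (rule lipschitz_onI)
  show "dist (f x) (f y) <= \<bar>L\<bar> * dist x y" for x y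
   using order_trans[OF assms mult_right_mono[of L "\<bar>L\<bar>"]] by (simp add: dist_norm)
 qed auto
 then show ?thesis by (rule lipschitz_on_continuous_on)
qed

locale flow_field =
 fixes X :: "'a::euclidean_space => 'a" and X' :: "'a => 'a \<Rightarrow>\<^sub>L 'a" and L :: real
 assumes C11: "C11_field X X' L"
begin

lemma Lpos: "L > 0" and deriv: "(X has_derivative X' x) (at x)" and norm_X': "norm (X' x) <= L"
 and X'_lip: "norm (X' x - X' y) <= L * norm (x - y)" using C11 by (auto simp: C11_field_def)

lemmas X_lip = C11_field_lipschitz[OF C11]
lemmas X_taylor = C11_field_taylor[OF C11]

lemma continuous_X: "continuous_on S X" and continuous_X': "continuous_on S X'"
 by (rule continuous_on_lipschitz[OF X_lip] continuous_on_lipschitz[OF X'_lip])+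

lemma norm_X'_apply: "norm (X' x v) <= L * norm v"
 by (rule order_trans[OF norm_blinfun mult_right_mono[OF norm_X']]) auto

definition flow :: "real => 'a => 'a" where
 "flow t x = (SOME \<gamma>. \<gamma> 0 = x & (\<forall>t. (\<gamma> has_vector_derivative X (\<gamma> t)) (at t))) t"

lemma flow_0 [simp]: "flow 0 x = x"
 and flow_vderiv: "((%t. flow t x) has_vector_derivative X (flow t x)) (at t)"
proof -
 have "\<exists>\<gamma>. \<gamma> 0 = x & (\<forall>t. (\<gamma> has_vector_derivative X (\<gamma> t)) (at t))"
  by (rule picard_exists[where f="%_. X" and K="norm (X x)", OF _ X_lip _ Lpos])
   (auto intro: continuous_on_compose2[OF continuous_X[of UNIV]])
 from someI_ex[OF this]
 have *: "(SOME \<gamma>. \<gamma> 0 = x & (\<forall>t. (\<gamma> has_vector_derivative X (\<gamma> t)) (at t))) 0 = x"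
  "!!t. ((SOME \<gamma>. \<gamma> 0 = x & (\<forall>t. (\<gamma> has_vector_derivative X (\<gamma> t)) (at t))) has_vector_derivative
   X ((SOME \<gamma>. \<gamma> 0 = x & (\<forall>t. (\<gamma> has_vector_derivative X (\<gamma> t)) (at t))) t)) (at t)"
  by auto
 show "flow 0 x = x" "((%t. flow t x) has_vector_derivative X (flow t x)) (at t)" using * unfolding flow_def by auto
qed

lemma solutions_dist:
 assumes "!!t. (\<gamma> has_vector_derivative X (\<gamma> t)) (at t)" "!!t. (\<eta> has_vector_derivative X (\<eta> t)) (at t)"
 shows "norm (\<gamma> t - \<eta> t) <= exp (L * \<bar>t\<bar>) * norm (\<gamma> 0 - \<eta> 0)"
proof -
 have "norm (\<gamma> t - \<eta> t) <= exp (L * \<bar>t\<bar>) * (norm (\<gamma> 0 - \<eta> 0) + 0 * \<bar>t\<bar>)"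
  by (rule gronwall_abs[where y'="%t. X (\<gamma> t) - X (\<eta> t)"])
   (use Lpos X_lip in \<open>auto intro!: has_vector_derivative_diff assms\<close>)
 then show ?thesis by simp
qed

lemma flow_lip: "norm (flow t x - flow t y) <= exp (L * \<bar>t\<bar>) * norm (x - y)"
 using solutions_dist[OF flow_vderiv flow_vderiv, where t=t] by simp

lemma flow_unique:
 assumes "\<gamma> 0 = x" "!!t. (\<gamma> has_vector_derivative X (\<gamma> t)) (at t)"
 shows "\<gamma> t = flow t x" using solutions_dist[OF assms(2) flow_vderiv[of x], where t=t] assms(1) by simp

lemma vderiv_shift:
 fixes \<gamma> :: "real => 'b::real_normed_vector"
 assumes "!!t. (\<gamma> has_vector_derivative g t) (at t)"
 shows "((%s. \<gamma> (s + t)) has_vector_derivative g (s + t)) (at s)"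
proof -
 have "((%s. s + t) has_real_derivative 1) (at s)" by (auto intro!: derivative_eq_intros)
 then show ?thesis using vector_diff_chain_at[of "%s. s + t" 1 s \<gamma> "g (s + t)"] assms
  by (simp add: o_def has_real_derivative_iff_has_vector_derivative)
qed

lemma flow_add: "flow (s + t) x = flow s (flow t x)" by (rule flow_unique) (use vderiv_shift[OF flow_vderiv] in auto)

lemma flow_minus [simp]: "flow (- t) (flow t x) = x" "flow t (flow (- t) x) = x"
 using flow_add[of "- t" t x] flow_add[of t "- t" x] by auto

lemma continuous_flow_time: "continuous_on S (%t. flow t x)"
 by (intro continuous_at_imp_continuous_on ballI) (rule has_vector_derivative_continuous[OF flow_vderiv])

text \<open>The fundamental solution of the linearized equation along the orbit of \<open>x\<close>.
  That it is the spatial derivative of the flow is the content of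
  \<open>flow_has_derivative\<close>.\<close>

definition Dflow :: "real => 'a => 'a \<Rightarrow>\<^sub>L 'a" where
 "Dflow t x = (SOME D. D 0 = id_blinfun &
  (\<forall>t. (D has_vector_derivative X' (flow t x) o\<^sub>L D t) (at t))) t"

lemma Dflow_0 [simp]: "Dflow 0 x = id_blinfun"
 and Dflow_vderiv: "((%t. Dflow t x) has_vector_derivative X' (flow t x) o\<^sub>L Dflow t x) (at t)"
proof -
 have "\<exists>D. D 0 = id_blinfun & (\<forall>t. (D has_vector_derivative X' (flow t x) o\<^sub>L D t) (at t))"
 proof (rule picard_exists[OF _ _ _ Lpos])
  show "continuous_on UNIV (%s. X' (flow s x) o\<^sub>L \<gamma> s)"
   if "continuous_on UNIV \<gamma>" for \<gamma> :: "real => 'a \<Rightarrow>\<^sub>L 'a"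
   by (intro continuous_intros that continuous_on_compose2[OF continuous_X'[of UNIV] continuous_flow_time]) auto
  show "norm ((X' (flow s x) o\<^sub>L D) - (X' (flow s x) o\<^sub>L E)) <= L * norm (D - E)" for s D E
  proof -
   have "(X' (flow s x) o\<^sub>L D) - (X' (flow s x) o\<^sub>L E) = X' (flow s x) o\<^sub>L (D - E)"
    by (rule blinfun_eqI) (simp add: blinfun.diff_left blinfun.diff_right)
   then show ?thesis using norm_blinfun_compose[of "X' (flow s x)" "D - E"]
     mult_right_mono[OF norm_X'[of "flow s x"], of "norm (D - E)"] by simp
  qed
  show "norm (X' (flow s x) o\<^sub>L id_blinfun) <= L" for s
   proof -
   have "X' (flow s x) o\<^sub>L id_blinfun = X' (flow s x)" by (rule blinfun_eqI) simp
   then show ?thesis by (simp add: norm_X')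
  qed
 qed
 from someI_ex[OF this]
 have *: "(SOME D. D 0 = id_blinfun & (\<forall>t. (D has_vector_derivative X' (flow t x) o\<^sub>L D t) (at t))) 0 = id_blinfun"
  "!!t. ((SOME D. D 0 = id_blinfun & (\<forall>t. (D has_vector_derivative X' (flow t x) o\<^sub>L D t) (at t))) has_vector_derivative
   X' (flow t x) o\<^sub>L ((SOME D. D 0 = id_blinfun & (\<forall>t. (D has_vector_derivative X' (flow t x) o\<^sub>L D t) (at t))) t)) (at t)"
  by auto
 show "Dflow 0 x = id_blinfun" "((%t. Dflow t x) has_vector_derivative X' (flow t x) o\<^sub>L Dflow t x) (at t)"
  using * unfolding Dflow_def by auto
qed

lemma Dflow_apply_vderiv: "((%t. Dflow t x v) has_vector_derivative X' (flow t x) (Dflow t x v)) (at t)"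
 using blinfun_vector_derivative[OF Dflow_vderiv, where v=v] by simp

lemma linearized_unique:
 assumes "!!t. (y has_vector_derivative X' (flow t x) (y t)) (at t)"
 shows "y t = Dflow t x (y 0)"
proof -
 have "norm (y t - Dflow t x (y 0)) <= exp (L * \<bar>t\<bar>) * (norm (y 0 - Dflow 0 x (y 0)) + 0 * \<bar>t\<bar>)"
 proof (rule gronwall_abs[where y'="%t. X' (flow t x) (y t) - X' (flow t x) (Dflow t x (y 0))"])
  show "norm (X' (flow s x) (y s) - X' (flow s x) (Dflow s x (y 0))) <= L * norm (y s - Dflow s x (y 0)) + 0" for s
   using norm_X'_apply by (simp add: blinfun.diff_right[symmetric])
 qed (use Lpos in \<open>auto intro!: has_vector_derivative_diff assms Dflow_apply_vderiv\<close>)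
 then show ?thesis by simp
qed

lemma norm_Dflow_apply: "norm (Dflow t x v) <= exp (L * \<bar>t\<bar>) * norm v"
 using gronwall_abs[of t "%t. blinfun_apply (Dflow t x) v" _ L 0, OF Dflow_apply_vderiv] norm_X'_apply Lpos by auto

text \<open>The difference solves the linearized equation with a forcing term, in which one factor
  \<open>exp (L * \<bar>t\<bar>)\<close> measures the distance of the two orbits and another the
  size of \<open>Dflow\<close>; the third factor comes from Gronwall's inequality.\<close>

lemma Dflow_lip: "norm (Dflow t x - Dflow t y) <= L * exp (3 * L * \<bar>t\<bar>) * \<bar>t\<bar> * norm (x - y)"
proof (rule norm_blinfun_bound)
 fix v :: 'a
 define c where "c = L * exp (2 * L * \<bar>t\<bar>) * norm (x - y) * norm v"
 have c: "c >= 0" using Lpos by (simp add: c_def)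
 have "norm (Dflow t x v - Dflow t y v) <= exp (L * \<bar>t\<bar>) * (norm (Dflow 0 x v - Dflow 0 y v) + c * \<bar>t\<bar>)"
 proof (rule gronwall_abs[where y'="%t. X' (flow t x) (Dflow t x v) - X' (flow t y) (Dflow t y v)"])
  fix s :: real assume s: "\<bar>s\<bar> <= \<bar>t\<bar>"
  have "X' (flow s x) (Dflow s x v) - X' (flow s y) (Dflow s y v) =
   X' (flow s x) (Dflow s x v - Dflow s y v) + (X' (flow s x) - X' (flow s y)) (Dflow s y v)"
   by (simp add: blinfun.diff_left blinfun.diff_right)
  moreover have "norm (X' (flow s x) (Dflow s x v - Dflow s y v)) <= L * norm (Dflow s x v - Dflow s y v)"
   by (rule norm_X'_apply)
  moreover have "norm ((X' (flow s x) - X' (flow s y)) (Dflow s y v)) <= c"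
  proof -
   have "norm ((X' (flow s x) - X' (flow s y)) (Dflow s y v)) <= norm (X' (flow s x) - X' (flow s y)) * norm (Dflow s y v)"
    by (rule norm_blinfun)
   also have "... <= (L * (exp (L * \<bar>s\<bar>) * norm (x - y))) * (exp (L * \<bar>s\<bar>) * norm v)"
    using Lpos by (intro mult_mono norm_Dflow_apply order_trans[OF X'_lip] mult_left_mono flow_lip) auto
   also have "... <= (L * (exp (L * \<bar>t\<bar>) * norm (x - y))) * (exp (L * \<bar>t\<bar>) * norm v)"
    using Lpos s by (intro mult_mono mult_left_mono mult_right_mono) auto
   also have "... = c" by (simp add: c_def exp_add[symmetric] mult_exp_exp[symmetric] algebra_simps)
   finally show ?thesis .
  qed
  ultimately show "norm (X' (flow s x) (Dflow s x v) - X' (flow s y) (Dflow s y v)) <= L * norm (Dflow s x v - Dflow s y v) + c"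
   using norm_triangle_le by (smt (verit))
 qed (use Lpos c in \<open>auto intro!: has_vector_derivative_diff Dflow_apply_vderiv\<close>)
 also have "... = L * exp (3 * L * \<bar>t\<bar>) * \<bar>t\<bar> * norm (x - y) * norm v"
  by (simp add: c_def algebra_simps exp_add[symmetric] mult_exp_exp[symmetric])
 finally show "norm ((Dflow t x - Dflow t y) v) <= L * exp (3 * L * \<bar>t\<bar>) * \<bar>t\<bar> * norm (x - y) * norm v"
  by (simp add: blinfun.diff_left)
qed (use Lpos in auto)

text \<open>The remainder vanishes at time 0 and solves the linearized equation with the Taylor
  remainder of \<open>X\<close> as forcing, which is quadratic in \<open>y - x\<close>.\<close>

lemma flow_taylor:
 "norm (flow t y - flow t x - Dflow t x (y - x)) <= L * exp (3 * L * \<bar>t\<bar>) * \<bar>t\<bar> * norm (y - x) ^ 2"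
proof -
 define c where "c = L * exp (2 * L * \<bar>t\<bar>) * norm (y - x) ^ 2"
 have c: "c >= 0" using Lpos by (simp add: c_def)
 define e where "e t = flow t y - flow t x - Dflow t x (y - x)" for t
 have "norm (e t :: 'a) <= exp (L * \<bar>t\<bar>) * (norm (e 0) + c * \<bar>t\<bar>)"
 proof (rule gronwall_abs[where y'="%t. X (flow t y) - X (flow t x) - X' (flow t x) (Dflow t x (y - x))"])
  fix s :: real assume s: "\<bar>s\<bar> <= \<bar>t\<bar>"
  have "X (flow s y) - X (flow s x) - X' (flow s x) (Dflow s x (y - x)) =
   (X (flow s y) - X (flow s x) - X' (flow s x) (flow s y - flow s x)) + X' (flow s x) (e s)"
   by (simp add: e_def blinfun.diff_right)
  moreover have "norm (X' (flow s x) (e s)) <= L * norm (e s)" by (rule norm_X'_apply)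
  moreover have "norm (X (flow s y) - X (flow s x) - X' (flow s x) (flow s y - flow s x)) <= c"
  proof -
   have "norm (X (flow s y) - X (flow s x) - X' (flow s x) (flow s y - flow s x)) <= L * norm (flow s y - flow s x) ^ 2"
    by (rule X_taylor)
   also have "... <= L * (exp (L * \<bar>s\<bar>) * norm (y - x)) ^ 2"
    using Lpos by (intro mult_left_mono power_mono flow_lip) auto
   also have "... <= L * (exp (L * \<bar>t\<bar>) * norm (y - x)) ^ 2"
    using Lpos s by (intro mult_left_mono power_mono mult_right_mono) auto
   also have "... = c"
    by (simp add: c_def power_mult_distrib power2_eq_square[of "exp _"] exp_add[symmetric] mult_exp_exp[symmetric] algebra_simps)
   finally show ?thesis .
  qed
  ultimately show "norm (X (flow s y) - X (flow s x) - X' (flow s x) (Dflow s x (y - x))) <= L * norm (e s) + c"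
   using norm_triangle_le by (smt (verit))
 qed (use Lpos c in \<open>auto simp: e_def intro!: has_vector_derivative_diff Dflow_apply_vderiv flow_vderiv\<close>)
 also have "... = L * exp (3 * L * \<bar>t\<bar>) * \<bar>t\<bar> * norm (y - x) ^ 2"
  by (simp add: c_def e_def algebra_simps exp_add[symmetric] mult_exp_exp[symmetric])
 finally show ?thesis by (simp add: e_def)
qed

lemma flow_has_derivative: "(flow t has_derivative Dflow t x) (at x)" unfolding has_derivative_at2
proof (intro conjI)
 show "bounded_linear (Dflow t x)" by (rule blinfun.bounded_linear_right)
 let ?K = "L * exp (3 * L * \<bar>t\<bar>) * \<bar>t\<bar>"
 show "((%y. (1 / norm (y - x)) *\<^sub>R (flow t y - (flow t x + Dflow t x (y - x)))) \<longlongrightarrow> 0) (at x)"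
 proof (rule Lim_null_comparison[where g="%y. ?K * norm (y - x)"])
  show "\<forall>\<^sub>F y in at x. norm ((1 / norm (y - x)) *\<^sub>R (flow t y - (flow t x + Dflow t x (y - x)))) <= ?K * norm (y - x)"
  proof (rule eventually_at_topological[THEN iffD2], intro exI[of _ UNIV] conjI ballI impI)
   fix y assume "y ~= x"
   then show "norm ((1 / norm (y - x)) *\<^sub>R (flow t y - (flow t x + Dflow t x (y - x)))) <= ?K * norm (y - x)"
    using flow_taylor[of t y x] unfolding norm_scaleR diff_diff_eq[symmetric]
    by (simp add: divide_le_eq power2_eq_square mult_ac)
  qed auto
  show "((%y. ?K * norm (y - x)) \<longlongrightarrow> 0) (at x)"
   by (intro tendsto_mult_right_zero tendsto_norm_zero) (auto intro!: tendsto_eq_intros)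
 qed
qed

lemma continuous_Dflow_time: "continuous_on S (%t. Dflow t x)"
 by (intro continuous_at_imp_continuous_on ballI) (rule has_vector_derivative_continuous[OF Dflow_vderiv])

text \<open>Lipschitz continuity in space, locally uniform in time, is combined with continuity in
  time at the single point \<open>x0\<close>.\<close>

lemma continuous_flow: "continuous_on UNIV (%(t, x). flow t x)"
proof (clarsimp simp: continuous_on_eq_continuous_at isCont_def)
 fix t0 x0
 have "((%p. norm (flow (fst p) (snd p) - flow t0 x0)) \<longlongrightarrow> 0) (at (t0, x0))"
 proof (rule Lim_null_comparison)
  show "\<forall>\<^sub>F p in at (t0, x0). norm (norm (flow (fst p) (snd p) - flow t0 x0)) <=
   exp (L * \<bar>fst p\<bar>) * norm (snd p - x0) + norm (flow (fst p) x0 - flow t0 x0)"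
  proof (intro always_eventually allI)
   fix p :: "real \<times> 'a"
   show "norm (norm (flow (fst p) (snd p) - flow t0 x0)) <=
    exp (L * \<bar>fst p\<bar>) * norm (snd p - x0) + norm (flow (fst p) x0 - flow t0 x0)"
    using flow_lip[of "fst p" "snd p" x0]
     norm_triangle_ineq[of "flow (fst p) (snd p) - flow (fst p) x0" "flow (fst p) x0 - flow t0 x0"] by simp
  qed
  have "isCont (%t. flow t x0) t0"
   using continuous_flow_time[of UNIV x0] by (simp add: continuous_on_eq_continuous_at)
  then have "((%p. flow (fst p) x0) \<longlongrightarrow> flow t0 x0) (at (t0, x0))"
   by (rule isCont_tendsto_compose) (auto intro!: tendsto_eq_intros)
  then show "((%p. exp (L * \<bar>fst p\<bar>) * norm (snd p - x0) + norm (flow (fst p) x0 - flow t0 x0)) \<longlongrightarrow> 0) (at (t0, x0))"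
   by (auto intro!: tendsto_eq_intros)
 qed
 then show "((%(t, x). flow t x) \<longlongrightarrow> flow t0 x0) (at (t0, x0))"
  by (simp add: tendsto_norm_zero_iff LIM_zero_iff split_beta')
qed

lemma continuous_Dflow: "continuous_on UNIV (%(t, x). Dflow t x)"
proof (clarsimp simp: continuous_on_eq_continuous_at isCont_def)
 fix t0 x0
 have "((%p. norm (Dflow (fst p) (snd p) - Dflow t0 x0)) \<longlongrightarrow> 0) (at (t0, x0))"
 proof (rule Lim_null_comparison)
  show "\<forall>\<^sub>F p in at (t0, x0). norm (norm (Dflow (fst p) (snd p) - Dflow t0 x0)) <=
   L * exp (3 * L * \<bar>fst p\<bar>) * \<bar>fst p\<bar> * norm (snd p - x0) + norm (Dflow (fst p) x0 - Dflow t0 x0)"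
  proof (intro always_eventually allI)
   fix p :: "real \<times> 'a"
   show "norm (norm (Dflow (fst p) (snd p) - Dflow t0 x0)) <=
    L * exp (3 * L * \<bar>fst p\<bar>) * \<bar>fst p\<bar> * norm (snd p - x0) + norm (Dflow (fst p) x0 - Dflow t0 x0)"
    using Dflow_lip[of "fst p" "snd p" x0]
     norm_triangle_ineq[of "Dflow (fst p) (snd p) - Dflow (fst p) x0" "Dflow (fst p) x0 - Dflow t0 x0"] by simp
  qed
  have "isCont (%t. Dflow t x0) t0"
   using continuous_Dflow_time[of UNIV x0] by (simp add: continuous_on_eq_continuous_at)
  then have "((%p. Dflow (fst p) x0) \<longlongrightarrow> Dflow t0 x0) (at (t0, x0))"
   by (rule isCont_tendsto_compose) (auto intro!: tendsto_eq_intros)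
  then show "((%p. L * exp (3 * L * \<bar>fst p\<bar>) * \<bar>fst p\<bar> * norm (snd p - x0) + norm (Dflow (fst p) x0 - Dflow t0 x0)) \<longlongrightarrow> 0) (at (t0, x0))"
   by (auto intro!: tendsto_eq_intros)
 qed
 then show "((%(t, x). Dflow t x) \<longlongrightarrow> Dflow t0 x0) (at (t0, x0))"
  by (simp add: tendsto_norm_zero_iff LIM_zero_iff split_beta')
qed

lemma flow_joint_derivative:
 "((%(t, x). flow t x) has_derivative (%(k, h). k *\<^sub>R X (flow t x) + Dflow t x h)) (at (t, x))"
proof -
 have "((%(t, x). flow t x) has_derivative (%(k, h). k *\<^sub>R X (flow t x) + Dflow t x h)) (at (t, x) within UNIV \<times> UNIV)"
 proof (rule has_derivative_partialsI)
  show "((%t. flow t x) has_derivative (%k. k *\<^sub>R X (flow t x))) (at t within UNIV)"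
   using flow_vderiv[where x=x and t=t] by (simp add: has_vector_derivative_def)
  show "(flow t has_derivative Dflow t x) (at x within UNIV)" for t x by (simp add: flow_has_derivative)
  show "continuous (at (t, x) within UNIV \<times> UNIV) (%(t, x). Dflow t x)"
   using continuous_Dflow by (simp add: continuous_on_eq_continuous_at)
 qed auto
 then show ?thesis by simp
qed

lemma Dflow_add: "Dflow (s + t) x = Dflow s (flow t x) o\<^sub>L Dflow t x"
proof (rule blinfun_eqI)
 fix v :: 'a
 have "((%x. flow s (flow t x)) has_derivative (%v. Dflow s (flow t x) (Dflow t x v))) (at x)"
  by (rule has_derivative_compose[OF flow_has_derivative flow_has_derivative])
 then have "(flow (s + t) has_derivative (%v. Dflow s (flow t x) (Dflow t x v))) (at x)"
  by (simp add: flow_add[abs_def])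
 from has_derivative_unique[OF flow_has_derivative this]
 show "Dflow (s + t) x v = (Dflow s (flow t x) o\<^sub>L Dflow t x) v" by (simp add: fun_eq_iff)
qed

text \<open>The velocity along an orbit solves the linearized equation. At a periodic point this
  makes it a fixed vector of the monodromy.\<close>

lemma Dflow_field: "Dflow t x (X x) = X (flow t x)"
proof -
 have "((%t. X (flow t x)) has_vector_derivative X' (flow t x) (X (flow t x))) (at t)" for t
  using vector_derivative_diff_chain_within[of "%t. flow t x" "X (flow t x)" t UNIV X "X' (flow t x)"]
   flow_vderiv[where x=x and t=t] deriv by (simp add: o_def has_derivative_at_withinI)
 from linearized_unique[OF this] show ?thesis by simp
qed

lemma flow_equivariant:
 assumes "!!x. X (x + c) = X x"
 shows "flow t (x + c) = flow t x + c"
proof -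
 have "flow t x + c = flow t (x + c)"
 proof (rule flow_unique)
  show "((%t. flow t x + c) has_vector_derivative X (flow t x + c)) (at t)" for t
   using has_vector_derivative_add[OF flow_vderiv has_vector_derivative_const[where c=c]] assms by simp
 qed simp
 then show ?thesis by simp
qed

lemma Dflow_equivariant:
 assumes "!!x. X (x + c) = X x"
 shows "Dflow t (x + c) = Dflow t x"
proof (rule blinfun_eqI)
 fix v :: 'a
 have "((%x. flow t (x + c)) has_derivative (%v. Dflow t (x + c) v)) (at x)"
  by (rule has_derivative_compose[OF _ flow_has_derivative, of "%x. x + c" "%v. v" x UNIV t])
   (auto intro!: derivative_eq_intros)
 moreover have "((%x. flow t (x + c)) has_derivative Dflow t x) (at x)"
  unfolding flow_equivariant[OF assms] by (rule derivative_eq_intros flow_has_derivative refl | simp)+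
 ultimately have "blinfun_apply (Dflow t (x + c)) = blinfun_apply (Dflow t x)" by (rule has_derivative_unique)
 then show "Dflow t (x + c) v = Dflow t x v" by simp
qed

end

section \<open>Linear algebra\<close>

declare transpose_matrix_vector [simp del]

section \<open>Polynomials in a matrix and eigenvectors\<close>

lemma matrix_add_right: "(A + B) ** C = A ** C + B ** C"
 by (simp add: vec_eq_iff matrix_matrix_mult_def sum.distrib distrib_right)

text \<open>The vector p(B) v by Horner's scheme, so that polynomials in \<open>B\<close> act on
  vectors without powers of the matrix being formed.\<close>

definition horner :: "complex ^ 'n ^ 'n => complex poly => complex ^ 'n => complex ^ 'n" where
 "horner B p v = fold_coeffs (%a w. a *s v + B *v w) p 0"

lemma horner_0 [simp]: "horner B 0 v = 0" by (simp add: horner_def)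

lemma horner_pCons [simp]: "horner B (pCons a p) v = a *s v + B *v horner B p v"
 by (cases "p = 0 & a = 0") (auto simp: horner_def)

lemma horner_add: "horner B (p + q) v = horner B p v + horner B q v" by (induction p q rule: poly_induct2)
  (auto simp: matrix_vector_right_distrib vec.scale_left_distrib)

lemma horner_smult: "horner B (smult c p) v = c *s horner B p v" by (induction p)
  (auto simp: vector_scalar_commute vec.scale_right_distrib)

lemma horner_minus_right: "horner B p (v - w) = horner B p v - horner B p w"
 by (induction p) (auto simp: matrix_vector_mult_diff_distrib vec.scale_right_diff_distrib)

lemma horner_scale_right: "horner B p (c *s v) = c *s horner B p v" by (induction p)
  (auto simp: vector_scalar_commute vec.scale_right_distrib)

lemma horner_commute: "horner B p (B *v v) = B *v horner B p v"
 by (induction p) (auto simp: matrix_vector_right_distrib vector_scalar_commute)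

lemma horner_linear_factor:
 "horner B ([:- \<mu>, 1:] * q) v = horner B q (B *v v - \<mu> *s v)"
proof -
 have "horner B ([:- \<mu>, 1:] * q) v = horner B (smult (- \<mu>) q + pCons 0 q) v" by simp
 also have "... = B *v horner B q v - \<mu> *s horner B q v" unfolding horner_add horner_smult by simp
 finally show ?thesis by (simp add: horner_minus_right horner_scale_right horner_commute)
qed

lemma horner_monom: "horner B (monom c i) v = c *s (((*v) B ^^ i) v)"
 by (induction i) (auto simp: monom_0 monom_Suc vector_scalar_commute)

lemma horner_sum: "horner B (\<Sum>i\<in>I. p i) v = (\<Sum>i\<in>I. horner B (p i) v)"
 by (induction I rule: infinite_finite_induct) (auto simp: horner_add)

lemma annihilating_poly_exists: "\<exists>p. p ~= 0 & horner B p v = 0"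
proof -
 define w where "w i = ((*v) B ^^ i) v" for i
 let ?n = "CARD('a)"
 show ?thesis
 \<comment> \<open>If two of the n + 1 iterates coincide, the difference of two monomials
   annihilates \<open>v\<close>; otherwise they are linearly dependent by counting
   dimensions.\<close>
 proof (cases "inj_on w {..?n}")
  case False
  then obtain i j where ij: "i ~= j" "w i = w j" by (auto simp: inj_on_def)
  have "coeff (monom 1 i - monom (1::complex) j) i = 1" using ij by simp
  then have "monom 1 i - monom (1::complex) j ~= 0" by force
  moreover have "horner B (monom 1 i + monom (-1) j) v = 0"
   unfolding horner_add horner_monom using ij by (simp add: w_def)
  then have "horner B (monom 1 i - monom (1::complex) j) v = 0" by (simp add: minus_monom[symmetric])
  ultimately show ?thesis by blast
 next
  case True
  have "vec.dependent (w ` {..?n})"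
  proof (rule vec.dependent_biggerset_general)
   have "vec.dim (w ` {..?n}) <= ?n"
    using vec.dim_subset_UNIV[of "w ` {..?n}"] by (simp add: vec.dimension_def card_cart_basis)
   then show "vec.dim (w ` {..?n}) < card (w ` {..?n})" by (simp add: card_image[OF True])
  qed
  then obtain u where u: "\<exists>x\<in>w ` {..?n}. u x ~= 0" "(\<Sum>x\<in>w ` {..?n}. u x *s x) = 0"
   by (subst (asm) vec.dependent_finite) auto
  define p where "p = (\<Sum>i\<le>?n. monom (u (w i)) i)"
  have "horner B p v = (\<Sum>i\<le>?n. u (w i) *s w i)" by (simp add: p_def horner_sum horner_monom w_def)
  also have "... = 0" using u(2) by (simp add: sum.reindex[OF True])
  finally have 1: "horner B p v = 0" .
  obtain i where i: "i <= ?n" "u (w i) ~= 0" using u(1) by auto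
  have "coeff p i = (\<Sum>j\<le>?n. if j = i then u (w i) else 0)" unfolding p_def coeff_sum by (intro sum.cong) auto
  then have "coeff p i ~= 0" using i by simp
  then have "p ~= 0" by force
  with 1 show ?thesis by blast
 qed
qed

text \<open>Applying the linear factors of an annihilating polynomial to \<open>v\<close> one at a
  time must lead into \<open>K\<close>; the last vector outside \<open>K\<close> is an eigenvector
  modulo \<open>K\<close>. With \<open>K\<close> the kernel of a semidefinite form this is an
  eigenvector of a quotient; with \<open>K = {0}\<close> and \<open>S\<close> an eigenspace it is a
  common eigenvector of commuting matrices.\<close>

lemma eigenvector_modulo:
 fixes B :: "complex ^ 'n ^ 'n"
 assumes S: "!!x c. x \<in> S ==> B *v x - c *s x \<in> S" and K: "0 \<in> K" "!!x c. x \<in> K ==> c *s x \<in> K"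
  and v: "v \<in> S" "v \<notin> K"
 shows "\<exists>\<mu> v. v \<in> S & v \<notin> K & B *v v - \<mu> *s v \<in> K"
proof -
 obtain p where p: "p ~= 0" "horner B p v = 0" using annihilating_poly_exists by blast
 have "p ~= 0 ==> horner B p v = 0 ==> v \<in> S ==> v \<notin> K ==> ?thesis" for v
 proof (induction "degree p" arbitrary: p v)
  case 0
  then obtain c where "p = [:c:]" "c ~= 0" by (metis degree_eq_zeroE pCons_0_0)
  with 0 K show ?case by simp
 next
  case (Suc d)
  then have "\<not> constant (poly p)" by (simp add: constant_degree)
  then obtain \<mu> where "poly p \<mu> = 0" using fundamental_theorem_of_algebra by blast
  then obtain q where q: "p = [:- \<mu>, 1:] * q" by (auto simp: poly_eq_0_iff_dvd elim: dvdE)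
  with Suc have "q ~= 0" by auto
  have "degree p = Suc (degree q)" unfolding q using \<open>q ~= 0\<close> by (subst degree_mult_eq) auto
  with Suc have d: "d = degree q" by simp
  show ?case
  proof (cases "B *v v - \<mu> *s v \<in> K")
   case True with Suc show ?thesis by blast
  next
   case False
   have "horner B q (B *v v - \<mu> *s v) = 0" using Suc(4) unfolding q horner_linear_factor .
   then show ?thesis using Suc(1)[OF d \<open>q ~= 0\<close>] Suc(5) False S by blast
  qed
 qed
 from this[OF p v] show ?thesis .
qed

lemma psd_kernel:
 fixes a :: "real ^ 'n ^ 'n"
 assumes sym: "!!v w. v \<bullet> (a *v w) = w \<bullet> (a *v v)" and psd: "!!v. 0 <= v \<bullet> (a *v v)"
  and v: "v \<bullet> (a *v v) = 0"
 shows "a *v v = 0"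
proof -
 define w where "w = a *v v"
 define b c where "b = w \<bullet> w" and "c = w \<bullet> (a *v w)"
 have c: "c >= 0" using psd by (simp add: c_def)
 \<comment> \<open>The quadratic \<open>2 * s * b + s\<^sup>2 * c\<close> is negative for small
   negative \<open>s\<close> unless \<open>b = 0\<close>; the denominator \<open>c + 1\<close> is
   positive even when \<open>c\<close> vanishes.\<close>
 define s where "s = - b / (c + 1)"
 have "0 <= (v + s *\<^sub>R w) \<bullet> (a *v (v + s *\<^sub>R w))" by (rule psd)
 also have "... = 2 * s * b + s\<^sup>2 * c"
  using v sym[of w v] by (simp add: matrix_vector_right_distrib scaleR_matrix_vector_assoc[symmetric]
   matrix_vector_mult_scaleR inner_simps b_def c_def w_def power2_eq_square algebra_simps inner_commute)
 also have "... = - (b\<^sup>2 * (c + 2) / (c + 1)\<^sup>2)"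
  using c by (simp add: s_def divide_simps power2_eq_square) (simp add: algebra_simps)
 finally have "b\<^sup>2 * (c + 2) / (c + 1)\<^sup>2 <= 0" by simp
 then have "b\<^sup>2 * (c + 2) <= 0" using c by (auto simp: divide_le_0_iff)
 then have "b = 0" using c by (smt (verit) mult_nonneg_nonneg mult_pos_pos zero_less_power2)
 then show ?thesis by (simp add: b_def w_def)
qed

section \<open>Complex eigenvectors of real matrices and Lyapunov forms\<close>

abbreviation "cmat \<equiv> map_matrix complex_of_real"
definition "cvec v = (\<chi> i. complex_of_real (v $ i))"
definition "rvec v = (\<chi> i. Re (v $ i))"
definition "ivec v = (\<chi> i. Im (v $ i))"

lemma cvec_nth [simp]: "cvec v $ i = complex_of_real (v $ i)" by (simp add: cvec_def)
lemma rvec_nth [simp]: "rvec v $ i = Re (v $ i)" by (simp add: rvec_def)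
lemma ivec_nth [simp]: "ivec v $ i = Im (v $ i)" by (simp add: ivec_def)

lemma cmat_nth [simp]: "cmat A $ i $ j = complex_of_real (A $ i $ j)" by (simp add: map_matrix_def)

lemma cmat_mult_cvec: "cmat A *v cvec v = cvec (A *v v)" by (simp add: vec_eq_iff matrix_vector_mult_def)

lemma rvec_cmat: "rvec (cmat A *v v) = A *v rvec v" and ivec_cmat: "ivec (cmat A *v v) = A *v ivec v"
 by (simp_all add: vec_eq_iff matrix_vector_mult_def)

lemma cmat_mult: "cmat (A ** B) = cmat A ** cmat B" by (simp add: vec_eq_iff matrix_matrix_mult_def)

lemma cmat_mat1 [simp]: "cmat (mat 1) = mat 1" by (simp add: vec_eq_iff mat_def)

text \<open>The matrix v w^T. Inner products with it are values of a bilinear form, which lets a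
  linear functional on matrices be read as such a form.\<close>

definition rank1 :: "real ^ 'n => real ^ 'n => real ^ 'n ^ 'n" where
 "rank1 v w = (\<chi> i j. v $ i * w $ j)"

lemma inner_rank1: "a \<bullet> rank1 v w = v \<bullet> (a *v w)"
 by (simp add: rank1_def inner_vec_def matrix_vector_mult_def sum_distrib_left mult_ac)

lemma rank1_conj: "transpose A ** rank1 v w ** A = rank1 (transpose A *v v) (transpose A *v w)"
proof -
 have "(\<Sum>k\<in>UNIV. (\<Sum>ka\<in>UNIV. A $ ka $ i * (v $ ka * w $ k)) * A $ k $ j) =
  (\<Sum>ja\<in>UNIV. A $ ja $ i * v $ ja) * (\<Sum>ja\<in>UNIV. A $ ja $ j * w $ ja)" for i j
  unfolding sum_product sum_distrib_right by (subst sum.swap) (simp add: mult_ac sum_distrib_left)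
 then show ?thesis by (simp add: vec_eq_iff rank1_def matrix_matrix_mult_def transpose_def matrix_vector_mult_def)
qed

lemma rank1_mult: "rank1 v w *v x = (w \<bullet> x) *\<^sub>R v"
 by (simp add: vec_eq_iff rank1_def matrix_vector_mult_def inner_vec_def sum_distrib_left sum_distrib_right mult_ac)

lemma inner_transpose_mult: "x \<bullet> (transpose A *v y) = (A *v x) \<bullet> (y :: real ^ 'n)"
 by (metis dot_lmul_matrix inner_commute transpose_matrix_vector)

definition no_unit_eigenvalue :: "real ^ 'n ^ 'n => bool" where
 "no_unit_eigenvalue A \<longleftrightarrow> (\<forall>\<mu> v. v ~= 0 & cmat A *v v = \<mu> *s v --> cmod \<mu> ~= 1)"

text \<open>
 The duality behind the discrete Lyapunov inequality: an obstruction to a strictly increasing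
 quadratic form is a positive semidefinite \<open>a\<close> with \<open>A a A\<^sup>T = a\<close>.
\<close>

lemma no_invariant_psd_form:
 fixes A a :: "real ^ 'n ^ 'n"
 assumes A: "no_unit_eigenvalue A"
  and sym: "!!v w. v \<bullet> (a *v w) = w \<bullet> (a *v v)" and psd: "!!v. 0 <= v \<bullet> (a *v v)"
  and inv: "!!v w. (transpose A *v v) \<bullet> (a *v (transpose A *v w)) = v \<bullet> (a *v w)"
 shows "a = 0"
proof (rule ccontr)
 assume "a ~= 0"
 then obtain v0 where v0: "a *v v0 ~= 0" by (metis matrix_eq matrix_vector_mult_0)
 let ?B = "cmat (transpose A)"
 define K where "K = {v. cmat a *v v = 0}"
 have K_iff: "v \<in> K \<longleftrightarrow> a *v rvec v = 0 & a *v ivec v = 0" for v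
 proof -
  have "cmat a *v v = 0 \<longleftrightarrow> rvec (cmat a *v v) = 0 & ivec (cmat a *v v) = 0"
   by (auto simp: vec_eq_iff complex_eq_iff)
  then show ?thesis by (simp add: K_def rvec_cmat ivec_cmat)
 qed
 have pres: "a *v (transpose A *v x) = 0" if "a *v x = 0" for x by (rule psd_kernel[OF sym psd]) (simp add: inv that)
 have aAt: "A *v (a *v (transpose A *v w)) = a *v w" for w
 proof (rule vector_eq_ldot[THEN iffD1], intro allI)
  fix v
  have "v \<bullet> (A *v (a *v (transpose A *v w))) = (transpose A *v v) \<bullet> (a *v (transpose A *v w))"
   using inner_transpose_mult[of "a *v (transpose A *v w)" A v] by (simp add: inner_commute)
  then show "v \<bullet> (A *v (a *v (transpose A *v w))) = v \<bullet> (a *v w)" by (simp add: inv)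
 qed
 have "cvec v0 \<notin> K" using v0 by (auto simp: K_iff rvec_def)
 then have "\<exists>\<mu> v. v \<in> UNIV & v \<notin> K & ?B *v v - \<mu> *s v \<in> K"
  by (intro eigenvector_modulo) (auto simp: K_def vector_scalar_commute)
 then obtain \<mu> v where v: "v \<notin> K" "?B *v v - \<mu> *s v \<in> K" by blast
 define k where "k = ?B *v v - \<mu> *s v"
 have k: "cmat a *v k = 0" using v by (simp add: k_def K_def)
 have Bv: "?B *v v = \<mu> *s v + k" by (simp add: k_def)
 define p q where "p = rvec v" and "q = ivec v"
 have aAt': "cmat A *v (cmat a *v (?B *v w)) = cmat a *v w" for w
 proof -
  have "rvec (cmat A *v (cmat a *v (?B *v w))) = rvec (cmat a *v w)"
   "ivec (cmat A *v (cmat a *v (?B *v w))) = ivec (cmat a *v w)" by (simp_all add: rvec_cmat ivec_cmat aAt)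
  then show ?thesis by (simp add: vec_eq_iff complex_eq_iff)
 qed
 \<comment> \<open>Up to the kernel of \<open>a\<close>, the matrix \<open>?B\<close> multiplies
   \<open>v\<close> by \<mu>. Inserting \<open>v\<close> in A a A^T = a therefore makes
   \<open>u\<close> an eigenvector of \<open>A\<close> with eigenvalue 1/\<mu>, and it remains to
   see that \<mu> has modulus 1.\<close>
 define u where "u = cmat a *v v"
 have u: "u ~= 0" using v by (simp add: u_def K_def)
 have 1: "\<mu> *s (cmat A *v u) = u"
  using aAt'[of v] by (simp add: Bv matrix_vector_right_distrib k vector_scalar_commute u_def)
 have mu: "\<mu> ~= 0" using 1 u by auto
 have 2: "cmat A *v u = inverse \<mu> *s u"
  using arg_cong[OF 1, of "%x. inverse \<mu> *s x"] mu by (simp add: vec.scale_scale)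
 \<comment> \<open>the Hermitian form of \<open>a\<close> at \<open>v\<close> is multiplied by \<open>\<bar>\<mu>\<bar>\<^sup>2\<close> and preserved\<close>
 define h where "h x = rvec x \<bullet> (a *v rvec x) + ivec x \<bullet> (a *v ivec x)" for x
 have h1: "h (?B *v v) = h v" by (simp add: h_def rvec_cmat ivec_cmat inv)
 have "h (\<mu> *s v + k) = (cmod \<mu>)\<^sup>2 * h v"
 proof -
  have kk: "a *v rvec k = 0" "a *v ivec k = 0" using v K_iff by (auto simp: k_def)
  have kr: "rvec k \<bullet> (a *v x) = 0" "ivec k \<bullet> (a *v x) = 0" for x
   using kk sym by (metis inner_zero_right)+
  have r: "rvec (\<mu> *s v + k) = Re \<mu> *\<^sub>R p - Im \<mu> *\<^sub>R q + rvec k"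
   and i: "ivec (\<mu> *s v + k) = Im \<mu> *\<^sub>R p + Re \<mu> *\<^sub>R q + ivec k"
   by (simp_all add: vec_eq_iff p_def q_def algebra_simps)
  have c2: "(cmod \<mu>)\<^sup>2 = Re \<mu> * Re \<mu> + Im \<mu> * Im \<mu>" unfolding cmod_power2 by (simp add: power2_eq_square)
  show ?thesis unfolding h_def r i p_def[symmetric] q_def[symmetric] c2 using sym[of p q]
   by (simp add: matrix_vector_right_distrib matrix_vector_mult_diff_distrib matrix_vector_mult_scaleR
     kk kr inner_simps algebra_simps)
 qed
 with h1 Bv have h2: "(cmod \<mu>)\<^sup>2 * h v = h v" by simp
 have "h v ~= 0"
 proof
  assume "h v = 0"
  then have "p \<bullet> (a *v p) = 0" "q \<bullet> (a *v q) = 0"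
   using psd[of p] psd[of q] by (auto simp: h_def p_def q_def)
  then have "a *v p = 0" "a *v q = 0" using psd_kernel[OF sym psd] by auto
  then show False using v K_iff by (simp add: p_def q_def)
 qed
 with h2 have "(cmod \<mu>)\<^sup>2 = 1" by simp
 then have "cmod \<mu> = 1" by (simp add: power2_eq_1_iff abs_if) (smt (verit) norm_ge_zero)
 then have "cmod (inverse \<mu>) = 1" by (simp add: norm_inverse)
 with A u 2 show False by (auto simp: no_unit_eigenvalue_def)
qed

text \<open>The image of Q |-> A^T Q A - Q is a subspace. If it missed the cone of positive
  matrices, a separating matrix \<open>a\<close> would vanish on it, which means A a A^T = a, and it
  would be symmetric and positive semidefinite; \<open>no_invariant_psd_form\<close> excludes this.
  Stable and unstable subspaces never have to be constructed.\<close>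

lemma discrete_lyapunov:
 fixes A :: "real ^ 'n ^ 'n"
 assumes A: "no_unit_eigenvalue A"
 shows "\<exists>Q :: real ^ 'n ^ 'n. \<forall>v. v ~= 0 --> v \<bullet> (Q *v v) < (A *v v) \<bullet> (Q *v (A *v v))"
proof (rule ccontr)
 assume neg: "\<nexists>Q :: real ^ 'n ^ 'n. \<forall>v. v ~= 0 --> v \<bullet> (Q *v v) < (A *v v) \<bullet> (Q *v (A *v v))"
 define f where "f Q = transpose A ** Q ** A - Q" for Q :: "real ^ 'n ^ 'n"
 \<comment> \<open>Only the quadratic form of \<open>G\<close> is constrained. Skew matrices may
   thus be added within \<open>PD\<close>, and this is what forces the separating matrix to be
   symmetric.\<close>
 define PD where "PD = {G :: real ^ 'n ^ 'n. \<forall>v. v ~= 0 --> 0 < v \<bullet> (G *v v)}"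
 have lin: "f (s *\<^sub>R P + t *\<^sub>R Q) = s *\<^sub>R f P + t *\<^sub>R f Q" for s t P Q
  by (simp add: f_def matrix_add_ldistrib matrix_add_right scalar_matrix_assoc[symmetric]
    matrix_scalar_ac algebra_simps)
 have fq: "v \<bullet> (f Q *v v) = (A *v v) \<bullet> (Q *v (A *v v)) - v \<bullet> (Q *v v)" for Q v
  by (simp add: f_def matrix_vector_mult_diff_rdistrib matrix_vector_mul_assoc[symmetric] inner_simps inner_transpose_mult)
 have "range f \<inter> PD = {}" using neg by (fastforce simp: PD_def fq)
 moreover have "convex (range f)" by (auto simp: convex_def lin[symmetric])
 moreover have "convex PD" unfolding convex_def PD_def
 proof (clarsimp simp: matrix_vector_mult_add_rdistrib inner_simps scaleR_matrix_vector_assoc[symmetric])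
  fix x y :: "real ^ 'n ^ 'n" and u w :: real and v :: "real ^ 'n"
  assume *: "\<forall>v. v ~= 0 --> 0 < v \<bullet> (x *v v)" "\<forall>v. v ~= 0 --> 0 < v \<bullet> (y *v v)"
   "0 <= u" "0 <= w" "u + w = 1" "v ~= 0"
  then show "0 < u * (v \<bullet> (x *v v)) + w * (v \<bullet> (y *v v))"
   by (cases "u = 0") (auto intro!: add_pos_nonneg)
 qed
 moreover have "mat 1 \<in> PD" by (simp add: PD_def)
 ultimately obtain a b where ab: "a ~= 0" "!!G. G \<in> range f ==> a \<bullet> G <= b" "!!G. G \<in> PD ==> b <= a \<bullet> G"
  using separating_hyperplane_sets[of "range f" PD] by blast
 have f0: "a \<bullet> f Q = 0" for Q
 proof (rule ccontr)
  assume n: "a \<bullet> f Q ~= 0"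
  \<comment> \<open>On this multiple of \<open>Q\<close> the functional has the value
    \<open>\<bar>b\<bar> + 1\<close>, above its bound \<open>b\<close> on the subspace.\<close>
  define s where "s = (\<bar>b\<bar> + 1) / (a \<bullet> f Q)"
  have "a \<bullet> f (s *\<^sub>R Q + 0 *\<^sub>R Q) <= b" by (rule ab) simp
  then have "s * (a \<bullet> f Q) <= b" unfolding lin by simp
  with n show False by (simp add: s_def)
 qed
 have b0: "0 <= b" using ab(2)[of "f 0"] f0[of 0] by auto
 have PD0: "0 <= a \<bullet> G" if "G \<in> PD" for G using ab(3)[OF that] b0 by linarith
 have sym: "v \<bullet> (a *v w) = w \<bullet> (a *v v)" for v w
 proof (rule ccontr)
  define k where "k = a \<bullet> (rank1 v w - rank1 w v)"
  assume "v \<bullet> (a *v w) ~= w \<bullet> (a *v v)"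
  then have k: "k ~= 0" by (simp add: k_def inner_diff_right inner_rank1)
  \<comment> \<open>Chosen so that the functional takes the value -1 on \<open>mat 1\<close> plus
    this multiple of the skew matrix.\<close>
  define s where "s = - (a \<bullet> mat 1 + 1) / k"
  have sk: "x \<bullet> ((rank1 v w - rank1 w v) *v x) = 0" for x
  proof -
   show ?thesis by (simp add: matrix_vector_mult_diff_rdistrib inner_diff_right rank1_mult inner_commute)
  qed
  have "mat 1 + s *\<^sub>R (rank1 v w - rank1 w v) \<in> PD"
   by (auto simp: PD_def matrix_vector_mult_add_rdistrib inner_add_right scaleR_matrix_vector_assoc[symmetric] sk)
  from PD0[OF this] have "0 <= a \<bullet> mat 1 + s * k" by (simp add: inner_add_right k_def)
  with k show False by (simp add: s_def)
 qed
 have psd: "0 <= v \<bullet> (a *v v)" for v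
 proof (rule field_le_epsilon)
  fix e :: real assume "e > 0"
  define d where "d = e / (\<bar>a \<bullet> mat 1\<bar> + 1)"
  have d: "d > 0" using \<open>e > 0\<close> by (simp add: d_def)
  have "rank1 v v + d *\<^sub>R mat 1 \<in> PD"
   using d by (auto simp: PD_def matrix_vector_mult_add_rdistrib inner_add_right
    scaleR_matrix_vector_assoc[symmetric] rank1_mult inner_commute intro!: add_nonneg_pos)
  from PD0[OF this] have "0 <= v \<bullet> (a *v v) + d * (a \<bullet> mat 1)"
   by (simp add: inner_add_right inner_rank1)
  also have "d * (a \<bullet> mat 1) <= d * (\<bar>a \<bullet> mat 1\<bar> + 1)" using d by (intro mult_left_mono) auto
  also have "... = e" by (simp add: d_def)
  finally show "0 <= v \<bullet> (a *v v) + e" by simp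
 qed
 have inv: "(transpose A *v v) \<bullet> (a *v (transpose A *v w)) = v \<bullet> (a *v w)" for v w
  using f0[of "rank1 v w"] by (simp add: f_def rank1_conj inner_diff_right inner_rank1)
 have "a = 0" by (rule no_invariant_psd_form[OF A sym psd inv])
 with ab show False by simp
qed

section \<open>Characteristic polynomials\<close>

lemma poly_det: "poly (det P) x = det (\<chi> i j. poly (P $ i $ j) x)" by (simp add: det_def poly_sum poly_prod)

lemma poly_charpoly: "poly (charpoly N) \<mu> = det (mat \<mu> - N)"
proof -
 have "(\<chi> i j. poly (((\<chi> i j. (if i = j then [:0, 1:] else 0) - [:N $ i $ j:])) $ i $ j) \<mu>) = mat \<mu> - N"
  by (simp add: vec_eq_iff mat_def)
 then show ?thesis unfolding charpoly_def poly_det by simp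
qed

lemma det_eq_0_iff_kernel:
 fixes A :: "'a::field ^ 'n ^ 'n"
 shows "det A = 0 \<longleftrightarrow> (\<exists>v. v ~= 0 & A *v v = 0)"
proof -
 have "det A ~= 0 \<longleftrightarrow> (\<forall>v. A *v v = 0 --> v = 0)"
  by (metis invertible_det_nz invertible_left_inverse matrix_left_invertible_ker)
 then show ?thesis by blast
qed

lemma mat_mult_vec: "mat c *v v = c *s v"
 by (simp add: vec_eq_iff mat_def matrix_vector_mult_def if_distrib[of "%x. x * _"] cong: if_cong)

lemma charpoly_root_iff: "poly (charpoly N) \<mu> = 0 \<longleftrightarrow> is_eigenvalue N \<mu>"
 unfolding poly_charpoly det_eq_0_iff_kernel is_eigenvalue_def
 by (auto simp: matrix_vector_mult_diff_rdistrib mat_mult_vec)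

text \<open>A permutation that moves some index replaces a linear diagonal entry by a constant, so
  only the identity reaches full degree.\<close>

lemma charpoly_monic:
 fixes N :: "complex ^ 'n ^ 'n"
 shows "degree (charpoly N) = CARD('n) & lead_coeff (charpoly N) = 1"
proof -
 define M where "M = (%i j. (if i = j then [:0, 1:] else 0) - [:N $ i $ j:])"
 define T where "T = (%p. of_int (sign p) * (\<Prod>i\<in>UNIV. M i (p i)))"
 have c: "charpoly N = (\<Sum>p | p permutes UNIV. T p)" by (simp add: charpoly_def det_def M_def T_def)
 have deg0: "degree (T p) < CARD('n)" if p: "p permutes UNIV" "p ~= id" for p
 proof -
  obtain i0 where i0: "p i0 ~= i0" using p(2) by (auto simp: fun_eq_iff)
  have "of_int (sign p) = [:of_int (sign p) :: complex:]" by (simp add: of_int_poly)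
  then have "degree (T p) <= degree (\<Prod>i\<in>UNIV. M i (p i))" unfolding T_def by (metis degree_pCons_0 degree_mult_le add_0)
  also have "... <= (\<Sum>i\<in>UNIV. degree (M i (p i)))"
   using degree_prod_sum_le[of UNIV "%i. M i (p i)"] by (simp add: o_def)
  also have "... <= (\<Sum>i\<in>UNIV. if i = i0 then 0 else 1)"
   by (intro sum_mono) (use i0 in \<open>auto simp: M_def\<close>)
  also have "... = card (UNIV - {i0} :: 'n set)" by (subst sum.mono_neutral_right[of UNIV "UNIV - {i0}"]) auto
  also have "... < CARD('n)" by (intro psubset_card_mono) auto
  finally show ?thesis .
 qed
 have Tid: "T id = (\<Prod>i\<in>UNIV. [:- (N $ i $ i), 1:])" by (simp add: T_def M_def)
 have degid: "degree (T id) = CARD('n)" unfolding Tid by (subst degree_prod_eq_sum_degree) auto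
 have lcid: "lead_coeff (T id) = 1" unfolding Tid by (simp add: lead_coeff_prod)
 define R where "R = (\<Sum>p\<in>{p. p permutes UNIV} - {id}. T p)"
 have fin: "finite {p. p permutes (UNIV :: 'n set)}" by (rule finite_permutations) simp
 have "charpoly N = T id + R" unfolding c R_def by (subst sum.remove[of _ id]) (use fin permutes_id in auto)
 moreover have "degree R < CARD('n)" unfolding R_def by (rule degree_sum_less) (use deg0 in auto)
 ultimately show ?thesis using degid lcid by (simp add: degree_add_eq_left coeff_eq_0)
qed

text \<open>Up to sign the determinant is the product of the roots with multiplicity. None lies
  inside the unit circle, and the root 1 has too small a multiplicity to account for all of
  them.\<close>

lemma cmod_det_gt_1:
 fixes N :: "complex ^ 'n ^ 'n"
 assumes ev: "!!\<mu>. is_eigenvalue N \<mu> ==> \<mu> = 1 \<or> cmod \<mu> > 1"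
  and ord: "order 1 (charpoly N) < CARD('n)"
 shows "cmod (det N) > 1"
proof -
 obtain p where p_def: "p = charpoly N" by blast
 have p: "degree p = CARD('n)" "lead_coeff p = 1" using charpoly_monic[of N] by (auto simp: p_def)
 then have "p ~= 0" by auto
 then have fin: "finite {z. poly p z = 0}" by (rule poly_roots_finite)
 have dec: "p = (\<Prod>z | poly p z = 0. [:- z, 1:] ^ order z p)" using complex_poly_decompose[of p] p by simp
 have deg: "CARD('n) = (\<Sum>z | poly p z = 0. order z p)"
 proof -
  have "degree p = (\<Sum>z | poly p z = 0. degree ([:- z, 1:] ^ order z p))"
   by (subst dec, subst degree_prod_eq_sum_degree) auto
  then show ?thesis by (simp add: p(1) degree_power_eq)
 qed
 have "\<exists>z. poly p z = 0 & z ~= 1"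
 proof (rule ccontr)
  assume "\<nexists>z. poly p z = 0 & z ~= 1"
  then have "{z. poly p z = 0} \<subseteq> {1}" by auto
  then have "(\<Sum>z | poly p z = 0. order z p) <= (\<Sum>z\<in>{1}. order z p)" by (intro sum_mono2) auto
  with deg ord show False by (simp add: p_def)
 qed
 then obtain z0 where z0: "poly p z0 = 0" "z0 ~= 1" by blast
 have gt: "cmod z0 > 1" using ev z0 by (auto simp: p_def charpoly_root_iff)
 have ge: "1 <= cmod z ^ order z p" if "poly p z = 0" for z
  using ev[of z] that by (intro one_le_power) (auto simp: p_def charpoly_root_iff)
 have "cmod (poly p 0) = (\<Prod>z | poly p z = 0. cmod z ^ order z p)"
  by (subst dec) (simp only: poly_prod prod_norm[symmetric] norm_power poly_power, simp)
 also have "... > 1"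
 proof -
  define a b where "a = cmod z0 ^ order z0 p" and "b = (\<Prod>z\<in>{z. poly p z = 0} - {z0}. cmod z ^ order z p)"
  have eq: "(\<Prod>z | poly p z = 0. cmod z ^ order z p) = a * b"
   unfolding a_def b_def by (rule prod.remove) (use fin z0 in auto)
  have "order z0 p > 0" using z0 \<open>p ~= 0\<close> by (simp add: order_root)
  then have a: "1 < a" unfolding a_def using gt by (intro one_less_power) auto
  have b: "1 <= b" unfolding b_def by (intro prod_ge_1) (use ge in auto)
  have "a * 1 <= a * b" using a b by (intro mult_left_mono) auto
  with a show ?thesis unfolding eq by linarith
 qed
 also have "poly p 0 = det (- N)" by (simp add: p_def poly_charpoly mat_0)
 also have "cmod (det (- N)) = cmod (det N)"
 proof -
  have "det (\<chi> i. (- 1) *s (N $ i)) = (\<Prod>i\<in>(UNIV::'n set). - 1) * det (\<chi> i. N $ i)"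
   by (rule det_rows_mul)
  moreover have "(\<chi> i. (- 1) *s (N $ i)) = - N" "(\<chi> i. N $ i) = N" by (simp_all add: vec_eq_iff)
  ultimately show ?thesis by (simp add: norm_mult norm_power)
 qed
 finally show ?thesis .
qed

lemma sum_const_poly: "(\<Sum>k\<in>A. [:f k:]) = [:sum f A:]" by (induction A rule: infinite_finite_induct) auto

text \<open>If \<open>v\<close> were independent of \<open>y\<close>, both would span an invariant
  plane on which \<open>N\<close> is unipotent, and 1 would be a multiple root. A second eigenvector
  (\<open>a = 0\<close>) and a Jordan chain are covered alike.\<close>

lemma simple_eigenvalue_no_chain:
 fixes N :: "complex ^ 'n ^ 'n"
 assumes y: "N *v y = y" "y ~= 0" and v: "N *v v = v + a *s y"
  and ord: "order 1 (charpoly N) <= 1"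
 shows "\<exists>c. v = c *s y"
proof (rule ccontr)
 assume ind: "\<nexists>c. v = c *s y"
 obtain i0 where i0: "y $ i0 ~= 0" using y(2) by (auto simp: vec_eq_iff)
 define c where "c = v $ i0 / y $ i0"
 define w where "w = v - c *s y"
 have w0: "w $ i0 = 0" using i0 by (simp add: w_def c_def)
 have w: "N *v w = w + a *s y" using y v by (simp add: w_def matrix_vector_mult_diff_distrib vector_scalar_commute)
 have "w ~= 0" using ind by (auto simp: w_def)
 then obtain i1 where i1: "w $ i1 ~= 0" by (auto simp: vec_eq_iff)
 have ne: "i0 ~= i1" using w0 i1 by auto
 \<comment> \<open>the rows of \<open>B\<close> are \<open>y\<close>, \<open>w\<close> and unit vectors\<close>
 define B where "B = (\<chi> i. if i = i0 then y else if i = i1 then w else axis i 1)"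
 have "det B ~= 0"
 proof
  assume "det B = 0"
  then have "det (transpose B) = 0" by (simp add: det_transpose)
  then obtain x where x: "x ~= 0" "transpose B *v x = 0" unfolding det_eq_0_iff_kernel by blast
  have "(\<Sum>k\<in>UNIV. B $ k $ j * x $ k) = 0" for j
   using arg_cong[OF x(2), of "%v. v $ j"] by (simp add: matrix_vector_mult_def transpose_def)
  then have *: "(\<Sum>k\<in>UNIV. B $ k $ j * x $ k) = 0" for j .
  have Bsum: "(\<Sum>k\<in>UNIV. B $ k $ j * x $ k) =
   y $ j * x $ i0 + (w $ j * x $ i1 + (if j = i0 \<or> j = i1 then 0 else x $ j))" for j
  proof -
   have "(\<Sum>k\<in>UNIV. B $ k $ j * x $ k) = B $ i0 $ j * x $ i0 + (B $ i1 $ j * x $ i1 + (\<Sum>k\<in>UNIV - {i0} - {i1}. B $ k $ j * x $ k))"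
   proof -
    have "(\<Sum>k\<in>UNIV. B $ k $ j * x $ k) = B $ i0 $ j * x $ i0 + (\<Sum>k\<in>UNIV - {i0}. B $ k $ j * x $ k)"
     by (rule sum.remove) auto
    moreover have "(\<Sum>k\<in>UNIV - {i0}. B $ k $ j * x $ k) = B $ i1 $ j * x $ i1 + (\<Sum>k\<in>UNIV - {i0} - {i1}. B $ k $ j * x $ k)"
     by (rule sum.remove) (use ne in auto)
    ultimately show ?thesis by (rule trans[OF _ arg_cong])
   qed
   also have "(\<Sum>k\<in>UNIV - {i0} - {i1}. B $ k $ j * x $ k) = (\<Sum>k\<in>UNIV - {i0} - {i1}. if k = j then x $ j else 0)"
    by (intro sum.cong) (auto simp: B_def axis_def)
   also have "... = (if j = i0 \<or> j = i1 then 0 else x $ j)" by (simp add: sum.delta')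
   finally show ?thesis using ne by (simp add: B_def)
  qed
  have x0: "x $ i0 = 0" using *[of i0] i0 unfolding Bsum by (simp add: w0)
  have x1: "x $ i1 = 0" using *[of i1] i1 x0 unfolding Bsum by simp
  have "x $ j = 0" for j
  proof (cases "j = i0 \<or> j = i1")
   case False
   with *[of j] show ?thesis unfolding Bsum by (simp add: x0 x1)
  qed (use x0 x1 in auto)
  with x show False by (simp add: vec_eq_iff)
 qed
 define PB where "PB = (\<chi> i j. [:B $ i $ j:])"
 define C where "C = (\<chi> i j. (if i = j then [:0, 1:] else 0) - [:N $ i $ j:])"
 \<comment> \<open>The rows \<open>i0\<close> and \<open>i1\<close> of this matrix are (X - 1) y and
   (X - 1) w - a y. A row operation removes the multiple of \<open>y\<close>, and the factor X - 1
   comes out twice. As \<open>det PB\<close> does not vanish at 1, the double root belongs to the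
   characteristic polynomial.\<close>
 define R where "R = PB ** transpose C"
 have R: "R $ i = [:0, 1:] *s (\<chi> j. [:B $ i $ j:]) - (\<chi> j. [:(N *v (B $ i)) $ j:])" for i
 proof (simp add: vec_eq_iff R_def PB_def C_def matrix_matrix_mult_def transpose_def, intro allI)
  fix j
  have "(\<Sum>k\<in>UNIV. [:B $ i $ k:] * ((if j = k then [:0, 1:] else 0) - [:N $ j $ k:])) =
   (\<Sum>k\<in>UNIV. (if j = k then [:0, 1:] * [:B $ i $ k:] else 0)) - (\<Sum>k\<in>UNIV. [:N $ j $ k * B $ i $ k:])"
   unfolding sum_subtractf[symmetric] by (intro sum.cong) (auto simp: algebra_simps)
  also have "(\<Sum>k\<in>UNIV. [:N $ j $ k * B $ i $ k:]) = [:(N *v (B $ i)) $ j:]"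
   unfolding matrix_vector_mult_def sum_const_poly by simp
  finally show "(\<Sum>k\<in>UNIV. smult (B $ i $ k) ((if j = k then [:0, 1:] else 0) - [:N $ j $ k:])) =
   [:- ((N *v (B $ i)) $ j), B $ i $ j:]" by (simp add: sum.delta)
 qed
 define X where "X = [:- 1, 1 :: complex:]"
 define py pw where "py = (\<chi> j. [:y $ j:])" and "pw = (\<chi> j. [:w $ j:])"
 have R0: "R $ i0 = X *s py" unfolding R by (simp add: B_def y vec_eq_iff X_def py_def)
 have R1: "R $ i1 = X *s pw - [:a:] *s py" unfolding R using ne by (simp add: B_def w vec_eq_iff X_def py_def pw_def)
 have "det R = X * det (\<chi> k. if k = i0 then py else R $ k)"
 proof -
  have "R = (\<chi> k. if k = i0 then X *s py else R $ k)" by (simp add: vec_eq_iff R0)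
  then have "det R = det (\<chi> k. if k = i0 then X *s py else R $ k)" by (rule arg_cong)
  also have "... = X * det (\<chi> k. if k = i0 then py else R $ k)" by (rule det_row_mul)
  finally show ?thesis .
 qed
 also have "det (\<chi> k. if k = i0 then py else R $ k) = X * det (\<chi> k. if k = i1 then pw else if k = i0 then py else R $ k)"
 proof -
  define A where "A = (\<chi> k. if k = i0 then py else R $ k)"
  have "det A = det (\<chi> k. if k = i1 then row i1 A + [:a:] *s row i0 A else row k A)"
   using det_row_operation[OF ne[symmetric], of A "[:a:]"] by simp
  also have "(\<chi> k. if k = i1 then row i1 A + [:a:] *s row i0 A else row k A) =
   (\<chi> k. if k = i1 then X *s pw else if k = i0 then py else R $ k)"
   using ne by (auto simp: vec_eq_iff row_def A_def R1)
  also have "det ... = X * det (\<chi> k. if k = i1 then pw else if k = i0 then py else R $ k)" by (rule det_row_mul)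
  finally show ?thesis by (simp add: A_def)
 qed
 finally have dvd: "X ^ 2 dvd det R" by (simp add: power2_eq_square mult.assoc)
 have detR: "det R = det PB * charpoly N" by (simp add: R_def det_mul det_transpose C_def charpoly_def)
 have PB1: "poly (det PB) 1 ~= 0" using \<open>det B ~= 0\<close> by (simp add: poly_det PB_def)
 then have "det PB ~= 0" by auto
 moreover have "charpoly N ~= 0" using charpoly_monic[of N] by auto
 ultimately have nz: "det PB * charpoly N ~= 0" by simp
 have "2 <= order 1 (det PB * charpoly N)" using dvd nz by (simp add: order_divides X_def detR[symmetric])
 also have "... = order 1 (charpoly N)" using nz PB1 by (simp add: order_mult order_0I)
 finally show False using ord by simp
qed

section \<open>The attracting orbit\<close>

definition lattice :: "(real ^ 'n) set" where
 "lattice = {c. \<forall>i. \<exists>k::int. c $ i = 2 * pi * k}"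

lemma lattice_0 [simp]: "0 \<in> lattice" by (auto simp: lattice_def intro!: exI[of _ "0::int"])

lemma lattice_add: "c \<in> lattice ==> d \<in> lattice ==> c + d \<in> lattice"
proof (clarsimp simp: lattice_def)
 fix i assume "\<forall>i. \<exists>k::int. c $ i = 2 * pi * k" "\<forall>i. \<exists>k::int. d $ i = 2 * pi * k"
 then obtain k l :: int where "c $ i = 2 * pi * k" "d $ i = 2 * pi * l" by meson
 then show "\<exists>k::int. c $ i + d $ i = 2 * pi * k" by (intro exI[of _ "k + l"]) (simp add: algebra_simps)
qed

lemma lattice_minus: "c \<in> lattice ==> - c \<in> lattice"
proof (clarsimp simp: lattice_def)
 fix i assume "\<forall>i. \<exists>k::int. c $ i = 2 * pi * k"
 then obtain k :: int where "c $ i = 2 * pi * k" by meson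
 then show "\<exists>k::int. - c $ i = 2 * pi * k" by (intro exI[of _ "- k"]) simp
qed

lemma lattice_diff: "c \<in> lattice ==> d \<in> lattice ==> c - d \<in> lattice"
 using lattice_add[of c "- d"] lattice_minus[of d] by simp

lemma lattice_small: 
 assumes "c \<in> lattice" "norm c < 1" shows "c = 0"
proof (rule ccontr)
 assume "c ~= 0"
 then obtain i where i: "c $ i ~= 0" by (auto simp: vec_eq_iff)
 obtain k :: int where k: "c $ i = 2 * pi * k" using assms by (auto simp: lattice_def)
 with i have "\<bar>real_of_int k\<bar> >= 1" by auto
 then have "2 * pi * \<bar>real_of_int k\<bar> >= 2 * pi * 1" by (intro mult_left_mono) auto
 then have "\<bar>c $ i\<bar> >= 2 * pi" by (simp add: k abs_mult)
 with component_le_norm_cart[of c i] assms pi_gt3 show False by linarith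
qed

text \<open>Keeps the family of sets in the Baire argument countable, as lattice translations are
  among its indices.\<close>

lemma countable_lattice: "countable (lattice :: (real ^ 'n) set)"
proof -
 have "countable (UNIV :: (int ^ 'n) set)"
 proof -
  have "inj (vec_nth :: int ^ 'n => 'n => int)" by (simp add: inj_def vec_nth_inject)
  moreover have "countable (range (vec_nth :: int ^ 'n => 'n => int))"
   by (rule countable_subset[OF _ countable_PiE[of UNIV "%_. UNIV"]]) (auto simp: PiE_UNIV_domain)
  ultimately show ?thesis by (rule countable_image_inj_on[rotated])
 qed
 moreover have "lattice \<subseteq> range (%k::int^'n. \<chi> i. 2 * pi * real_of_int (k $ i))"
 proof
  fix c :: "real ^ 'n" assume "c \<in> lattice"
  then have "\<exists>f :: 'n => int. \<forall>i. c $ i = 2 * pi * f i" unfolding lattice_def by (intro choice) simp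
  then obtain f :: "'n => int" where "!!i. c $ i = 2 * pi * f i" by blast
  then show "c \<in> range (%k::int^'n. \<chi> i. 2 * pi * real_of_int (k $ i))"
   by (intro image_eqI[of _ _ "\<chi> i. f i"]) (auto simp: vec_eq_iff)
 qed
 ultimately show ?thesis using countable_image countable_subset by blast
qed

lemma periodic_axis:
 assumes "periodic f"
 shows "f (x + axis i (2 * pi * real_of_int k)) = f x"
proof (induction k arbitrary: x rule: int_induct[of _ 0])
 case (step1 k)
 have "axis i (2 * pi * real_of_int (k + 1)) = axis i (2 * pi * real_of_int k) + axis i (2 * pi)"
  by (simp add: vec_eq_iff axis_def algebra_simps)
 then have "x + axis i (2 * pi * real_of_int (k + 1)) = (x + axis i (2 * pi * real_of_int k)) + axis i (2 * pi)"
  by (simp only: add.assoc)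
 with step1 assms show ?case by (simp only: periodic_def)
next
 case (step2 k)
 have "axis i (2 * pi * real_of_int k) = axis i (2 * pi * real_of_int (k - 1)) + axis i (2 * pi)"
  by (simp add: vec_eq_iff axis_def algebra_simps)
 then have "x + axis i (2 * pi * real_of_int k) = (x + axis i (2 * pi * real_of_int (k - 1))) + axis i (2 * pi)"
  by (simp only: add.assoc)
 then have "f (x + axis i (2 * pi * real_of_int k)) = f (x + axis i (2 * pi * real_of_int (k - 1)))"
  using assms by (simp only: periodic_def)
 with step2 show ?case by simp
qed (simp add: axis_def zero_vec_def[symmetric])

lemma periodic_lattice:
 fixes f :: "real ^ 'n => 'b"
 assumes f: "periodic f" and c: "c \<in> lattice"
 shows "f (x + c) = f x"
proof -
 have "f (x + (\<Sum>i\<in>I. axis i (c $ i))) = f x" for I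
 proof (induction I arbitrary: x rule: infinite_finite_induct)
  case (insert i I)
  obtain k :: int where "c $ i = 2 * pi * k" using c by (auto simp: lattice_def)
  then have "f (x + axis i (c $ i) + (\<Sum>i\<in>I. axis i (c $ i))) = f x"
   using periodic_axis[OF f] by (simp add: insert)
  then show ?case using insert by (simp add: add_ac)
 qed auto
 moreover have "(\<Sum>i\<in>UNIV. axis i (c $ i)) = c" by (simp add: vec_eq_iff axis_def)
 ultimately show ?thesis by (metis (no_types))
qed

lemma torus_proj_eq_iff: "torus_proj x = torus_proj y \<longleftrightarrow> y - x \<in> lattice"
proof -
 have "abs_circle a = abs_circle b \<longleftrightarrow> (\<exists>k::int. b = a + 2 * pi * k)" for a b
  by (rule circle.abs_eq_iff)
 then show ?thesis by (simp add: torus_proj_def vec_eq_iff lattice_def algebra_simps)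
qed

lemma continuous_torus_proj: "continuous_on UNIV (torus_proj :: real ^ 'n => _)"
proof -
 have *: "continuous_on UNIV abs_circle" by (simp add: continuous_on_open_vimage open_circle_def)
 show ?thesis unfolding torus_proj_def
  by (intro continuous_on_vec_lambda continuous_on_compose2[OF *] continuous_intros) auto
qed

lemma lattice_translate_to_cell: "\<exists>c\<in>lattice. x + c \<in> (cell :: (real ^ 'n) set)"
proof -
 define c where "c = (\<chi> i. 2 * pi * real_of_int (- \<lfloor>x $ i / (2 * pi)\<rfloor>))"
 have "c \<in> lattice" unfolding lattice_def c_def by (simp only: mem_Collect_eq vec_lambda_beta) blast
 moreover have "0 <= (x + c) $ i & (x + c) $ i <= 2 * pi" for i
 proof -
  have "(x + c) $ i = (2 * pi) * (x $ i / (2 * pi) - of_int \<lfloor>x $ i / (2 * pi)\<rfloor>)"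
   by (simp add: c_def algebra_simps)
  moreover have "0 <= x $ i / (2 * pi) - of_int \<lfloor>x $ i / (2 * pi)\<rfloor>"
   "x $ i / (2 * pi) - of_int \<lfloor>x $ i / (2 * pi)\<rfloor> <= 1" by linarith+
  ultimately show ?thesis using mult_left_mono[of "x $ i / (2 * pi) - of_int \<lfloor>x $ i / (2 * pi)\<rfloor>" 1 "2 * pi"] by simp
 qed
 then have "x + c \<in> cell" by (simp add: cell_def mem_box_cart)
 ultimately show ?thesis by blast
qed

lemma compact_cell: "compact (cell :: (real ^ 'n) set)" by (simp add: cell_def)

lemma lattice_convergent_const:
 assumes "!!j. c j \<in> lattice" "c \<longlonglongrightarrow> d"
 shows "\<exists>J. \<forall>j\<ge>J. c j = d"
proof -
 have "\<forall>\<^sub>F j in sequentially. dist (c j) d < 1/2" using assms(2) by (rule tendstoD) simp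
 then obtain J where J: "!!j. j >= J ==> dist (c j) d < 1/2" by (auto simp: eventually_sequentially)
 have eq: "c j = c J" if "j >= J" for j
 proof -
  have "dist (c j) (c J) < 1" using J[OF that] J[of J] dist_triangle2[of "c j" "c J" d] by linarith
  then have "c j - c J = 0" by (intro lattice_small lattice_diff assms(1)) (simp add: dist_norm)
  then show ?thesis by simp
 qed
 have "c \<longlonglongrightarrow> c J" by (rule tendsto_eventually) (use eq in \<open>unfold eventually_sequentially, blast\<close>)
 then have "c J = d" using assms(2) LIMSEQ_unique by blast
 with eq show ?thesis by blast
qed

section \<open>Determinants along the flow\<close>

definition trace_of :: "((real ^ 'n) \<Rightarrow>\<^sub>L (real ^ 'n)) => real" where
 "trace_of B = (\<Sum>i\<in>UNIV. B (axis i 1) $ i)"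

definition bmat :: "((real ^ 'n) \<Rightarrow>\<^sub>L (real ^ 'n)) => real ^ 'n ^ 'n" where
 "bmat B = matrix (blinfun_apply B)"

lemma bmat_apply [simp]: "bmat B *v v = B v"
 unfolding bmat_def by (rule fun_cong[OF matrix_vector_mul(3)[OF blinfun.bounded_linear_right]])

lemma bmat_compose: "bmat (B o\<^sub>L C) = bmat B ** bmat C"
 by (simp add: matrix_eq matrix_vector_mul_assoc[symmetric])

lemma bmat_id [simp]: "bmat id_blinfun = mat 1" by (simp add: matrix_eq)

lemma bmat_nth: "bmat B $ i $ j = B (axis j 1) $ i" by (simp add: bmat_def matrix_def)

text \<open>A permutation other than the identity moves at least two indices, hence meets two zero
  entries of the identity matrix; one of them survives when a single factor is
  differentiated.\<close>

lemma det_derivative_at_identity: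
 fixes B :: "real => (real ^ 'n) \<Rightarrow>\<^sub>L (real ^ 'n)"
 assumes B: "(B has_vector_derivative B') (at 0)" and B0: "B 0 = id_blinfun"
 shows "((%t. det (bmat (B t))) has_real_derivative trace_of B') (at 0)"
proof -
 have entry: "((%t. bmat (B t) $ i $ j) has_real_derivative B' (axis j 1) $ i) (at 0)" for i j
  unfolding bmat_nth has_real_derivative_iff_has_vector_derivative
  by (intro bounded_linear.has_vector_derivative[OF bounded_linear_vec_nth] blinfun_vector_derivative B)
 have ent0: "bmat (B 0) $ i $ j = (if i = j then 1 else 0)" for i j by (simp add: B0 mat_def)
 let ?D = "%p. of_int (sign p) * (\<Sum>i\<in>UNIV. B' (axis (p i) 1) $ i * (\<Prod>j\<in>UNIV - {i}. bmat (B 0) $ j $ p j))"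
 have "((%t. det (bmat (B t))) has_real_derivative (\<Sum>p | p permutes UNIV. ?D p)) (at 0)" unfolding det_def
  by (intro DERIV_sum DERIV_cmult has_field_derivative_prod entry)
 moreover have "?D p = (if p = id then trace_of B' else 0)" if "p permutes UNIV" for p
 proof (cases "p = id")
  case True
  then show ?thesis by (simp add: trace_of_def ent0)
 next
  case False
  then obtain a where a: "p a ~= a" by (auto simp: fun_eq_iff)
  have inj: "inj p" using that by (simp add: permutes_inj)
  have "(\<Prod>j\<in>UNIV - {i}. bmat (B 0) $ j $ p j) = 0" for i
  proof (rule prod_zero)
   have "p (p a) ~= p a" using inj a by (auto dest: injD)
   then have "bmat (B 0) $ p a $ p (p a) = 0" "bmat (B 0) $ a $ p a = 0" using a unfolding ent0 by auto
   then show "\<exists>j\<in>UNIV - {i}. bmat (B 0) $ j $ p j = 0" using a by (metis DiffI UNIV_I singletonD)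
  qed simp
  then show ?thesis using False by (simp only: mult_zero_right sum.neutral_const if_False)
 qed
 moreover have "(\<Sum>p | p permutes (UNIV :: 'n set). if p = id then trace_of B' else 0) = trace_of B'"
  by (subst sum.delta) (auto simp: finite_permutations permutes_id)
 ultimately show ?thesis by simp
qed

lemma blinfun_compose_id_right: "B o\<^sub>L id_blinfun = B" by (rule blinfun_eqI) simp

lemma bounded_linear_trace_of: "bounded_linear trace_of" unfolding trace_of_def
 by (intro bounded_linear_sum bounded_linear_compose[OF bounded_linear_vec_nth] blinfun.bounded_linear_left)

text \<open>The averaged characteristics follow \<open>Y\<close>, whereas the Morse-Smale hypothesis
  concerns \<open>X = - Y\<close>. A source of \<open>X\<close> attracts the orbits of
  \<open>flow\<close>, and the time of \<open>torus_flow X\<close> runs backwards.\<close>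

locale torus_field = flow_field Y Y' L
 for Y :: "real ^ 'n => real ^ 'n" and Y' L +
 assumes periodic_Y: "periodic Y"
begin

definition X where "X x = - Y x"

lemma flow_lattice: "c \<in> lattice ==> flow t (x + c) = flow t x + c"
 by (rule flow_equivariant) (rule periodic_lattice[OF periodic_Y])

lemma Dflow_lattice: "c \<in> lattice ==> Dflow t (x + c) = Dflow t x"
 by (rule Dflow_equivariant) (rule periodic_lattice[OF periodic_Y])

lemma Y_lattice: "c \<in> lattice ==> Y (x + c) = Y x" by (rule periodic_lattice[OF periodic_Y])

lemma reflect_vderiv:
 fixes \<gamma> :: "real => 'b::real_normed_vector"
 assumes "!!t. (\<gamma> has_vector_derivative g t) (at t)"
 shows "((%s. \<gamma> (- s)) has_vector_derivative - g (- s)) (at s)"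
proof -
 have "(uminus has_real_derivative -1) (at s)" by (auto intro!: derivative_eq_intros)
 then show ?thesis using vector_diff_chain_at[of uminus "-1" s \<gamma> "g (- s)"] assms
  by (simp add: o_def has_real_derivative_iff_has_vector_derivative)
qed

lemma lifted_flow_eq: "lifted_flow X t x = flow (- t) x" unfolding lifted_flow_def
proof (rule the_equality)
 have "((%s. flow (- s) x) has_vector_derivative X (flow (- s) x)) (at s)" for s
  using reflect_vderiv[OF flow_vderiv] by (simp add: X_def)
 then show "\<exists>\<gamma>. \<gamma> 0 = x & (\<forall>s. (\<gamma> has_vector_derivative X (\<gamma> s)) (at s)) & \<gamma> t = flow (- t) x"
  by (intro exI[of _ "%s. flow (- s) x"]) auto
 fix y
 assume "\<exists>\<gamma>. \<gamma> 0 = x & (\<forall>s. (\<gamma> has_vector_derivative X (\<gamma> s)) (at s)) & \<gamma> t = y"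
 then obtain \<gamma> where \<gamma>: "\<gamma> 0 = x" "!!s. (\<gamma> has_vector_derivative X (\<gamma> s)) (at s)" "\<gamma> t = y" by blast
 have "(%s. \<gamma> (- s)) (- t) = flow (- t) x"
  by (rule flow_unique) (use reflect_vderiv[OF \<gamma>(2)] \<gamma>(1) in \<open>auto simp: X_def\<close>)
 with \<gamma> show "y = flow (- t) x" by simp
qed

lemma torus_flow_eq: "torus_flow X t (torus_proj x) = torus_proj (flow (- t) x)"
proof -
 define x' where "x' = (SOME x'. torus_proj x' = torus_proj x)"
 have "torus_proj x' = torus_proj x" unfolding x'_def by (rule someI) simp
 then have c: "x - x' \<in> lattice" by (simp add: torus_proj_eq_iff)
 have "torus_flow X t (torus_proj x) = torus_proj (flow (- t) x')"
  by (simp add: torus_flow_def x'_def[symmetric] lifted_flow_eq)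
 also have "... = torus_proj (flow (- t) x)" using flow_lattice[OF c, of "- t" x'] c by (simp add: torus_proj_eq_iff)
 finally show ?thesis .
qed

text \<open>Liouville's formula. The cocycle property of \<open>Dflow\<close> reduces the derivative
  at any time to the derivative at the identity.\<close>

lemma det_Dflow: "det (bmat (Dflow t x)) = exp (antider (%s. trace_of (Y' (flow s x))) t)"
proof -
 define g where "g s = trace_of (Y' (flow s x))" for s
 define f where "f s = det (bmat (Dflow s x))" for s
 have contg: "continuous_on UNIV g" unfolding g_def by (intro bounded_linear.continuous_on[OF bounded_linear_trace_of]
   continuous_on_compose2[OF continuous_X'[of UNIV] continuous_flow_time]) auto
 have df: "(f has_real_derivative g s * f s) (at s)" for s
 proof -
  have "((%h. det (bmat (Dflow h (flow s x)))) has_real_derivative g s) (at 0)"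
   using det_derivative_at_identity[OF Dflow_vderiv[of "flow s x" 0]] by (simp add: g_def blinfun_compose_id_right)
  then have "((%h. det (bmat (Dflow h (flow s x))) * f s) has_real_derivative g s * f s) (at 0)"
   by (auto intro!: derivative_eq_intros)
  moreover have "(%h. det (bmat (Dflow h (flow s x))) * f s) = (%h. f (h + s))"
   by (simp add: f_def Dflow_add bmat_compose det_mul)
  ultimately have "((%h. f (h + s)) has_real_derivative g s * f s) (at 0)" by simp
  then show ?thesis using DERIV_shift[of f "g s * f s" 0 s] by simp
 qed
 have da: "(antider g has_real_derivative g s) (at s)" for s
  using antider_has_vector_derivative[OF contg] by (simp add: has_real_derivative_iff_has_vector_derivative)
 have "((%s. f s * exp (- antider g s)) has_real_derivative 0) (at s)" for s
  by (rule derivative_eq_intros df da refl)+ (simp add: algebra_simps)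
 then have "f t * exp (- antider g t) = f 0 * exp (- antider g 0)"
  using DERIV_isconst_all[of "%s. f s * exp (- antider g s)" t 0] by auto
 then have "f t * exp (- antider g t) = 1" by (simp add: f_def)
 then show ?thesis by (simp add: f_def g_def[abs_def, symmetric] exp_minus field_simps)
qed

end

lemma complex_vec_eq_iff: "v = w \<longleftrightarrow> rvec v = rvec w & ivec v = ivec w"
 by (auto simp: vec_eq_iff complex_eq_iff)

lemma rvec_scale: "rvec (c *s v) = Re c *\<^sub>R rvec v - Im c *\<^sub>R ivec v"
 and ivec_scale: "ivec (c *s v) = Im c *\<^sub>R rvec v + Re c *\<^sub>R ivec v" by (simp_all add: vec_eq_iff)

lemma rvec_diff: "rvec (v - w) = rvec v - rvec w" and ivec_diff: "ivec (v - w) = ivec v - ivec w"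
 by (simp_all add: vec_eq_iff)

lemma rvec_0 [simp]: "rvec 0 = 0" and ivec_0 [simp]: "ivec 0 = 0" by (simp_all add: vec_eq_iff)

lemma rvec_cvec [simp]: "rvec (cvec v) = v" and ivec_cvec [simp]: "ivec (cvec v) = 0" by (simp_all add: vec_eq_iff)

section \<open>Linearized return maps\<close>

context torus_field
begin

text \<open>A covector with value 1 on \<open>Y p\<close>: it reads a displacement along the orbit
  as a time. At a critical point it is 0, so the same formulas serve critical points and closed
  orbits.\<close>

definition beta :: "real ^ 'n => real ^ 'n" where
 "beta p = (1 / (Y p \<bullet> Y p)) *\<^sub>R Y p"

lemma beta_Y: "Y p ~= 0 ==> beta p \<bullet> Y p = 1" by (simp add: beta_def)

lemma beta_0: "Y p = 0 ==> beta p = 0" by (simp add: beta_def)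

text \<open>The projection along \<open>Y p\<close> onto the kernel of \<open>beta p\<close>; the
  identity at a critical point.\<close>

definition proj :: "real ^ 'n => (real ^ 'n) \<Rightarrow>\<^sub>L (real ^ 'n)" where
 "proj p = id_blinfun - (blinfun_scaleR_left (Y p) o\<^sub>L blinfun_inner_right (beta p))"

lemma proj_apply: "proj p h = h - (beta p \<bullet> h) *\<^sub>R Y p" by (simp add: proj_def blinfun.diff_left)

lemma proj_Y: "proj p (Y p) = 0" by (cases "Y p = 0") (simp_all add: proj_apply beta_Y)

lemma beta_proj: "beta p \<bullet> proj p h = 0"
 by (cases "Y p = 0") (simp_all add: proj_apply beta_Y beta_0 inner_simps)

text \<open>The linearized Poincare map at a periodic point, acting on the whole space instead of a
  transversal plane: the direction of the flow is sent to 0. At a critical point it is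
  \<open>Dflow T p\<close> itself.\<close>

definition ret :: "real ^ 'n => real => (real ^ 'n) \<Rightarrow>\<^sub>L (real ^ 'n)" where
 "ret p T = proj p o\<^sub>L Dflow T p"

text \<open>The lattice vector \<open>k\<close> undoes the winding of a closed orbit in the
  universal cover. A critical point qualifies with \<open>k = 0\<close> and any positive
  \<open>T\<close>.\<close>

definition periodic_point :: "real ^ 'n => real => real ^ 'n => bool" where
 "periodic_point p T k \<longleftrightarrow> T > 0 & k \<in> lattice & flow T p + k = p"

lemma periodic_pointD:
 assumes "periodic_point p T k"
 shows "flow T p = p - k" "Dflow (- T) p o\<^sub>L Dflow T p = id_blinfun" "Dflow T p o\<^sub>L Dflow (- T) p = id_blinfun"
  "Dflow T p (Y p) = Y p" "Dflow (- T) p (Y p) = Y p"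
proof -
 have k: "k \<in> lattice" "- k \<in> lattice" "flow T p + k = p"
  using assms lattice_minus by (auto simp: periodic_point_def)
 then show f: "flow T p = p - k" by (simp add: eq_diff_eq)
 have D: "Dflow (- T) (p + - k) = Dflow (- T) p" by (rule Dflow_lattice[OF k(2)])
 show 1: "Dflow (- T) p o\<^sub>L Dflow T p = id_blinfun" using Dflow_add[of "- T" T p] D by (simp add: f)
 have "flow (- T) (flow T p + k) = flow (- T) p" by (simp add: k)
 then have f': "flow (- T) p = p + k" using flow_lattice[OF k(1), of "- T" "flow T p"] by simp
 show "Dflow T p o\<^sub>L Dflow (- T) p = id_blinfun"
  using Dflow_add[of T "- T" p] Dflow_lattice[OF k(1), of T p] by (simp add: f')
 show MY: "Dflow T p (Y p) = Y p" using Y_lattice[OF k(2), of p] by (simp add: Dflow_field f)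
 show "Dflow (- T) p (Y p) = Y p" using 1 MY by (metis blinfun_apply_blinfun_compose blinfun_apply_id_blinfun)
qed

text \<open>The real and imaginary parts of exp (l t) v solve the linearized equation, whose
  solutions are unique.\<close>

lemma fixed_point_eigenvector:
 assumes p: "!!t. flow t p = p" and v: "cmat (bmat (Y' p)) *v v = l *s v"
 shows "cmat (bmat (Dflow t p)) *v v = exp (l * of_real t) *s v"
proof -
 define a b where "a = rvec v" and "b = ivec v"
 have La: "Y' p a = Re l *\<^sub>R a - Im l *\<^sub>R b"
  using arg_cong[OF v, of rvec] by (simp add: rvec_cmat rvec_scale a_def b_def)
 have Lb: "Y' p b = Im l *\<^sub>R a + Re l *\<^sub>R b"
  using arg_cong[OF v, of ivec] by (simp add: ivec_cmat ivec_scale a_def b_def)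
 define e where "e t = exp (Re l * t) * cos (Im l * t)" for t
 define s where "s t = exp (Re l * t) * sin (Im l * t)" for t
 have de: "(e has_real_derivative Re l * e t - Im l * s t) (at t)" for t
  unfolding e_def s_def by (auto intro!: derivative_eq_intros simp: algebra_simps)
 have ds: "(s has_real_derivative Re l * s t + Im l * e t) (at t)" for t
  unfolding e_def s_def by (auto intro!: derivative_eq_intros simp: algebra_simps)
 have ea: "((%t. e t *\<^sub>R x) has_vector_derivative (Re l * e t - Im l * s t) *\<^sub>R x) (at t)" for t and x :: "real ^ 'n"
  using has_vector_derivative_scaleR[OF de has_vector_derivative_const[where c=x]] by simp
 have sa: "((%t. s t *\<^sub>R x) has_vector_derivative (Re l * s t + Im l * e t) *\<^sub>R x) (at t)" for t and x :: "real ^ 'n"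
  using has_vector_derivative_scaleR[OF ds has_vector_derivative_const[where c=x]] by simp
 have "((%t. e t *\<^sub>R a - s t *\<^sub>R b) has_vector_derivative Y' (flow t p) (e t *\<^sub>R a - s t *\<^sub>R b)) (at t)" for t
 proof -
  have eq: "Y' (flow t p) (e t *\<^sub>R a - s t *\<^sub>R b) =
   (Re l * e t - Im l * s t) *\<^sub>R a - (Re l * s t + Im l * e t) *\<^sub>R b"
   by (simp add: p blinfun.diff_right blinfun.scaleR_right La Lb algebra_simps)
  show ?thesis unfolding eq by (intro has_vector_derivative_diff ea sa)
 qed
 from linearized_unique[OF this] have 1: "e t *\<^sub>R a - s t *\<^sub>R b = Dflow t p a" by (simp add: e_def s_def)
 have "((%t. s t *\<^sub>R a + e t *\<^sub>R b) has_vector_derivative Y' (flow t p) (s t *\<^sub>R a + e t *\<^sub>R b)) (at t)" for t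
 proof -
  have eq: "Y' (flow t p) (s t *\<^sub>R a + e t *\<^sub>R b) =
   (Re l * s t + Im l * e t) *\<^sub>R a + (Re l * e t - Im l * s t) *\<^sub>R b"
   by (simp add: p blinfun.add_right blinfun.scaleR_right La Lb algebra_simps)
  show ?thesis unfolding eq by (intro has_vector_derivative_add ea sa)
 qed
 from linearized_unique[OF this] have 2: "s t *\<^sub>R a + e t *\<^sub>R b = Dflow t p b" by (simp add: e_def s_def)
 have "Re (exp (l * of_real t)) = e t" "Im (exp (l * of_real t)) = s t" by (simp_all add: e_def s_def Re_exp Im_exp)
 then show ?thesis using 1 2 by (simp add: complex_vec_eq_iff rvec_cmat ivec_cmat rvec_scale ivec_scale a_def b_def)
qed

lemma fixed_point_commute:
 assumes p: "!!t. flow t p = p"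
 shows "Dflow t p (Y' p v) = Y' p (Dflow t p v)"
proof -
 have "((%t. Y' p (Dflow t p v)) has_vector_derivative Y' (flow t p) (Y' p (Dflow t p v))) (at t)" for t
  using bounded_linear.has_vector_derivative[OF blinfun.bounded_linear_right Dflow_apply_vderiv[of p v t], of "Y' p"]
  by (simp add: p)
 from linearized_unique[OF this, of t] show ?thesis by simp
qed

text \<open>Hyperbolicity of a critical point speaks of the derivative of the field. It commutes
  with the derivative of the time t map, so every eigenspace of the latter contains a common
  eigenvector, and there \<mu> = exp (l t).\<close>

lemma fixed_point_unit_eigenvalue:
 assumes p: "!!t. flow t p = p"
  and hyp: "!!\<mu>. is_eigenvalue (cmat (bmat (Y' p))) \<mu> ==> Re \<mu> ~= 0"
  and mu: "is_eigenvalue (cmat (bmat (Dflow t p))) \<mu>" "t ~= 0"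
 shows "cmod \<mu> ~= 1"
proof
 assume m1: "cmod \<mu> = 1"
 obtain v where v: "v ~= 0" "cmat (bmat (Dflow t p)) *v v = \<mu> *s v" using mu by (auto simp: is_eigenvalue_def)
 define B N where "B = cmat (bmat (Y' p))" and "N = cmat (bmat (Dflow t p))"
 have comm: "N *v (B *v x) = B *v (N *v x)" for x
  by (simp add: complex_vec_eq_iff B_def N_def rvec_cmat ivec_cmat fixed_point_commute[OF p])
 define S where "S = {x. N *v x = \<mu> *s x}"
 have "\<exists>l w. w \<in> S & w \<notin> {0} & B *v w - l *s w \<in> {0}" by (rule eigenvector_modulo[of _ _ _ v])
   (use v in \<open>auto simp: S_def comm matrix_vector_mult_diff_distrib vector_scalar_commute N_def[symmetric]
    vec.scale_right_diff_distrib mult.commute\<close>)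
 then obtain l w where w: "N *v w = \<mu> *s w" "w ~= 0" "B *v w = l *s w" by (auto simp: S_def)
 have "N *v w = exp (l * of_real t) *s w"
  unfolding N_def by (rule fixed_point_eigenvector[OF p]) (use w in \<open>simp add: B_def\<close>)
 with w have "\<mu> *s w = exp (l * of_real t) *s w" by simp
 with w(2) have "\<mu> = exp (l * of_real t)" by simp
 with m1 mu(2) have "Re l = 0" by (simp add: norm_exp_eq_Re)
 moreover have "Re l ~= 0" using w hyp[of l] by (auto simp: B_def is_eigenvalue_def)
 ultimately show False by simp
qed

text \<open>On a closed orbit a unimodular eigenvector of the projected map becomes one of
  \<open>Dflow (- T) p\<close>, with inverse eigenvalue, after adding a multiple of
  \<open>Y p\<close>. Only for the eigenvalue 1 is there no such multiple, and then a second
  eigenvector or a Jordan chain would contradict simplicity. At a critical point nothing is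
  projected away.\<close>

lemma no_unit_eigenvalue_ret:
 assumes pp: "periodic_point p T k"
  and ev: "!!\<mu>. is_eigenvalue (cmat (bmat (Dflow (- T) p))) \<mu> ==> cmod \<mu> = 1 ==> \<mu> = 1 & Y p ~= 0"
  and ord: "order 1 (charpoly (cmat (bmat (Dflow (- T) p)))) <= 1"
 shows "no_unit_eigenvalue (bmat (ret p T))" unfolding no_unit_eigenvalue_def
proof (intro allI impI notI, elim conjE)
 fix \<mu> v assume v: "v ~= 0" "cmat (bmat (ret p T)) *v v = \<mu> *s v" and m1: "cmod \<mu> = 1"
 define M N where "M = cmat (bmat (Dflow T p))" and "N = cmat (bmat (Dflow (- T) p))"
 define y where "y = cvec (Y p)"
 define cb where "cb w = Complex (beta p \<bullet> rvec w) (beta p \<bullet> ivec w)" for w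
 note P = periodic_pointD[OF pp]
 have NM: "N *v (M *v x) = x" for x
  unfolding M_def N_def matrix_vector_mul_assoc cmat_mult[symmetric] bmat_compose[symmetric] P(2) by simp
 have Ny: "N *v y = y" by (simp add: N_def y_def cmat_mult_cvec P)
 have mu0: "\<mu> ~= 0" using m1 by auto
 define nu where "nu = inverse \<mu>"
 have nu: "cmod nu = 1" "nu ~= 0" using m1 mu0 by (auto simp: nu_def norm_inverse)
 define a where "a = cb (M *v v)"
 have ret: "cmat (bmat (ret p T)) *v v = M *v v - a *s y"
  by (simp add: complex_vec_eq_iff rvec_cmat ivec_cmat M_def ret_def proj_apply a_def cb_def y_def
    rvec_diff ivec_diff rvec_scale ivec_scale)
 then have Mv: "M *v v = \<mu> *s v + a *s y" using v by (simp add: algebra_simps)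
 have "N *v (M *v v) = \<mu> *s (N *v v) + a *s y"
  unfolding Mv by (simp add: matrix_vector_right_distrib vector_scalar_commute Ny)
 then have "v = \<mu> *s (N *v v) + a *s y" by (simp add: NM)
 then have "nu *s v = nu *s (\<mu> *s (N *v v)) + (nu * a) *s y" by (metis vec.scale_right_distrib vec.scale_scale)
 then have Nv: "N *v v = nu *s v + (- nu * a) *s y" using mu0 by (simp add: nu_def)
 show False
 proof (cases "Y p = 0")
  case True
  then have "y = 0" by (simp add: y_def vec_eq_iff)
  then have "is_eigenvalue N nu" using v Nv by (auto simp: is_eigenvalue_def)
  with ev[of nu] nu True show False by (simp add: N_def)
 next
  case False
  have cby: "cb (c *s y) = c" for c
   using False by (simp add: cb_def rvec_scale ivec_scale y_def beta_Y complex_eq_iff)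
  have cbv: "cb v = 0"
  proof -
   have "cb (cmat (bmat (ret p T)) *v v) = 0"
    by (simp add: cb_def rvec_cmat ivec_cmat ret_def beta_proj complex_eq_iff)
   moreover have "cb (\<mu> *s v) = \<mu> * cb v"
    by (simp add: cb_def rvec_scale ivec_scale inner_simps complex_eq_iff)
   ultimately show ?thesis using v mu0 by simp
  qed
  have vy: "v ~= c *s y" for c
  proof
   assume "v = c *s y"
   then have "c = 0" using cby[of c] cbv by simp
   with \<open>v = c *s y\<close> v show False by simp
  qed
  have y0: "y ~= 0" using False by (auto simp: y_def vec_eq_iff)
  show False
  proof (cases "nu = 1")
   case True
   then show False using simple_eigenvalue_no_chain[OF Ny y0, of v "- nu * a"] Nv ord vy by (auto simp: N_def)
  next
   case nu1: False
   \<comment> \<open>The solution of \<open>c - nu * a = nu * c\<close>, which makes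
     \<open>v + c *s y\<close> an exact eigenvector.\<close>
   define c where "c = nu * a / (1 - nu)"
   have c: "- nu * a + c = nu * c" using nu1 by (simp add: c_def divide_simps) (simp add: algebra_simps)
   have "N *v (v + c *s y) = nu *s v + (- nu * a + c) *s y"
    by (simp only: matrix_vector_right_distrib vector_scalar_commute Ny Nv vec.scale_left_distrib add.assoc)
   also have "... = nu *s (v + c *s y)" unfolding c by (simp add: vec.scale_right_distrib)
   finally have "N *v (v + c *s y) = nu *s (v + c *s y)" .
   moreover have "v + c *s y ~= 0" using vy[of "- c"] by (simp add: eq_neg_iff_add_eq_0)
   ultimately have "is_eigenvalue N nu" by (auto simp: is_eigenvalue_def)
   with ev[of nu] nu nu1 show False by (simp add: N_def)
  qed
 qed
qed

text \<open>Both kinds of critical elements are brought into one form. The bound on the order of the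
  eigenvalue 1 remembers the kind; later it leaves room for an expanding eigenvalue.\<close>

lemma hyperbolic_data:
 assumes "hyperbolic_element X \<Lambda>"
 shows "\<exists>p T k. periodic_point p T k & no_unit_eigenvalue (bmat (ret p T)) &
  \<Lambda> = (%s. torus_proj (flow s p)) ` {0..T} &
  order 1 (charpoly (cmat (bmat (Dflow (- T) p)))) <= (if Y p = 0 then 0 else 1)"
 using assms unfolding hyperbolic_element_def
proof (elim disjE exE conjE)
 fix p assume cp: "critical_point X \<Lambda> p" and hyp: "\<forall>\<mu>. is_eigenvalue (jacobian X p) \<mu> --> Re \<mu> ~= 0"
 have Yp: "Y p = 0" and \<Lambda>: "\<Lambda> = {torus_proj p}" using cp by (auto simp: critical_point_def X_def)
 have stat: "flow t p = p" for t using flow_unique[of "%_. p" p t] Yp by simp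
 \<comment> \<open>Every positive number is a period of a critical point; 1 is an arbitrary
   choice.\<close>
 have pp: "periodic_point p 1 0" by (simp add: periodic_point_def stat)
 have "(X has_derivative (%v. - Y' p v)) (at p)" unfolding X_def by (intro derivative_intros deriv)
 then have "frechet_derivative X (at p) = (%v. - Y' p v)" by (simp add: frechet_derivative_at[symmetric])
 then have J: "jacobian X p = - cmat (bmat (Y' p))" by (simp add: jacobian_def vec_eq_iff bmat_nth matrix_def)
 have "Re \<mu> ~= 0" if ev: "is_eigenvalue (cmat (bmat (Y' p))) \<mu>" for \<mu>
 proof -
  obtain v where v: "v ~= 0" "cmat (bmat (Y' p)) *v v = \<mu> *s v" using ev by (auto simp: is_eigenvalue_def)
  have "jacobian X p *v v = - (cmat (bmat (Y' p)) *v v)"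
   unfolding J using matrix_vector_mult_diff_rdistrib[of 0 "cmat (bmat (Y' p))" v] by simp
  also have "... = (- \<mu>) *s v" by (simp add: v)
  finally have "is_eigenvalue (jacobian X p) (- \<mu>)" using v by (auto simp: is_eigenvalue_def)
  with hyp show ?thesis by force
 qed
 from fixed_point_unit_eigenvalue[OF stat this]
 have ne: "!!\<mu>. is_eigenvalue (cmat (bmat (Dflow (- 1) p))) \<mu> ==> cmod \<mu> ~= 1" by simp
 have "poly (charpoly (cmat (bmat (Dflow (- 1) p)))) 1 ~= 0" using ne[of 1] by (auto simp: charpoly_root_iff)
 then have ord: "order 1 (charpoly (cmat (bmat (Dflow (- 1) p)))) = 0" by (simp add: order_0I)
 have nu: "no_unit_eigenvalue (bmat (ret p 1))" by (rule no_unit_eigenvalue_ret[OF pp]) (use ne ord in auto)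
 show ?thesis
 proof -
  have "periodic_point p 1 0 & no_unit_eigenvalue (bmat (ret p 1)) &
   \<Lambda> = (%s. torus_proj (flow s p)) ` {0..1} &
   order 1 (charpoly (cmat (bmat (Dflow (- 1) p)))) <= (if Y p = 0 then 0 else 1)" using pp ord nu
   by (simp add: Yp \<Lambda> stat image_constant_conv)
  then show ?thesis by blast
 qed
next
 fix p T
 assume co: "closed_orbit X \<Lambda> p T" and simple: "simple_eigenvalue (jacobian (lifted_flow X T) p) 1"
  and hyp: "\<forall>\<mu>. is_eigenvalue (jacobian (lifted_flow X T) p) \<mu> & \<mu> ~= 1 --> cmod \<mu> ~= 1"
 have Yp: "Y p ~= 0" and T: "T > 0" and ret: "torus_flow X T (torus_proj p) = torus_proj p"
  and \<Lambda>: "\<Lambda> = (%t. torus_flow X t (torus_proj p)) ` {0..T}"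
  using co by (auto simp: closed_orbit_def X_def)
 define k where "k = flow (- T) p - p"
 have k: "k \<in> lattice"
  using ret lattice_minus[of "p - flow (- T) p"] by (simp add: torus_flow_eq torus_proj_eq_iff k_def)
 have "flow T (p + k) = p" by (simp add: k_def)
 then have pp: "periodic_point p T k" using flow_lattice[OF k] T k by (simp add: periodic_point_def)
 have "lifted_flow X T = flow (- T)" by (simp add: fun_eq_iff lifted_flow_eq)
 then have J: "jacobian (lifted_flow X T) p = cmat (bmat (Dflow (- T) p))"
  using frechet_derivative_at[OF flow_has_derivative[of "- T" p]] by (simp add: jacobian_def bmat_def)
 have ord: "order 1 (charpoly (cmat (bmat (Dflow (- T) p)))) = 1" using simple by (simp add: simple_eigenvalue_def J)
 have "no_unit_eigenvalue (bmat (ret p T))"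
  by (rule no_unit_eigenvalue_ret[OF pp]) (use hyp ord Yp in \<open>auto simp: J\<close>)
 moreover have "\<Lambda> = (%s. torus_proj (flow s p)) ` {0..T}"
 proof -
  \<comment> \<open>Modulo the lattice, running \<open>X\<close> for time \<open>t\<close> amounts
    to running \<open>Y\<close> for the rest of the period.\<close>
  have eq: "torus_flow X t (torus_proj p) = torus_proj (flow (T - t) p)" for t
  proof -
   have "flow (T - t) p = flow (- t) (p - k)" using flow_add[of "- t" T p] periodic_pointD(1)[OF pp] by simp
   also have "... = flow (- t) p - k" using flow_lattice[OF lattice_minus[OF k], of "- t" p] by simp
   finally show ?thesis using k by (simp add: torus_flow_eq torus_proj_eq_iff lattice_minus)
  qed
  have "\<Lambda> = (%s. torus_proj (flow s p)) ` (%t. T - t) ` {0..T}" by (simp only: \<Lambda> image_image eq)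
  also have "(%t. T - t) ` {0..T} = {0..T}" by (auto simp: image_iff intro!: bexI[of _ "T - _"])
  finally show ?thesis .
 qed
 ultimately show ?thesis using pp ord Yp by (intro exI[of _ p] exI[of _ T] exI[of _ k]) simp
qed

end

section \<open>Quadratic forms along trapped orbits\<close>

lemma strict_differentiability:
 fixes G :: "'a::real_normed_vector => 'b::real_normed_vector"
 assumes G: "!!x. (G has_derivative blinfun_apply (G' x)) (at x)" and cont: "continuous_on UNIV G'" and "\<kappa> > 0"
 shows "\<exists>\<rho>>0. \<forall>x\<in>cball p \<rho>. \<forall>y\<in>cball p \<rho>. norm (G x - G y - G' p (x - y)) <= \<kappa> * norm (x - y)"
proof -
 have "isCont G' p" using cont by (simp add: continuous_on_eq_continuous_at)
 then obtain d where d: "d > 0" "!!x. dist x p < d ==> dist (G' x) (G' p) < \<kappa>"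
  using \<open>\<kappa> > 0\<close> by (auto simp: continuous_at_eps_delta)
 show ?thesis
 proof (intro exI[of _ "d/2"] conjI ballI)
  fix x y assume xy: "x \<in> cball p (d/2)" "y \<in> cball p (d/2)"
  have "norm (G x - G y - G' p (x - y)) <= norm (x - y) * \<kappa>"
  proof (rule differentiable_bound_linearization[where S="cball p (d/2)" and f'=G'])
   show "y + t *\<^sub>R (x - y) \<in> cball p (d/2)" if "t \<in> {0..1}" for t
   proof -
    have "(1 - t) *\<^sub>R y + t *\<^sub>R x \<in> cball p (d/2)"
     using xy that by (intro convexD[OF convex_cball]) auto
    then show ?thesis by (simp add: algebra_simps)
   qed
   show "onorm (blinfun_apply (G' z) - blinfun_apply (G' p)) <= \<kappa>" if "z \<in> cball p (d/2)" for z
   proof -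
    have "onorm (blinfun_apply (G' z) - blinfun_apply (G' p)) = norm (G' z - G' p)"
     by (simp add: norm_blinfun.rep_eq minus_blinfun.rep_eq fun_diff_def)
    also have "... <= \<kappa>" using d(2)[of z] that d(1) by (simp add: dist_norm norm_minus_commute)
    finally show ?thesis .
   qed
  qed (use G d in \<open>auto intro: has_derivative_at_withinI\<close>)
  then show "norm (G x - G y - G' p (x - y)) <= \<kappa> * norm (x - y)" by (simp add: mult.commute)
 qed (use d in auto)
qed

lemma vector_derivative_eps:
 fixes f :: "real => 'a::real_normed_vector"
 assumes f: "(f has_vector_derivative v) (at 0)" and e: "e > 0"
 shows "\<exists>d>0. \<forall>s. \<bar>s\<bar> < d --> norm (f s - f 0 - s *\<^sub>R v) <= e * \<bar>s\<bar>"
proof -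
 have "\<forall>e>0. \<exists>d>0. \<forall>y. norm (y - 0) < d --> norm (f y - f 0 - (y - 0) *\<^sub>R v) <= e * norm (y - 0)"
  using f unfolding has_vector_derivative_def has_derivative_at_alt by blast
 with e show ?thesis by simp
qed

lemma quadratic_form_bound:
 fixes Q :: "real ^ 'n ^ 'n"
 shows "\<exists>K>0. \<forall>v w. \<bar>v \<bullet> (Q *v w)\<bar> <= K * norm v * norm w"
proof -
 have "bounded_linear ((*v) Q)" by simp
 then obtain K where K: "K > 0" "!!w. norm (Q *v w) <= norm w * K" using bounded_linear.pos_bounded by blast
 have "\<bar>v \<bullet> (Q *v w)\<bar> <= K * norm v * norm w" for v w
 proof -
  have "\<bar>v \<bullet> (Q *v w)\<bar> <= norm v * norm (Q *v w)" by (rule Cauchy_Schwarz_ineq2)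
  also have "... <= norm v * (norm w * K)" by (intro mult_left_mono K) auto
  finally show ?thesis by (simp add: mult_ac)
 qed
 with K show ?thesis by blast
qed

text \<open>By homogeneity and compactness of the sphere the strict inequality has a margin
  \<open>m * (norm v)\<^sup>2\<close>. Half of it pays for replacing \<open>A *v v\<close> by a
  nearby \<open>d\<close>.\<close>

lemma quadratic_growth:
 fixes A Q :: "real ^ 'n ^ 'n"
 assumes "!!v. v ~= 0 ==> v \<bullet> (Q *v v) < (A *v v) \<bullet> (Q *v (A *v v))"
 shows "\<exists>\<kappa>>0. \<exists>c>0. \<forall>v d. norm (d - A *v v) <= \<kappa> * norm v -->
  v \<bullet> (Q *v v) + c * (norm v)\<^sup>2 <= d \<bullet> (Q *v d)"
proof -
 obtain K where K: "K > 0" "!!v w. \<bar>v \<bullet> (Q *v w)\<bar> <= K * norm v * norm w"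
  using quadratic_form_bound by blast
 have "bounded_linear ((*v) A)" by simp
 then obtain a where a: "a > 0" "!!w. norm (A *v w) <= norm w * a" using bounded_linear.pos_bounded by blast
 define g where "g v = (A *v v) \<bullet> (Q *v (A *v v)) - v \<bullet> (Q *v v)" for v
 have contv: "continuous_on S (%v. B *v f v)" if "continuous_on S f" for B :: "real^'n^'n" and f S
  by (rule bounded_linear.continuous_on[OF _ that]) simp
 have "continuous_on (sphere 0 1) g" unfolding g_def by (intro continuous_intros contv)
 moreover have "compact (sphere (0::real^'n) 1)" "sphere (0::real^'n) 1 ~= {}" by auto
 ultimately obtain v0 where v0: "v0 \<in> sphere 0 1" "!!v. v \<in> sphere 0 1 ==> g v0 <= g v"
  using continuous_attains_inf[of "sphere 0 1" g] by blast
 define m where "m = g v0"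
 have "v0 ~= 0" using v0 by auto
 then have m: "m > 0" using assms[of v0] by (simp add: m_def g_def)
 have gm: "m * (norm v)\<^sup>2 <= g v" for v
 proof (cases "v = 0")
  case False
  define u where "u = (1 / norm v) *\<^sub>R v"
  have "u \<in> sphere 0 1" using False by (simp add: u_def)
  then have "m <= g u" using v0 by (simp add: m_def)
  moreover have "g v = (norm v)\<^sup>2 * g u"
   using False by (simp add: u_def g_def matrix_vector_mult_scaleR power2_eq_square algebra_simps)
  ultimately show ?thesis by (simp add: mult.commute mult_right_mono)
 qed (simp add: g_def)
 \<comment> \<open>The cross terms and the square of the error sum up to at most
   \<open>\<kappa> * (2 * K * a + K) * (norm v)\<^sup>2\<close>; the square is linear in \<kappa>
   because of \<open>\<kappa> <= 1\<close>.\<close>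
 define \<kappa> where "\<kappa> = min 1 (m / (2 * (2 * K * a + K)))"
 have \<kappa>: "\<kappa> > 0" "\<kappa> <= 1" "\<kappa> * (2 * K * a + K) <= m / 2"
 proof -
  have half: "m / (2 * s) * s = m / 2" if "s > 0" for s :: real using that by simp
  have pos: "2 * K * a + K > 0" using K(1) a(1) by (simp add: add_pos_pos)
  then show "\<kappa> > 0" "\<kappa> <= 1" using m by (auto simp: \<kappa>_def)
  have "\<kappa> * (2 * K * a + K) <= m / (2 * (2 * K * a + K)) * (2 * K * a + K)"
   using pos by (intro mult_right_mono) (auto simp: \<kappa>_def)
  also have "... = m / 2" by (rule half[OF pos])
  finally show "\<kappa> * (2 * K * a + K) <= m / 2" .
 qed
 have "v \<bullet> (Q *v v) + m / 2 * (norm v)\<^sup>2 <= d \<bullet> (Q *v d)" if le: "norm (d - A *v v) <= \<kappa> * norm v" for v d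
 proof -
  define r w where "r = d - A *v v" and "w = A *v v"
  have d: "d = w + r" by (simp add: r_def w_def)
  have r: "norm r <= \<kappa> * norm v" using le by (simp add: r_def)
  have r1: "norm r <= 1 * norm v" by (rule order_trans[OF r mult_right_mono[OF \<kappa>(2) norm_ge_zero]])
  have w: "norm w <= a * norm v" using a(2)[of v] by (simp add: w_def mult.commute)
  have eq: "d \<bullet> (Q *v d) = w \<bullet> (Q *v w) + (w \<bullet> (Q *v r) + r \<bullet> (Q *v w) + r \<bullet> (Q *v r))"
   unfolding d by (simp add: matrix_vector_right_distrib inner_simps)
  have "\<bar>w \<bullet> (Q *v r)\<bar> <= K * (a * norm v) * (\<kappa> * norm v)"
   using K(1) a(1) \<kappa>(1) by (intro order_trans[OF K(2)] mult_mono r w) auto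
  moreover have "\<bar>r \<bullet> (Q *v w)\<bar> <= K * (\<kappa> * norm v) * (a * norm v)"
   using K(1) a(1) \<kappa>(1) by (intro order_trans[OF K(2)] mult_mono r w) auto
  moreover have "\<bar>r \<bullet> (Q *v r)\<bar> <= K * (\<kappa> * norm v) * (1 * norm v)"
   using K(1) \<kappa>(1) by (intro order_trans[OF K(2)[of r r]] mult_mono[of "K * norm r"] mult_left_mono r r1) auto
  ultimately have "w \<bullet> (Q *v r) + r \<bullet> (Q *v w) + r \<bullet> (Q *v r) >= - (\<kappa> * (2 * K * a + K) * (norm v)\<^sup>2)"
   by (simp add: power2_eq_square algebra_simps)
  moreover have "\<kappa> * (2 * K * a + K) * (norm v)\<^sup>2 <= m / 2 * (norm v)\<^sup>2"
   by (intro mult_right_mono \<kappa>) simp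
  ultimately show ?thesis using gm[of v] unfolding eq by (simp add: g_def w_def)
 qed
 with \<kappa>(1) m show ?thesis by (intro exI[of _ \<kappa>] conjI exI[of _ "m/2"]) auto
qed

text \<open>If the form were positive on the difference, it would grow by at least a fixed amount at
  every step although both orbits stay in one ball. This takes the place of the stable manifold
  theorem.\<close>

lemma bounded_orbits_nonpositive:
 fixes A Q :: "real ^ 'n ^ 'n"
 assumes gr: "!!v d. norm (d - A *v v) <= \<kappa> * norm v ==> v \<bullet> (Q *v v) + c * (norm v)\<^sup>2 <= d \<bullet> (Q *v d)" and c: "c > 0"
  and F: "!!x y. x \<in> cball p \<rho> ==> y \<in> cball p \<rho> ==> norm (F x - F y - A *v (x - y)) <= \<kappa> * norm (x - y)"
  and x: "!!j. (F ^^ j) x \<in> cball p \<rho>" and y: "!!j. (F ^^ j) y \<in> cball p \<rho>"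
 shows "(x - y) \<bullet> (Q *v (x - y)) <= 0"
proof (rule ccontr)
 define d where "d j = (F ^^ j) x - (F ^^ j) y" for j
 define q where "q v = v \<bullet> (Q *v v)" for v
 assume "\<not> ?thesis"
 then have e: "q (d 0) > 0" by (simp add: q_def d_def)
 obtain K where K: "K > 0" "!!v w. \<bar>v \<bullet> (Q *v w)\<bar> <= K * norm v * norm w"
  using quadratic_form_bound by blast
 have qK: "q v <= K * (norm v)\<^sup>2" for v using K(2)[of v v] by (simp add: q_def power2_eq_square mult_ac)
 have step: "q (d j) + c * (norm (d j))\<^sup>2 <= q (d (Suc j))" for j
  unfolding q_def d_def by (rule gr) (use F[OF x[of j] y[of j]] in simp)
 define b where "b = c * (q (d 0) / K)"
 have b: "b > 0" using e K c by (simp add: b_def)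
 have grow: "q (d 0) + real j * b <= q (d j)" for j
 proof (induction j)
  case (Suc j)
  have "q (d 0) <= q (d j)" using Suc b by (smt (verit) mult_nonneg_nonneg of_nat_0_le_iff)
  also have "... <= K * (norm (d j))\<^sup>2" by (rule qK)
  finally have "q (d 0) / K <= (norm (d j))\<^sup>2" using K(1) by (simp add: divide_le_eq mult.commute)
  then have "b <= c * (norm (d j))\<^sup>2" using c unfolding b_def by (intro mult_left_mono) auto
  with step[of j] Suc show ?case by (simp add: algebra_simps)
 qed simp
 have "q (d j) <= K * (2 * \<rho>)\<^sup>2" for j
 proof -
  have "norm (d j) <= 2 * \<rho>" using x[of j] y[of j] dist_triangle2[of "(F ^^ j) x" "(F ^^ j) y" p]
   by (simp add: d_def dist_norm norm_minus_commute)
  then have "(norm (d j))\<^sup>2 <= (2 * \<rho>)\<^sup>2" by (intro power_mono) auto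
  then show ?thesis using qK[of "d j"] K(1) by (smt (verit) mult_left_mono)
 qed
 then have "real j * b <= K * (2 * \<rho>)\<^sup>2" for j using grow[of j] e by (smt (verit))
 moreover obtain j where "real j * b > K * (2 * \<rho>)\<^sup>2" using reals_Archimedean3[OF b] by blast
 ultimately show False by (meson not_less)
qed

section \<open>The resynchronized return map\<close>

context torus_field
begin

text \<open>Slides \<open>z\<close> along its orbit by the time that \<open>beta\<close> reads off.
  The derivative at \<open>p\<close> is \<open>proj p\<close>, so to first order this projects to a
  Poincare section, but it is globally defined and no implicit function has to be found. At a
  critical point it is the identity.\<close>

definition resync :: "real ^ 'n => real ^ 'n => real ^ 'n" where
 "resync p z = flow (- (beta p \<bullet> (z - p))) z"

definition Dresync :: "real ^ 'n => real ^ 'n => (real ^ 'n) \<Rightarrow>\<^sub>L (real ^ 'n)" where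
 "Dresync p z = Dflow (- (beta p \<bullet> (z - p))) z
  - (blinfun_scaleR_left (Y (resync p z)) o\<^sub>L blinfun_inner_right (beta p))"

text \<open>The period is followed, the winding undone, and the result resynchronized. A periodic
  point \<open>p\<close> is fixed, with derivative \<open>ret p T\<close>.\<close>

definition Fmap :: "real ^ 'n => real => real ^ 'n => real ^ 'n => real ^ 'n" where
 "Fmap p T k y = resync p (flow T y + k)"

lemma resync_has_derivative: "(resync p has_derivative Dresync p z) (at z)"
proof -
 have "((%z. (- (beta p \<bullet> (z - p)), z)) has_derivative (%h. (- (beta p \<bullet> h), h))) (at z)"
  by (auto intro!: derivative_eq_intros)
 from has_derivative_compose[OF this flow_joint_derivative]
 have "(resync p has_derivative (%h. (- (beta p \<bullet> h)) *\<^sub>R Y (resync p z) + Dflow (- (beta p \<bullet> (z - p))) z h)) (at z)"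
  by (simp add: resync_def[abs_def])
 moreover have "(%h. (- (beta p \<bullet> h)) *\<^sub>R Y (resync p z) + Dflow (- (beta p \<bullet> (z - p))) z h) = Dresync p z"
  by (simp add: fun_eq_iff Dresync_def blinfun.diff_left)
 ultimately show ?thesis by simp
qed

lemma continuous_flow_compose:
 assumes "continuous_on S f" "continuous_on S g"
 shows "continuous_on S (%x. flow (f x) (g x))" "continuous_on S (%x. Dflow (f x) (g x))"
 using continuous_on_compose2[OF continuous_flow continuous_on_Pair[OF assms]]
  continuous_on_compose2[OF continuous_Dflow continuous_on_Pair[OF assms]] by auto

lemma continuous_resync: "continuous_on S (resync p)"
 unfolding resync_def[abs_def] by (intro continuous_flow_compose continuous_intros)

lemma continuous_Dresync: "continuous_on S (Dresync p)"
proof -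
 have "continuous_on S (%z. Y (resync p z))"
  by (rule continuous_on_compose2[OF continuous_X[of UNIV] continuous_resync]) simp
 then show ?thesis unfolding Dresync_def[abs_def] by (intro continuous_flow_compose continuous_intros)
qed

lemma Fmap_has_derivative:
 "(Fmap p T k has_derivative (Dresync p (flow T y + k) o\<^sub>L Dflow T y)) (at y)"
proof -
 have "((%y. flow T y + k) has_derivative Dflow T y) (at y)"
  by (rule derivative_eq_intros flow_has_derivative refl | simp)+
 from has_derivative_compose[OF this resync_has_derivative]
 show ?thesis by (simp add: Fmap_def[abs_def] blinfun_compose.rep_eq o_def)
qed

lemma continuous_Fmap: "continuous_on S (Fmap p T k)" unfolding Fmap_def[abs_def]
 by (rule continuous_on_compose2[OF continuous_resync[of UNIV]])
  (auto intro!: continuous_flow_compose continuous_intros)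

lemma continuous_DFmap: "continuous_on S (%y. Dresync p (flow T y + k) o\<^sub>L Dflow T y)"
 by (intro continuous_intros continuous_on_compose2[OF continuous_Dresync[of UNIV]] continuous_flow_compose) auto

lemma resync_self [simp]: "resync p p = p" by (simp add: resync_def)

lemma Dresync_self: "Dresync p p = proj p" by (simp add: Dresync_def proj_def)

lemma Fmap_strict:
 assumes pp: "periodic_point p T k" and "\<kappa> > 0"
 shows "\<exists>\<rho>>0. \<forall>x\<in>cball p \<rho>. \<forall>y\<in>cball p \<rho>.
  norm (Fmap p T k x - Fmap p T k y - bmat (ret p T) *v (x - y)) <= \<kappa> * norm (x - y)"
proof -
 have "Dresync p (flow T p + k) o\<^sub>L Dflow T p = ret p T"
  using pp by (simp add: periodic_point_def Dresync_self ret_def)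
 with strict_differentiability[OF Fmap_has_derivative[of p T k] continuous_DFmap \<open>\<kappa> > 0\<close>, of p]
 show ?thesis by simp
qed

text \<open>A step only moves along the orbit and by a lattice vector. Iterates of
  \<open>Fmap\<close> thus inherit what is known about the orbit of the starting point.\<close>

lemma Fmap_orbit: "k \<in> lattice ==> Fmap p T k y = flow (T - beta p \<bullet> (flow T y + k - p)) y + k"
 using flow_add[of "- (beta p \<bullet> (flow T y + k - p))" T y] by (simp add: Fmap_def resync_def flow_lattice)

definition orbit_set :: "real ^ 'n => real => (real ^ 'n) set" where
 "orbit_set p T = {flow s p + c | s c. s \<in> {0..T} & c \<in> lattice}"

text \<open>An orbit of this kind does not accumulate on itself: the times range over a compact
  interval and the lattice is discrete, so points of the set that tend to \<open>p\<close> are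
  eventually reached from \<open>p\<close> in a short time.\<close>

lemma orbit_set_local:
 assumes s0: "s0 > 0"
 shows "\<forall>\<^sub>F q in nhds p. q \<in> orbit_set p0 T0 --> (\<exists>s. \<bar>s\<bar> < s0 & q = flow s p)"
proof (rule ccontr)
 assume "\<not> ?thesis"
 then have "\<exists>q. dist q p < e & q \<in> orbit_set p0 T0 & (\<forall>s. \<bar>s\<bar> < s0 --> q ~= flow s p)" if "e > 0" for e
  using that unfolding eventually_nhds_metric by blast
 then have "\<forall>j::nat. \<exists>q. dist q p < 1 / (real j + 1) & q \<in> orbit_set p0 T0 & (\<forall>s. \<bar>s\<bar> < s0 --> q ~= flow s p)"
  by simp
 then obtain q where q: "!!j::nat. dist (q j) p < 1 / (real j + 1)" "!!j. q j \<in> orbit_set p0 T0"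
   "!!j s. \<bar>s\<bar> < s0 ==> q j ~= flow s p" by metis
 from q(2) have "\<forall>j. \<exists>s c. q j = flow s p0 + c & s \<in> {0..T0} & c \<in> lattice"
  by (auto simp: orbit_set_def)
 then obtain s c where sc: "!!j. q j = flow (s j) p0 + c j" "!!j. s j \<in> {0..T0}" "!!j. c j \<in> lattice" by metis
 have qlim: "q \<longlonglongrightarrow> p"
 proof (rule metric_tendsto_imp_tendsto[where f="%j. 1 / (real j + 1)" and a=0])
  show "(%j. 1 / (real j + 1)) \<longlonglongrightarrow> 0" using LIMSEQ_inverse_real_of_nat by (simp add: inverse_eq_divide add.commute)
  show "\<forall>\<^sub>F j in sequentially. dist (q j) p <= dist (1 / (real j + 1)) 0"
   using q(1) by (auto intro!: always_eventually less_imp_le)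
 qed
 have "seq_compact {0..T0}" by (simp add: compact_imp_seq_compact)
 then obtain s' r where s': "strict_mono r" "(s \<circ> r) \<longlonglongrightarrow> s'"
  using sc(2) unfolding seq_compact_def by metis
 have "isCont (%t. flow t p0) s'" using continuous_flow_time[of UNIV p0] by (simp add: continuous_on_eq_continuous_at)
 then have fl: "(%j. flow (s (r j)) p0) \<longlonglongrightarrow> flow s' p0"
  using s'(2) by (auto intro: isCont_tendsto_compose simp: o_def)
 have "(%j. q (r j)) \<longlonglongrightarrow> p" using LIMSEQ_subseq_LIMSEQ[OF qlim s'(1)] by (simp add: o_def)
 from tendsto_diff[OF this fl] have "(%j. c (r j)) \<longlonglongrightarrow> p - flow s' p0" by (simp add: sc(1))
 then obtain J where J: "!!j. j >= J ==> c (r j) = p - flow s' p0"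
  using lattice_convergent_const[of "%j. c (r j)"] sc(3) by blast
 have lat: "p - flow s' p0 \<in> lattice" using J[of J] sc(3)[of "r J"] by simp
 have "\<forall>\<^sub>F j in sequentially. dist ((s \<circ> r) j) s' < s0" using s'(2) s0 by (rule tendstoD)
 then obtain j where j: "j >= J" "\<bar>s (r j) - s'\<bar> < s0"
  by (auto simp: eventually_sequentially dist_real_def) (metis nle_le)
 have "q (r j) = flow ((s (r j) - s') + s') p0 + (p - flow s' p0)" using sc(1) J[OF j(1)] by simp
 also have "... = flow (s (r j) - s') (flow s' p0 + (p - flow s' p0))" unfolding flow_add flow_lattice[OF lat] ..
 finally have "q (r j) = flow (s (r j) - s') p" by simp
 with q(3)[OF j(2)] show False by blast
qed

text \<open>The derivative of \<open>resync p\<close> at \<open>p\<close> annihilates the velocity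
  \<open>Y p\<close>. The piece of orbit near \<open>p\<close>, and hence the set \<open>K\<close>,
  is collapsed onto \<open>p\<close> with an error of smaller order than the distance.\<close>

lemma resync_near_orbit:
 assumes K: "!!s0. s0 > 0 ==> \<forall>\<^sub>F q in nhds p. q \<in> K --> (\<exists>s. \<bar>s\<bar> < s0 & q = flow s p)" and "\<kappa> > 0"
 shows "\<exists>r>0. \<forall>q\<in>K. norm (q - p) < r --> norm (resync p q - p) <= \<kappa> * norm (q - p)"
proof (cases "Y p = 0")
 case True
 have stat: "flow t p = p" for t using flow_unique[of "%_. p" p t] True by simp
 have "\<forall>\<^sub>F q in nhds p. q \<in> K --> q = p" by (rule eventually_mono[OF K[of 1]]) (auto simp: stat)
 then obtain r where "r > 0" and r: "!!q. dist q p < r ==> q \<in> K ==> q = p" by (auto simp: eventually_nhds_metric)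
 show ?thesis
 proof (intro exI[of _ r] conjI ballI impI \<open>r > 0\<close>)
  fix q assume "q \<in> K" "norm (q - p) < r"
  then have "q = p" by (intro r) (auto simp: dist_norm)
  then show "norm (resync p q - p) <= \<kappa> * norm (q - p)" by simp
 qed
next
 case False
 \<comment> \<open>Converts time into distance: for short times \<open>norm (flow s p - p)\<close>
   is at least \<open>norm (Y p) / 2 * \<bar>s\<bar>\<close>.\<close>
 define e where "e = \<kappa> * norm (Y p) / 2"
 have e: "e > 0" using False \<open>\<kappa> > 0\<close> by (simp add: e_def)
 have v: "((%s. flow s p) has_vector_derivative Y p) (at 0)" using flow_vderiv[where x=p and t=0] by simp
 have "((%s. resync p (flow s p)) has_vector_derivative Dresync p (flow 0 p) (Y p)) (at 0)"
  using vector_derivative_diff_chain_within[of "%s. flow s p" "Y p" 0 UNIV "resync p" "Dresync p p"]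
   v resync_has_derivative[of p p] by (auto simp: o_def intro: has_derivative_at_withinI)
 then have g: "((%s. resync p (flow s p)) has_vector_derivative 0) (at 0)" by (simp add: Dresync_self proj_Y)
 obtain d1 where d1: "d1 > 0" "!!s. \<bar>s\<bar> < d1 ==> norm (resync p (flow s p) - p) <= e * \<bar>s\<bar>"
  using vector_derivative_eps[OF g e] by (simp only: flow_0 resync_self scaleR_zero_right diff_zero) blast
 have y2: "norm (Y p) / 2 > 0" using False by simp
 obtain d2 where d2: "d2 > 0" "!!s. \<bar>s\<bar> < d2 ==> norm (flow s p - p - s *\<^sub>R Y p) <= norm (Y p) / 2 * \<bar>s\<bar>"
  using vector_derivative_eps[OF v y2] by (simp only: flow_0) blast
 have "\<forall>\<^sub>F q in nhds p. q \<in> K --> (\<exists>s. \<bar>s\<bar> < min d1 d2 & q = flow s p)" using d1 d2 by (intro K) simp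
 then obtain r where r: "r > 0" "!!q. dist q p < r ==> q \<in> K ==> \<exists>s. \<bar>s\<bar> < min d1 d2 & q = flow s p"
  unfolding eventually_nhds_metric by blast
 show ?thesis
 proof (intro exI[of _ r] conjI ballI impI r(1))
  fix q assume "q \<in> K" "norm (q - p) < r"
  then obtain s where s: "\<bar>s\<bar> < d1" "\<bar>s\<bar> < d2" "q = flow s p" using r(2)[of q] by (auto simp: dist_norm)
  have "norm (s *\<^sub>R Y p) <= norm (q - p) + norm (flow s p - p - s *\<^sub>R Y p)"
   using norm_triangle_ineq4[of "q - p" "flow s p - p - s *\<^sub>R Y p"] s(3) by simp
  then have "norm (Y p) / 2 * \<bar>s\<bar> <= norm (q - p)" using d2(2)[OF s(2)] by (simp add: mult.commute)
  then have "\<kappa> * (norm (Y p) / 2 * \<bar>s\<bar>) <= \<kappa> * norm (q - p)" using \<open>\<kappa> > 0\<close> by (intro mult_left_mono) auto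
  then show "norm (resync p q - p) <= \<kappa> * norm (q - p)"
   using d1(2)[OF s(1)] s(3) by (simp add: e_def mult.assoc)
 qed
qed

text \<open>In general the return map expands some directions, so invariance of the ball is not a
  matter of contraction. It holds for orbits close to \<open>K\<close>: near \<open>p\<close> this
  set is only a piece of the orbit of \<open>p\<close>, which \<open>resync\<close> collapses, and a
  point within \<eta> of it is sent close to \<open>p\<close>.\<close>

lemma Fmap_stays:
 assumes K: "!!s0. s0 > 0 ==> \<forall>\<^sub>F q in nhds p. q \<in> K --> (\<exists>s. \<bar>s\<bar> < s0 & q = flow s p)"
  and Kl: "!!q c. q \<in> K ==> c \<in> lattice ==> q + c \<in> K"
  and pp: "periodic_point p T k"
 shows "\<exists>\<rho>0>0. \<forall>\<rho>. 0 < \<rho> & \<rho> < \<rho>0 --> (\<exists>\<eta>>0. \<forall>z. norm (z - p) <= \<rho> &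
  (\<exists>q\<in>K. norm (flow T z - q) < \<eta>) --> norm (Fmap p T k z - p) <= \<rho>)"
proof -
 define C1 where "C1 = exp (L * \<bar>T\<bar>)"
 have C1: "C1 >= 1" using Lpos by (simp add: C1_def)
 obtain \<rho>1 where \<rho>1: "\<rho>1 > 0" "!!x y. x \<in> cball p \<rho>1 ==> y \<in> cball p \<rho>1 ==>
   norm (resync p x - resync p y - Dresync p p (x - y)) <= 1 * norm (x - y)"
  using strict_differentiability[OF resync_has_derivative continuous_Dresync, of 1 p p] by auto
 define C2 where "C2 = norm (Dresync p p) + 1"
 have C2: "C2 >= 1" by (simp add: C2_def)
 have lip: "norm (resync p x - resync p y) <= C2 * norm (x - y)" if "x \<in> cball p \<rho>1" "y \<in> cball p \<rho>1" for x y
  using \<rho>1(2)[OF that] norm_blinfun[of "Dresync p p" "x - y"]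
   norm_triangle_sub[of "resync p x - resync p y" "Dresync p p (x - y)"] by (simp add: C2_def algebra_simps)
 obtain r where r: "r > 0" "!!q. q \<in> K ==> norm (q - p) < r ==> norm (resync p q - p) <= 1 / (4 * C1) * norm (q - p)"
  using resync_near_orbit[OF K, of "1 / (4 * C1)"] C1 by auto
 \<comment> \<open>Leaves room for the expansion \<open>C1\<close> of the flow and for the passage
   to a nearby point of \<open>K\<close>, whose distance from \<open>p\<close> is at most
   \<open>2 * C1 * \<rho>\<close>.\<close>
 define \<rho>0 where "\<rho>0 = min r \<rho>1 / (2 * C1)"
 have k: "k \<in> lattice" "flow T p + k = p" using pp by (auto simp: periodic_point_def)
 show ?thesis
 proof (rule exI[of _ \<rho>0], intro conjI allI impI)
  show "\<rho>0 > 0" using r \<rho>1 C1 by (simp add: \<rho>0_def)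
  fix \<rho> assume \<rho>: "0 < \<rho> & \<rho> < \<rho>0"
  have "\<rho> * (2 * C1) < min r \<rho>1"
   using \<rho> C1 unfolding \<rho>0_def by (subst pos_less_divide_eq[symmetric]) auto
  then have \<rho>2: "2 * C1 * \<rho> < r" "2 * C1 * \<rho> < \<rho>1" by (simp_all add: mult.commute)
  \<comment> \<open>By the Lipschitz bound of \<open>resync\<close> this contributes
    \<open>\<rho> / 4\<close>; the collapsed point of \<open>K\<close> contributes
    \<open>\<rho> / 2\<close>.\<close>
  define \<eta> where "\<eta> = \<rho> / (4 * C2)"
  have "\<eta> > 0" "C2 * \<eta> = \<rho> / 4" using \<rho> C2 by (auto simp: \<eta>_def)
  moreover from this have "1 * \<eta> <= C2 * \<eta>" using C2 by (intro mult_right_mono) auto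
  ultimately have \<eta>: "\<eta> > 0" "\<eta> <= \<rho>" "C2 * \<eta> = \<rho> / 4" using \<rho> by auto
  have C1r: "\<rho> <= C1 * \<rho>" using C1 \<rho> by simp
  show "\<exists>\<eta>>0. \<forall>z. norm (z - p) <= \<rho> & (\<exists>q\<in>K. norm (flow T z - q) < \<eta>) --> norm (Fmap p T k z - p) <= \<rho>"
  proof (intro exI[of _ \<eta>] conjI allI impI \<eta>(1))
   fix z assume "norm (z - p) <= \<rho> & (\<exists>q\<in>K. norm (flow T z - q) < \<eta>)"
   then obtain q where z: "norm (z - p) <= \<rho>" and q: "q \<in> K" "norm (flow T z - q) < \<eta>" by blast
   define z' q' where "z' = flow T z + k" and "q' = q + k"
   have q'K: "q' \<in> K" using Kl q(1) k(1) by (simp add: q'_def)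
   have zq: "norm (z' - q') < \<eta>" using q(2) by (simp add: z'_def q'_def)
   have "norm (z' - p) = norm (flow T z - flow T p)" unfolding z'_def periodic_pointD(1)[OF pp] by (rule arg_cong[of _ _ norm]) (simp add: algebra_simps)
   also have "... <= C1 * norm (z - p)" unfolding C1_def by (rule flow_lip)
   also have "... <= C1 * \<rho>" using z C1 by (intro mult_left_mono) auto
   finally have zp: "norm (z' - p) <= C1 * \<rho>" .
   have "norm (q' - p) <= norm (z' - p) + norm (z' - q')" using norm_triangle_ineq4[of "z' - p" "z' - q'"] by simp
   then have qp: "norm (q' - p) <= 2 * C1 * \<rho>" using zp zq \<eta> C1r by linarith
   have "norm (resync p z' - resync p q') <= C2 * norm (z' - q')"
   proof (rule lip)
    have "0 <= C1 * \<rho>" "2 * C1 * \<rho> = C1 * \<rho> + C1 * \<rho>" using C1 \<rho> by auto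
    then show "z' \<in> cball p \<rho>1" using zp \<rho>2(2) by (simp add: dist_norm norm_minus_commute)
    show "q' \<in> cball p \<rho>1" using qp \<rho>2(2) by (simp add: dist_norm norm_minus_commute)
   qed
   also have "... <= C2 * \<eta>" using zq C2 by (intro mult_left_mono) auto
   finally have 1: "norm (resync p z' - resync p q') <= \<rho> / 4" using \<eta> by simp
   have "norm (resync p q' - p) <= 1 / (4 * C1) * norm (q' - p)" using qp \<rho>2 by (intro r(2) q'K) simp
   also have "... <= 1 / (4 * C1) * (2 * C1 * \<rho>)" using qp C1 by (intro mult_left_mono) auto
   also have "... = \<rho> / 2" using C1 by simp
   finally have 2: "norm (resync p q' - p) <= \<rho> / 2" .
   have "norm (resync p z' - p) <= norm (resync p z' - resync p q') + norm (resync p q' - p)"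
    using norm_triangle_ineq[of "resync p z' - resync p q'" "resync p q' - p"] by simp
   then show "norm (Fmap p T k z - p) <= \<rho>" using 1 2 \<rho> by (simp add: Fmap_def z'_def)
  qed
 qed
qed

end

section \<open>Accumulation at the critical elements\<close>

context torus_field
begin

text \<open>Two visits of one orbit to a neighbourhood of the limit can be chosen arbitrarily far
  apart in time.\<close>

lemma limit_nonwandering:
 assumes t: "filterlim t at_top sequentially" and c: "!!j. c j \<in> lattice"
  and lim: "(%j. flow (t j) x + c j) \<longlonglongrightarrow> z"
 shows "torus_proj z \<in> nonwandering_set (torus_flow X)"
 unfolding nonwandering_set_def wandering_def mem_Collect_eq
proof (rule notI, elim exE conjE)
 fix U T
 assume U: "open U" "torus_proj z \<in> U" and T: "0 < T"
  and empty: "U \<inter> (\<Union>t\<in>{t. T < \<bar>t\<bar>}. torus_flow X t ` U) = {}"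
 have tp: "torus_proj (flow (t j) x + c j) = torus_proj (flow (t j) x)" for j
  using lattice_minus[OF c[of j]] by (simp add: torus_proj_eq_iff)
 have "(%j. torus_proj (flow (t j) x + c j)) \<longlonglongrightarrow> torus_proj z"
  by (rule continuous_on_tendsto_compose[OF continuous_torus_proj lim]) auto
 then have "(%j. torus_proj (flow (t j) x)) \<longlonglongrightarrow> torus_proj z" by (simp add: tp)
 then have ev: "\<forall>\<^sub>F j in sequentially. torus_proj (flow (t j) x) \<in> U"
  using U by (rule topological_tendstoD)
 then obtain j where j: "torus_proj (flow (t j) x) \<in> U" using eventually_happens'[OF sequentially_bot] by blast
 have "\<forall>\<^sub>F l in sequentially. t l > t j + T" using t unfolding filterlim_at_top_dense by blast
 with ev have "\<forall>\<^sub>F l in sequentially. torus_proj (flow (t l) x) \<in> U & t l > t j + T"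
  by (rule eventually_conj)
 then obtain l where l: "torus_proj (flow (t l) x) \<in> U" "t l > t j + T"
  using eventually_happens'[OF sequentially_bot] by blast
 define s where "s = - (t l - t j)"
 have "torus_flow X s (torus_proj (flow (t j) x)) = torus_proj (flow (t l) x)"
  using flow_add[of "t l - t j" "t j" x] by (simp add: torus_flow_eq s_def)
 then have "torus_proj (flow (t l) x) \<in> U \<inter> torus_flow X s ` U"
  using l(1) imageI[OF j, of "torus_flow X s"] by (intro IntI) simp_all
 moreover have "T < \<bar>s\<bar>" using l T by (simp add: s_def)
 ultimately have "torus_proj (flow (t l) x) \<in> U \<inter> (\<Union>t\<in>{t. T < \<bar>t\<bar>}. torus_flow X t ` U)" by blast
 with empty show False by blast
qed

lemma limit_exists:
 assumes t: "filterlim t at_top sequentially"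
 shows "\<exists>r c z. strict_mono (r :: nat => nat) & (\<forall>j. c j \<in> lattice) &
  (%j. flow (t (r j)) x + c j) \<longlonglongrightarrow> z & torus_proj z \<in> nonwandering_set (torus_flow X)"
proof -
 have "\<forall>j. \<exists>c. c \<in> lattice & flow (t j) x + c \<in> cell" using lattice_translate_to_cell by blast
 then obtain c where c: "!!j. c j \<in> lattice" "!!j. flow (t j) x + c j \<in> cell" by metis
 have "seq_compact (cell :: (real ^ 'n) set)" using compact_cell by (rule compact_imp_seq_compact)
 then obtain z r where z: "strict_mono r" "((%j. flow (t j) x + c j) \<circ> r) \<longlonglongrightarrow> z"
  using c(2) by (elim seq_compactE[where f="%j. flow (t j) x + c j"]) blast+
 have "filterlim (%j. t (r j)) at_top sequentially" by (rule filterlim_compose[OF t filterlim_subseq[OF z(1)]])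
 from limit_nonwandering[OF this, of "%j. c (r j)" x z] c z
 show ?thesis by (intro exI[of _ r] exI[of _ "%j. c (r j)"] exI[of _ z]) (simp add: o_def)
qed

text \<open>The form in which the Morse-Smale property enters the search for an attractor. A triple
  consists of base point, period and winding vector of a lifted critical element.\<close>

definition crit_data :: "((real ^ 'n) \<times> real \<times> (real ^ 'n)) set => bool" where
 "crit_data D \<longleftrightarrow> finite D & (\<forall>(p, T, k)\<in>D. periodic_point p T k & no_unit_eigenvalue (bmat (ret p T)) &
  order 1 (charpoly (cmat (bmat (Dflow (- T) p)))) <= (if Y p = 0 then 0 else 1)) &
 (\<forall>z. torus_proj z \<in> nonwandering_set (torus_flow X) --> (\<exists>(p, T, k)\<in>D. z \<in> orbit_set p T))"

lemma morse_smale_crit_data: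
 assumes "morse_smale X"
 shows "\<exists>D. crit_data D"
proof -
 let ?C = "{\<Lambda>. critical_element X \<Lambda>}"
 have fin: "finite ?C" and nw: "nonwandering_set (torus_flow X) = \<Union>?C"
  and hyp: "!!\<Lambda>. \<Lambda> \<in> ?C ==> hyperbolic_element X \<Lambda>"
  using assms unfolding morse_smale_def by auto
 define P where "P \<Lambda> d \<longleftrightarrow> (case d of (p, T, k) => periodic_point p T k & no_unit_eigenvalue (bmat (ret p T)) &
  \<Lambda> = (%s. torus_proj (flow s p)) ` {0..T} &
  order 1 (charpoly (cmat (bmat (Dflow (- T) p)))) <= (if Y p = 0 then 0 else 1))" for \<Lambda> d
 have "\<forall>\<Lambda>\<in>?C. \<exists>d. P \<Lambda> d" using hyperbolic_data[OF hyp] unfolding P_def by fast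
 then obtain f where f: "!!\<Lambda>. \<Lambda> \<in> ?C ==> P \<Lambda> (f \<Lambda>)" by metis
 have "crit_data (f ` ?C)" unfolding crit_data_def
 proof (intro conjI ballI allI impI)
  show "finite (f ` ?C)" using fin by simp
  fix d assume "d \<in> f ` ?C"
  then obtain \<Lambda> where "\<Lambda> \<in> ?C" "d = f \<Lambda>" by blast
  with f[of \<Lambda>] show "case d of (p, T, k) => periodic_point p T k & no_unit_eigenvalue (bmat (ret p T)) &
  order 1 (charpoly (cmat (bmat (Dflow (- T) p)))) <= (if Y p = 0 then 0 else 1)" by (auto simp: P_def)
 next
  fix z assume "torus_proj z \<in> nonwandering_set (torus_flow X)"
  then obtain \<Lambda> where \<Lambda>: "\<Lambda> \<in> ?C" "torus_proj z \<in> \<Lambda>" unfolding nw by blast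
  obtain p T k where d: "f \<Lambda> = (p, T, k)" by (cases "f \<Lambda>")
  have "\<Lambda> = (%s. torus_proj (flow s p)) ` {0..T}" using f[OF \<Lambda>(1)] by (simp add: P_def d)
  then obtain s where s: "s \<in> {0..T}" "torus_proj (flow s p) = torus_proj z" using \<Lambda>(2) by force
  then have "z - flow s p \<in> lattice" by (simp add: torus_proj_eq_iff)
  then have "z \<in> orbit_set p T" unfolding orbit_set_def using s(1)
   by (intro CollectI exI[of _ s] exI[of _ "z - flow s p"]) simp
  with \<Lambda>(1) d show "\<exists>(p, T, k)\<in>f ` ?C. z \<in> orbit_set p T" by force
 qed
 then show ?thesis by blast
qed

lemma orbit_set_lattice:
 assumes "q \<in> orbit_set p T" "c \<in> lattice" shows "q + c \<in> orbit_set p T"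
proof -
 obtain s d where "q = flow s p + d" "s \<in> {0..T}" "d \<in> lattice" using assms by (auto simp: orbit_set_def)
 then show ?thesis unfolding orbit_set_def
  using assms(2) lattice_add by (intro CollectI exI[of _ s] exI[of _ "d + c"]) (auto simp: add.assoc)
qed

definition crit_set :: "((real ^ 'n) \<times> real \<times> (real ^ 'n)) set => (real ^ 'n) set" where
 "crit_set D = (\<Union>(p, T, k)\<in>D. orbit_set p T)"

lemma crit_set_lattice: "q \<in> crit_set D ==> c \<in> lattice ==> q + c \<in> crit_set D"
 using orbit_set_lattice by (fastforce simp: crit_set_def)

lemma crit_set_local:
 assumes "finite D" "s0 > 0"
 shows "\<forall>\<^sub>F q in nhds p. q \<in> crit_set D --> (\<exists>s. \<bar>s\<bar> < s0 & q = flow s p)"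
proof -
 have "\<forall>\<^sub>F q in nhds p. \<forall>d\<in>D. q \<in> orbit_set (fst d) (fst (snd d)) --> (\<exists>s. \<bar>s\<bar> < s0 & q = flow s p)"
  by (intro eventually_ball_finite assms ballI orbit_set_local)
 then show ?thesis
 proof (rule eventually_mono, intro impI)
  fix q assume *: "\<forall>d\<in>D. q \<in> orbit_set (fst d) (fst (snd d)) --> (\<exists>s. \<bar>s\<bar> < s0 & q = flow s p)"
   and "q \<in> crit_set D"
  then obtain p' T' k' where "(p', T', k') \<in> D" "q \<in> orbit_set p' T'" by (auto simp: crit_set_def)
  with bspec[OF *, of "(p', T', k')"] show "\<exists>s. \<bar>s\<bar> < s0 & q = flow s p" by simp
 qed
qed

text \<open>Otherwise a sequence of late positions away from the set would, up to translations, have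
  a limit point; this is nonwandering and so belongs to the set.\<close>

lemma eventually_near_crit:
 assumes D: "crit_data D" and "\<eta> > 0"
 shows "\<exists>t0. \<forall>t\<ge>t0. \<exists>q\<in>crit_set D. norm (flow t x - q) < \<eta>"
proof (rule ccontr)
 assume "\<not> ?thesis"
 then have "\<forall>j::nat. \<exists>t\<ge>real j. \<forall>q\<in>crit_set D. \<not> norm (flow t x - q) < \<eta>" by blast
 then obtain t where t: "!!j::nat. t j >= real j" "!!j q. q \<in> crit_set D ==> \<not> norm (flow (t j) x - q) < \<eta>"
  by metis
 have "filterlim t at_top sequentially"
  by (rule filterlim_at_top_mono[OF filterlim_real_sequentially]) (use t in auto)
 from limit_exists[OF this, of x] obtain r c z where z: "!!j. c j \<in> lattice"
  "(%j. flow (t (r j)) x + c j) \<longlonglongrightarrow> z" "torus_proj z \<in> nonwandering_set (torus_flow X)" by blast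
 have "z \<in> crit_set D" using D z(3) unfolding crit_data_def crit_set_def by blast
 have "\<forall>\<^sub>F j in sequentially. dist (flow (t (r j)) x + c j) z < \<eta>" using z(2) \<open>\<eta> > 0\<close> by (rule tendstoD)
 then obtain j where "dist (flow (t (r j)) x + c j) z < \<eta>"
  using eventually_happens'[OF sequentially_bot] by blast
 then have "norm (flow (t (r j)) x - (z + - c j)) < \<eta>" by (simp add: dist_norm algebra_simps)
 with t(2)[OF crit_set_lattice[OF \<open>z \<in> crit_set D\<close> lattice_minus[OF z(1)]], of "r j" j] show False by blast
qed

lemma accumulates_at_crit:
 assumes D: "crit_data D"
 shows "\<exists>(p, T, k)\<in>D. \<forall>d>0. \<forall>t1. \<exists>t\<ge>t1. \<exists>c\<in>lattice. norm (flow t x + c - p) < d"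
proof -
 from limit_exists[OF filterlim_real_sequentially, of x] obtain r c z where
  r: "strict_mono (r :: nat => nat)" and c: "!!j. c j \<in> lattice"
  and lim: "(%j. flow (real (r j)) x + c j) \<longlonglongrightarrow> z" and nw: "torus_proj z \<in> nonwandering_set (torus_flow X)" by blast
 from D nw obtain p T k where d: "(p, T, k) \<in> D" "z \<in> orbit_set p T" unfolding crit_data_def by blast
 then have pp: "periodic_point p T k" using D by (auto simp: crit_data_def)
 have k: "k \<in> lattice" "flow T p + k = p" using pp by (auto simp: periodic_point_def)
 obtain s e where s: "z = flow s p + e" "s \<in> {0..T}" "e \<in> lattice" using d(2) by (auto simp: orbit_set_def)
 \<comment> \<open>The limit point may lie anywhere on the orbit of \<open>p\<close>; flowing for
   the remaining time \<open>T - s\<close> moves the accumulation to a translate of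
   \<open>p\<close>.\<close>
 have "isCont (flow (T - s)) z" using flow_has_derivative has_derivative_continuous by blast
 from isCont_tendsto_compose[OF this lim]
 have "(%j. flow (T - s) (flow (real (r j)) x + c j)) \<longlonglongrightarrow> flow (T - s) z" .
 moreover have "flow (T - s) z = p - k + e"
  using flow_add[of "T - s" s p] periodic_pointD(1)[OF pp] by (simp add: s(1) flow_lattice[OF s(3)])
 moreover have "flow (T - s) (flow (real (r j)) x + c j) = flow (T - s + real (r j)) x + c j" for j
  by (simp add: flow_add flow_lattice[OF c])
 ultimately have L: "(%j. flow (T - s + real (r j)) x + c j) \<longlonglongrightarrow> p - k + e" by simp
 have "\<exists>t\<ge>t1. \<exists>c\<in>lattice. norm (flow t x + c - p) < d" if "d > 0" for d t1
 proof -
  have "\<forall>\<^sub>F j in sequentially. dist (flow (T - s + real (r j)) x + c j) (p - k + e) < d"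
   using L \<open>d > 0\<close> by (rule tendstoD)
  moreover have "\<forall>\<^sub>F j in sequentially. T - s + real (r j) >= t1"
  proof -
   have "filterlim (%j. real (r j)) at_top sequentially"
    by (rule filterlim_compose[OF filterlim_real_sequentially filterlim_subseq[OF r]])
   then have "\<forall>\<^sub>F j in sequentially. real (r j) >= t1 - (T - s)" by (simp add: filterlim_at_top)
   then show ?thesis by (rule eventually_mono) simp
  qed
  ultimately have "\<forall>\<^sub>F j in sequentially. dist (flow (T - s + real (r j)) x + c j) (p - k + e) < d & T - s + real (r j) >= t1"
   by (rule eventually_conj)
  then obtain j where j: "dist (flow (T - s + real (r j)) x + c j) (p - k + e) < d" "T - s + real (r j) >= t1"
   using eventually_happens'[OF sequentially_bot] by blast
  have "norm (flow (T - s + real (r j)) x + (c j + k - e) - p) < d" using j(1) by (simp add: dist_norm algebra_simps)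
  with j(2) lattice_diff[OF lattice_add[OF c k(1)] s(3)] show ?thesis by blast
 qed
 with d(1) show ?thesis by blast
qed

text \<open>The bound on \<rho> keeps the resynchronization time below \<open>T\<close>. No step
  then goes back in time, and the orbit remains in the range of times where it is near the critical
  set.\<close>

lemma Fmap_iterates_stay:
 assumes D: "crit_data D" and d: "(p, T, k) \<in> D"
  and stay: "!!z. norm (z - p) <= \<rho> ==> (\<exists>q\<in>crit_set D. norm (flow T z - q) < \<eta>) ==> norm (Fmap p T k z - p) <= \<rho>"
  and \<rho>: "norm (beta p) * (exp (L * T) * \<rho>) <= T"
  and near: "!!t. t >= t0 ==> \<exists>q\<in>crit_set D. norm (flow t x - q) < \<eta>"
  and t: "t >= t0" and c: "c \<in> lattice" and z: "norm (flow t x + c - p) <= \<rho>"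
 shows "norm ((Fmap p T k ^^ j) (flow t x + c) - p) <= \<rho>"
proof -
 have pp: "periodic_point p T k" using D d by (auto simp: crit_data_def)
 have k: "k \<in> lattice" "T > 0" using pp by (auto simp: periodic_point_def)
 define z where "z j = (Fmap p T k ^^ j) (flow t x + c)" for j
 have "norm (z j - p) <= \<rho> & (\<exists>s\<ge>t0. \<exists>c\<in>lattice. z j = flow s x + c)"
 proof (induction j)
  case 0
  then show ?case using t c z by (auto simp: z_def)
 next
  case (Suc j)
  then obtain s c where s: "s >= t0" "c \<in> lattice" "z j = flow s x + c" and zj: "norm (z j - p) <= \<rho>" by blast
  have fz: "flow T (z j) = flow (T + s) x + c" by (simp add: s(3) flow_lattice[OF s(2)] flow_add)
  obtain q where q: "q \<in> crit_set D" "norm (flow (T + s) x - q) < \<eta>" using near[of "T + s"] s(1) k by auto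
  have "\<exists>q\<in>crit_set D. norm (flow T (z j) - q) < \<eta>"
   using q crit_set_lattice[OF q(1) s(2)] by (intro bexI[of _ "q + c"]) (auto simp: fz)
  from stay[OF zj this] have 1: "norm (z (Suc j) - p) <= \<rho>" by (simp add: z_def)
  define b where "b = beta p \<bullet> (flow T (z j) + k - p)"
  have "\<bar>b\<bar> <= norm (beta p) * norm (flow T (z j) + k - p)" unfolding b_def by (rule Cauchy_Schwarz_ineq2)
  also have "flow T (z j) + k - p = flow T (z j) - flow T p"
   unfolding periodic_pointD(1)[OF pp] by (simp add: algebra_simps)
  also have "norm (beta p) * norm (flow T (z j) - flow T p) <= norm (beta p) * (exp (L * \<bar>T\<bar>) * norm (z j - p))"
   by (intro mult_left_mono flow_lip) auto
  also have "... <= norm (beta p) * (exp (L * T) * \<rho>)" using zj k by (intro mult_left_mono) auto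
  finally have b: "b <= T" using \<rho> by linarith
  have "z (Suc j) = flow (T - b) (z j) + k" by (simp add: z_def Fmap_orbit[OF k(1)] b_def)
  also have "... = flow (T - b + s) x + (c + k)" by (simp add: s(3) flow_lattice[OF s(2)] flow_add add.assoc)
  finally have "\<exists>s\<ge>t0. \<exists>c\<in>lattice. z (Suc j) = flow s x + c"
   using b s k lattice_add[OF s(2) k(1)] by (intro exI[of _ "T - b + s"]) auto
  with 1 show ?case by blast
 qed
 then show ?thesis by (simp add: z_def)
qed

text \<open>Suppose every form has a positive value. Points trapped near a given element, from a
  given time on and after a given translation, form a closed set, and by
  \<open>bounded_orbits_nonpositive\<close> no two of them differ in a positive direction at that
  time, so the set has no interior. The times can be taken rational, which makes the family
  countable.\<close>

lemma source_form_exists: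
 assumes D: "crit_data D"
  and Q: "!!p T k. (p, T, k) \<in> D ==> \<forall>v. v ~= 0 -->
   v \<bullet> (Q (p, T, k) *v v) < (bmat (ret p T) *v v) \<bullet> (Q (p, T, k) *v (bmat (ret p T) *v v))"
 shows "\<exists>(p, T, k)\<in>D. \<forall>v. v \<bullet> (Q (p, T, k) *v v) <= 0"
proof (rule ccontr)
 assume neg: "\<not> ?thesis"
 have fin: "finite D" using D by (simp add: crit_data_def)
 \<comment> \<open>Collects what the radius at one element must achieve: no step backwards in time,
   invariance of the ball near the critical set, and nonpositive differences of trapped
   points.\<close>
 define good where "good d r \<longleftrightarrow> r > 0 & norm (beta (fst d)) * (exp (L * fst (snd d)) * r) <= fst (snd d) &
  (\<exists>\<eta>>0. \<forall>z. norm (z - fst d) <= r --> (\<exists>q\<in>crit_set D. norm (flow (fst (snd d)) z - q) < \<eta>) -->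
    norm (Fmap (fst d) (fst (snd d)) (snd (snd d)) z - fst d) <= r) &
  (\<forall>x y. (\<forall>j. (Fmap (fst d) (fst (snd d)) (snd (snd d)) ^^ j) x \<in> cball (fst d) r) -->
    (\<forall>j. (Fmap (fst d) (fst (snd d)) (snd (snd d)) ^^ j) y \<in> cball (fst d) r) -->
    (x - y) \<bullet> (Q d *v (x - y)) <= 0)" for d r
 have "\<forall>d\<in>D. \<exists>r. good d r"
 proof
  fix d assume dD: "d \<in> D"
  obtain p T k where d: "d = (p, T, k)" by (cases d)
  have pp: "periodic_point p T k" using D dD d by (auto simp: crit_data_def)
  then have T: "T > 0" by (simp add: periodic_point_def)
  obtain \<rho>0 where \<rho>0: "\<rho>0 > 0" "!!\<rho>. 0 < \<rho> ==> \<rho> < \<rho>0 ==> \<exists>\<eta>>0. \<forall>z. norm (z - p) <= \<rho> &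
   (\<exists>q\<in>crit_set D. norm (flow T z - q) < \<eta>) --> norm (Fmap p T k z - p) <= \<rho>"
   using Fmap_stays[OF crit_set_local[OF fin] crit_set_lattice pp] by blast
  obtain \<kappa> cc where \<kappa>: "\<kappa> > 0" "cc > 0" "!!v d'. norm (d' - bmat (ret p T) *v v) <= \<kappa> * norm v ==>
   v \<bullet> (Q d *v v) + cc * (norm v)\<^sup>2 <= d' \<bullet> (Q d *v d')"
   using quadratic_growth[of "Q d" "bmat (ret p T)"] Q[of p T k] dD d by blast
  obtain \<rho>1 where \<rho>1: "\<rho>1 > 0" "!!x y. x \<in> cball p \<rho>1 ==> y \<in> cball p \<rho>1 ==>
   norm (Fmap p T k x - Fmap p T k y - bmat (ret p T) *v (x - y)) <= \<kappa> * norm (x - y)"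
   using Fmap_strict[OF pp \<kappa>(1)] by blast
  define m where "m = norm (beta p) * exp (L * T) + 1"
  have m: "m > 0" by (simp add: m_def add_nonneg_pos)
  define r where "r = min (\<rho>0 / 2) (min \<rho>1 (T / m))"
  have r: "r > 0" "r < \<rho>0" "r <= \<rho>1" "r <= T / m" using \<rho>0(1) \<rho>1(1) T m by (auto simp: r_def)
  have "norm (beta p) * (exp (L * T) * r) <= m * r" using r(1) by (simp add: m_def algebra_simps)
  also have "... <= T" using r(4) m by (simp add: pos_le_divide_eq mult.commute)
  finally have 1: "norm (beta p) * (exp (L * T) * r) <= T" .
  have F: "norm (Fmap p T k x - Fmap p T k y - bmat (ret p T) *v (x - y)) <= \<kappa> * norm (x - y)"
   if "x \<in> cball p r" "y \<in> cball p r" for x y by (rule \<rho>1(2)) (use that r(3) in auto)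
  have 2: "(x - y) \<bullet> (Q d *v (x - y)) <= 0"
   if "!!j. (Fmap p T k ^^ j) x \<in> cball p r" "!!j. (Fmap p T k ^^ j) y \<in> cball p r" for x y
   by (rule bounded_orbits_nonpositive[where A="bmat (ret p T)" and \<kappa>=\<kappa> and c=cc, OF \<kappa>(3) \<kappa>(2) F that])
  have 3: "\<exists>\<eta>>0. \<forall>z. norm (z - p) <= r --> (\<exists>q\<in>crit_set D. norm (flow T z - q) < \<eta>) --> norm (Fmap p T k z - p) <= r"
   using \<rho>0(2)[OF r(1,2)] by blast
  have "good d r" unfolding good_def d fst_conv snd_conv by (intro conjI 3 allI impI r(1) 1 2[unfolded d]) blast+
  then show "\<exists>r. good d r" ..
 qed
 from bchoice[OF this] obtain \<rho> where \<rho>_good: "!!d. d \<in> D ==> good d (\<rho> d)" by blast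
 have \<rho>: "\<rho> (p, T, k) > 0"
  "norm (beta p) * (exp (L * T) * \<rho> (p, T, k)) <= T"
  "\<exists>\<eta>>0. \<forall>z. norm (z - p) <= \<rho> (p, T, k) -->
   (\<exists>q\<in>crit_set D. norm (flow T z - q) < \<eta>) --> norm (Fmap p T k z - p) <= \<rho> (p, T, k)"
  "(\<forall>j. (Fmap p T k ^^ j) x \<in> cball p (\<rho> (p, T, k))) ==>
   (\<forall>j. (Fmap p T k ^^ j) y \<in> cball p (\<rho> (p, T, k))) ==> (x - y) \<bullet> (Q (p, T, k) *v (x - y)) <= 0"
  if "(p, T, k) \<in> D" for p T k x y using \<rho>_good[OF that] unfolding good_def fst_conv snd_conv by blast+
 \<comment> \<open>The points that are trapped near the element \<open>d\<close> after time
   \<open>t\<close> and translation by \<open>c\<close>.\<close>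
 define E where "E d c t = {x. \<forall>j. (Fmap (fst d) (fst (snd d)) (snd (snd d)) ^^ j) (flow t x + c) \<in> cball (fst d) (\<rho> d)}"
  for d c t
 have iter_cont: "continuous_on UNIV (Fmap p T k ^^ j)" for p T k j
  by (induction j) (auto simp: o_def intro: continuous_on_compose2[OF continuous_Fmap] continuous_on_id)
 have flow_cont: "continuous_on UNIV (%x. flow t x + c)" for t c by (intro continuous_intros continuous_flow_compose)
 have closedE: "closed (E d c t)" for d c t
 proof -
  have "E d c t = (\<Inter>j. (%x. (Fmap (fst d) (fst (snd d)) (snd (snd d)) ^^ j) (flow t x + c)) -` cball (fst d) (\<rho> d))"
   by (auto simp: E_def)
  moreover have "closed ((%x. (Fmap p T k ^^ j) (flow t x + c)) -` cball (fst d) (\<rho> d))" for p T k j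
   by (rule continuous_closed_vimage[OF closed_cball])
    (use continuous_on_compose2[OF iter_cont flow_cont] in \<open>auto simp: continuous_on_eq_continuous_at\<close>)
  ultimately show ?thesis by auto
 qed
 have cover: "\<exists>d\<in>D. \<exists>c\<in>lattice. \<exists>t\<in>\<rat>. x \<in> E d c t" for x
 proof -
  obtain p T k where d: "(p, T, k) \<in> D"
   and acc: "!!e t1. e > 0 ==> \<exists>t\<ge>t1. \<exists>c\<in>lattice. norm (flow t x + c - p) < e"
   using accumulates_at_crit[OF D, of x] by blast
  let ?r = "\<rho> (p, T, k)"
  obtain \<eta> where \<eta>: "\<eta> > 0" "!!z. norm (z - p) <= ?r ==> (\<exists>q\<in>crit_set D. norm (flow T z - q) < \<eta>)
   ==> norm (Fmap p T k z - p) <= ?r" using \<rho>(3)[OF d] by blast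
  obtain t0 where t0: "!!t. t >= t0 ==> \<exists>q\<in>crit_set D. norm (flow t x - q) < \<eta>"
   using eventually_near_crit[OF D \<eta>(1), of x] by blast
  obtain t c where t: "t >= t0" "c \<in> lattice" "norm (flow t x + c - p) < ?r"
   using acc[of ?r t0] \<rho>(1)[OF d] by blast
  have "isCont (%t. norm (flow t x + c - p)) t" using continuous_flow_time[of UNIV x]
   by (intro continuous_intros) (simp add: continuous_on_eq_continuous_at)
  then have "\<forall>\<^sub>F s in at t. norm (flow s x + c - p) < ?r"
   using t(3) unfolding isCont_def by (rule order_tendstoD)
  then obtain e where e: "e > 0" "!!s. s ~= t ==> dist s t < e ==> norm (flow s x + c - p) < ?r"
   unfolding eventually_at by blast
  \<comment> \<open>Being in the ball is an open condition in time, so a rational time slightly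
    later works as well.\<close>
  obtain s where s: "s \<in> \<rat>" "t < s" "s < t + e" using Rats_dense_in_real[of t "t + e"] e(1) by auto
  have "norm (flow s x + c - p) <= ?r" using e(2)[of s] s by (simp add: dist_real_def)
  then have "norm ((Fmap p T k ^^ j) (flow s x + c) - p) <= ?r" for j
   by (intro Fmap_iterates_stay[OF D d \<eta>(2) \<rho>(2)[OF d] t0 _ t(2)]) (use s t in auto)
  then have "x \<in> E (p, T, k) c s" by (simp add: E_def dist_norm norm_minus_commute)
  with d s t show ?thesis by blast
 qed
 define G where "G = (%(d, c, t). - E d c t) ` (D \<times> lattice \<times> \<rat>)"
 have "countable G" unfolding G_def
  by (intro countable_image countable_SIGMA countable_finite fin countable_lattice countable_rat)
 have "\<exists>d\<in>D. \<exists>c\<in>lattice. \<exists>t\<in>\<rat>. interior (E d c t) ~= {}"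
 proof (rule ccontr)
  assume "\<not> ?thesis"
  then have int: "interior (E d c t) = {}" if "d \<in> D" "c \<in> lattice" "t \<in> \<rat>" for d c t using that by blast
  have "UNIV \<subseteq> closure (\<Inter>G)"
  proof (rule Baire[OF closed_UNIV \<open>countable G\<close>])
   fix S assume "S \<in> G"
   then obtain d c t where S: "S = - E d c t" "d \<in> D" "c \<in> lattice" "t \<in> \<rat>" by (auto simp: G_def)
   then show "openin (top_of_set UNIV) S & UNIV \<subseteq> closure S"
    using closedE[of d c t] int[of d c t] by (simp add: closure_complement open_Compl)
  qed
  moreover have "\<Inter>G = {}"
  proof -
   have "x \<notin> \<Inter>G" for x using cover[of x] unfolding G_def by force
   then show ?thesis by blast
  qed
  ultimately show False by simp
 qed
 then obtain p T k c t where dct: "(p, T, k) \<in> D" "c \<in> lattice" "interior (E (p, T, k) c t) ~= {}"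
  by (metis prod_cases3)
 then obtain x1 where "x1 \<in> interior (E (p, T, k) c t)" by blast
 then obtain r where r: "r > 0" "ball x1 r \<subseteq> E (p, T, k) c t" by (meson mem_interior)
 have "\<not> (\<forall>v. v \<bullet> (Q (p, T, k) *v v) <= 0)"
 proof
  assume "\<forall>v. v \<bullet> (Q (p, T, k) *v v) <= 0"
  then have "case (p, T, k) of (p, T, k) => \<forall>v. v \<bullet> (Q (p, T, k) *v v) <= 0" by simp
  with neg dct(1) show False by blast
 qed
 then obtain v where v: "v \<bullet> (Q (p, T, k) *v v) > 0" by (auto simp: not_le)
 define y where "y = flow t x1 + c"
 \<comment> \<open>The point that the flow for time \<open>t\<close> and the translation by
   \<open>c\<close> send to \<open>y + e *\<^sub>R v\<close>. For small \<open>e\<close> it is still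
   close enough to \<open>x1\<close> to lie in the set.\<close>
 define g where "g e = flow (- t) (y + e *\<^sub>R v - c)" for e :: real
 have "continuous_on UNIV g" unfolding g_def by (intro continuous_intros continuous_flow_compose)
 then have "isCont g 0" by (simp add: continuous_on_eq_continuous_at)
 moreover have g0: "g 0 = x1" by (simp add: g_def y_def)
 ultimately obtain e0 where e0: "e0 > 0" "!!e. \<bar>e\<bar> < e0 ==> dist (g e) x1 < r"
  using r(1) unfolding continuous_at_eps_delta by (auto simp: dist_real_def)
 define e where "e = e0 / 2"
 have e: "e > 0" "dist (g e) x1 < r" using e0 by (auto simp: e_def)
 have x1E: "x1 \<in> E (p, T, k) c t" and geE: "g e \<in> E (p, T, k) c t" using r e by (auto simp: dist_commute)
 have eq: "flow t (g e) + c = y + e *\<^sub>R v" by (simp add: g_def)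
 have "((y + e *\<^sub>R v) - y) \<bullet> (Q (p, T, k) *v ((y + e *\<^sub>R v) - y)) <= 0"
 proof (rule \<rho>(4)[OF dct(1)])
  show "\<forall>j. (Fmap p T k ^^ j) (y + e *\<^sub>R v) \<in> cball p (\<rho> (p, T, k))"
   using geE unfolding E_def mem_Collect_eq fst_conv snd_conv eq .
  show "\<forall>j. (Fmap p T k ^^ j) y \<in> cball p (\<rho> (p, T, k))"
   using x1E unfolding E_def mem_Collect_eq fst_conv snd_conv y_def .
 qed
 then have "e * (e * (v \<bullet> (Q (p, T, k) *v v))) <= 0" by (simp add: matrix_vector_mult_scaleR)
 with e v show False by (simp add: mult_le_0_iff)
qed

end

text \<open>The negative of the form is comparable to the square of the norm and decreases by a
  fixed factor at each step. The factor 1/4 leaves room for a nonlinear error of the same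
  size.\<close>

lemma contraction_power:
 fixes A Q :: "real ^ 'n ^ 'n"
 assumes Q: "!!v. v ~= 0 ==> v \<bullet> (Q *v v) < (A *v v) \<bullet> (Q *v (A *v v))"
  and neg: "!!v. v \<bullet> (Q *v v) <= 0"
 shows "\<exists>m. \<forall>v. norm (((*v) A ^^ Suc m) v) <= norm v / 4"
proof -
 define q where "q v = - (v \<bullet> (Q *v v))" for v
 have q0: "q v >= 0" for v using neg[of v] by (simp add: q_def)
 obtain \<kappa> c where c: "c > 0" "\<kappa> > 0" "!!v d. norm (d - A *v v) <= \<kappa> * norm v ==>
   v \<bullet> (Q *v v) + c * (norm v)\<^sup>2 <= d \<bullet> (Q *v d)" using quadratic_growth[OF Q] by blast
 have step: "q (A *v v) + c * (norm v)\<^sup>2 <= q v" for v using c(3)[of "A *v v" v] c(2) by (simp add: q_def)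
 have lower: "c * (norm v)\<^sup>2 <= q v" for v using step[of v] q0[of "A *v v"] by linarith
 obtain K0 where K0: "K0 > 0" "!!v w. \<bar>v \<bullet> (Q *v w)\<bar> <= K0 * norm v * norm w"
  using quadratic_form_bound by blast
 \<comment> \<open>Adding \<open>c\<close> ensures \<open>K > c\<close>, hence \<theta> > 0.\<close>
 define K where "K = K0 + c"
 have K: "K > 0" "K > c" "q v <= K * (norm v)\<^sup>2" for v
 proof -
  show "K > 0" "K > c" using K0 c by (auto simp: K_def)
  have "q v <= K0 * (norm v)\<^sup>2" using K0(2)[of v v] by (simp add: q_def power2_eq_square mult_ac)
  also have "... <= K * (norm v)\<^sup>2" using c by (intro mult_right_mono) (auto simp: K_def)
  finally show "q v <= K * (norm v)\<^sup>2" .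
 qed
 define \<theta> where "\<theta> = 1 - c / K"
 have \<theta>: "0 < \<theta>" "\<theta> < 1" using K(1,2) c(1) by (auto simp: \<theta>_def)
 have qA: "q (A *v v) <= \<theta> * q v" for v
 proof -
  have "c / K * q v <= c / K * (K * (norm v)\<^sup>2)" using c(1) K(1) by (intro mult_left_mono K(3)) auto
  also have "... = c * (norm v)\<^sup>2" using K(1) by simp
  finally show ?thesis using step[of v] by (simp add: \<theta>_def algebra_simps)
 qed
 have qj: "q (((*v) A ^^ j) v) <= \<theta> ^ j * q v" for j v
 proof (induction j)
  case (Suc j)
  have "q (((*v) A ^^ Suc j) v) <= \<theta> * q (((*v) A ^^ j) v)" using qA by simp
  also have "... <= \<theta> * (\<theta> ^ j * q v)" using \<theta> Suc by (intro mult_left_mono) auto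
  finally show ?case by (simp add: mult.assoc)
 qed simp
 have "(%j. \<theta> ^ j) \<longlonglongrightarrow> 0" using \<theta> by (intro LIMSEQ_realpow_zero) auto
 then have "\<forall>\<^sub>F j in sequentially. \<theta> ^ j < c / (16 * K)"
  using c(1) K(1) by (intro order_tendstoD) auto
 then obtain j0 where j0: "!!j. j >= j0 ==> \<theta> ^ j < c / (16 * K)" by (auto simp: eventually_sequentially)
 have "norm (((*v) A ^^ Suc j0) v) <= norm v / 4" for v
 proof -
  let ?w = "((*v) A ^^ Suc j0) v"
  have "c * (norm ?w)\<^sup>2 <= q ?w" by (rule lower)
  also have "... <= \<theta> ^ Suc j0 * q v" by (rule qj)
  also have "... <= c / (16 * K) * (K * (norm v)\<^sup>2)"
   using j0[of "Suc j0"] \<theta> c(1) K(1) q0[of v] by (intro mult_mono K(3)) auto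
  also have "... = c * (norm v / 4)\<^sup>2" using K(1) by (simp add: power_divide)
  finally have "(norm ?w)\<^sup>2 <= (norm v / 4)\<^sup>2" using c(1) by simp
  then show ?thesis by (rule power2_le_imp_le) simp
 qed
 then show ?thesis by blast
qed

lemma cmat_funpow:
 fixes A :: "real ^ 'n ^ 'n"
 shows "rvec (((*v) (cmat A) ^^ j) w) = ((*v) A ^^ j) (rvec w)"
  "ivec (((*v) (cmat A) ^^ j) w) = ((*v) A ^^ j) (ivec w)" by (induction j) (auto simp: rvec_cmat ivec_cmat)

section \<open>Existence of the attracting orbit\<close>

context torus_field
begin

text \<open>An eigenvector of \<open>Dflow (- T) p\<close> that is not a multiple of
  \<open>Y p\<close> projects to an eigenvector of the return map with inverse eigenvalue, which the
  contraction places inside the unit circle.\<close>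

lemma contracting_eigenvalues:
 assumes pp: "periodic_point p T k"
  and contr: "!!v. norm (((*v) (bmat (ret p T)) ^^ Suc m) v) <= norm v / 4"
  and ev: "is_eigenvalue (cmat (bmat (Dflow (- T) p))) \<mu>"
 shows "\<mu> = 1 \<or> cmod \<mu> > 1"
proof -
 define M N A where "M = cmat (bmat (Dflow T p))" and "N = cmat (bmat (Dflow (- T) p))" and "A = cmat (bmat (ret p T))"
 define y where "y = cvec (Y p)"
 define cb where "cb w = Complex (beta p \<bullet> rvec w) (beta p \<bullet> ivec w)" for w
 note P = periodic_pointD[OF pp]
 obtain v where v: "v ~= 0" "N *v v = \<mu> *s v" using ev by (auto simp: is_eigenvalue_def N_def)
 have MN: "M *v (N *v x) = x" for x
  unfolding M_def N_def matrix_vector_mul_assoc cmat_mult[symmetric] bmat_compose[symmetric] P(3) by simp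
 have My: "M *v y = y" and Ny: "N *v y = y" by (simp_all add: M_def N_def y_def cmat_mult_cvec P)
 have A: "A *v x = M *v x - cb (M *v x) *s y" for x
  by (simp add: complex_vec_eq_iff rvec_cmat ivec_cmat M_def A_def ret_def proj_apply cb_def y_def
    rvec_diff ivec_diff rvec_scale ivec_scale)
 have vM: "v = \<mu> *s (M *v v)" using MN[of v] v by (simp add: vector_scalar_commute)
 then have mu0: "\<mu> ~= 0" using v(1) by auto
 define nu where "nu = inverse \<mu>"
 have Mv: "M *v v = nu *s v"  using arg_cong[OF vM, of "%x. nu *s x"] mu0 by (simp add: nu_def vec.scale_scale)
 have cbs: "cb (c *s x) = c * cb x" for c x by (simp add: cb_def rvec_scale ivec_scale inner_simps complex_eq_iff)
 have cby: "cb y *s y = y"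
 proof (cases "Y p = 0")
  case True
  then have "y = 0" by (simp add: y_def vec_eq_iff)
  then show ?thesis by simp
 next
  case False
  then have "cb y = 1" by (simp add: cb_def y_def beta_Y complex_eq_iff)
  then show ?thesis by simp
 qed
 have Ay: "A *v y = 0" by (simp add: A My cby)
 define w where "w = v - cb v *s y"
 have Av: "A *v v = nu *s w" by (simp add: A Mv cbs w_def vec.scale_right_diff_distrib vec.scale_scale)
 have Aw: "A *v w = nu *s w" by (subst w_def) (simp add: matrix_vector_mult_diff_distrib vector_scalar_commute Ay Av)
 show ?thesis
 proof (cases "w = 0")
  case True
  then have vy: "v = cb v *s y" by (simp add: w_def)
  have "N *v (cb v *s y) = cb v *s y" by (simp add: vector_scalar_commute Ny)
  then have "N *v v = v" unfolding vy[symmetric] .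
  then have "\<mu> *s v = 1 *s v" using v by simp
  then show ?thesis using v(1) by (metis vec.scale_cancel_right)
 next
  case False
  have Aj: "((*v) A ^^ j) w = nu ^ j *s w" for j
   by (induction j) (simp_all add: vector_scalar_commute Aw vec.scale_scale mult.commute)
  \<comment> \<open>The square of the Hermitian norm; contraction is known for real vectors and is
    applied to real and imaginary parts.\<close>
  define n2 where "n2 x = (norm (rvec x))\<^sup>2 + (norm (ivec x))\<^sup>2" for x :: "complex ^ 'n"
  have n2s: "n2 (c *s x) = (cmod c)\<^sup>2 * n2 x" for c x
  proof -
   have c2: "(cmod c)\<^sup>2 = Re c * Re c + Im c * Im c" unfolding cmod_power2 by (simp add: power2_eq_square)
   show ?thesis unfolding n2_def rvec_scale ivec_scale c2
    by (simp add: power2_norm_eq_inner inner_simps inner_commute algebra_simps)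
  qed
  have pos: "n2 w > 0"
  proof -
   have "rvec w ~= 0 \<or> ivec w ~= 0" using False by (simp add: complex_vec_eq_iff)
   then show ?thesis by (auto simp: n2_def intro: add_pos_nonneg add_nonneg_pos)
  qed
  have "n2 (((*v) A ^^ Suc m) w) <= n2 w / 16"
  proof -
   have "(norm (((*v) (bmat (ret p T)) ^^ Suc m) x))\<^sup>2 <= (norm x / 4)\<^sup>2" for x
    by (intro power_mono contr) simp
   then show ?thesis unfolding n2_def A_def cmat_funpow
    using add_mono[of "(norm (((*v) (bmat (ret p T)) ^^ Suc m) (rvec w)))\<^sup>2" "(norm (rvec w) / 4)\<^sup>2"
     "(norm (((*v) (bmat (ret p T)) ^^ Suc m) (ivec w)))\<^sup>2" "(norm (ivec w) / 4)\<^sup>2"]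
    by (simp add: power_divide)
  qed
  then have "(cmod (nu ^ Suc m))\<^sup>2 * n2 w <= 1 / 16 * n2 w" unfolding Aj n2s by simp
  then have "(cmod (nu ^ Suc m))\<^sup>2 <= 1 / 16" using pos by (simp only: mult_le_cancel_right_pos)
  then have lt: "(cmod (nu ^ Suc m))\<^sup>2 < 1" by simp
  have "cmod nu < 1"
  proof (rule ccontr)
   assume "\<not> cmod nu < 1"
   then have "1 <= cmod nu ^ Suc m" by (intro one_le_power) simp
   then have "1 <= (cmod (nu ^ Suc m))\<^sup>2" unfolding norm_power by (rule one_le_power)
   with lt show False by simp
  qed
  then show ?thesis using mu0 by (simp add: nu_def norm_inverse inverse_less_1_iff)
 qed
qed

text \<open>\<open>Dflow\<close> fixes \<open>Y p\<close> and \<open>proj\<close> kills it, so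
  projecting after every period or only at the end gives the same map. A contracting power of the
  return map is therefore the return map of a multiple of the period.\<close>

lemma ret_power:
 assumes pp: "periodic_point p T k"
 shows "periodic_point p (real (Suc j) * T) (real (Suc j) *\<^sub>R k) &
  (\<forall>h. ret p (real (Suc j) * T) h = ((*v) (bmat (ret p T)) ^^ Suc j) h) &
  det (bmat (Dflow (real (Suc j) * T) p)) = det (bmat (Dflow T p)) ^ Suc j"
proof (induction j)
 case 0
 then show ?case using pp by simp
next
 case (Suc j)
 note P = periodic_pointD[OF pp]
 define S where "S = real (Suc j) * T"
 define l where "l = real (Suc j) *\<^sub>R k"
 have pS: "periodic_point p S l" and rS: "!!h. ret p S h = ((*v) (bmat (ret p T)) ^^ Suc j) h"
  and dS: "det (bmat (Dflow S p)) = det (bmat (Dflow T p)) ^ Suc j" using Suc unfolding S_def l_def by blast+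
 have T: "T > 0" "k \<in> lattice" using pp by (auto simp: periodic_point_def)
 have l: "l \<in> lattice" "flow S p + l = p" "S > 0" using pS by (auto simp: periodic_point_def)
 have eq: "real (Suc (Suc j)) * T = S + T" "real (Suc (Suc j)) *\<^sub>R k = l + k"
  unfolding S_def l_def of_nat_Suc[of "Suc j"] scaleR_add_left distrib_right scaleR_one by simp_all
 have "flow (S + T) p = flow S p - k"
  using flow_lattice[OF lattice_minus[OF T(2)], of S p] by (simp add: flow_add P(1))
 then have 1: "periodic_point p (S + T) (l + k)" using l T by (simp add: periodic_point_def lattice_add)
 have D: "Dflow (S + T) p = Dflow S p o\<^sub>L Dflow T p"
  using Dflow_lattice[OF lattice_minus[OF T(2)], of S p] by (simp add: Dflow_add P(1))
 have 2: "ret p (S + T) h = ((*v) (bmat (ret p T)) ^^ Suc (Suc j)) h" for h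
 proof -
  have "Dflow T p h = ret p T h + (beta p \<bullet> Dflow T p h) *\<^sub>R Y p" by (simp add: ret_def proj_apply)
  then have "Dflow S p (Dflow T p h) = Dflow S p (ret p T h) + (beta p \<bullet> Dflow T p h) *\<^sub>R Y p"
   using periodic_pointD(4)[OF pS] by (metis blinfun.add_right blinfun.scaleR_right)
  then have "ret p (S + T) h = proj p (Dflow S p (ret p T h)) + (beta p \<bullet> Dflow T p h) *\<^sub>R proj p (Y p)"
   unfolding ret_def D by (simp add: blinfun.add_right blinfun.scaleR_right)
  also have "... = ret p S (ret p T h)" by (simp add: proj_Y ret_def)
  finally show ?thesis unfolding rS by (simp add: funpow_swap1)
 qed
 have 3: "det (bmat (Dflow (S + T) p)) = det (bmat (Dflow T p)) ^ Suc (Suc j)"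
  by (simp add: D bmat_compose det_mul dS mult.commute)
 show ?case unfolding eq using 1 2 3 by blast
qed

text \<open>If the lifted orbit closes up, Rolle's theorem gives a zero of the velocity; if it
  winds, it passes over a translate of \<open>z\<close>. In both cases the orbit meets a zero of the
  field and is constant.\<close>

lemma one_dim_no_closed_orbit:
 assumes n: "CARD('n) = 1" and z: "Y z = 0" and pp: "periodic_point p T k"
 shows "Y p = 0"
proof -
 obtain i :: 'n where i: "UNIV = {i}" using n card_1_singletonE by blast
 then have all: "j = i" for j by blast
 have ext: "x = y" if "x $ i = y $ i" for x y :: "'b ^ 'n" unfolding vec_eq_iff using that by (metis all)
 have T: "T > 0" "k \<in> lattice" "flow T p = p - k"
  using pp periodic_pointD(1)[OF pp] by (auto simp: periodic_point_def)
 have crit: "Y p = 0" if c: "Y (flow c p) = 0" for c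
 proof -
  have "flow c p = flow (- c) (flow c p)" by (rule flow_unique[of "%_. flow c p"]) (use c in auto)
  then have "flow c p = p" by simp
  with c show ?thesis by simp
 qed
 define g where "g t = flow t p $ i" for t
 have dg: "(g has_real_derivative Y (flow t p) $ i) (at t)" for t
  unfolding g_def has_real_derivative_iff_has_vector_derivative
  by (rule bounded_linear.has_vector_derivative[OF bounded_linear_vec_nth flow_vderiv])
 have cg: "continuous_on S g" for S by (meson dg DERIV_isCont continuous_at_imp_continuous_on)
 show ?thesis
 proof (cases "k $ i = 0")
  case True
  then have "g 0 = g T" by (simp add: g_def T(3))
  obtain c where "DERIV g c :> 0" using Rolle[OF T(1) \<open>g 0 = g T\<close> cg] dg real_differentiable_def by blast
  then have "Y (flow c p) $ i = 0" using dg DERIV_unique by blast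
  then show ?thesis by (intro crit[of c] ext) simp
 next
  case False
  obtain j :: int where j: "k $ i = 2 * pi * j" using T(2) by (auto simp: lattice_def)
  with False have "\<bar>real_of_int j\<bar> >= 1" by auto
  then have kk: "\<bar>k $ i\<bar> >= 2 * pi" by (simp add: j abs_mult)
  define lo hi where "lo = min (g 0) (g T)" and "hi = max (g 0) (g T)"
  have gT: "g T = g 0 - k $ i" by (simp add: g_def T(3))
  have lohi: "lo + 2 * pi <= hi" using kk gT by (auto simp: lo_def hi_def)
  \<comment> \<open>Gives the first translate of \<open>z\<close> at or above \<open>lo\<close>; it
    is at most \<open>hi\<close>, as the orbit sweeps a full period.\<close>
  define l where "l = \<lceil>(lo - z $ i) / (2 * pi)\<rceil>"
  have "(lo - z $ i) / (2 * pi) <= l" "l < (lo - z $ i) / (2 * pi) + 1" unfolding l_def by linarith+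
  then have "(2 * pi) * ((lo - z $ i) / (2 * pi)) <= (2 * pi) * l" "(2 * pi) * l < (2 * pi) * ((lo - z $ i) / (2 * pi) + 1)"
   by (intro mult_left_mono mult_strict_left_mono; simp)+
  then have l: "lo <= z $ i + 2 * pi * l" "z $ i + 2 * pi * l <= hi" using lohi by (auto simp: distrib_left)
  have conn: "connected (g ` {0..T})" by (intro connected_continuous_image cg) simp
  have "lo \<in> g ` {0..T}" "hi \<in> g ` {0..T}" using T(1) by (auto simp: lo_def hi_def min_def max_def)
  from connectedD_interval[OF conn this l] obtain c where c: "g c = z $ i + 2 * pi * l" by auto
  define e where "e = (\<chi> j::'n. 2 * pi * real_of_int l)"
  have "e \<in> lattice" by (auto simp: e_def lattice_def)
  have "flow c p = z + e" using c by (intro ext) (simp add: g_def e_def)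
  then have "Y (flow c p) = 0" using z Y_lattice[OF \<open>e \<in> lattice\<close>] by simp
  then show ?thesis by (rule crit)
 qed
qed

text \<open>The last conclusion says that volume contracts along the attractor, by Liouville's
  formula. The return map only controls directions across the flow, so the determinant needs an
  eigenvalue different from 1; for a closed orbit there is one as soon as n > 1.\<close>

lemma source_exists:
 assumes D: "crit_data D" and one: "CARD('n) = 1 ==> \<exists>z. Y z = 0"
 shows "\<exists>p T k. periodic_point p T k & (\<forall>h. norm (ret p T h) <= norm h / 4) &
  antider (%s. trace_of (Y' (flow s p))) T < 0"
proof -
 have "\<forall>d. \<exists>Q::real^'n^'n. d \<in> D --> (\<forall>v. v ~= 0 -->
   v \<bullet> (Q *v v) < (bmat (ret (fst d) (fst (snd d))) *v v) \<bullet> (Q *v (bmat (ret (fst d) (fst (snd d))) *v v)))"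
 proof
  fix d :: "(real ^ 'n) \<times> real \<times> (real ^ 'n)"
  show "\<exists>Q::real^'n^'n. d \<in> D --> (\<forall>v. v ~= 0 -->
   v \<bullet> (Q *v v) < (bmat (ret (fst d) (fst (snd d))) *v v) \<bullet> (Q *v (bmat (ret (fst d) (fst (snd d))) *v v)))"
  proof (cases "d \<in> D")
   case True
   then have "no_unit_eigenvalue (bmat (ret (fst d) (fst (snd d))))" using D by (auto simp: crit_data_def split_beta)
   from discrete_lyapunov[OF this] show ?thesis by blast
  qed auto
 qed
 then obtain Q where Q: "!!d v. d \<in> D ==> v ~= 0 ==>
   v \<bullet> (Q d *v v) < (bmat (ret (fst d) (fst (snd d))) *v v) \<bullet> (Q d *v (bmat (ret (fst d) (fst (snd d))) *v v))"
  by metis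
 obtain p T k where d: "(p, T, k) \<in> D" and neg: "!!v. v \<bullet> (Q (p, T, k) *v v) <= 0"
  using source_form_exists[OF D, of Q] Q by force
 have pp: "periodic_point p T k" and ord: "order 1 (charpoly (cmat (bmat (Dflow (- T) p)))) <= (if Y p = 0 then 0 else 1)"
  using D d by (auto simp: crit_data_def)
 obtain m where m: "!!v. norm (((*v) (bmat (ret p T)) ^^ Suc m) v) <= norm v / 4"
  using contraction_power[OF Q[OF d, unfolded fst_conv snd_conv] neg] by blast
 have "order 1 (charpoly (cmat (bmat (Dflow (- T) p)))) < CARD('n)"
 proof (cases "Y p = 0")
  case True
  then show ?thesis using ord by simp
 next
  case False
  then have "CARD('n) ~= 1" using one one_dim_no_closed_orbit[OF _ _ pp] by blast
  moreover have "CARD('n) > 0" by simp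
  ultimately have "CARD('n) > 1" by linarith
  then show ?thesis using ord False by simp
 qed
 from cmod_det_gt_1[OF contracting_eigenvalues[OF pp m] this]
 have "cmod (det (cmat (bmat (Dflow (- T) p)))) > 1" .
 moreover have "det (cmat (bmat (Dflow (- T) p))) = of_real (det (bmat (Dflow (- T) p)))" by (simp add: det_def)
 ultimately have N1: "\<bar>det (bmat (Dflow (- T) p))\<bar> > 1" by simp
 have "det (bmat (Dflow (- T) p)) * det (bmat (Dflow T p)) = 1"
  using arg_cong[OF periodic_pointD(2)[OF pp], of "%B. det (bmat B)"] by (simp add: bmat_compose det_mul)
 moreover have "det (bmat (Dflow T p)) > 0" "det (bmat (Dflow (- T) p)) > 0" by (simp_all add: det_Dflow)
 ultimately have M1: "det (bmat (Dflow T p)) < 1" using N1 by (smt (verit) mult_less_cancel_right1)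
 \<comment> \<open>Enough periods to make the return map contract by 1/4. The determinant is raised
   to the same power and stays below 1.\<close>
 define S where "S = real (Suc m) * T"
 note R = ret_power[OF pp, of m, folded S_def]
 have "exp (antider (%s. trace_of (Y' (flow s p))) S) = det (bmat (Dflow T p)) ^ Suc m"
  using R by (simp add: det_Dflow[symmetric])
 also have "... < 1" using M1 \<open>det (bmat (Dflow T p)) > 0\<close> by (intro power_Suc_less_one) auto
 finally have "antider (%s. trace_of (Y' (flow s p))) S < 0" by simp
 moreover have "norm (ret p S h) <= norm h / 4" for h using R m by simp
 ultimately show ?thesis using R by blast
qed

end

section \<open>Fourier analysis on the torus\<close>

lemma periodic_comp: "periodic f ==> periodic (%x. h (f x))" by (simp add: periodic_def)

definition slab :: "'n => real => real => (real ^ 'n) set" where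
 "slab i l u = cbox (\<chi> j. if j = i then l else 0) (\<chi> j. if j = i then u else 2 * pi)"

lemma cell_slab: "cell = slab i 0 (2 * pi)" by (simp add: cell_def slab_def zero_vec_def)

lemma integral_slab_shift:
 fixes g :: "real ^ 'n => 'b::euclidean_space"
 shows "integral (slab i l u) (%x. g (x + axis i h)) = integral (slab i (l + h) (u + h)) g"
proof -
 have "(\<chi> j. if j = i then l + h else 0) = (\<chi> j. if j = i then l else 0) + axis i h"
  "(\<chi> j. if j = i then u + h else 2 * pi) = (\<chi> j. if j = i then u else 2 * pi) + axis i h"
  by (auto simp: vec_eq_iff axis_def)
 moreover have "(%x. g (x + axis i h)) = g \<circ> ((+) (axis i h))" by (simp add: fun_eq_iff add.commute)
 ultimately show ?thesis unfolding slab_def by (simp only: integral_shift_cbox_plus)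
qed

lemma integral_slab_split:
 fixes g :: "real ^ 'n => 'b::euclidean_space"
 assumes "continuous_on UNIV g" "l <= m" "m <= u"
 shows "integral (slab i l u) g = integral (slab i l m) g + integral (slab i m u) g"
proof -
 have B: "axis i 1 \<in> (Basis :: (real ^ 'n) set)" by simp
 have "g integrable_on slab i l u"
  unfolding slab_def by (intro integrable_continuous continuous_on_subset[OF assms(1)]) auto
 then have "integral (slab i l u) g = integral (slab i l u \<inter> {x. x \<bullet> axis i 1 <= m}) g + integral (slab i l u \<inter> {x. x \<bullet> axis i 1 >= m}) g"
  unfolding slab_def by (rule integral_split[OF _ B])
 moreover have "slab i l u \<inter> {x. x \<bullet> axis i 1 <= m} = slab i l m" "slab i l u \<inter> {x. x \<bullet> axis i 1 >= m} = slab i m u"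
 proof -
  have S: "x \<in> slab i l u \<longleftrightarrow> l <= x $ i & x $ i <= u & (\<forall>j. j ~= i --> 0 <= x $ j & x $ j <= 2 * pi)" for x l u
   unfolding slab_def mem_box_cart vec_lambda_beta by (auto split: if_split_asm)
  show "slab i l u \<inter> {x. x \<bullet> axis i 1 <= m} = slab i l m" "slab i l u \<inter> {x. x \<bullet> axis i 1 >= m} = slab i m u"
   using assms(2,3) by (auto simp: S inner_axis)
 qed
 ultimately show ?thesis by simp
qed

lemma integral_cell_shift:
 fixes g :: "real ^ 'n => 'b::euclidean_space"
 assumes g: "continuous_on UNIV g" "periodic g" and h: "0 <= h" "h <= 2 * pi"
 shows "integral cell (%x. g (x + axis i h)) = integral cell g"
proof -
 have "integral cell (%x. g (x + axis i h)) = integral (slab i h (2 * pi + h)) g"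
  using integral_slab_shift[where g=g, of i 0 "2 * pi" h] by (simp add: cell_slab[of i])
 also have "... = integral (slab i h (2 * pi)) g + integral (slab i (2 * pi) (2 * pi + h)) g"
  by (rule integral_slab_split[OF g(1)]) (use h in auto)
 also have "integral (slab i (2 * pi) (2 * pi + h)) g = integral (slab i 0 h) (%x. g (x + axis i (2 * pi)))"
  using integral_slab_shift[where g=g, of i 0 h "2 * pi"] by (simp add: add.commute)
 also have "... = integral (slab i 0 h) g" using g(2) by (simp add: periodic_def)
 also have "integral (slab i h (2 * pi)) g + integral (slab i 0 h) g = integral cell g"
  unfolding cell_slab[of i] using integral_slab_split[OF g(1) h, of i] by simp
 finally show ?thesis .
qed

text \<open>The integral of a translate does not depend on the translation; this identity is
  differentiated at 0 instead of integrating iteratively. The derivative is one-sided, since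
  \<open>integral_cell_shift\<close> covers shifts in \<open>{0..2 * pi}\<close>.\<close>

lemma integral_cell_derivative_eq_0:
 fixes g :: "real ^ 'n => 'b::euclidean_space"
 assumes g: "!!x. (g has_derivative g' x) (at x)" and per: "periodic g"
  and cont: "continuous_on UNIV (%x. g' x (axis i 1))"
 shows "integral cell (%x. g' x (axis i 1)) = 0"
proof -
 have cg: "continuous_on UNIV g" by (intro continuous_at_imp_continuous_on ballI has_derivative_continuous[OF g])
 define e :: "real ^ 'n" where "e = axis i 1"
 have ax: "axis i (h :: real) = h *\<^sub>R e" for h by (simp add: e_def vec_eq_iff axis_def)
 have "((%h. integral (cbox 0 (\<chi> i. 2 * pi)) (%x. g (x + h *\<^sub>R e))) has_vector_derivative
   integral (cbox 0 (\<chi> i. 2 * pi)) (%x. g' (x + 0 *\<^sub>R e) (e))) (at 0 within {0..2 * pi})"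
 proof (rule leibniz_rule_vector_derivative)
  fix h :: real and x :: "real ^ 'n"
  have "((%h. x + h *\<^sub>R e) has_vector_derivative e) (at h)" by (auto intro!: derivative_eq_intros)
  from vector_derivative_diff_chain_within[OF this, of g "g' (x + h *\<^sub>R e)"] g
  have "((%h. g (x + h *\<^sub>R e)) has_vector_derivative g' (x + h *\<^sub>R e) (e)) (at h)"
   by (simp add: o_def has_derivative_at_withinI)
  then show "((%h. g (x + h *\<^sub>R e)) has_vector_derivative g' (x + h *\<^sub>R e) (e)) (at h within {0..2 * pi})"
   by (rule has_vector_derivative_at_within)
  show "(%x. g (x + h *\<^sub>R e)) integrable_on cbox 0 (\<chi> i. 2 * pi)"
   by (intro integrable_continuous continuous_on_compose2[OF cg] continuous_intros) auto
 next
  show "continuous_on ({0..2 * pi} \<times> cbox 0 (\<chi> i. 2 * pi)) (%(h, x). g' (x + h *\<^sub>R e) (e))"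
   unfolding split_beta by (intro continuous_on_compose2[OF cont[folded e_def]] continuous_intros) auto
 qed auto
 then have 1: "((%h. integral cell (%x. g (x + h *\<^sub>R e))) has_vector_derivative
   integral cell (%x. g' x (e))) (at 0 within {0..2 * pi})" by (simp add: cell_def)
 have "((%h. integral cell g) has_vector_derivative 0) (at 0 within {0..2 * pi})"
  by (rule has_vector_derivative_const)
 then have "((%h. integral cell (%x. g (x + h *\<^sub>R e))) has_vector_derivative 0) (at 0 within {0..2 * pi})"
  by (rule has_vector_derivative_transform[rotated 2]) (auto simp: integral_cell_shift[OF cg per, of _ i, unfolded ax])
 with 1 show ?thesis unfolding e_def[symmetric]
  by (intro vector_derivative_unique_within_closed_interval[of 0 "2 * pi" 0]) auto
qed

lemma integrable_cell:
 fixes f :: "real ^ 'n => 'b::euclidean_space"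
 assumes "continuous_on UNIV f"
 shows "set_integrable lebesgue cell f" "f integrable_on cell"
  "(LINT x:cell|lebesgue. f x) = integral cell f"
proof -
 show *: "set_integrable lebesgue cell f"
  unfolding cell_def by (intro absolutely_integrable_continuous continuous_on_subset[OF assms]) auto
 show "f integrable_on cell" "(LINT x:cell|lebesgue. f x) = integral cell f"
  using set_lebesgue_integral_eq_integral[OF *] by auto
qed

section \<open>Characters and Fourier coefficients\<close>

definition character :: "int ^ 'n => real ^ 'n => complex" where
 "character k x = cis (frequency k \<bullet> x)"

lemma continuous_character: "continuous_on S (character k)"
 unfolding character_def cis_conv_exp by (intro continuous_intros)

lemma frequency_add: "frequency (k + l) = frequency k + frequency l"
 and frequency_minus: "frequency (- k) = - frequency k"
 and frequency_diff: "frequency (k - l) = frequency k - frequency l"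
 and frequency_0 [simp]: "frequency 0 = 0" by (simp_all add: frequency_def vec_eq_iff)

lemma character_add: "character (k + l) x = character k x * character l x"
 by (simp add: character_def frequency_add inner_add_left cis_mult)

lemma character_0 [simp]: "character 0 x = 1" by (simp add: character_def)

lemma character_minus: "character (- k) x = cnj (character k x)" by (simp add: character_def frequency_minus cis_cnj)

lemma norm_character [simp]: "cmod (character k x) = 1" by (simp add: character_def)

lemma character_diff_arg: "character k (x - y) = character k x * character (- k) y"
 by (simp add: character_def frequency_minus inner_diff_right cis_mult)

lemma periodic_character: "periodic (character k)" unfolding periodic_def character_def
proof (intro allI)
 fix x i
 have "frequency k \<bullet> (x + axis i (2 * pi)) = frequency k \<bullet> x + 2 * pi * of_int (k $ i)"
  by (simp add: inner_add_right inner_axis frequency_def)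
 then show "cis (frequency k \<bullet> (x + axis i (2 * pi))) = cis (frequency k \<bullet> x)"
  by (simp add: cis_mult[symmetric] cis_multiple_2pi)
qed

lemma character_has_derivative:
 "(character k has_derivative (%h. (\<i> * of_real (frequency k \<bullet> h)) * character k x)) (at x)"
proof -
 have "((%x. exp (\<i> * of_real (frequency k \<bullet> x))) has_derivative
  (%h. (\<i> * of_real (frequency k \<bullet> h)) * exp (\<i> * of_real (frequency k \<bullet> x)))) (at x)"
 proof -
  have "((%x. \<i> * of_real (frequency k \<bullet> x)) has_derivative (%h. \<i> * of_real (frequency k \<bullet> h))) (at x)"
   by (intro derivative_intros) 
  from has_derivative_compose[OF this, of exp "%h. h * exp (\<i> * of_real (frequency k \<bullet> x))"]
  show ?thesis using DERIV_exp[of "\<i> * of_real (frequency k \<bullet> x)"]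
   by (simp add: has_field_derivative_def mult.commute[of "exp _"] mult_commute_abs)
 qed
 then show ?thesis by (simp add: character_def[abs_def] cis_conv_exp)
qed

lemma measure_cell: "integral cell (%x::real^'n. 1::real) = (2 * pi) ^ CARD('n)"
proof -
 have "0 \<in> cbox 0 (\<chi> i::'n. 2 * pi)" by (simp add: mem_box_cart)
 then have "cbox 0 (\<chi> i::'n. 2 * pi) ~= {}" by blast
 then show ?thesis by (simp add: cell_def content_cbox_cart)
qed

lemma integral_character:
 "integral cell (character (k :: int ^ 'n)) = (if k = 0 then (2 * pi) ^ CARD('n) else 0)"
proof (cases "k = 0")
 case True
 have "integral cell (%x::real^'n. complex_of_real 1) = of_real ((2 * pi) ^ CARD('n))"
  unfolding measure_cell[symmetric]
  by (rule integral_unique[OF has_integral_of_real]) (intro integrable_integral integrable_cell continuous_intros)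
 then show ?thesis using True by (simp add: character_def[abs_def])
next
 case False
 then obtain i where i: "k $ i ~= 0" by (auto simp: vec_eq_iff)
 have "integral cell (%x. (\<i> * of_real (frequency k \<bullet> axis i 1)) * character k x) = 0"
  by (rule integral_cell_derivative_eq_0[OF character_has_derivative periodic_character])
   (intro continuous_intros continuous_character)
 then have "(\<i> * of_real (frequency k \<bullet> axis i 1)) * integral cell (character k) = 0" by simp
 then show ?thesis using i False by (simp add: inner_axis frequency_def)
qed

abbreviation cell_integral :: "(real ^ 'n => 'b::{banach, second_countable_topology}) => 'b" where
 "cell_integral f \<equiv> LINT x:cell|lebesgue. f x"

definition torus_vol :: "'n itself => real" where
 "torus_vol _ = (2 * pi) ^ CARD('n)"

lemma torus_vol_pos: "torus_vol TYPE('n) > 0" by (simp add: torus_vol_def)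

lemma cell_sets: "cell \<in> sets lebesgue" unfolding cell_def by (metis lmeasurable_cbox fmeasurableD)

lemma set_borel_measurable_L2: "u \<in> borel_measurable lebesgue ==> set_borel_measurable lebesgue cell (u :: real ^ 'n => complex)"
 unfolding set_borel_measurable_def by (rule borel_measurable_scaleR[OF borel_measurable_indicator[OF cell_sets]])

lemma L2_torusD:
 assumes "u \<in> L2_torus"
 shows "periodic u" "u \<in> borel_measurable lebesgue" "set_integrable lebesgue cell (%x. (cmod (u x))\<^sup>2)"
 using assms by (auto simp: L2_torus_def)

lemma L2_mult_integrable:
 fixes u v :: "real ^ 'n => complex"
 assumes u: "u \<in> L2_torus" and v: "v \<in> L2_torus"
 shows "set_integrable lebesgue cell (%x. u x * v x)"
proof (rule set_integrable_bound)
 show "set_integrable lebesgue cell (%x. (cmod (u x))\<^sup>2 + (cmod (v x))\<^sup>2)"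
  by (rule set_integral_add(1)[OF L2_torusD(3)[OF u] L2_torusD(3)[OF v]])
 show "set_borel_measurable lebesgue cell (%x. u x * v x)"
  by (rule set_borel_measurable_L2[OF borel_measurable_times[OF L2_torusD(2)[OF u] L2_torusD(2)[OF v]]])
 have "norm (u x * v x) <= norm ((cmod (u x))\<^sup>2 + (cmod (v x))\<^sup>2)" for x
 proof -
  have "0 <= cmod (u x) * cmod (v x)" by simp
  then have "cmod (u x) * cmod (v x) <= (cmod (u x))\<^sup>2 + (cmod (v x))\<^sup>2"
   using sum_squares_bound[of "cmod (u x)" "cmod (v x)"] by linarith
  then show ?thesis by (simp add: norm_mult)
 qed
 then show "AE x in lebesgue. x \<in> cell --> norm (u x * v x) <= norm ((cmod (u x))\<^sup>2 + (cmod (v x))\<^sup>2)" by simp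
qed

lemma continuous_L2:
 fixes f :: "real ^ 'n => complex"
 assumes "continuous_on UNIV f" "periodic f"
 shows "f \<in> L2_torus" unfolding L2_torus_def
proof (intro CollectI conjI assms)
 show "f \<in> borel_measurable lebesgue"
  using borel_measurable_continuous_onI[OF assms(1)] by (intro measurable_completion) simp
 show "set_integrable lebesgue cell (%x. (cmod (f x))\<^sup>2)" by (intro integrable_cell continuous_intros assms)
qed

lemma character_L2: "character k \<in> L2_torus" by (intro continuous_L2 continuous_character periodic_character)

lemma const_L2: "(%_. c) \<in> L2_torus" by (intro continuous_L2) (auto simp: periodic_def)

lemma L2_add:
 assumes u: "u \<in> L2_torus" and v: "v \<in> L2_torus"
 shows "(%x. u x + v x) \<in> L2_torus" unfolding L2_torus_def
proof (intro CollectI conjI)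
 show "periodic (%x. u x + v x)" using L2_torusD[OF u] L2_torusD[OF v] by (simp add: periodic_def)
 show m: "(%x. u x + v x) \<in> borel_measurable lebesgue" using L2_torusD[OF u] L2_torusD[OF v] by simp
 show "set_integrable lebesgue cell (%x. (cmod (u x + v x))\<^sup>2)"
 proof (rule set_integrable_bound)
  show "set_integrable lebesgue cell (%x. 2 * (cmod (u x))\<^sup>2 + 2 * (cmod (v x))\<^sup>2)"
   by (intro set_integral_add(1) set_integrable_mult_right L2_torusD(3)[OF u] L2_torusD(3)[OF v])
  show "set_borel_measurable lebesgue cell (%x. (cmod (u x + v x))\<^sup>2)" unfolding set_borel_measurable_def
   by (intro borel_measurable_scaleR borel_measurable_indicator cell_sets borel_measurable_power
     measurable_compose[OF m borel_measurable_norm])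
  have "(cmod (u x + v x))\<^sup>2 <= 2 * (cmod (u x))\<^sup>2 + 2 * (cmod (v x))\<^sup>2" for x
  proof -
   have "(cmod (u x + v x))\<^sup>2 <= (cmod (u x) + cmod (v x))\<^sup>2" by (intro power_mono norm_triangle_ineq) simp
   also have "... <= 2 * (cmod (u x))\<^sup>2 + 2 * (cmod (v x))\<^sup>2"
    using sum_squares_bound[of "cmod (u x)" "cmod (v x)"] by (simp add: power2_sum)
   finally show ?thesis .
  qed
  then show "AE x in lebesgue. x \<in> cell --> norm ((cmod (u x + v x))\<^sup>2) <= norm (2 * (cmod (u x))\<^sup>2 + 2 * (cmod (v x))\<^sup>2)"
   by simp
 qed
qed

lemma L2_scale:
 assumes u: "u \<in> L2_torus"
 shows "(%x. c * u x) \<in> L2_torus"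
 using L2_torusD[OF u] by (simp add: L2_torus_def periodic_def norm_mult power_mult_distrib)

lemma L2_diff: "u \<in> L2_torus ==> v \<in> L2_torus ==> (%x. u x - v x) \<in> L2_torus"
 using L2_add[of u "%x. - 1 * v x"] L2_scale[of v "-1"] by simp

lemma L2_cnj: "u \<in> L2_torus ==> (%x. cnj (u x)) \<in> L2_torus"
 using measurable_compose[OF L2_torusD(2) borel_measurable_continuous_onI[of cnj]]
 by (auto simp: L2_torus_def periodic_def intro: continuous_on_cnj continuous_on_id)

lemma L2_sum: "(!!k. k \<in> F ==> u k \<in> L2_torus) ==> (%x. \<Sum>k\<in>F. u k x) \<in> L2_torus"
 by (induction F rule: infinite_finite_induct) (auto intro: L2_add const_L2)

lemma L2_integrable: "u \<in> L2_torus ==> set_integrable lebesgue cell u"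
 using L2_mult_integrable[OF _ const_L2[of 1], of u] by simp

lemma cell_integral_sum:
 fixes f :: "'k => real ^ 'n => 'b::{banach, second_countable_topology}"
 assumes "!!k. k \<in> F ==> set_integrable lebesgue cell (f k)"
 shows "set_integrable lebesgue cell (%x. \<Sum>k\<in>F. f k x) & cell_integral (%x. \<Sum>k\<in>F. f k x) = (\<Sum>k\<in>F. cell_integral (f k))"
 using assms
proof (induction F rule: infinite_finite_induct)
 case (insert k F)
 then show ?case using set_integral_add[of lebesgue cell "f k" "%x. \<Sum>k\<in>F. f k x"] by simp
qed (auto simp: set_integrable_def set_lebesgue_integral_def)

lemma fourier_coeff_character_integral:
 fixes u :: "real ^ 'n => complex"
 shows "cell_integral (%x. u x * character (- k) x) = torus_vol TYPE('n) * fourier_coeff u k"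
  "cell_integral (%x. u x * cnj (character k x)) = torus_vol TYPE('n) * fourier_coeff u k"
 by (simp_all add: fourier_coeff_def character_def frequency_minus torus_vol_def cis_cnj)

lemma fourier_coeff_character: "fourier_coeff (character k) l = (if k = l then 1 else 0)"
proof -
 have "cell_integral (%x. character k x * character (- l) x) = integral cell (character (k - l))"
  using integrable_cell(3)[OF continuous_character, of "k - l"] by (simp add: character_add[symmetric])
 then show ?thesis using fourier_coeff_character_integral(1)[of "character k" l] torus_vol_pos[where 'n='a]
  by (simp add: integral_character torus_vol_def split: if_splits)
qed

lemma fourier_coeff_add:
 "u \<in> L2_torus ==> v \<in> L2_torus ==> fourier_coeff (%x. u x + v x) k = fourier_coeff u k + fourier_coeff v k"
 unfolding fourier_coeff_def distrib_right
 using set_integral_add(2)[of lebesgue cell "%x. u x * cis (- (frequency k \<bullet> x))" "%x. v x * cis (- (frequency k \<bullet> x))"]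
  L2_mult_integrable[OF _ character_L2[of "- k"], of u] L2_mult_integrable[OF _ character_L2[of "- k"], of v]
 by (simp add: character_def frequency_minus add_divide_distrib)

lemma fourier_coeff_scale: "fourier_coeff (%x. c * u x) k = c * fourier_coeff u k"
 unfolding fourier_coeff_def by (simp add: mult.assoc)

lemma fourier_coeff_diff:
 "u \<in> L2_torus ==> v \<in> L2_torus ==> fourier_coeff (%x. u x - v x) k = fourier_coeff u k - fourier_coeff v k"
 using fourier_coeff_add[OF _ L2_scale[of v "-1"], of u k] fourier_coeff_scale[of "-1" v k] by simp

lemma fourier_coeff_sum:
 assumes "!!l. l \<in> F ==> u l \<in> L2_torus"
 shows "fourier_coeff (%x. \<Sum>l\<in>F. u l x) k = (\<Sum>l\<in>F. fourier_coeff (u l) k)" using assms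
proof (induction F rule: infinite_finite_induct)
 case (insert l F)
 then show ?case using fourier_coeff_add[OF _ L2_sum, of "u l" F u k] by simp
qed (auto simp: fourier_coeff_def set_lebesgue_integral_def)

lemma integral_cnj_trig:
 fixes v :: "real ^ 'n => complex"
 assumes v: "v \<in> L2_torus"
 shows "cell_integral (%x. v x * cnj (\<Sum>k\<in>F. c k * character k x)) =
  torus_vol TYPE('n) * (\<Sum>k\<in>F. cnj (c k) * fourier_coeff v k)"
proof -
 have "cell_integral (%x. v x * cnj (\<Sum>k\<in>F. c k * character k x)) =
  cell_integral (%x. \<Sum>k\<in>F. cnj (c k) * (v x * character (- k) x))"
  by (simp add: sum_distrib_left character_minus mult_ac)
 also have "... = (\<Sum>k\<in>F. cell_integral (%x. cnj (c k) * (v x * character (- k) x)))"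
  by (rule cell_integral_sum[THEN conjunct2])
   (intro set_integrable_mult_right L2_mult_integrable v character_L2)
 also have "... = (\<Sum>k\<in>F. cnj (c k) * (torus_vol TYPE('n) * fourier_coeff v k))"
  by (simp add: fourier_coeff_character_integral(1))
 finally show ?thesis by (simp add: sum_distrib_left mult_ac)
qed

lemma L2_norm_nonneg [simp]: "0 <= L2_norm_torus u" unfolding L2_norm_torus_def set_lebesgue_integral_def
 by (intro real_sqrt_ge_zero integral_nonneg_AE) auto

lemma L2_norm_square: "(L2_norm_torus u)\<^sup>2 = cell_integral (%x. (cmod (u x))\<^sup>2)"
proof -
 have "0 <= cell_integral (%x. (cmod (u x))\<^sup>2)"
  unfolding set_lebesgue_integral_def by (intro integral_nonneg_AE) auto
 then show ?thesis by (simp add: L2_norm_torus_def)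
qed

lemma L2_norm_square_complex:
 assumes "u \<in> L2_torus"
 shows "complex_of_real ((L2_norm_torus u)\<^sup>2) = cell_integral (%x. u x * cnj (u x))"
 unfolding L2_norm_square by (simp add: complex_norm_square[symmetric] set_integral_complex_of_real[symmetric])

lemma bessel_inequality:
 fixes u :: "real ^ 'n => complex"
 assumes u: "u \<in> L2_torus" and F: "finite F"
 shows "torus_vol TYPE('n) * (\<Sum>k\<in>F. (cmod (fourier_coeff u k))\<^sup>2) <= (L2_norm_torus u)\<^sup>2"
proof -
 define p where "p x = (\<Sum>k\<in>F. fourier_coeff u k * character k x)" for x
 have p: "p \<in> L2_torus" unfolding p_def by (intro L2_sum L2_scale character_L2)
 define S where "S = (\<Sum>k\<in>F. (cmod (fourier_coeff u k))\<^sup>2)"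
 have sq: "cnj z * z = of_real ((cmod z)\<^sup>2)" for z by (metis complex_norm_square mult.commute)
 have Ic: "fourier_coeff p k = fourier_coeff u k" if "k \<in> F" for k
 proof -
  have "fourier_coeff p k = (\<Sum>l\<in>F. fourier_coeff u l * fourier_coeff (character l) k)"
   unfolding p_def by (subst fourier_coeff_sum) (auto simp: fourier_coeff_scale intro: L2_scale character_L2)
  also have "... = fourier_coeff u k" using that F by (simp add: fourier_coeff_character if_distrib sum.delta cong: if_cong)
  finally show ?thesis .
 qed
 have up: "cell_integral (%x. u x * cnj (p x)) = torus_vol TYPE('n) * S"
  unfolding p_def integral_cnj_trig[OF u] S_def by (simp only: sq of_real_sum of_real_mult)
 have pp: "cell_integral (%x. p x * cnj (p x)) = torus_vol TYPE('n) * S"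
 proof -
  have "cell_integral (%x. p x * cnj (p x)) = torus_vol TYPE('n) * (\<Sum>k\<in>F. cnj (fourier_coeff u k) * fourier_coeff p k)"
   by (subst (2) p_def) (rule integral_cnj_trig[OF p])
  also have "(\<Sum>k\<in>F. cnj (fourier_coeff u k) * fourier_coeff p k) = of_real S"
   unfolding S_def of_real_sum sq[symmetric] by (intro sum.cong) (auto simp: Ic)
  finally show ?thesis by simp
 qed
 have pu: "cell_integral (%x. p x * cnj (u x)) = torus_vol TYPE('n) * S"
 proof -
  have "cell_integral (%x. p x * cnj (u x)) = cell_integral (%x. cnj (u x * cnj (p x)))" by (simp add: mult.commute)
  also have "... = cnj (cell_integral (%x. u x * cnj (p x)))"
   using integral_bounded_linear[OF bounded_linear_cnj L2_mult_integrable[OF u L2_cnj[OF p], unfolded set_integrable_def]]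
   unfolding set_lebesgue_integral_def by (simp only: complex_cnj_scaleR)
  finally show ?thesis by (simp add: up)
 qed
 have "complex_of_real ((L2_norm_torus (%x. u x - p x))\<^sup>2) =
   cell_integral (%x. (u x * cnj (u x) - u x * cnj (p x)) - (p x * cnj (u x) - p x * cnj (p x)))"
  by (subst L2_norm_square_complex[OF L2_diff[OF u p]]) (simp add: algebra_simps)
 also have "... = (cell_integral (%x. u x * cnj (u x)) - cell_integral (%x. u x * cnj (p x)))
  - (cell_integral (%x. p x * cnj (u x)) - cell_integral (%x. p x * cnj (p x)))"
  by (subst set_integral_diff(2) set_integral_diff(2)
    | intro set_integral_diff(1) L2_mult_integrable u p L2_cnj)+ simp
 also have "... = complex_of_real ((L2_norm_torus u)\<^sup>2 - torus_vol TYPE('n) * S)"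
  unfolding up pu pp by (simp add: L2_norm_square_complex[OF u, symmetric])
 finally have "(L2_norm_torus (%x. u x - p x))\<^sup>2 = (L2_norm_torus u)\<^sup>2 - torus_vol TYPE('n) * S"
  by (simp only: of_real_eq_iff)
 then show ?thesis unfolding S_def[symmetric] using zero_le_power2[of "L2_norm_torus (%x. u x - p x)"] by linarith
qed

lemma L2_Cauchy_Schwarz:
 assumes u: "u \<in> L2_torus" and v: "v \<in> L2_torus"
 shows "cell_integral (%x. cmod (u x) * cmod (v x)) <= L2_norm_torus u * L2_norm_torus v"
proof -
 define a b c where "a = L2_norm_torus u" and "b = L2_norm_torus v" and "c = cell_integral (%x. cmod (u x) * cmod (v x))"
 have int: "set_integrable lebesgue cell (%x. cmod (u x) * cmod (v x))"
  using set_integrable_norm[OF L2_mult_integrable[OF u v]] by (simp add: norm_mult)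
 have key: "0 <= a\<^sup>2 * s\<^sup>2 + 2 * s * c + b\<^sup>2" for s
 proof -
  have "0 <= cell_integral (%x. (s * cmod (u x) + cmod (v x))\<^sup>2)"
   unfolding set_lebesgue_integral_def by (intro integral_nonneg_AE) auto
  also have "... = cell_integral (%x. (s\<^sup>2 * (cmod (u x))\<^sup>2 + (2 * s) * (cmod (u x) * cmod (v x))) + (cmod (v x))\<^sup>2)"
   by (simp add: power2_sum power_mult_distrib algebra_simps)
  also have "... = (s\<^sup>2 * a\<^sup>2 + (2 * s) * c) + b\<^sup>2" unfolding a_def b_def c_def L2_norm_square
   by (subst set_integral_add(2) | intro set_integral_add(1) set_integrable_mult_right L2_torusD(3)[OF u] L2_torusD(3)[OF v] int)+ simp
  finally show ?thesis by (simp add: algebra_simps)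
 qed
 have ab: "a >= 0" "b >= 0" by (auto simp: a_def b_def)
 have "c <= a * b"
 proof (cases "a = 0")
  case True
  show ?thesis
  proof (rule ccontr)
   assume "\<not> c <= a * b"
   then have "c > 0" using True by simp
   then have "2 * (- (b\<^sup>2 + 1) / (2 * c)) * c = - (b\<^sup>2 + 1)" by simp
   then show False using key[of "- (b\<^sup>2 + 1) / (2 * c)"] True by simp
  qed
 next
  case False
  then have a: "a > 0" using ab by simp
  show ?thesis
  proof (rule ccontr)
   assume "\<not> c <= a * b"
   then have lt: "a * b < c" by simp
   have "0 <= a\<^sup>2 * (- c / a\<^sup>2)\<^sup>2 + 2 * (- c / a\<^sup>2) * c + b\<^sup>2" by (rule key)
   also have "... = b\<^sup>2 - c\<^sup>2 / a\<^sup>2" using a by (simp add: power2_eq_square field_simps)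
   finally have "c\<^sup>2 <= (a * b)\<^sup>2" using a by (simp add: field_simps power_mult_distrib)
   moreover have "(a * b)\<^sup>2 < c\<^sup>2" using lt ab by (intro power_strict_mono) auto
   ultimately show False by simp
  qed
 qed
 then show ?thesis by (simp add: a_def b_def c_def)
qed

lemma L2_norm_triangle:
 assumes u: "u \<in> L2_torus" and v: "v \<in> L2_torus"
 shows "L2_norm_torus (%x. u x + v x) <= L2_norm_torus u + L2_norm_torus v"
proof (rule power2_le_imp_le)
 have int: "set_integrable lebesgue cell (%x. cmod (u x) * cmod (v x))"
  using set_integrable_norm[OF L2_mult_integrable[OF u v]] by (simp add: norm_mult)
 have "(L2_norm_torus (%x. u x + v x))\<^sup>2 <= cell_integral (%x. ((cmod (u x))\<^sup>2 + 2 * (cmod (u x) * cmod (v x))) + (cmod (v x))\<^sup>2)"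
  unfolding L2_norm_square
 proof (rule set_integral_mono)
  show "set_integrable lebesgue cell (%x. (cmod (u x + v x))\<^sup>2)" by (rule L2_torusD[OF L2_add[OF u v]])
  show "set_integrable lebesgue cell (%x. ((cmod (u x))\<^sup>2 + 2 * (cmod (u x) * cmod (v x))) + (cmod (v x))\<^sup>2)"
   by (intro set_integral_add(1) set_integrable_mult_right L2_torusD(3)[OF u] L2_torusD(3)[OF v] int)
  fix x
  have "(cmod (u x + v x))\<^sup>2 <= (cmod (u x) + cmod (v x))\<^sup>2" by (intro power_mono norm_triangle_ineq) simp
  then show "(cmod (u x + v x))\<^sup>2 <= ((cmod (u x))\<^sup>2 + 2 * (cmod (u x) * cmod (v x))) + (cmod (v x))\<^sup>2"
   by (simp add: power2_sum)
 qed
 also have "... = ((L2_norm_torus u)\<^sup>2 + 2 * cell_integral (%x. cmod (u x) * cmod (v x))) + (L2_norm_torus v)\<^sup>2"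
  unfolding L2_norm_square
  by (subst set_integral_add(2) | intro set_integral_add(1) set_integrable_mult_right L2_torusD(3)[OF u] L2_torusD(3)[OF v] int)+ simp
 also have "... <= (L2_norm_torus u + L2_norm_torus v)\<^sup>2"
  using L2_Cauchy_Schwarz[OF u v] by (simp add: power2_sum)
 finally show "(L2_norm_torus (%x. u x + v x))\<^sup>2 <= (L2_norm_torus u + L2_norm_torus v)\<^sup>2" .
qed simp

text \<open>A product of one-dimensional kernels of Fejer type.\<close>

definition kernel :: "nat => real ^ 'n => real" where
 "kernel j z = (\<Prod>i\<in>UNIV. ((1 + cos (z $ i)) / 2) ^ j)"

text \<open>Trigonometric polynomials whose coefficients are real and nonnegative, a property that
  survives products. Together with pointwise positivity of the kernel it places the Fourier
  multiplier of mollification in [0, 1].\<close>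

definition trig_pos :: "(real ^ 'n => real) => bool" where
 "trig_pos f \<longleftrightarrow> (\<exists>F b. finite F & (\<forall>k. 0 <= (b k :: real)) &
  (\<forall>z. complex_of_real (f z) = (\<Sum>k\<in>F. of_real (b k) * character k z)))"

lemma trig_pos_mult:
 assumes "trig_pos f" "trig_pos g"
 shows "trig_pos (%z. f z * g z)"
proof -
 obtain F b where F: "finite F" "!!k. 0 <= (b k :: real)" "!!z. complex_of_real (f z) = (\<Sum>k\<in>F. of_real (b k) * character k z)"
  using assms(1) by (auto simp: trig_pos_def)
 obtain G c where G: "finite G" "!!k. 0 <= (c k :: real)" "!!z. complex_of_real (g z) = (\<Sum>k\<in>G. of_real (c k) * character k z)"
  using assms(2) by (auto simp: trig_pos_def)
 define h where "h = (%(k, l). k + l :: int ^ 'a)"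
 define d where "d m = (\<Sum>p\<in>{p \<in> F \<times> G. h p = m}. b (fst p) * c (snd p))" for m
 have "complex_of_real (f z * g z) = (\<Sum>m\<in>h ` (F \<times> G). of_real (d m) * character m z)" for z
 proof -
  have "complex_of_real (f z * g z) = (\<Sum>p\<in>F \<times> G. of_real (b (fst p) * c (snd p)) * character (h p) z)"
   by (simp add: F G sum_product sum.cartesian_product h_def character_add split_beta mult_ac)
  also have "... = (\<Sum>m\<in>h ` (F \<times> G). \<Sum>p\<in>{p \<in> F \<times> G. h p = m}. of_real (b (fst p) * c (snd p)) * character (h p) z)"
   by (rule sum.image_gen) (use F G in auto)
  also have "... = (\<Sum>m\<in>h ` (F \<times> G). of_real (d m) * character m z)"
  proof (rule sum.cong[OF refl])
   fix m
   have "(\<Sum>p\<in>{p \<in> F \<times> G. h p = m}. of_real (b (fst p) * c (snd p)) * character (h p) z) =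
    (\<Sum>p\<in>{p \<in> F \<times> G. h p = m}. complex_of_real (b (fst p) * c (snd p)) * character m z)"
    by (intro sum.cong) auto
   then show "(\<Sum>p\<in>{p \<in> F \<times> G. h p = m}. of_real (b (fst p) * c (snd p)) * character (h p) z) = of_real (d m) * character m z"
    by (simp only: d_def of_real_sum sum_distrib_right)
  qed
  finally show ?thesis .
 qed
 moreover have "0 <= d m" for m unfolding d_def using F(2) G(2) by (intro sum_nonneg) auto
 moreover have "finite (h ` (F \<times> G))" using F G by auto
 ultimately show ?thesis unfolding trig_pos_def by blast
qed

lemma trig_pos_1: "trig_pos (%_. 1)" unfolding trig_pos_def by (intro exI[of _ "{0}"] exI[of _ "%_. 1"]) auto

lemma trig_pos_cos: "trig_pos (%z. (1 + cos (z $ i)) / 2)"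
proof -
 let ?e = "axis i 1 :: int ^ 'a"
 have fr: "frequency ?e \<bullet> z = z $ i" for z
 proof -
  have "frequency ?e = axis i 1" by (simp add: frequency_def vec_eq_iff axis_def)
  then show ?thesis by (simp add: inner_axis')
 qed
 have ne: "?e ~= 0" "?e ~= - ?e" "- ?e ~= 0" by (auto simp: vec_eq_iff axis_def)
 define b where "b k = (if k = 0 then 1/2 else 1/4 :: real)" for k :: "int ^ 'a"
 have "complex_of_real ((1 + cos (z $ i)) / 2) = (\<Sum>k\<in>{0, ?e, - ?e}. of_real (b k) * character k z)" for z
  using ne by (simp add: b_def character_def frequency_minus fr complex_eq_iff)
 moreover have "0 <= b k" for k by (simp add: b_def)
 ultimately show ?thesis unfolding trig_pos_def by (intro exI[of _ "{0, ?e, - ?e}"] exI[of _ b]) simp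
qed

lemma trig_pos_power: "trig_pos f ==> trig_pos (%z. f z ^ j)" by (induction j) (auto intro: trig_pos_mult trig_pos_1)

lemma trig_pos_prod: "(!!i. i \<in> I ==> trig_pos (f i)) ==> trig_pos (%z. \<Prod>i\<in>I. f i z)"
 by (induction I rule: infinite_finite_induct) (auto intro: trig_pos_mult trig_pos_1)

lemma trig_pos_kernel: "trig_pos (kernel j)"
 unfolding kernel_def[abs_def] by (intro trig_pos_prod trig_pos_power trig_pos_cos)

lemma half_cos: "0 <= (1 + cos (t::real)) / 2" "(1 + cos (t::real)) / 2 <= 1"
proof -
 have "0 <= 1 + cos t" using cos_ge_minus_one[of t] by linarith
 then show "0 <= (1 + cos t) / 2" by simp
 show "(1 + cos t) / 2 <= 1" using cos_le_one[of t] by simp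
qed

lemma kernel_nonneg: "0 <= kernel j z" unfolding kernel_def by (intro prod_nonneg ballI zero_le_power half_cos)

lemma continuous_kernel: "continuous_on S (kernel j)" unfolding kernel_def[abs_def] by (intro continuous_intros) auto

lemma kernel_le:
 fixes z :: "real ^ 'n"
 shows "kernel j z <= ((1 + cos (z $ i)) / 2) ^ j"
proof -
 have "kernel j z = ((1 + cos (z $ i)) / 2) ^ j * (\<Prod>l\<in>UNIV - {i}. ((1 + cos (z $ l)) / 2) ^ j)"
  unfolding kernel_def by (rule prod.remove) auto
 also have "... <= ((1 + cos (z $ i)) / 2) ^ j * 1"
  by (intro mult_left_mono prod_le_1 conjI zero_le_power power_le_one half_cos)
 finally show ?thesis by simp
qed

definition kmass :: "'n::finite itself => nat => real" where
 "kmass _ j = integral cell (kernel j :: real ^ 'n => real)"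

lemma cos_gt_near:
 assumes s: "0 < s" "s <= 1" and c: "cos s < cos x"
 shows "\<exists>m::int. \<bar>x - 2 * pi * m\<bar> < s"
proof -
 define m where "m = round (x / (2 * pi))"
 define t where "t = x - 2 * pi * m"
 have "\<bar>of_int m - x / (2 * pi)\<bar> <= 1/2" unfolding m_def by (rule of_int_round_abs_le)
 then have "(2 * pi) * \<bar>of_int m - x / (2 * pi)\<bar> <= (2 * pi) * (1/2)" by (intro mult_left_mono) auto
 moreover have "(2 * pi) * \<bar>of_int m - x / (2 * pi)\<bar> = \<bar>t\<bar>"
 proof -
  have "(2 * pi) * \<bar>of_int m - x / (2 * pi)\<bar> = \<bar>(2 * pi) * (of_int m - x / (2 * pi))\<bar>" by (simp add: abs_mult)
  also have "(2 * pi) * (of_int m - x / (2 * pi)) = - t" by (simp add: t_def algebra_simps)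
  finally show ?thesis by simp
 qed
 ultimately have t: "\<bar>t\<bar> <= pi" by simp
 have "cos x = cos (t + 2 * pi * of_int m)" by (simp add: t_def)
 also have "... = cos t" using cos_int_2pin[of m] sin_int_2pin[of m] by (simp add: cos_add)
 finally have lt: "cos s < cos \<bar>t\<bar>" using c by simp
 have "\<bar>t\<bar> < s"
 proof (rule ccontr)
  assume "\<not> \<bar>t\<bar> < s"
  then have "cos \<bar>t\<bar> <= cos s" using t s by (intro cos_monotone_0_pi_le) auto
  with lt show False by simp
 qed
 then show ?thesis unfolding t_def by blast
qed

text \<open>Away from the lattice some coordinate satisfies \<open>(1 + cos t) / 2 <= q\<close>,
  while on a small cube with a corner at the origin the kernel is at least the \<open>j\<close>-th
  power of p^n > q. The mass of the kernel thus decays more slowly than its values far from the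
  lattice.\<close>

lemma kernel_far_small:
 assumes "0 < d"
 shows "\<exists>q c. q >= 0 & (%j. c j) \<longlonglongrightarrow> 0 & (\<forall>j. kmass TYPE('n) j > 0 & c j = q ^ j / kmass TYPE('n) j) &
  (\<forall>j z::real^'n. (\<forall>e\<in>lattice. d <= norm (z - e)) --> kernel j z <= q ^ j)"
proof -
 \<comment> \<open>A point with all coordinates within \<open>s\<close> of those of a lattice point
   has distance less than \<open>s * CARD('n) <= d\<close> from it.\<close>
 define s where "s = min (d / CARD('n)) 1"
 have n0: "real CARD('n) > 0" by simp
 have "s <= d / CARD('n)" by (simp add: s_def)
 then have "s * CARD('n) <= d" using n0 by (simp only: pos_le_divide_eq)
 moreover have "0 < s" "s <= 1" using assms n0 by (simp_all add: s_def)
 ultimately have s: "0 < s" "s <= 1" "s * CARD('n) <= d" by simp_all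
 have spi: "s < pi" using s pi_gt3 by linarith
 define q where "q = (1 + cos s) / 2"
 have q: "0 <= q" "q < 1" using half_cos(1)[of s] cos_monotone_0_pi[of 0 s] s spi by (auto simp: q_def)
 have "isCont (%t::real. ((1 + cos t) / 2) ^ CARD('n)) 0" by (intro continuous_intros) auto
 from iffD1[OF continuous_at_eps_delta this, rule_format, of "1 - q"] q(2)
 have "\<exists>\<eta>>0. \<forall>t. \<bar>t\<bar> < \<eta> --> \<bar>((1 + cos t) / 2) ^ CARD('n) - 1\<bar> < 1 - q"
  unfolding dist_real_def by (metis cos_zero diff_gt_0_iff_gt diff_zero div_self one_add_one power_one zero_neq_numeral)
 then obtain \<eta>0 where \<eta>0: "\<eta>0 > 0" "!!t. \<bar>t\<bar> < \<eta>0 ==> \<bar>((1 + cos t) / 2) ^ CARD('n) - 1\<bar> < 1 - q" by blast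
 define \<eta> where "\<eta> = min (\<eta>0 / 2) 1"
 have \<eta>: "0 < \<eta>" "\<eta> < \<eta>0" "\<eta> <= 1" "\<eta> < pi" using \<eta>0 pi_gt3 by (auto simp: \<eta>_def)
 define p where "p = (1 + cos \<eta>) / 2"
 have p: "q < p ^ CARD('n)" using \<eta>0(2)[of \<eta>] \<eta> by (simp add: p_def)
 have p0: "0 <= p" using half_cos(1) by (simp add: p_def)
 let ?B = "cbox 0 (\<chi> i. \<eta>) :: (real ^ 'n) set"
 have Bc: "?B \<subseteq> cell"
 proof
  fix z assume "z \<in> ?B"
  then have z: "0 <= z $ i" "z $ i <= \<eta>" for i by (auto simp: mem_box_cart)
  have "z $ i <= 2 * pi" for i using z(2)[of i] \<eta>(3) pi_gt3 by linarith
  with z(1) show "z \<in> cell" by (simp add: cell_def mem_box_cart)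
 qed
 have Bvol: "integral ?B (%_. 1::real) = \<eta> ^ CARD('n)"
 proof -
  have "0 \<in> ?B" using \<eta> by (simp add: mem_box_cart)
  then have "?B ~= {}" by blast
  then show ?thesis by (simp add: content_cbox_cart)
 qed
 have lower: "\<eta> ^ CARD('n) * (p ^ CARD('n)) ^ j <= kmass TYPE('n) j" for j
 proof -
  have "(p ^ CARD('n)) ^ j <= kernel j z" if "z \<in> ?B" for z
  proof -
   have "p ^ j <= ((1 + cos (z $ i)) / 2) ^ j" for i
   proof (rule power_mono[OF _ p0])
    have "0 <= z $ i" "z $ i <= \<eta>" using that by (auto simp: mem_box_cart)
    then show "p <= (1 + cos (z $ i)) / 2" unfolding p_def using \<eta> cos_monotone_0_pi_le[of "z $ i" \<eta>] by simp
   qed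
   then have "(\<Prod>i\<in>(UNIV::'n set). p ^ j) <= kernel j z"
    unfolding kernel_def by (intro prod_mono) (use p0 in auto)
   then show ?thesis by (simp add: power_mult[symmetric] mult.commute)
  qed
  then have "integral ?B (%z. (p ^ CARD('n)) ^ j) <= integral ?B (kernel j)"
   by (intro integral_le integrable_continuous continuous_kernel continuous_intros) auto
  also have "... <= integral cell (kernel j :: real ^ 'n => real)"
   by (rule integral_subset_le[OF Bc integrable_continuous[OF continuous_kernel] integrable_cell(2)[OF continuous_kernel]]) (simp add: kernel_nonneg)
  also have "integral ?B (%z. (p ^ CARD('n)) ^ j) = \<eta> ^ CARD('n) * (p ^ CARD('n)) ^ j"
   using integral_mult_right[of ?B "(p ^ CARD('n)) ^ j" "%_. 1"] Bvol by (simp add: mult.commute)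
  finally show ?thesis by (simp add: kmass_def)
 qed
 have pn: "p ^ CARD('n) > 0" using p q by linarith
 have pos: "kmass TYPE('n) j > 0" for j by (rule less_le_trans[OF mult_pos_pos lower]) (use pn \<eta>(1) in auto)
 define c where "c j = q ^ j / kmass TYPE('n) j" for j
 have "(%j. c j) \<longlonglongrightarrow> 0"
 proof (rule Lim_null_comparison)
  have "norm (c j) <= (1 / \<eta> ^ CARD('n)) * (q / p ^ CARD('n)) ^ j" for j
  proof -
   have "c j <= q ^ j / (\<eta> ^ CARD('n) * (p ^ CARD('n)) ^ j)"
    unfolding c_def using q \<eta>(1) pn pos[of j] by (intro divide_left_mono lower mult_pos_pos) auto
   then show ?thesis using q pos[of j] by (simp add: c_def power_divide)
  qed
  then show "\<forall>\<^sub>F j in sequentially. norm (c j) <= (1 / \<eta> ^ CARD('n)) * (q / p ^ CARD('n)) ^ j" by simp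
  have "(%j. (q / p ^ CARD('n)) ^ j) \<longlonglongrightarrow> 0" using q p pn by (intro LIMSEQ_realpow_zero) auto
  then show "(%j. (1 / \<eta> ^ CARD('n)) * (q / p ^ CARD('n)) ^ j) \<longlonglongrightarrow> 0" by (rule tendsto_mult_right_zero)
 qed
 moreover have "kernel j z <= q ^ j" if far: "\<forall>e\<in>lattice. d <= norm (z - e)" for j and z :: "real ^ 'n"
 proof (rule ccontr)
  assume neg: "\<not> kernel j z <= q ^ j"
  have near: "\<exists>m::int. \<bar>z $ i - 2 * pi * m\<bar> < s" for i
  proof (rule cos_gt_near[OF s(1,2)], rule ccontr)
   assume "\<not> cos s < cos (z $ i)"
   then have "((1 + cos (z $ i)) / 2) ^ j <= q ^ j" unfolding q_def by (intro power_mono half_cos) simp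
   with kernel_le[of j z i] neg show False by simp
  qed
  then obtain m :: "'n => int" where m: "!!i. \<bar>z $ i - 2 * pi * m i\<bar> < s" by metis
  define e where "e = (\<chi> i. 2 * pi * real_of_int (m i))"
  have "e \<in> lattice" by (auto simp: e_def lattice_def)
  have "norm (z - e) <= (\<Sum>i\<in>UNIV. \<bar>(z - e) $ i\<bar>)" by (rule norm_le_l1_cart)
  also have "... < (\<Sum>i\<in>(UNIV::'n set). s)" by (intro sum_strict_mono) (auto simp: e_def m)
  also have "... <= d" using s(3) by (simp add: mult.commute)
  finally show False using far \<open>e \<in> lattice\<close> by force
 qed
 ultimately show ?thesis using q pos c_def by blast
qed

section \<open>Mollification\<close>

definition mol :: "nat => (real ^ 'n => real) => real ^ 'n => real" where
 "mol j f x = integral cell (%y. f y * kernel j (x - y)) / kmass TYPE('n) j"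

lemma kmass_pos: "kmass TYPE('n::finite) j > 0" using kernel_far_small[where 'n='n, of 1] by auto

lemma of_real_cell_integral:
 fixes f :: "real ^ 'n => real"
 assumes "continuous_on UNIV f"
 shows "complex_of_real (integral cell f) = cell_integral (%x. of_real (f x))"
 by (simp add: integrable_cell(3)[OF assms, symmetric] set_integral_complex_of_real)

lemma mol_expansion:
 "\<exists>F \<mu>. finite F & (\<forall>k. 0 <= (\<mu> k :: real) & \<mu> k <= 1) &
  (\<forall>f x. continuous_on UNIV f --> complex_of_real (mol j f x) =
    (\<Sum>k\<in>F. of_real (\<mu> k) * fourier_coeff (%y. of_real (f y)) k * character k (x :: real ^ 'n))) &
  (\<forall>x. integral cell (%y :: real ^ 'n. kernel j (x - y)) = kmass TYPE('n) j)"
proof -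
 obtain F b where F: "finite F" "!!k. 0 <= (b k :: real)"
  "!!z :: real ^ 'n. complex_of_real (kernel j z) = (\<Sum>k\<in>F. of_real (b k) * character k z)"
  using trig_pos_kernel[of j] by (auto simp: trig_pos_def)
 define CC where "CC = torus_vol TYPE('n)"
 define M where "M = kmass TYPE('n) j"
 have CC: "CC > 0" by (simp add: CC_def torus_vol_pos)
 have M: "M > 0" by (simp add: M_def kmass_pos)
 have conv: "complex_of_real (integral cell (%y. f y * kernel j (x - y))) =
  (\<Sum>k\<in>F. of_real (b k) * (of_real CC * fourier_coeff (%y. of_real (f y)) k) * character k x)"
  if f: "continuous_on UNIV f" for f and x :: "real ^ 'n"
 proof -
  have cf: "continuous_on UNIV (%y. complex_of_real (f y))" by (intro continuous_intros f)
  have "continuous_on UNIV (%y. f y * kernel j (x - y))"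
   by (intro continuous_intros f continuous_on_compose2[OF continuous_kernel[of UNIV]]) auto
  then have "complex_of_real (integral cell (%y. f y * kernel j (x - y))) = cell_integral (%y. of_real (f y * kernel j (x - y)))"
   by (rule of_real_cell_integral)
  also have "... = cell_integral (%y. \<Sum>k\<in>F. (of_real (b k) * character k x) * (of_real (f y) * character (- k) y))"
   by (simp add: F(3) character_diff_arg sum_distrib_left mult_ac)
  also have "... = (\<Sum>k\<in>F. cell_integral (%y. (of_real (b k) * character k x) * (of_real (f y) * character (- k) y)))"
   by (rule cell_integral_sum[THEN conjunct2])
    (intro integrable_cell(1) continuous_on_mult continuous_on_const cf continuous_character)
  also have "... = (\<Sum>k\<in>F. of_real (b k) * (of_real CC * fourier_coeff (%y. of_real (f y)) k) * character k x)"
   unfolding set_integral_mult_right fourier_coeff_character_integral(1) CC_def by (simp add: mult_ac)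
  finally show ?thesis .
 qed
 define F' where "F' = F"
 have coef1: "fourier_coeff (%y::real^'n. 1) k = (if k = 0 then 1 else 0)" for k
  using fourier_coeff_character[of "0 :: int ^ 'n" k] by (auto simp: character_def[abs_def])
 \<comment> \<open>The expansion for the constant function 1 shows that all translates of the kernel
   have the same mass.\<close>
 have mass: "integral cell (%y. kernel j (x - y)) = (if 0 \<in> F then CC * b 0 else 0)" for x :: "real ^ 'n"
 proof -
  have "complex_of_real (integral cell (%y. kernel j (x - y))) =
   (\<Sum>k\<in>F. of_real (b k) * (of_real CC * (if k = 0 then 1 else 0)) * character k x)"
   using conv[where f="%_. 1" and x=x, OF continuous_on_const, unfolded of_real_1 coef1 mult_1_left] .
  also have "... = (\<Sum>k\<in>F. if k = 0 then of_real (b 0 * CC) else 0)" by (intro sum.cong) auto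
  also have "... = of_real (if 0 \<in> F then CC * b 0 else 0)" using F(1) by (simp add: mult.commute)
  finally show ?thesis by (simp only: of_real_eq_iff)
 qed
 have kers: "kernel j (0 - y) = kernel j y" for y :: "real ^ 'n" by (simp add: kernel_def)
 have M0: "M = (if 0 \<in> F then CC * b 0 else 0)" using mass[of 0] unfolding kers by (simp add: M_def kmass_def)
 then have F0: "0 \<in> F" "M = CC * b 0" using M by (auto split: if_splits)
 have b0: "b 0 > 0" using F0 M CC by (simp add: zero_less_mult_iff)
 \<comment> \<open>The kernel is nonnegative, so no Fourier coefficient exceeds its mean.\<close>
 have ble: "b k <= b 0" if "k \<in> F" for k
 proof -
  have cK: "continuous_on UNIV (%z::real^'n. complex_of_real (kernel j z))" by (intro continuous_intros continuous_kernel)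
  have "fourier_coeff (%z::real^'n. complex_of_real (kernel j z)) k = (\<Sum>l\<in>F. of_real (b l) * fourier_coeff (character l) k)"
   unfolding F(3) by (subst fourier_coeff_sum) (auto simp: fourier_coeff_scale intro: L2_scale character_L2)
  also have "... = of_real (b k)" using that F(1) by (simp add: fourier_coeff_character if_distrib sum.delta cong: if_cong)
  finally have "of_real (CC * b k) = cell_integral (%z::real^'n. of_real (kernel j z) * character (- k) z)"
   by (simp add: fourier_coeff_character_integral(1) CC_def)
  then have "CC * b k = cmod (cell_integral (%z::real^'n. of_real (kernel j z) * character (- k) z))"
   using CC F(2)[of k] by (metis abs_of_nonneg less_imp_le mult_nonneg_nonneg norm_of_real)
  also have "... <= cell_integral (%z::real^'n. cmod (of_real (kernel j z) * character (- k) z))"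
   by (rule set_integral_norm_bound) (intro integrable_cell(1) continuous_on_mult cK continuous_character)
  also have "... = integral cell (kernel j :: real ^ 'n => real)"
   using integrable_cell(3)[OF continuous_kernel[of UNIV j], where 'n='n] by (simp add: norm_mult kernel_nonneg)
  also have "... = CC * b 0" using F0 by (simp add: M_def kmass_def)
  finally show ?thesis using CC by simp
 qed
 define \<mu> where "\<mu> k = (if k \<in> F then b k / b 0 else 0)" for k
 have 1: "0 <= \<mu> k & \<mu> k <= 1" for k using b0 F(2) ble by (simp add: \<mu>_def)
 have 2: "complex_of_real (mol j f x) = (\<Sum>k\<in>F. of_real (\<mu> k) * fourier_coeff (%y. of_real (f y)) k * character k x)"
  if f: "continuous_on UNIV f" for f and x :: "real ^ 'n"
 proof -
  have "complex_of_real (mol j f x) = complex_of_real (integral cell (%y. f y * kernel j (x - y))) / of_real M"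
   by (simp add: mol_def M_def)
  also have "... = (\<Sum>k\<in>F. of_real (b k) * (of_real CC * fourier_coeff (%y. of_real (f y)) k) * character k x / of_real M)"
   unfolding conv[OF f] by (simp add: sum_divide_distrib)
  also have "... = (\<Sum>k\<in>F. of_real (\<mu> k) * fourier_coeff (%y. of_real (f y)) k * character k x)"
   using CC b0 by (intro sum.cong) (auto simp: \<mu>_def F0(2))
  finally show ?thesis .
 qed
 have 3: "integral cell (%y :: real ^ 'n. kernel j (x - y)) = kmass TYPE('n) j" for x :: "real ^ 'n"
  using mass[of x] F0 by (simp add: M_def)
 show ?thesis using F(1) 1 2 3 by blast
qed

text \<open>Near the lattice the modulus of continuity is used, elsewhere the smallness of the
  kernel. The sequence \<open>c\<close> depends only on \<delta>, so the limit is uniform in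
  families of functions.\<close>

lemma mol_uniform:
 assumes "0 < \<delta>"
 shows "\<exists>c. (c \<longlonglongrightarrow> 0) & (\<forall>(f :: real ^ 'n => real) B \<epsilon> j x. continuous_on UNIV f --> periodic f --> (\<forall>x. \<bar>f x\<bar> <= B) -->
  (\<forall>x y. norm (x - y) < \<delta> --> \<bar>f x - f y\<bar> <= \<epsilon>) --> \<bar>mol j f x - f x\<bar> <= \<epsilon> + B * c j)"
proof -
 obtain q c0 where q: "q >= 0" "c0 \<longlonglongrightarrow> 0" "!!j. kmass TYPE('n) j > 0" "!!j. c0 j = q ^ j / kmass TYPE('n) j"
  "!!j z::real^'n. (\<forall>e\<in>lattice. \<delta> <= norm (z - e)) ==> kernel j z <= q ^ j"
  using kernel_far_small[OF assms, where 'n='n] by blast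
 define c where "c j = 2 * torus_vol TYPE('n) * c0 j" for j
 have "c \<longlonglongrightarrow> 0" unfolding c_def by (intro tendsto_mult_right_zero q(2))
 moreover have "\<bar>mol j f x - f x\<bar> <= \<epsilon> + B * c j"
  if f: "continuous_on UNIV f" "periodic f" and B: "!!x. \<bar>f x\<bar> <= B"
   and mod: "!!x y. norm (x - y) < \<delta> ==> \<bar>f x - f y\<bar> <= \<epsilon>" for f :: "real ^ 'n => real" and B \<epsilon> j x
 proof -
  define M where "M = kmass TYPE('n) j"
  have M: "M > 0" using q(3) by (simp add: M_def)
  have mass: "integral cell (%y. kernel j (x - y)) = M"
   using mol_expansion[where 'n='n, of j] unfolding M_def by blast
  have cK: "continuous_on UNIV (%y. kernel j (x - y))"
   by (intro continuous_on_compose2[OF continuous_kernel[of UNIV]] continuous_intros) auto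
  have cf: "continuous_on UNIV (%y. (f y - f x) * kernel j (x - y))" by (intro continuous_intros f cK)
  have e0: "\<epsilon> >= 0" using mod[of x x] assms by simp
  have pt: "\<bar>(f y - f x) * kernel j (x - y)\<bar> <= \<epsilon> * kernel j (x - y) + 2 * B * q ^ j" for y
  proof (cases "\<forall>e\<in>lattice. \<delta> <= norm ((x - y) - e)")
   case True
   have B0: "B >= 0" using B[of x] by linarith
   have "\<bar>f y - f x\<bar> * kernel j (x - y) <= (2 * B) * q ^ j"
    using B[of x] B[of y] q(5)[OF True] B0 by (intro mult_mono kernel_nonneg) auto
   then show ?thesis using kernel_nonneg[of j "x - y"] e0 by (simp add: abs_mult add_increasing)
  next
   case False
   then obtain e where e: "e \<in> lattice" "norm (x - (y + e)) < \<delta>" by (auto simp: algebra_simps not_le)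
   then have "\<bar>f y - f x\<bar> <= \<epsilon>"
    using mod[OF e(2)] periodic_lattice[OF f(2) e(1), of y] by (simp add: abs_minus_commute)
   then have "\<bar>f y - f x\<bar> * kernel j (x - y) <= \<epsilon> * kernel j (x - y)" by (intro mult_right_mono kernel_nonneg)
   moreover have "0 <= B * q ^ j" using B[of x] q(1) by (intro mult_nonneg_nonneg) auto
   ultimately show ?thesis by (simp add: abs_mult kernel_nonneg)
  qed
  have "mol j f x - f x = integral cell (%y. (f y - f x) * kernel j (x - y)) / M"
  proof -
   have "integral cell (%y. (f y - f x) * kernel j (x - y)) =
    integral cell (%y. f y * kernel j (x - y)) - f x * M" unfolding left_diff_distrib mass[symmetric]
    by (subst integral_diff) (auto intro!: integrable_cell continuous_intros f cK)
   then show ?thesis using M by (simp add: mol_def M_def[symmetric] diff_divide_distrib)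
  qed
  also have "\<bar>...\<bar> <= (\<epsilon> * M + 2 * B * q ^ j * torus_vol TYPE('n)) / M"
  proof -
   have "\<bar>integral cell (%y. (f y - f x) * kernel j (x - y))\<bar> <= integral cell (%y. \<epsilon> * kernel j (x - y) + 2 * B * q ^ j)"
    using pt unfolding real_norm_def[symmetric]
    by (intro integral_norm_bound_integral integrable_cell cf continuous_intros cK) auto
   also have "... = \<epsilon> * M + 2 * B * q ^ j * torus_vol TYPE('n)"
   proof -
    have "integral cell (%y::real^'n. 2 * B * q ^ j) = 2 * B * q ^ j * torus_vol TYPE('n)"
     using integral_mult_right[of cell "2 * B * q ^ j" "%y::real^'n. 1"] by (simp add: measure_cell torus_vol_def)
    then show ?thesis using mass by (subst integral_add) (auto intro!: integrable_cell continuous_intros cK)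
   qed
   finally show ?thesis using M by (simp add: divide_right_mono)
  qed
  also have "... = \<epsilon> + B * c j" using M by (simp add: c_def q(4) M_def[symmetric] add_divide_distrib)
  finally show ?thesis .
 qed
 ultimately show ?thesis by blast
qed

lemma periodic_compact_bounds:
 fixes g :: "'t::metric_space => real ^ 'n => real"
 assumes S: "compact S" and g: "continuous_on (S \<times> UNIV) (%(t, x). g t x)" and per: "!!t. t \<in> S ==> periodic (g t)"
 shows "\<exists>B. \<forall>t\<in>S. \<forall>x. \<bar>g t x\<bar> <= B"
  "\<epsilon> > 0 ==> \<exists>\<delta>>0. \<forall>t\<in>S. \<forall>x y. norm (x - y) < \<delta> --> \<bar>g t x - g t y\<bar> <= \<epsilon>"
proof -
 define R where "R = (\<Union>x\<in>cell. cball x 1 :: (real ^ 'n) set)"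
 obtain a where a: "!!x. x \<in> (cell :: (real ^ 'n) set) ==> norm x <= a"
  using compact_imp_bounded[OF compact_cell] unfolding bounded_iff by blast
 \<comment> \<open>The margin 1 around the cell allows two points at distance below 1 to be moved
   into the ball by the same lattice vector.\<close>
 define C where "C = (cball 0 (a + 1) :: (real ^ 'n) set)"
 have near: "\<exists>c\<in>lattice. x + c \<in> C & (\<forall>y. norm (x - y) < 1 --> y + c \<in> C)" for x
 proof -
  obtain c where c: "c \<in> lattice" "x + c \<in> cell" using lattice_translate_to_cell by blast
  have "y + c \<in> C" if "norm (x - y) < 1" for y
   using norm_triangle_ineq4[of "x + c" "x - y"] a[OF c(2)] that by (simp add: C_def add.commute)
  moreover have "x + c \<in> C" using a[OF c(2)] by (simp add: C_def)
  ultimately show ?thesis using c by blast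
 qed
 have comp: "compact (S \<times> C)" unfolding C_def by (intro compact_Times S compact_cball)
 have cont: "continuous_on (S \<times> C) (%(t, x). g t x)" by (rule continuous_on_subset[OF g]) auto
 have "bounded ((%(t, x). g t x) ` (S \<times> C))" by (intro compact_imp_bounded compact_continuous_image cont comp)
 then obtain B where B: "!!t x. t \<in> S ==> x \<in> C ==> \<bar>g t x\<bar> <= B" unfolding bounded_iff by force
 have "\<bar>g t x\<bar> <= B" if t: "t \<in> S" for t x
 proof -
  obtain c where "c \<in> lattice" "x + c \<in> C" using near[of x] by blast
  then show ?thesis using B[OF t, of "x + c"] periodic_lattice[OF per[OF t], of c x] by simp
 qed
 then show "\<exists>B. \<forall>t\<in>S. \<forall>x. \<bar>g t x\<bar> <= B" by blast
 assume "\<epsilon> > 0"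
 have "uniformly_continuous_on (S \<times> C) (%(t, x). g t x)" by (rule compact_uniformly_continuous[OF cont comp])
 then obtain d where d: "d > 0" "!!p q. p \<in> S \<times> C ==> q \<in> S \<times> C ==> dist q p < d ==> dist ((%(t, x). g t x) q) ((%(t, x). g t x) p) < \<epsilon>"
  using \<open>\<epsilon> > 0\<close> unfolding uniformly_continuous_on_def by metis
 show "\<exists>\<delta>>0. \<forall>t\<in>S. \<forall>x y. norm (x - y) < \<delta> --> \<bar>g t x - g t y\<bar> <= \<epsilon>"
 proof (intro exI[of _ "min d 1"] conjI ballI allI impI)
  fix t and x y :: "real ^ 'n" assume t: "t \<in> S" and xy: "norm (x - y) < min d 1"
  obtain c where c: "c \<in> lattice" "x + c \<in> C" "y + c \<in> C" using near[of x] xy by force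
  have "dist (t, x + c) (t, y + c) < d" using xy by (simp add: dist_Pair_Pair dist_norm)
  then have "\<bar>g t (x + c) - g t (y + c)\<bar> < \<epsilon>" using d(2)[of "(t, y + c)" "(t, x + c)"] t c by (simp add: dist_real_def)
  then show "\<bar>g t x - g t y\<bar> <= \<epsilon>" using periodic_lattice[OF per[OF t] c(1)] by simp
 qed (use d in auto)
qed

lemma mol_family_uniform:
 fixes g :: "'t::metric_space => real ^ 'n => real"
 assumes S: "compact S" and g: "continuous_on (S \<times> UNIV) (%(t, x). g t x)" and per: "!!t. t \<in> S ==> periodic (g t)"
  and "\<epsilon> > 0"
 shows "\<forall>\<^sub>F j in sequentially. \<forall>t\<in>S. \<forall>x. \<bar>mol j (g t) x - g t x\<bar> <= \<epsilon>"
proof -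
 obtain B where B: "!!t x. t \<in> S ==> \<bar>g t x\<bar> <= B" using periodic_compact_bounds(1)[OF S g per] by blast
 obtain \<delta> where \<delta>: "\<delta> > 0" "!!t x y. t \<in> S ==> norm (x - y) < \<delta> ==> \<bar>g t x - g t y\<bar> <= \<epsilon> / 2"
  using periodic_compact_bounds(2)[OF S g per, of "\<epsilon> / 2"] \<open>\<epsilon> > 0\<close> by auto
 obtain c where c: "c \<longlonglongrightarrow> 0" "!!(f :: real ^ 'n => real) B \<epsilon> j x. continuous_on UNIV f ==> periodic f ==> (!!x. \<bar>f x\<bar> <= B) ==>
  (!!x y. norm (x - y) < \<delta> ==> \<bar>f x - f y\<bar> <= \<epsilon>) ==> \<bar>mol j f x - f x\<bar> <= \<epsilon> + B * c j"
  using mol_uniform[OF \<delta>(1), where 'n='n] by metis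
 have "(%j. B * c j) \<longlonglongrightarrow> 0" by (rule tendsto_mult_right_zero[OF c(1)])
 then have "\<forall>\<^sub>F j in sequentially. B * c j < \<epsilon> / 2" using \<open>\<epsilon> > 0\<close> by (intro order_tendstoD) auto
 then show ?thesis
 proof (rule eventually_mono, intro ballI allI)
  fix j t x assume j: "B * c j < \<epsilon> / 2" and t: "t \<in> S"
  have "continuous_on UNIV (g t)"
   using continuous_on_compose2[OF g continuous_on_Pair[OF continuous_on_const[of _ t] continuous_on_id[of UNIV]]] t by (simp add: image_subset_iff)
  then have "\<bar>mol j (g t) x - g t x\<bar> <= \<epsilon> / 2 + B * c j" by (intro c(2) per t B \<delta>(2))
  with j show "\<bar>mol j (g t) x - g t x\<bar> <= \<epsilon>" by simp
 qed
qed

lemma continuous_on_snd_compose: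
 fixes f :: "real ^ 'n => real"
 assumes "continuous_on UNIV f"
 shows "continuous_on (S \<times> UNIV) (%(t, x). f x)"
 unfolding split_beta by (rule continuous_on_compose2[OF assms continuous_on_snd[OF continuous_on_id]]) auto

lemma mol_uniform_single:
 fixes f :: "real ^ 'n => real"
 assumes "continuous_on UNIV f" "periodic f" "\<epsilon> > 0"
 shows "\<forall>\<^sub>F j in sequentially. \<forall>x. \<bar>mol j f x - f x\<bar> <= \<epsilon>"
 using mol_family_uniform[of "{0::real}" "%_. f" \<epsilon>, OF _ continuous_on_snd_compose[OF assms(1)] assms(2,3)] by simp

lemma continuous_mol:
 assumes "continuous_on UNIV f"
 shows "continuous_on UNIV (mol j f)" 
proof -
 obtain F \<mu> where ex: "!!x. complex_of_real (mol j f x) = (\<Sum>k\<in>F. of_real (\<mu> k) * fourier_coeff (%y. of_real (f y)) k * character k x)"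
  using mol_expansion[of j] assms by blast
 then have "mol j f = (%x. Re (\<Sum>k\<in>F. of_real (\<mu> k) * fourier_coeff (%y. of_real (f y)) k * character k x))"
  by (simp only: ex[symmetric] Re_complex_of_real)
 moreover have "continuous_on UNIV (%x. Re (\<Sum>k\<in>F. of_real (\<mu> k) * fourier_coeff (%y. of_real (f y)) k * character k x))"
  by (intro continuous_intros continuous_character)
 ultimately show ?thesis by simp
qed

lemma of_real_L2: "continuous_on UNIV f ==> periodic f ==> (%x. complex_of_real (f x)) \<in> L2_torus"
 using periodic_comp[of f complex_of_real] by (intro continuous_L2 continuous_on_of_real)

lemma norm_pairing_le:
 assumes u: "u \<in> L2_torus" and f: "continuous_on UNIV f" and B: "!!x. \<bar>f x\<bar> <= B"
 shows "set_integrable lebesgue cell (%x. u x * of_real (f x))"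
  "cmod (pairing u f) <= B * cell_integral (%x. cmod (u x))"
proof -
 have iu: "set_integrable lebesgue cell (%x. B * cmod (u x))"
  by (intro set_integrable_mult_right set_integrable_norm L2_integrable u)
 have le: "norm (u x * of_real (f x)) <= B * cmod (u x)" for x
  using mult_right_mono[OF B[of x], of "cmod (u x)"] by (simp add: norm_mult mult.commute)
 show int: "set_integrable lebesgue cell (%x. u x * of_real (f x))"
 proof (rule set_integrable_bound[OF iu])
  have "(%x. complex_of_real (f x)) \<in> borel_measurable lebesgue"
   using borel_measurable_continuous_onI[OF continuous_on_of_real[OF f]] by (intro measurable_completion) simp
  then show "set_borel_measurable lebesgue cell (%x. u x * of_real (f x))"
   by (intro set_borel_measurable_L2 borel_measurable_times L2_torusD(2)[OF u])
  show "AE x in lebesgue. x \<in> cell --> norm (u x * of_real (f x)) <= norm (B * cmod (u x))"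
  proof (intro AE_I2 impI)
   fix x show "norm (u x * of_real (f x)) <= norm (B * cmod (u x))" using le[of x] by simp
  qed
 qed
 have "cmod (pairing u f) <= cell_integral (%x. norm (u x * of_real (f x)))"
  unfolding pairing_def by (rule set_integral_norm_bound[OF int])
 also have "... <= cell_integral (%x. B * cmod (u x))" by (intro set_integral_mono set_integrable_norm int iu le)
 finally show "cmod (pairing u f) <= B * cell_integral (%x. cmod (u x))" by simp
qed

lemma pairing_diff:
 assumes "set_integrable lebesgue cell (%x. u x * complex_of_real (f x))" "set_integrable lebesgue cell (%x. u x * complex_of_real (g x))"
 shows "pairing u (%x. f x - g x) = pairing u f - pairing u g"
 unfolding pairing_def using set_integral_diff(2)[OF assms] by (simp add: right_diff_distrib)

lemma continuous_periodic_bounded: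
 fixes f :: "real ^ 'n => real"
 assumes "continuous_on UNIV f" "periodic f"
 shows "\<exists>B. \<forall>x. \<bar>f x\<bar> <= B"
 using periodic_compact_bounds(1)[of "{0::real}" "%_. f", OF _ continuous_on_snd_compose[OF assms(1)] assms(2)] by simp

lemma pairing_mol_tendsto:
 assumes u: "u \<in> L2_torus" and f: "continuous_on UNIV f" "periodic f"
 shows "(%j. pairing u (mol j f)) \<longlonglongrightarrow> pairing u f"
proof (rule LIMSEQ_I)
 fix r :: real assume r: "r > 0"
 define I where "I = cell_integral (%x. cmod (u x))"
 have I: "I >= 0" unfolding I_def set_lebesgue_integral_def by (intro integral_nonneg_AE) auto
 obtain B where B: "!!x. \<bar>f x\<bar> <= B" using continuous_periodic_bounded[OF f] by blast
 define e where "e = r / (2 * (I + 1))"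
 have e: "e > 0" "e * I < r"
 proof -
  show "e > 0" using r I by (simp add: e_def)
  have "e * I <= e * (I + 1)" using \<open>e > 0\<close> by simp
  also have "... = r / 2" using I by (simp add: e_def divide_simps)
  finally show "e * I < r" using r by simp
 qed
 obtain J where J: "!!j x. j >= J ==> \<bar>mol j f x - f x\<bar> <= e"
  using mol_uniform_single[OF f e(1)] unfolding eventually_sequentially by blast
 have "norm (pairing u (mol j f) - pairing u f) < r" if "j >= J" for j
 proof -
  have c: "continuous_on UNIV (%x. mol j f x - f x)" by (intro continuous_intros continuous_mol f)
  have "\<bar>mol j f x\<bar> <= B + e" for x using J[OF that, of x] B[of x] by linarith
  then have "pairing u (%x. mol j f x - f x) = pairing u (mol j f) - pairing u f"
   by (intro pairing_diff norm_pairing_le(1)[OF u f(1) B] norm_pairing_le(1)[OF u continuous_mol[OF f(1)]])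
  moreover have "cmod (pairing u (%x. mol j f x - f x)) <= e * I"
   unfolding I_def by (rule norm_pairing_le(2)[OF u c J[OF that]])
  ultimately show ?thesis using e(2) by simp
 qed
 then show "\<exists>J. \<forall>j\<ge>J. norm (pairing u (mol j f) - pairing u f) < r" by blast
qed

text \<open>\<open>pairing\<close> involves no complex conjugate, so the frequency \<open>k\<close>
  of \<open>f\<close> meets the frequency \<open>- k\<close> of \<open>u\<close>.\<close>

lemma pairing_mol:
 fixes u :: "real ^ 'n => complex"
 shows "\<exists>F \<mu>. finite F & (\<forall>k. 0 <= (\<mu> k :: real) & \<mu> k <= 1) &
  (\<forall>u f. u \<in> L2_torus --> continuous_on UNIV f -->
   pairing u (mol j f) = (\<Sum>k\<in>F. of_real (\<mu> k) * (torus_vol TYPE('n) * fourier_coeff u (- k)) * fourier_coeff (%y :: real ^ 'n. of_real (f y)) k))"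
proof -
 obtain F \<mu> where F: "finite F" "!!k. 0 <= (\<mu> k :: real) & \<mu> k <= 1"
  "!!f x. continuous_on UNIV f ==> complex_of_real (mol j f x) =
    (\<Sum>k\<in>F. of_real (\<mu> k) * fourier_coeff (%y. of_real (f y)) k * character k (x :: real ^ 'n))"
  using mol_expansion[of j, where 'n='n] by blast
 have "pairing u (mol j f) = (\<Sum>k\<in>F. of_real (\<mu> k) * (torus_vol TYPE('n) * fourier_coeff u (- k)) * fourier_coeff (%y. of_real (f y)) k)"
  if u: "u \<in> L2_torus" and f: "continuous_on UNIV f" for u and f :: "real ^ 'n => real"
 proof -
  have "pairing u (mol j f) = cell_integral (%x. \<Sum>k\<in>F. (of_real (\<mu> k) * fourier_coeff (%y. of_real (f y)) k) * (u x * character (- (- k)) x))"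
   unfolding pairing_def F(3)[OF f] by (simp add: sum_distrib_left mult_ac)
  also have "... = (\<Sum>k\<in>F. cell_integral (%x. (of_real (\<mu> k) * fourier_coeff (%y. of_real (f y)) k) * (u x * character (- (- k)) x)))"
   by (rule cell_integral_sum[THEN conjunct2]) (intro set_integrable_mult_right L2_mult_integrable u character_L2)
  also have "... = (\<Sum>k\<in>F. of_real (\<mu> k) * (torus_vol TYPE('n) * fourier_coeff u (- k)) * fourier_coeff (%y. of_real (f y)) k)"
   unfolding set_integral_mult_right fourier_coeff_character_integral(1) by (simp add: mult_ac)
  finally show ?thesis .
 qed
 with F show ?thesis by blast
qed

section \<open>Sobolev duality\<close>

definition bessel_weight :: "real => int ^ 'n => real" where
 "bessel_weight \<sigma> k = (1 + (norm (frequency k))\<^sup>2) powr (\<sigma> / 2)"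

lemma bessel_weight_pos: "bessel_weight \<sigma> k > 0"
proof -
 have "1 + (norm (frequency k))\<^sup>2 > 0" by (intro add_pos_nonneg) auto
 then show ?thesis by (simp add: bessel_weight_def)
qed

text \<open>Cauchy-Schwarz in frequency space. \<open>B\<close> controls the norm of
  \<open>f\<close> of order \<open>- \<sigma>\<close> through finite partial sums, and mollification
  turns the pairing into a finite sum, so that Bessel's inequality suffices in place of Parseval's
  identity.\<close>

lemma sobolev_duality:
 fixes u :: "real ^ 'n => complex"
 assumes u: "u \<in> L2_torus" and g: "is_bessel \<sigma> u g" and f: "continuous_on UNIV f" "periodic f" and B: "0 <= B"
  and le: "!!F. finite F ==> (\<Sum>k\<in>F. (cmod (fourier_coeff (%y. of_real (f y)) k) / bessel_weight \<sigma> k)\<^sup>2) <= B\<^sup>2"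
 shows "cmod (pairing u f) <= sqrt (torus_vol TYPE('n)) * L2_norm_torus g * B"
proof -
 define CC where "CC = torus_vol TYPE('n)"
 have CC: "CC > 0" by (simp add: CC_def torus_vol_pos)
 have gL: "g \<in> L2_torus" using g by (simp add: is_bessel_def)
 have gu: "fourier_coeff g k = of_real (bessel_weight \<sigma> k) * fourier_coeff u k" for k
  using g by (simp add: is_bessel_def bessel_weight_def)
 have w: "bessel_weight \<sigma> (- k) = bessel_weight \<sigma> k" for k :: "int ^ 'n"
  by (simp add: bessel_weight_def frequency_minus)
 have "cmod (pairing u (mol j f)) <= sqrt CC * L2_norm_torus g * B" for j
 proof -
  obtain F \<mu> where F: "finite F" "!!k. 0 <= (\<mu> k :: real) & \<mu> k <= 1"
   "pairing u (mol j f) = (\<Sum>k\<in>F. of_real (\<mu> k) * (CC * fourier_coeff u (- k)) * fourier_coeff (%y. of_real (f y)) k)"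
   using pairing_mol[of j, where 'n='n] u f unfolding CC_def by blast
  define a where "a k = cmod (fourier_coeff g (- k))" for k
  define b where "b k = cmod (fourier_coeff (%y. of_real (f y)) k) / bessel_weight \<sigma> k" for k
  have "cmod (pairing u (mol j f)) <= (\<Sum>k\<in>F. cmod (of_real (\<mu> k) * (CC * fourier_coeff u (- k)) * fourier_coeff (%y. of_real (f y)) k))"
   unfolding F(3) by (rule norm_sum)
  also have "... <= (\<Sum>k\<in>F. CC * (a k * b k))"
  proof (rule sum_mono)
   fix k
   have "cmod (fourier_coeff u (- k)) * bessel_weight \<sigma> k = a k"
    using bessel_weight_pos[of \<sigma> k] by (simp add: a_def gu w norm_mult mult.commute)
   then have "CC * (a k * b k) = CC * (cmod (fourier_coeff u (- k)) * cmod (fourier_coeff (%y. of_real (f y)) k))"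
    using bessel_weight_pos[of \<sigma> k] by (simp add: b_def field_simps)
   moreover have "\<mu> k * (CC * (cmod (fourier_coeff u (- k)) * cmod (fourier_coeff (%y. of_real (f y)) k)))
    <= 1 * (CC * (cmod (fourier_coeff u (- k)) * cmod (fourier_coeff (%y. of_real (f y)) k)))"
    using F(2)[of k] CC by (intro mult_right_mono) auto
   ultimately show "cmod (of_real (\<mu> k) * (CC * fourier_coeff u (- k)) * fourier_coeff (%y. of_real (f y)) k) <= CC * (a k * b k)"
    using F(2)[of k] CC by (simp add: norm_mult mult.assoc)
  qed
  also have "... = CC * (\<Sum>k\<in>F. a k * b k)" by (simp add: sum_distrib_left)
  also have "(\<Sum>k\<in>F. a k * b k) <= L2_set a F * L2_set b F"
   using L2_set_mult_ineq[of a b F] by (simp add: a_def b_def bessel_weight_pos less_imp_le)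
  also have "L2_set b F <= B" unfolding L2_set_def using le[OF F(1)] B by (intro real_le_lsqrt) (auto simp: b_def)
  also have "L2_set a F <= L2_norm_torus g / sqrt CC"
  proof -
   have "(\<Sum>k\<in>F. (a k)\<^sup>2) = (\<Sum>k\<in>uminus ` F. (cmod (fourier_coeff g k))\<^sup>2)"
    by (subst sum.reindex) (auto simp: a_def inj_on_def)
   also have "CC * ... <= (L2_norm_torus g)\<^sup>2"
    unfolding CC_def by (rule bessel_inequality[OF gL]) (use F(1) in simp)
   finally have "(\<Sum>k\<in>F. (a k)\<^sup>2) <= (L2_norm_torus g / sqrt CC)\<^sup>2"
    using CC by (simp add: power_divide pos_le_divide_eq mult.commute)
   then show ?thesis unfolding L2_set_def using CC by (intro real_le_lsqrt) auto
  qed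
  finally have "cmod (pairing u (mol j f)) <= CC * (L2_norm_torus g / sqrt CC * B)"
   using CC B by (simp add: mult_left_mono mult_right_mono L2_set_nonneg)
  also have "CC * (L2_norm_torus g / sqrt CC * B) = (CC / sqrt CC) * L2_norm_torus g * B" by simp
  also have "CC / sqrt CC = sqrt CC" using CC by (simp add: real_div_sqrt)
  finally show ?thesis .
 qed
 then show ?thesis unfolding CC_def[symmetric]
  by (intro tendsto_le[OF sequentially_bot tendsto_const tendsto_norm[OF pairing_mol_tendsto[OF u f]]] always_eventually) auto
qed

lemma fourier_coeff_le_L1:
 fixes f :: "real ^ 'n => real"
 assumes "continuous_on UNIV f"
 shows "torus_vol TYPE('n) * cmod (fourier_coeff (%y. of_real (f y)) k) <= integral cell (%x. \<bar>f x\<bar>)"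
proof -
 have c: "continuous_on UNIV (%x. complex_of_real (f x) * character (- k) x)"
  by (intro continuous_on_mult continuous_on_of_real assms continuous_character)
 have "torus_vol TYPE('n) * cmod (fourier_coeff (%y. of_real (f y)) k) = cmod (cell_integral (%x. of_real (f x) * character (- k) x))"
  using torus_vol_pos[where 'n='n] by (simp add: fourier_coeff_character_integral(1) norm_mult)
 also have "... <= cell_integral (%x. cmod (of_real (f x) * character (- k) x))"
  by (intro set_integral_norm_bound integrable_cell(1) c)
 also have "... = integral cell (%x. \<bar>f x\<bar>)"
  using integrable_cell(3)[of "%x. \<bar>f x\<bar>"] assms by (simp add: norm_mult continuous_on_rabs)
 finally show ?thesis .
qed

lemma L2_norm_of_real:
 fixes f :: "real ^ 'n => real"
 assumes "continuous_on UNIV f"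
 shows "(L2_norm_torus (%x. complex_of_real (f x)))\<^sup>2 = integral cell (%x. (f x)\<^sup>2)"
 unfolding L2_norm_square using integrable_cell(3)[of "%x. (f x)\<^sup>2"] assms by (simp add: continuous_on_power)

lemma sobolev_duality_L2:
 fixes u :: "real ^ 'n => complex"
 assumes u: "u \<in> L2_torus" and g: "is_bessel \<sigma> u g" and f: "continuous_on UNIV f" "periodic f" and "\<sigma> >= 0"
 shows "cmod (pairing u f) <= L2_norm_torus g * sqrt (integral cell (%x. (f x)\<^sup>2))"
proof -
 define CC where "CC = torus_vol TYPE('n)"
 have CC: "CC > 0" by (simp add: CC_def torus_vol_pos)
 define N where "N = L2_norm_torus (%x. complex_of_real (f x))"
 have N: "N >= 0" by (simp add: N_def)
 have "cmod (pairing u f) <= sqrt CC * L2_norm_torus g * (N / sqrt CC)" unfolding CC_def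
 proof (rule sobolev_duality[OF u g f])
  fix F :: "(int ^ 'n) set" assume F: "finite F"
  have "(\<Sum>k\<in>F. (cmod (fourier_coeff (%y. of_real (f y)) k) / bessel_weight \<sigma> k)\<^sup>2) <= (\<Sum>k\<in>F. (cmod (fourier_coeff (%y. of_real (f y)) k))\<^sup>2)"
  proof (intro sum_mono power_mono)
   fix k :: "int ^ 'n"
   have "1 <= bessel_weight \<sigma> k" unfolding bessel_weight_def using \<open>\<sigma> >= 0\<close> by (intro ge_one_powr_ge_zero) auto
   then show "cmod (fourier_coeff (%y. of_real (f y)) k) / bessel_weight \<sigma> k <= cmod (fourier_coeff (%y. of_real (f y)) k)"
    using frac_le[of "cmod (fourier_coeff (%y. of_real (f y)) k)" "cmod (fourier_coeff (%y. of_real (f y)) k)" 1 "bessel_weight \<sigma> k"] by simp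
  qed (auto simp: bessel_weight_pos less_imp_le)
  also have "... <= (N / sqrt CC)\<^sup>2"
   using bessel_inequality[OF of_real_L2[OF f] F] CC by (simp add: N_def CC_def power_divide pos_le_divide_eq mult.commute)
  finally show "(\<Sum>k\<in>F. (cmod (fourier_coeff (%y. of_real (f y)) k) / bessel_weight \<sigma> k)\<^sup>2) <= (N / sqrt (torus_vol TYPE('n)))\<^sup>2"
   by (simp add: CC_def)
 qed (use N CC in \<open>auto simp: CC_def\<close>)
 also have "... = L2_norm_torus g * N" using CC by simp
 also have "N = sqrt (integral cell (%x. (f x)\<^sup>2))" using L2_norm_of_real[OF f(1)] N by (simp add: N_def real_sqrt_unique)
 finally show ?thesis .
qed

section \<open>Uniqueness for Fourier coefficients and well-defined Sobolev norms\<close>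

lemma closed_lattice: "closed (lattice :: (real ^ 'n) set)"
proof (rule discrete_imp_closed[of 1])
 show "\<forall>x\<in>lattice. \<forall>y\<in>lattice. dist y x < 1 --> y = (x :: real ^ 'n)"
 proof (intro ballI impI)
  fix x y :: "real ^ 'n" assume xy: "x \<in> lattice" "y \<in> lattice" "dist y x < 1"
  have "y - x \<in> lattice" using xy lattice_diff by blast
  moreover have "norm (y - x) < 1" using xy(3) by (simp add: dist_norm)
  ultimately have "y - x = 0" using lattice_small by blast
  then show "y = x" by simp
 qed
qed simp

lemma pairing_eq_0:
 fixes g :: "real ^ 'n => complex"
 assumes g: "g \<in> L2_torus" "!!k. fourier_coeff g k = 0" and f: "continuous_on UNIV f" "periodic f"
 shows "pairing g f = 0"
proof -
 have "pairing g (mol j f) = 0" for j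
 proof -
  obtain F \<mu> where "pairing g (mol j f) = (\<Sum>k\<in>F. of_real (\<mu> k) * (torus_vol TYPE('n) * fourier_coeff g (- k)) * fourier_coeff (%y :: real ^ 'n. of_real (f y)) k)"
   using pairing_mol[of j, where 'n='n] g(1) f(1) by blast
  then show ?thesis by (simp add: g(2))
 qed
 then have "(%j. 0) \<longlonglongrightarrow> pairing g f" using pairing_mol_tendsto[OF g(1) f] by simp
 then show ?thesis using LIMSEQ_unique tendsto_const by blast
qed

definition periodization :: "(real ^ 'n) set => (real ^ 'n) set" where
 "periodization K = (\<Union>x\<in>K. \<Union>y\<in>lattice. {x + y})"

lemma closed_periodization: "compact K ==> closed (periodization K)"
 unfolding periodization_def by (rule compact_closed_sums[OF _ closed_lattice])

lemma periodization_translate: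
 assumes c: "c \<in> lattice"
 shows "(%y. y + c) ` periodization K = periodization K"
proof
 show "(%y. y + c) ` periodization K \<subseteq> periodization K"
 proof
  fix z assume "z \<in> (%y. y + c) ` periodization K"
  then obtain x y where xy: "x \<in> K" "y \<in> lattice" "z = x + y + c" by (auto simp: periodization_def)
  then have "y + c \<in> lattice" "z = x + (y + c)" using c lattice_add by (auto simp: add.assoc)
  then show "z \<in> periodization K" using xy(1) by (auto simp: periodization_def)
 qed
 show "periodization K \<subseteq> (%y. y + c) ` periodization K"
 proof
  fix z assume "z \<in> periodization K"
  then obtain x y where xy: "x \<in> K" "y \<in> lattice" "z = x + y" by (auto simp: periodization_def)
  then have "y - c \<in> lattice" using c lattice_diff by blast
  then have "x + (y - c) \<in> periodization K" using xy(1) by (auto simp: periodization_def)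
  then show "z \<in> (%y. y + c) ` periodization K" using xy(3) by (auto intro: image_eqI[of _ _ "x + (y - c)"])
 qed
qed

lemma infdist_periodization:
 assumes "c \<in> lattice"
 shows "infdist (x + c) (periodization K) = infdist x (periodization K)"
proof -
 have "infdist (x + c) ((%y. y + c) ` periodization K) = infdist x (periodization K)"
  by (simp add: infdist_def image_image)
 then show ?thesis by (simp add: periodization_translate[OF assms])
qed

lemma axis_lattice: "axis i (2 * pi) \<in> lattice"
proof -
 have "axis i (2 * pi) $ j = 2 * pi * real_of_int (if j = i then 1 else 0)" for j by (simp add: axis_def)
 then show ?thesis unfolding lattice_def by blast
qed

text \<open>Cutoffs made from the distance to the periodized set are continuous and periodic, so
  their pairing with \<open>g\<close> is 0. They tend to the indicator of the set and are dominated
  by 1.\<close>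

lemma pairing_periodization_eq_0:
 fixes g :: "real ^ 'n => complex"
 assumes g: "g \<in> L2_torus" "!!k. fourier_coeff g k = 0" and K: "compact K" "K ~= {}"
 shows "integrable lebesgue (%x. indicator (cell \<inter> periodization K) x *\<^sub>R g x)"
  "integral\<^sup>L lebesgue (%x. indicator (cell \<inter> periodization K) x *\<^sub>R g x) = 0"
proof -
 define D where "D = periodization K"
 have D: "closed D" "D ~= {}"
 proof -
  show "closed D" unfolding D_def by (rule closed_periodization[OF K(1)])
  obtain k where "k \<in> K" using K(2) by blast
  then have "k + 0 \<in> D" using lattice_0 unfolding D_def periodization_def by blast
  then show "D ~= {}" by blast
 qed
 define f where "f m x = max 0 (1 - real m * infdist x D)" for m x
 have f: "continuous_on UNIV (f m)" "periodic (f m)" "0 <= f m x" "f m x <= 1" for m x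
 proof -
  show "continuous_on UNIV (f m)" unfolding f_def by (intro continuous_intros continuous_on_infdist)
  show "periodic (f m)" unfolding f_def periodic_def D_def by (simp add: infdist_periodization axis_lattice)
  show "0 <= f m x" by (simp add: f_def)
  have "0 <= real m * infdist x D" by (simp add: infdist_nonneg)
  then show "f m x <= 1" unfolding f_def by linarith
 qed
 have lim: "(%m. f m x) \<longlonglongrightarrow> indicator D x" for x
 proof (cases "x \<in> D")
  case True
  then have "f m x = 1" for m by (simp add: f_def)
  then show ?thesis using True by simp
 next
  case False
  then have pos: "infdist x D > 0" using in_closed_iff_infdist_zero[OF D, of x] infdist_nonneg[of x D] by simp
  obtain m0 where m0: "1 < real m0 * infdist x D" using reals_Archimedean3[OF pos] by blast
  have "f m x = 0" if "m >= m0" for m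
  proof -
   have "real m0 * infdist x D <= real m * infdist x D" using that pos by (intro mult_right_mono) auto
   then show ?thesis using m0 by (simp add: f_def)
  qed
  then have "\<forall>\<^sub>F m in sequentially. f m x = 0" by (auto simp: eventually_sequentially)
  then show ?thesis using False by (simp add: tendsto_eventually)
 qed
 have mg: "g \<in> borel_measurable lebesgue" using g(1) by (rule L2_torusD)
 have mD: "cell \<inter> D \<in> sets lebesgue" using D(1) by (simp add: compact_Int_closed compact_cell fmeasurableD lmeasurable_compact)
 have ig: "integrable lebesgue (%x. indicator cell x *\<^sub>R g x)"
  using L2_integrable[OF g(1)] by (simp add: set_integrable_def)
 let ?s = "%m x. indicator cell x *\<^sub>R (g x * of_real (f m x))"
 let ?l = "%x. indicator (cell \<inter> D) x *\<^sub>R g x"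
 have ms: "?s m \<in> borel_measurable lebesgue" for m
 proof -
  have "(%x. complex_of_real (f m x)) \<in> borel_measurable lebesgue"
   using borel_measurable_continuous_onI[OF continuous_on_of_real[OF f(1)[of m]]] by (intro measurable_completion) simp
  then show ?thesis by (intro borel_measurable_scaleR borel_measurable_indicator cell_sets borel_measurable_times mg)
 qed
 have ml: "?l \<in> borel_measurable lebesgue" by (intro borel_measurable_scaleR borel_measurable_indicator mD mg)
 have wi: "integrable lebesgue (%x. norm (indicator cell x *\<^sub>R g x))" by (rule integrable_norm[OF ig])
 have b: "norm (?s m x) <= norm (indicator cell x *\<^sub>R g x)" for m x
 proof -
  have "norm (g x) * f m x <= norm (g x) * 1" using f(4) by (intro mult_left_mono) auto
  then show ?thesis using f(3)[of m x] by (simp add: norm_mult indicator_def)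
 qed
 have pl: "(%m. ?s m x) \<longlonglongrightarrow> ?l x" for x
 proof -
  have "(%m. ?s m x) \<longlonglongrightarrow> indicator cell x *\<^sub>R (g x * of_real (indicator D x))"
   by (intro tendsto_intros lim)
  moreover have "indicator cell x *\<^sub>R (g x * of_real (indicator D x)) = ?l x" by (auto simp: indicator_def)
  ultimately show ?thesis by simp
 qed
 have pl': "AE x in lebesgue. (%m. ?s m x) \<longlonglongrightarrow> ?l x" by (rule AE_I2) (rule pl)
 have b': "AE x in lebesgue. norm (?s m x) <= norm (indicator cell x *\<^sub>R g x)" for m by (rule AE_I2) (rule b)
 note dc = ml ms wi pl' b'
 show "integrable lebesgue (%x. indicator (cell \<inter> periodization K) x *\<^sub>R g x)"
  unfolding D_def[symmetric] by (rule integrable_dominated_convergence[OF dc])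
 have "(%m. integral\<^sup>L lebesgue (?s m)) \<longlonglongrightarrow> integral\<^sup>L lebesgue ?l"
  by (rule integral_dominated_convergence[OF dc])
 moreover have "integral\<^sup>L lebesgue (?s m) = 0" for m
  using pairing_eq_0[OF g f(1,2)] by (simp add: pairing_def set_lebesgue_integral_def)
 ultimately have "(%m. 0) \<longlonglongrightarrow> integral\<^sup>L lebesgue ?l" by simp
 then show "integral\<^sup>L lebesgue (%x. indicator (cell \<inter> periodization K) x *\<^sub>R g x) = 0"
  unfolding D_def[symmetric] using LIMSEQ_unique tendsto_const by blast
qed

text \<open>By inner regularity a compact \<open>K\<close> exhausts the set up to small measure. On
  the periodization of \<open>K\<close> the real part of \<open>g\<close> is still positive, but its
  integral over the cell vanishes; hence \<open>K\<close> is a null set.\<close>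

lemma positive_part_negligible:
 fixes g :: "real ^ 'n => complex"
 assumes g: "g \<in> L2_torus" "!!k. fourier_coeff g k = 0"
 shows "negligible {x \<in> cell. 0 < Re (g x)}"
proof -
 define A where "A = {x \<in> cell. 0 < Re (g x)}"
 have mg: "g \<in> borel_measurable lebesgue" using g(1) by (rule L2_torusD)
 have "{x \<in> space lebesgue. 0 < Re (g x)} \<in> sets lebesgue"
  by (intro borel_measurable_less borel_measurable_const measurable_compose[OF mg borel_measurable_Re])
 then have A: "A \<in> sets lebesgue"
  using sets.Int[OF cell_sets, of "{x \<in> space lebesgue. 0 < Re (g x)}"] by (simp add: A_def Int_def)
 have "\<exists>T. A \<subseteq> T & T \<in> lmeasurable & measure lebesgue T <= e" if e: "e > 0" for e
 proof -
  obtain K where K: "closed K" "K \<subseteq> A" "A - K \<in> lmeasurable" "emeasure lebesgue (A - K) < ennreal e"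
   using sets_lebesgue_inner_closed[OF A e] by blast
  have Kc: "compact K"
  proof -
   have "K \<subseteq> cell" using K(2) by (auto simp: A_def)
   then have "cell \<inter> K = K" by blast
   then show ?thesis using compact_Int_closed[OF compact_cell K(1)] by simp
  qed
  have neg: "negligible K"
  proof (cases "K = {}")
   case False
   let ?S = "cell \<inter> periodization K"
   have mS: "?S \<in> sets lebesgue" using closed_periodization[OF Kc] by (simp add: compact_Int_closed compact_cell fmeasurableD lmeasurable_compact)
   note i = pairing_periodization_eq_0[OF g Kc False]
   have pos: "0 < Re (g x)" if x: "x \<in> ?S" for x
   proof -
    obtain k c where k: "k \<in> K" "c \<in> lattice" "x = k + c" using x by (auto simp: periodization_def)
    then have "g x = g k" using periodic_lattice[OF L2_torusD(1)[OF g(1)], of c k] by simp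
    then show ?thesis using k(1) K(2) by (auto simp: A_def)
   qed
   let ?h = "%x. Re (indicator ?S x *\<^sub>R g x)"
   have ih: "integrable lebesgue ?h" by (rule integrable_Re[OF i(1)])
   have i0: "integral\<^sup>L lebesgue ?h = 0" using integral_Re[OF i(1)] i(2) by simp
   have h0: "0 <= ?h x" for x using pos[of x] by (simp add: indicator_scaleR_eq_if less_imp_le)
   have "AE x in lebesgue. ?h x = 0" using integral_nonneg_eq_0_iff_AE[OF ih] h0 i0 by simp
   then have "AE x in lebesgue. x \<notin> ?S"
    by eventually_elim (use pos in \<open>force simp: indicator_def split: if_splits\<close>)
   then have "?S \<in> null_sets lebesgue" using AE_iff_null_sets[OF mS] by blast
   then have "negligible ?S" by (simp add: negligible_iff_null_sets)
   moreover have "K \<subseteq> ?S"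
   proof
    fix x assume x: "x \<in> K"
    then have "x + 0 \<in> periodization K" using lattice_0 unfolding periodization_def by blast
    then show "x \<in> ?S" using x K(2) by (auto simp: A_def)
   qed
   ultimately show ?thesis by (rule negligible_subset)
  qed simp
  have nK: "K \<in> lmeasurable" "measure lebesgue K = 0"
   using neg by (auto simp: negligible_imp_measurable negligible_imp_measure0)
  have "measure lebesgue (A - K) <= e" using K(4) e by (simp add: emeasure_eq_measure2[OF K(3)] ennreal_less_iff)
  then have "measure lebesgue (K \<union> (A - K)) <= e"
   using measure_Un_le[of K lebesgue "A - K"] nK K(3) by (auto simp: fmeasurableD)
  moreover have "K \<union> (A - K) \<in> lmeasurable" by (intro fmeasurable.Un nK K)
  ultimately show ?thesis by (intro exI[of _ "K \<union> (A - K)"]) auto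
 qed
 then show ?thesis unfolding A_def[symmetric] by (simp add: negligible_outer_le)
qed

text \<open>Multiplying \<open>g\<close> by 1, -1, i and -i covers all signs of its real and
  imaginary parts. The result makes \<open>sobolev_norm\<close> independent of the representative
  that it chooses.\<close>

lemma L2_norm_eq_0:
 fixes g :: "real ^ 'n => complex"
 assumes g: "g \<in> L2_torus" "!!k. fourier_coeff g k = 0"
 shows "L2_norm_torus g = 0"
proof -
 have n: "negligible {x \<in> cell. 0 < Re (a * g x)}" for a
  by (intro positive_part_negligible L2_scale g) (simp add: fourier_coeff_scale g(2))
 define N where "N = {x \<in> cell. 0 < Re (1 * g x)} \<union> {x \<in> cell. 0 < Re (- 1 * g x)} \<union> {x \<in> cell. 0 < Re (\<i> * g x)} \<union> {x \<in> cell. 0 < Re (- \<i> * g x)}"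
 have "negligible N" unfolding N_def by (intro negligible_Un n)
 then have N: "N \<in> null_sets lebesgue" by (simp add: negligible_iff_null_sets)
 have z: "g x = 0" if "x \<in> cell" "x \<notin> N" for x
 proof -
  have "\<not> 0 < Re (1 * g x)" "\<not> 0 < Re (- 1 * g x)" "\<not> 0 < Re (\<i> * g x)" "\<not> 0 < Re (- \<i> * g x)"
   using that unfolding N_def by blast+
  then have "Re (g x) = 0" "Im (g x) = 0" by auto
  then show ?thesis by (simp add: complex_eq_iff)
 qed
 have "AE x in lebesgue. indicator cell x *\<^sub>R (cmod (g x))\<^sup>2 = (0::real)"
  by (rule AE_I'[OF N]) (use z in \<open>auto simp: indicator_def\<close>)
 then have "cell_integral (%x. (cmod (g x))\<^sup>2) = 0"
  unfolding set_lebesgue_integral_def by (rule integral_eq_zero_AE)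
 then show ?thesis by (simp add: L2_norm_torus_def)
qed

lemma is_bessel_diff:
 assumes "is_bessel \<sigma> u g" "is_bessel \<sigma> v h" "u \<in> L2_torus" "v \<in> L2_torus"
 shows "is_bessel \<sigma> (%x. u x - v x) (%x. g x - h x)"
 using assms by (auto simp: is_bessel_def L2_diff fourier_coeff_diff algebra_simps)

lemma L2_norm_le_diff:
 assumes "u \<in> L2_torus" "v \<in> L2_torus"
 shows "L2_norm_torus u <= L2_norm_torus (%x. u x - v x) + L2_norm_torus v"
 using L2_norm_triangle[OF L2_diff[OF assms] assms(2)] by simp

lemma is_bessel_norm_le:
 assumes g: "is_bessel \<sigma> u g" and h: "is_bessel \<sigma> u h"
 shows "L2_norm_torus g <= L2_norm_torus h"
proof -
 have gh: "g \<in> L2_torus" "h \<in> L2_torus" using g h by (auto simp: is_bessel_def)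
 have "L2_norm_torus (%x. g x - h x) = 0"
  using g h by (intro L2_norm_eq_0 L2_diff gh) (simp add: fourier_coeff_diff gh is_bessel_def)
 then show ?thesis using L2_norm_le_diff[OF gh] by simp
qed

lemma sobolev_norm_eq: "is_bessel \<sigma> u g ==> sobolev_norm \<sigma> u = L2_norm_torus g"
 unfolding sobolev_norm_def using is_bessel_norm_le someI[of "is_bessel \<sigma> u" g] by (metis order_antisym)

lemma sobolevE:
 assumes "u \<in> sobolev \<sigma>"
 obtains g where "u \<in> L2_torus" "is_bessel \<sigma> u g" "sobolev_norm \<sigma> u = L2_norm_torus g"
 using assms sobolev_norm_eq by (auto simp: sobolev_def)

lemma sobolev_norm_nonneg: "u \<in> sobolev \<sigma> ==> 0 <= sobolev_norm \<sigma> u"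
 by (metis L2_norm_nonneg sobolevE)

lemma sobolev_norm_le_diff:
 assumes "u \<in> sobolev \<sigma>" "v \<in> sobolev \<sigma>"
 shows "sobolev_norm \<sigma> u <= sobolev_norm \<sigma> (%x. u x - v x) + sobolev_norm \<sigma> v"
  "sobolev_norm \<sigma> v <= sobolev_norm \<sigma> (%x. u x - v x) + sobolev_norm \<sigma> u"
  "(%x. u x - v x) \<in> sobolev \<sigma>"
proof -
 obtain g where g: "u \<in> L2_torus" "is_bessel \<sigma> u g" "sobolev_norm \<sigma> u = L2_norm_torus g" using sobolevE[OF assms(1)] .
 obtain h where h: "v \<in> L2_torus" "is_bessel \<sigma> v h" "sobolev_norm \<sigma> v = L2_norm_torus h" using sobolevE[OF assms(2)] .
 have d: "is_bessel \<sigma> (%x. u x - v x) (%x. g x - h x)" using is_bessel_diff g h by blast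
 have gh: "g \<in> L2_torus" "h \<in> L2_torus" using g(2) h(2) by (auto simp: is_bessel_def)
 show "sobolev_norm \<sigma> u <= sobolev_norm \<sigma> (%x. u x - v x) + sobolev_norm \<sigma> v"
  using L2_norm_le_diff[OF gh] by (simp add: sobolev_norm_eq[OF d] g h)
 have "L2_norm_torus (%x. h x - g x) = L2_norm_torus (%x. g x - h x)"
  unfolding L2_norm_torus_def by (simp add: norm_minus_commute)
 then show "sobolev_norm \<sigma> v <= sobolev_norm \<sigma> (%x. u x - v x) + sobolev_norm \<sigma> u"
  using L2_norm_le_diff[OF gh(2,1)] by (simp add: sobolev_norm_eq[OF d] g h)
 show "(%x. u x - v x) \<in> sobolev \<sigma>" using d L2_diff[OF g(1) h(1)] by (auto simp: sobolev_def)
qed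

lemma sobolev_one:
 "(%x :: real ^ 'n. 1) \<in> sobolev \<sigma>" "sobolev_norm \<sigma> (%x :: real ^ 'n. 1) = sqrt (torus_vol TYPE('n))"
proof -
 have fc: "fourier_coeff (%x :: real ^ 'n. 1) k = (if k = 0 then 1 else 0)" for k
 proof -
  have "character 0 = (%x :: real ^ 'n. 1)" by (rule ext) simp
  then show ?thesis using fourier_coeff_character[of "0 :: int ^ 'n" k] by auto
 qed
 have b: "is_bessel \<sigma> (%x :: real ^ 'n. 1) (%x. 1)" by (simp add: is_bessel_def const_L2 fc)
 show "(%x :: real ^ 'n. 1) \<in> sobolev \<sigma>" using b const_L2 by (auto simp: sobolev_def)
 have "L2_norm_torus (%x::real^'n. 1) = sqrt (torus_vol TYPE('n))" using integrable_cell(3)[of "%x::real^'n. 1::real"]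
  by (simp add: L2_norm_torus_def measure_cell torus_vol_def)
 then show "sobolev_norm \<sigma> (%x :: real ^ 'n. 1) = sqrt (torus_vol TYPE('n))" by (simp add: sobolev_norm_eq[OF b])
qed

lemma sobolev_norm_bounded:
 assumes u: "continuous_in_sobolev \<sigma> u"
 shows "\<exists>B. \<forall>s\<in>{a..b}. sobolev_norm \<sigma> (u s) <= B"
proof -
 define N where "N s = sobolev_norm \<sigma> (u s)" for s
 have mem: "u s \<in> sobolev \<sigma>" for s using u by (simp add: continuous_in_sobolev_def)
 have "isCont N t" for t
 proof -
  have "((%s. sobolev_norm \<sigma> (%x. u s x - u t x)) \<longlongrightarrow> 0) (at t)" using u by (simp add: continuous_in_sobolev_def)
  moreover have "norm (N s - N t) <= sobolev_norm \<sigma> (%x. u s x - u t x)" for s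
   using sobolev_norm_le_diff(1,2)[OF mem[of s] mem[of t]] by (simp add: N_def abs_le_iff)
  ultimately have "((%s. N s - N t) \<longlongrightarrow> 0) (at t)"
   by (intro Lim_null_comparison[of "%s. N s - N t" "%s. sobolev_norm \<sigma> (%x. u s x - u t x)"]) auto
  then show ?thesis by (simp add: isCont_def LIM_zero_iff)
 qed
 then have "continuous_on {a..b} N" by (simp add: continuous_at_imp_continuous_on)
 then have "bounded (N ` {a..b})" by (intro compact_imp_bounded compact_continuous_image) auto
 then obtain B where "!!s. s \<in> {a..b} ==> \<bar>N s\<bar> <= B" unfolding bounded_real by (meson image_eqI)
 then have "\<forall>s\<in>{a..b}. N s <= B" by (auto intro: order_trans[OF abs_ge_self])
 then show ?thesis unfolding N_def by blast
qed

lemma card_low_frequencies: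
 "finite {k :: int ^ 'n. \<forall>i. \<bar>k $ i\<bar> <= int N}" "card {k :: int ^ 'n. \<forall>i. \<bar>k $ i\<bar> <= int N} <= (2 * N + 1) ^ CARD('n)"
proof -
 let ?P = "Pi\<^sub>E (UNIV :: 'n set) (%_. {- int N..int N})"
 have sub: "{k :: int ^ 'n. \<forall>i. \<bar>k $ i\<bar> <= int N} \<subseteq> vec_lambda ` ?P"
 proof
  fix k :: "int ^ 'n" assume k: "k \<in> {k. \<forall>i. \<bar>k $ i\<bar> <= int N}"
  then have "- int N <= k $ i & k $ i <= int N" for i by (simp add: abs_le_iff minus_le_iff)
  then have "vec_nth k \<in> ?P" by (simp add: PiE_def Pi_def)
  then show "k \<in> vec_lambda ` ?P" by (intro image_eqI[of _ _ "vec_nth k"]) (simp_all add: vec_nth_inverse)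
 qed
 have fin: "finite ?P" by (intro finite_PiE) auto
 show "finite {k :: int ^ 'n. \<forall>i. \<bar>k $ i\<bar> <= int N}" by (rule finite_subset[OF sub finite_imageI[OF fin]])
 have "card {k :: int ^ 'n. \<forall>i. \<bar>k $ i\<bar> <= int N} <= card (vec_lambda ` ?P :: (int ^ 'n) set)"
  by (rule card_mono[OF finite_imageI[OF fin] sub])
 also have "... <= card ?P" by (rule card_image_le[OF fin])
 also have "... = (2 * N + 1) ^ CARD('n)"
 proof -
  have "nat (1 + int N - - int N) = 2 * N + 1" by simp
  then show ?thesis by (simp add: card_PiE)
 qed
 finally show "card {k :: int ^ 'n. \<forall>i. \<bar>k $ i\<bar> <= int N} <= (2 * N + 1) ^ CARD('n)" .
qed

text \<open>A function that is bounded in \<open>L\<^sup>2\<close> and small in \<open>L\<^sup>1\<close> is small in negative Sobolev norms: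
 the coefficients of frequency up to \<open>exp (\<gamma> / n)\<close> are few and small, the weight takes care of the others.\<close>

lemma sobolev_decay:
 fixes u :: "real ^ 'n => complex"
 assumes u: "u \<in> sobolev \<sigma>" and f: "continuous_on UNIV f" "periodic f"
  and \<sigma>: "0 <= \<sigma>" "2 * \<sigma> <= CARD('n)" and \<gamma>: "0 <= \<gamma>"
  and L1: "integral cell (%x. \<bar>f x\<bar>) <= C1 * exp (- \<gamma>)" and L2: "integral cell (%x. (f x)\<^sup>2) <= C2"
 shows "cmod (pairing u f) <= sqrt (5 ^ CARD('n) * C1\<^sup>2 / torus_vol TYPE('n) + C2) * sobolev_norm \<sigma> u * exp (- \<sigma> * \<gamma> / CARD('n))"
proof -
 define n where "n = real CARD('n)"
 have n: "n > 0" by (simp add: n_def)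
 define v where "v = torus_vol TYPE('n)"
 have v: "v > 0" by (simp add: v_def torus_vol_pos)
 \<comment> \<open>The frequency cutoff: there are about exp \<gamma> frequencies below it, each
   with a squared coefficient of order exp (-2 \<gamma>), so they contribute exp (-\<gamma>) in
   total.\<close>
 define E where "E = exp (\<gamma> / n)"
 have E: "E >= 1" using \<gamma> n by (simp add: E_def)
 define N where "N = nat \<lceil>E\<rceil>"
 have N: "E <= real N" "real N <= E + 1" using E by (auto simp: N_def)
 \<comment> \<open>The square of the decay factor to be proved.\<close>
 define \<theta> where "\<theta> = exp (- 2 * \<sigma> * \<gamma> / n)"
 have \<theta>: "\<theta> > 0" "\<theta> = (exp (- \<sigma> * \<gamma> / n))\<^sup>2" by (simp_all add: \<theta>_def power2_eq_square exp_add[symmetric])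
 have C2: "C2 >= 0"
 proof -
  have "0 <= integral cell (%x. (f x)\<^sup>2)" by (intro integral_nonneg integrable_cell(2) continuous_intros f) auto
  then show ?thesis using L2 by linarith
 qed
 define c where "c k = cmod (fourier_coeff (%y. of_real (f y)) k)" for k
 define w where "w k = bessel_weight \<sigma> k" for k :: "int ^ 'n"
 define low where "low = {k :: int ^ 'n. \<forall>i. \<bar>k $ i\<bar> <= int N}"
 obtain g where g: "u \<in> L2_torus" "is_bessel \<sigma> u g" "sobolev_norm \<sigma> u = L2_norm_torus g" using sobolevE[OF u] .
 have w1: "w k >= 1" for k unfolding w_def bessel_weight_def using \<sigma> by (intro ge_one_powr_ge_zero) auto
 have cw: "(c k / w k)\<^sup>2 <= (c k)\<^sup>2" for k
 proof -
  have "c k / w k <= c k / 1" using w1[of k] by (intro divide_left_mono) (auto simp: c_def)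
  then show ?thesis using w1[of k] by (intro power_mono) (auto simp: c_def)
 qed
 have lowk: "(c k / w k)\<^sup>2 <= (C1 * exp (- \<gamma>) / v)\<^sup>2" for k
 proof -
  have "v * c k <= C1 * exp (- \<gamma>)" using fourier_coeff_le_L1[OF f(1), of k] L1 by (simp add: v_def c_def)
  then have "c k <= C1 * exp (- \<gamma>) / v" using v by (simp add: pos_le_divide_eq mult.commute)
  then have "(c k)\<^sup>2 <= (C1 * exp (- \<gamma>) / v)\<^sup>2" by (intro power_mono) (auto simp: c_def)
  with cw[of k] show ?thesis by linarith
 qed
 have lowsum: "(\<Sum>k\<in>F \<inter> low. (c k / w k)\<^sup>2) <= 5 ^ CARD('n) * C1\<^sup>2 / v\<^sup>2 * \<theta>" if F: "finite F" for F
 proof -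
  have "(\<Sum>k\<in>F \<inter> low. (c k / w k)\<^sup>2) <= real (card (F \<inter> low)) * (C1 * exp (- \<gamma>) / v)\<^sup>2"
   using sum_bounded_above[of "F \<inter> low" "%k. (c k / w k)\<^sup>2" "(C1 * exp (- \<gamma>) / v)\<^sup>2"] lowk by simp
  also have "... <= (5 ^ CARD('n) * exp \<gamma>) * (C1 * exp (- \<gamma>) / v)\<^sup>2"
  proof (intro mult_right_mono)
   have "card (F \<inter> low) <= (2 * N + 1) ^ CARD('n)"
    using card_mono[of low "F \<inter> low"] card_low_frequencies[of N, where 'n='n] by (simp add: low_def)
   then have "real (card (F \<inter> low)) <= real ((2 * N + 1) ^ CARD('n))" by (rule of_nat_mono)
   also have "... = (2 * real N + 1) ^ CARD('n)" by (simp add: add.commute)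
   \<comment> \<open>From \<open>N <= E + 1\<close> and \<open>E >= 1\<close>.\<close>
   also have "... <= (5 * E) ^ CARD('n)" using N E by (intro power_mono) auto
   also have "... = 5 ^ CARD('n) * exp \<gamma>"
   proof -
    have "E ^ CARD('n) = exp (real CARD('n) * (\<gamma> / n))" unfolding E_def by (rule exp_of_nat_mult[symmetric])
    also have "real CARD('n) * (\<gamma> / n) = \<gamma>" using n by (simp add: n_def)
    finally show ?thesis by (simp add: power_mult_distrib)
   qed
   finally show "real (card (F \<inter> low)) <= 5 ^ CARD('n) * exp \<gamma>" .
  qed simp
  also have "... = 5 ^ CARD('n) * C1\<^sup>2 / v\<^sup>2 * exp (- \<gamma>)"
  proof -
   have "exp \<gamma> * (exp (- \<gamma>))\<^sup>2 = exp (- \<gamma>)" by (simp add: power2_eq_square exp_add[symmetric])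
   then show ?thesis by (simp add: power_mult_distrib power_divide mult.assoc mult.left_commute)
  qed
  also have "... <= 5 ^ CARD('n) * C1\<^sup>2 / v\<^sup>2 * \<theta>"
  \<comment> \<open>Here \<open>2 * \<sigma>\<close> being at most the dimension enters: the
    contribution of the low frequencies decays at least as fast as \<theta>.\<close>
  proof (intro mult_left_mono)
   have "(2 * \<sigma>) * \<gamma> <= n * \<gamma>" using \<sigma> \<gamma> by (intro mult_right_mono) (auto simp: n_def)
   then have "2 * \<sigma> * \<gamma> / n <= \<gamma>" using n by (simp add: pos_divide_le_eq mult.commute)
   then show "exp (- \<gamma>) <= \<theta>" by (simp add: \<theta>_def)
  qed auto
  finally show ?thesis .
 qed
 have highk: "(c k / w k)\<^sup>2 <= (c k)\<^sup>2 * \<theta>" if k: "k \<notin> low" for k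
 proof -
  obtain i where i: "\<bar>k $ i\<bar> > int N" using k by (auto simp: low_def not_le)
  have "real N <= \<bar>real_of_int (k $ i)\<bar>" using i by linarith
  also have "... <= norm (frequency k)" using component_le_norm_cart[of "frequency k" i] by (simp add: frequency_def)
  finally have nk: "E <= norm (frequency k)" using N by linarith
  have "E\<^sup>2 <= 1 + (norm (frequency k))\<^sup>2" using power_mono[OF nk, of 2] E by linarith
  then have "(E\<^sup>2) powr (\<sigma> / 2) <= w k" unfolding w_def bessel_weight_def using \<sigma> by (intro powr_mono2) auto
  moreover have "(E\<^sup>2) powr (\<sigma> / 2) = exp (\<sigma> * \<gamma> / n)"
  proof -
   have "E\<^sup>2 = exp (2 * (\<gamma> / n))" by (simp add: E_def power2_eq_square exp_add[symmetric])
   then show ?thesis by (simp add: powr_def)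
  qed
  ultimately have "exp (\<sigma> * \<gamma> / n) <= w k" by simp
  then have "c k / w k <= c k / exp (\<sigma> * \<gamma> / n)" using w1[of k] by (intro divide_left_mono) (auto simp: c_def)
  also have "... = c k * exp (- \<sigma> * \<gamma> / n)" by (simp add: exp_minus divide_inverse)
  finally have "(c k / w k)\<^sup>2 <= (c k * exp (- \<sigma> * \<gamma> / n))\<^sup>2" using w1[of k] by (intro power_mono) (auto simp: c_def)
  then show ?thesis by (simp add: \<theta>(2) power_mult_distrib)
 qed
 have highsum: "(\<Sum>k\<in>F - low. (c k / w k)\<^sup>2) <= C2 / v * \<theta>" if F: "finite F" for F
 proof -
  have "(\<Sum>k\<in>F - low. (c k / w k)\<^sup>2) <= (\<Sum>k\<in>F - low. (c k)\<^sup>2 * \<theta>)" by (intro sum_mono highk) auto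
  also have "... = (\<Sum>k\<in>F - low. (c k)\<^sup>2) * \<theta>" by (simp add: sum_distrib_right)
  also have "... <= C2 / v * \<theta>"
  proof (intro mult_right_mono)
   have "v * (\<Sum>k\<in>F - low. (c k)\<^sup>2) <= (L2_norm_torus (%x. complex_of_real (f x)))\<^sup>2"
    unfolding v_def c_def by (rule bessel_inequality[OF of_real_L2[OF f]]) (use F in auto)
   also have "... <= C2" using L2 by (simp add: L2_norm_of_real[OF f(1)])
   finally show "(\<Sum>k\<in>F - low. (c k)\<^sup>2) <= C2 / v" using v by (simp add: pos_le_divide_eq mult.commute)
  qed (use \<theta> in auto)
  finally show ?thesis .
 qed
 define A where "A = 5 ^ CARD('n) * C1\<^sup>2 / v\<^sup>2 + C2 / v"
 have A: "A >= 0" using C2 v by (simp add: A_def)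
 define B where "B = sqrt A * exp (- \<sigma> * \<gamma> / n)"
 have B: "B >= 0" "B\<^sup>2 = A * \<theta>" using A by (simp_all add: B_def power_mult_distrib \<theta>(2))
 have "cmod (pairing u f) <= sqrt v * L2_norm_torus g * B" unfolding v_def
 proof (rule sobolev_duality[OF g(1,2) f B(1)])
  fix F :: "(int ^ 'n) set" assume F: "finite F"
  have "(\<Sum>k\<in>F. (c k / w k)\<^sup>2) = (\<Sum>k\<in>F \<inter> low. (c k / w k)\<^sup>2) + (\<Sum>k\<in>F - low. (c k / w k)\<^sup>2)"
   by (rule sum.Int_Diff[OF F])
  also have "... <= 5 ^ CARD('n) * C1\<^sup>2 / v\<^sup>2 * \<theta> + C2 / v * \<theta>" by (intro add_mono lowsum highsum F)
  also have "... = B\<^sup>2" unfolding B(2) A_def by (simp add: distrib_right)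
  finally show "(\<Sum>k\<in>F. (cmod (fourier_coeff (%y. of_real (f y)) k) / bessel_weight \<sigma> k)\<^sup>2) <= B\<^sup>2"
   by (simp add: c_def w_def)
 qed
 also have "... = (sqrt v * sqrt A) * L2_norm_torus g * exp (- \<sigma> * \<gamma> / n)" by (simp add: B_def)
 also have "sqrt v * sqrt A = sqrt (5 ^ CARD('n) * C1\<^sup>2 / v + C2)"
  unfolding real_sqrt_mult[symmetric] A_def using v by (simp add: distrib_left power2_eq_square)
 finally show ?thesis by (simp add: g(3) n_def v_def)
qed

section \<open>Averaging\<close>

definition inv_under :: "'a::ab_group_add set => ('a => 'b) => bool" where
 "inv_under \<Lambda> f \<longleftrightarrow> (\<forall>c\<in>\<Lambda>. \<forall>w. f (w + c) = f w)"

text \<open>Treats the periods in time and in space at once: continuous functions invariant under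
  \<Lambda> take all their values on one compact set.\<close>

definition cocompact :: "'a::real_normed_vector set => bool" where
 "cocompact \<Lambda> \<longleftrightarrow> (\<exists>K. compact K & (\<forall>x. \<exists>c\<in>\<Lambda>. x + c \<in> K))"

lemma bounded_of_invariant:
 fixes f :: "'a::real_normed_vector => 'b::real_normed_vector"
 assumes "cocompact \<Lambda>" "inv_under \<Lambda> f" "continuous_on UNIV f"
 shows "\<exists>B. \<forall>x. norm (f x) <= B"
proof -
 obtain K where K: "compact K" "!!x. \<exists>c\<in>\<Lambda>. x + c \<in> K" using assms(1) by (auto simp: cocompact_def)
 have "bounded (f ` K)"
  by (intro compact_imp_bounded compact_continuous_image continuous_on_subset[OF assms(3)] K(1)) auto
 then obtain B where B: "!!x. x \<in> K ==> norm (f x) <= B" unfolding bounded_iff by blast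
 have "norm (f x) <= B" for x
 proof -
  obtain c where "c \<in> \<Lambda>" "x + c \<in> K" using K(2) by blast
  then show ?thesis using B[of "x + c"] assms(2) by (simp add: inv_under_def)
 qed
 then show ?thesis by blast
qed

lemma inv_under_frechet:
 assumes inv: "inv_under \<Lambda> f" and d: "!!x. f differentiable (at x)"
 shows "inv_under \<Lambda> (%x. frechet_derivative f (at x) v)" unfolding inv_under_def
proof (intro ballI allI)
 fix c w assume c: "c \<in> \<Lambda>"
 have "((%x. x + c) has_derivative (%h. h)) (at w)" by (auto intro!: derivative_eq_intros)
 moreover have "(f has_derivative frechet_derivative f (at (w + c))) (at (w + c))"
  using d frechet_derivative_works by blast
 ultimately have "((%x. f (x + c)) has_derivative (%h. frechet_derivative f (at (w + c)) h)) (at w)"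
  by (rule has_derivative_compose)
 moreover have "(%x. f (x + c)) = f" using inv c by (auto simp: inv_under_def)
 ultimately have "(f has_derivative frechet_derivative f (at (w + c))) (at w)" by simp
 then have "frechet_derivative f (at (w + c)) = frechet_derivative f (at w)" by (rule frechet_derivative_at)
 then show "frechet_derivative f (at (w + c)) v = frechet_derivative f (at w) v" by simp
qed

text \<open>\<open>Ck\<close> provides continuity of directional derivatives; their bounds on a
  basis add up to a bound of the operator norm.\<close>

lemma norm_frechet_bounded:
 fixes f :: "'a::euclidean_space => 'b::real_normed_vector"
 assumes \<Lambda>: "cocompact \<Lambda>" and inv: "inv_under \<Lambda> f" and d: "!!x. f differentiable (at x)"
  and c: "!!v. continuous_on UNIV (%x. frechet_derivative f (at x) v)"
 shows "\<exists>B\<ge>0. \<forall>x. norm (Blinfun (frechet_derivative f (at x))) <= B"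
proof -
 have "\<exists>M. \<forall>x. norm (frechet_derivative f (at x) b) <= M" for b
  by (rule bounded_of_invariant[OF \<Lambda> inv_under_frechet[OF inv d] c])
 then obtain M where M: "!!b x. norm (frechet_derivative f (at x) b) <= M b" by metis
 have bl: "bounded_linear (frechet_derivative f (at x))" for x
  using d frechet_derivative_works has_derivative_bounded_linear by blast
 have "norm (Blinfun (frechet_derivative f (at x))) <= (\<Sum>b\<in>Basis. M b)" for x
 proof -
  have "norm (Blinfun (frechet_derivative f (at x))) <= (\<Sum>b\<in>Basis. norm (Blinfun (frechet_derivative f (at x)) b))"
   by (rule norm_blinfun_euclidean_le)
  also have "... <= (\<Sum>b\<in>Basis. M b)" by (intro sum_mono) (simp add: bounded_linear_Blinfun_apply[OF bl] M)
  finally show ?thesis .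
 qed
 moreover have "0 <= (\<Sum>b\<in>(Basis :: 'a set). M b)" by (intro sum_nonneg order_trans[OF norm_ge_zero M])
 ultimately show ?thesis by blast
qed

lemma lipschitz_of_Ck:
 fixes f :: "'a::euclidean_space => 'b::real_normed_vector"
 assumes \<Lambda>: "cocompact \<Lambda>" and inv: "inv_under \<Lambda> f" and Ck: "Ck (Suc 0) f"
 shows "\<exists>B\<ge>0. \<forall>x y. norm (f x - f y) <= B * norm (x - y)"
proof -
 have d: "f differentiable (at x)" for x using Ck by simp
 have c: "continuous_on UNIV (%x. frechet_derivative f (at x) v)" for v using Ck by simp
 obtain B where B: "B >= 0" "!!x. norm (Blinfun (frechet_derivative f (at x))) <= B"
  using norm_frechet_bounded[OF \<Lambda> inv d c] by blast
 have D: "(f has_derivative frechet_derivative f (at x)) (at x)" for x using d frechet_derivative_works by blast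
 have "norm (f x - f y) <= B * norm (x - y)" for x y
 proof (rule differentiable_bound[of UNIV f "%x. frechet_derivative f (at x)"])
  show "onorm (frechet_derivative f (at z)) <= B" for z
   using B(2)[of z] by (simp add: norm_blinfun.rep_eq bounded_linear_Blinfun_apply[OF has_derivative_bounded_linear[OF D]])
 qed (use D in auto)
 with B(1) show ?thesis by blast
qed

lemma C11_of_Ck:
 fixes f :: "'a::euclidean_space => 'b::real_normed_vector"
 assumes \<Lambda>: "cocompact \<Lambda>" and inv: "inv_under \<Lambda> f" and Ck: "Ck (Suc (Suc 0)) f"
 shows "\<exists>f' L. C11_field f f' L & (\<forall>x. blinfun_apply (f' x) = frechet_derivative f (at x))"
proof -
 have d: "f differentiable (at x)" for x using Ck by simp
 have C1: "Ck (Suc 0) (%x. frechet_derivative f (at x) v)" for v using Ck by simp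
 have c: "continuous_on UNIV (%x. frechet_derivative f (at x) v)" for v
  using C1[of v] by (simp add: continuous_at_imp_continuous_on differentiable_imp_continuous_within)
 obtain B where B: "B >= 0" "!!x. norm (Blinfun (frechet_derivative f (at x))) <= B"
  using norm_frechet_bounded[OF \<Lambda> inv d c] by blast
 have D: "(f has_derivative frechet_derivative f (at x)) (at x)" for x using d frechet_derivative_works by blast
 define f' where "f' x = Blinfun (frechet_derivative f (at x))" for x
 have f': "blinfun_apply (f' x) = frechet_derivative f (at x)" for x
  unfolding f'_def by (rule bounded_linear_Blinfun_apply[OF has_derivative_bounded_linear[OF D]])
 have "\<exists>M\<ge>0. \<forall>x y. norm (frechet_derivative f (at x) b - frechet_derivative f (at y) b) <= M * norm (x - y)" for b
  by (rule lipschitz_of_Ck[OF \<Lambda> inv_under_frechet[OF inv d] C1])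
 then obtain M where M: "!!b. M b >= 0"
  "!!b x y. norm (frechet_derivative f (at x) b - frechet_derivative f (at y) b) <= M b * norm (x - y)" by metis
 define N where "N = (\<Sum>b\<in>(Basis :: 'a set). M b)"
 have N: "N >= 0" unfolding N_def by (intro sum_nonneg M)
 have lip: "norm (f' x - f' y) <= N * norm (x - y)" for x y
 proof -
  have "norm (f' x - f' y) <= (\<Sum>b\<in>Basis. norm ((f' x - f' y) b))" by (rule norm_blinfun_euclidean_le)
  also have "... <= (\<Sum>b\<in>Basis. M b * norm (x - y))" by (intro sum_mono) (simp add: blinfun.diff_left f' M)
  finally show ?thesis by (simp add: N_def sum_distrib_right)
 qed
 have "C11_field f f' (B + N + 1)" unfolding C11_field_def
 proof (intro conjI allI)
  show "0 < B + N + 1" using B N by simp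
  show "(f has_derivative f' x) (at x)" for x by (simp add: f' D)
  show "norm (f' x) <= B + N + 1" for x using B(2)[of x] N by (simp add: f'_def)
  show "norm (f' x - f' y) <= (B + N + 1) * norm (x - y)" for x y
   by (rule order_trans[OF lip]) (use B in \<open>intro mult_right_mono; simp\<close>)
 qed
 with f' show ?thesis by blast
qed

text \<open>Serves to place \<open>V\<close> and its divergence as components of one field on a
  larger space.\<close>

lemma C11_linear:
 assumes f: "C11_field f f' L" and A: "bounded_linear A" and P: "bounded_linear P"
 shows "\<exists>L'. C11_field (%s. A (f (P s)) + c) (%s. Blinfun A o\<^sub>L f' (P s) o\<^sub>L Blinfun P) L'"
proof -
 define a p where "a = norm (Blinfun A)" and "p = norm (Blinfun P)"
 have ap: "a >= 0" "p >= 0" by (simp_all add: a_def p_def)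
 have L: "L > 0" and d: "(f has_derivative f' x) (at x)" and n: "norm (f' x) <= L"
  and l: "norm (f' x - f' y) <= L * norm (x - y)" for x y using f by (auto simp: C11_field_def)
 define L' where "L' = a * L * p * (1 + p) + 1"
 have L': "a * L * p <= L'" "a * L * p * p <= L'"
 proof -
  have "0 <= a * L * p" using ap L by simp
  moreover have "0 <= a * L * p * p" using ap L by simp
  moreover have "L' = a * L * p + a * L * p * p + 1" by (simp add: L'_def algebra_simps)
  ultimately show "a * L * p <= L'" "a * L * p * p <= L'" by linarith+
 qed
 have bnd: "norm (Blinfun A o\<^sub>L B o\<^sub>L Blinfun P) <= a * norm B * p" for B
 proof -
  have "norm (Blinfun A o\<^sub>L B o\<^sub>L Blinfun P) <= norm (Blinfun A o\<^sub>L B) * norm (Blinfun P)" by (rule norm_blinfun_compose)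
  also have "... <= (norm (Blinfun A) * norm B) * norm (Blinfun P)" by (intro mult_right_mono norm_blinfun_compose) auto
  finally show ?thesis by (simp add: a_def p_def)
 qed
 have "C11_field (%s. A (f (P s)) + c) (%s. Blinfun A o\<^sub>L f' (P s) o\<^sub>L Blinfun P) L'"
  unfolding C11_field_def
 proof (intro conjI allI)
  show "0 < L'" using ap L by (simp add: L'_def add_nonneg_pos)
  fix x y
  have "((%s. f (P s)) has_derivative (%h. f' (P x) (P h))) (at x)"
   by (rule has_derivative_compose[OF bounded_linear_imp_has_derivative[OF P] d])
  then have "((%s. A (f (P s))) has_derivative (%h. A (f' (P x) (P h)))) (at x)"
   by (rule bounded_linear.has_derivative[OF A])
  then have "((%s. A (f (P s)) + c) has_derivative (%h. A (f' (P x) (P h)))) (at x)"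
   by (auto intro!: derivative_eq_intros)
  moreover have "blinfun_apply (Blinfun A o\<^sub>L f' (P x) o\<^sub>L Blinfun P) = (%h. A (f' (P x) (P h)))"
   by (rule ext) (simp add: bounded_linear_Blinfun_apply A P)
  ultimately show "((%s. A (f (P s)) + c) has_derivative (Blinfun A o\<^sub>L f' (P x) o\<^sub>L Blinfun P)) (at x)" by simp
  have "a * norm (f' (P x)) * p <= a * L * p" using n ap by (intro mult_right_mono mult_left_mono) auto
  then show "norm (Blinfun A o\<^sub>L f' (P x) o\<^sub>L Blinfun P) <= L'" using bnd[of "f' (P x)"] L'(1) by linarith
  have "norm ((Blinfun A o\<^sub>L f' (P x) o\<^sub>L Blinfun P) - (Blinfun A o\<^sub>L f' (P y) o\<^sub>L Blinfun P)) = norm (Blinfun A o\<^sub>L (f' (P x) - f' (P y)) o\<^sub>L Blinfun P)"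
   by (rule arg_cong[where f=norm]) (rule blinfun_eqI, simp add: blinfun.diff_left blinfun.diff_right)
  also have "... <= a * norm (f' (P x) - f' (P y)) * p" by (rule bnd)
  also have "... <= a * (L * (p * norm (x - y))) * p"
  proof (intro mult_right_mono mult_left_mono ap)
   have "norm (P x - P y) <= p * norm (x - y)"
    using norm_blinfun[of "Blinfun P" "x - y"] by (simp add: p_def bounded_linear_Blinfun_apply[OF P] bounded_linear.linear[OF P] linear_diff)
   then have "L * norm (P x - P y) <= L * (p * norm (x - y))" using L by (intro mult_left_mono) auto
   then show "norm (f' (P x) - f' (P y)) <= L * (p * norm (x - y))" using l[of "P x" "P y"] by linarith
  qed
  also have "... = (a * L * p * p) * norm (x - y)" by (simp add: mult_ac)
  also have "... <= L' * norm (x - y)" by (intro mult_right_mono L') auto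
  finally show "norm ((Blinfun A o\<^sub>L f' (P x) o\<^sub>L Blinfun P) - (Blinfun A o\<^sub>L f' (P y) o\<^sub>L Blinfun P)) <= L' * norm (x - y)" .
 qed
 then show ?thesis by blast
qed

lemma C11_add:
 assumes f: "C11_field f f' L" and g: "C11_field g g' M"
 shows "C11_field (%x. f x + g x) (%x. f' x + g' x) (L + M)" unfolding C11_field_def
proof (intro conjI allI)
 show "0 < L + M" using f g by (simp add: C11_field_def)
 fix x y
 have "(f has_derivative f' x) (at x)" "(g has_derivative g' x) (at x)" using f g by (auto simp: C11_field_def)
 from has_derivative_add[OF this] show "((%x. f x + g x) has_derivative (f' x + g' x)) (at x)"
  by (simp add: plus_blinfun.rep_eq)
 show "norm (f' x + g' x) <= L + M" by (rule norm_triangle_mono) (use f g in \<open>auto simp: C11_field_def\<close>)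
 have "norm ((f' x - f' y) + (g' x - g' y)) <= L * norm (x - y) + M * norm (x - y)"
  by (rule norm_triangle_mono) (use f g in \<open>auto simp: C11_field_def\<close>)
 then show "norm (f' x + g' x - (f' y + g' y)) <= (L + M) * norm (x - y)" by (simp add: algebra_simps)
qed

lemma C11_sum:
 assumes "finite I" "!!i. i \<in> I ==> \<exists>f' L. C11_field (f i) f' L"
 shows "\<exists>f' L. C11_field (%x. \<Sum>i\<in>I. f i x) f' L" using assms
proof (induction I rule: finite_induct)
 case empty
 have "C11_field (%x. 0) (%x. 0) 1" by (simp add: C11_field_def zero_blinfun.rep_eq)
 then show ?case by auto
next
 case (insert i I)
 obtain f' L where "C11_field (f i) f' L" using insert.prems by blast
 moreover obtain g' M where "C11_field (%x. \<Sum>i\<in>I. f i x) g' M" using insert by blast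
 ultimately have "C11_field (%x. f i x + (\<Sum>i\<in>I. f i x)) (%x. f' x + g' x) (L + M)" by (rule C11_add)
 then show ?case using insert.hyps by auto
qed

lemma periodic_real_int:
 fixes f :: "real => 'b"
 assumes per: "!!t. f (t + 2 * pi) = f t"
 shows "f (t + 2 * pi * of_int m) = f t"
proof -
 have nat: "f (t + 2 * pi * real n) = f t" for n t
 proof (induction n)
  case (Suc n)
  have e: "t + 2 * pi * real (Suc n) = (t + 2 * pi * real n) + 2 * pi" by (simp add: algebra_simps)
  show ?case unfolding e per by (rule Suc.IH)
 qed simp
 show ?thesis
 proof (cases m)
  case (nonneg n)
  then show ?thesis using nat by simp
 next
  case (neg n)
  have m: "real_of_int m = - real (Suc n)" using neg by simp
  have e: "(t + 2 * pi * of_int m) + 2 * pi * real (Suc n) = t" unfolding m by (simp add: algebra_simps)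
  show ?thesis using nat[of "t + 2 * pi * of_int m" "Suc n"] unfolding e by simp
 qed
qed

definition time_lattice :: "(real \<times> (real ^ 'n)) set" where
 "time_lattice = {(2 * pi * real_of_int m, c) | m c. c \<in> lattice}"

lemma cocompact_time_lattice: "cocompact (time_lattice :: (real \<times> (real ^ 'n)) set)" unfolding cocompact_def
proof (intro exI conjI allI)
 show "compact ({0..2 * pi} \<times> (cell :: (real ^ 'n) set))" by (intro compact_Times compact_cell) auto
 fix p :: "real \<times> (real ^ 'n)"
 obtain t x where p: "p = (t, x)" using prod.exhaust by blast
 obtain c where c: "c \<in> lattice" "x + c \<in> cell" using lattice_translate_to_cell by blast
 define m where "m = - \<lfloor>t / (2 * pi)\<rfloor>"
 have fl: "real_of_int \<lfloor>t / (2 * pi)\<rfloor> <= t / (2 * pi)" "t / (2 * pi) <= real_of_int \<lfloor>t / (2 * pi)\<rfloor> + 1" by linarith+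
 have "2 * pi * real_of_int \<lfloor>t / (2 * pi)\<rfloor> <= 2 * pi * (t / (2 * pi))"
  by (rule mult_left_mono[OF fl(1)]) simp
 moreover have "2 * pi * (t / (2 * pi)) <= 2 * pi * (real_of_int \<lfloor>t / (2 * pi)\<rfloor> + 1)"
  by (rule mult_left_mono[OF fl(2)]) simp
 ultimately have "t + 2 * pi * real_of_int m \<in> {0..2 * pi}" by (simp add: m_def algebra_simps)
 then have 1: "p + (2 * pi * real_of_int m, c) \<in> {0..2 * pi} \<times> cell" using c by (simp add: p)
 have 2: "(2 * pi * real_of_int m, c) \<in> time_lattice" using c by (auto simp: time_lattice_def)
 show "\<exists>c\<in>time_lattice. p + c \<in> {0..2 * pi} \<times> cell" 
  by (rule bexI[where x="(2 * pi * real_of_int m, c)"]) (rule 1, rule 2)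
qed

text \<open>Three derivatives of \<open>V\<close> enter: two make the field itself
  \<open>C11\<close>, one more does so for its divergence.\<close>

lemma field_regularity:
 fixes V :: "real => real ^ 'n => real ^ 'n"
 assumes sm: "smooth (%(t, x). V t x)" and pt: "!!t x. V (t + 2 * pi) x = V t x" and px: "!!t. periodic (V t)"
 obtains V' L D' M B where "C11_field (%(t, x). V t x) V' L" "C11_field (%(t, x). divergence (V t) x) D' M"
  "!!t x. divergence (V t) x = (\<Sum>i\<in>UNIV. V' (t, x) (0, axis i 1) $ i)"
  "!!t. periodic (divergence (V t))"
  "!!t x. (V t has_derivative (%h. V' (t, x) (0, h))) (at x)"
  "!!t x. norm (V t x) <= B" "!!t x. \<bar>divergence (V t) x\<bar> <= B" 
proof -
 let ?F = "%(t, x). V t x"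
 have inv: "inv_under time_lattice ?F" unfolding inv_under_def time_lattice_def
  using periodic_real_int[of "%t. V t x" for x, OF pt] periodic_lattice[OF px] by (auto simp: split_beta)
 have Ck: "Ck k ?F" for k using sm by (simp add: smooth_def)
 obtain V' L where V': "C11_field ?F V' L" "!!p. blinfun_apply (V' p) = frechet_derivative ?F (at p)"
  using C11_of_Ck[OF cocompact_time_lattice inv Ck] by blast
 have dF: "(?F has_derivative V' p) (at p)" for p using V'(1) unfolding C11_field_def by blast
 have dd: "?F differentiable (at p)" for p using dF unfolding differentiable_def by blast
 have dV: "(V t has_derivative (%h. V' (t, x) (0, h))) (at x)" for t x
 proof -
  have "((%x. (t, x)) has_derivative (%h. (0, h))) (at x)" by (auto intro!: derivative_eq_intros)
  from has_derivative_compose[OF this dF] show ?thesis by simp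
 qed
 have fV: "frechet_derivative (V t) (at x) h = V' (t, x) (0, h)" for t x h using frechet_derivative_at[OF dV] by metis
 have div: "divergence (V t) x = (\<Sum>i\<in>UNIV. V' (t, x) (0, axis i 1) $ i)" for t x
  by (simp add: divergence_def fV)
 have invd: "inv_under time_lattice (%p. V' p v)" for v unfolding V'(2) by (rule inv_under_frechet[OF inv dd])
 have comp: "\<exists>f' L. C11_field (%p. V' p v $ i) f' L" for v i
 proof -
  have "Ck (Suc (Suc 0)) (%p. V' p v)" using Ck[of "Suc (Suc (Suc 0))"] unfolding V'(2) Ck.simps(2)[of "Suc (Suc 0)" ?F] by blast
  then obtain g' K where "C11_field (%p. V' p v) g' K" using C11_of_Ck[OF cocompact_time_lattice invd] by blast
  from C11_linear[OF this bounded_linear_vec_nth[of i] bounded_linear_ident, of 0] show ?thesis by auto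
 qed
 have "\<exists>f' L. C11_field (%p. \<Sum>i\<in>UNIV. V' p (0, axis i 1) $ i) f' L" by (intro C11_sum comp) auto
 moreover have divF: "(%(t, x). divergence (V t) x) = (%p. \<Sum>i\<in>UNIV. V' p (0, axis i 1) $ i)"
  by (auto simp: div)
 ultimately obtain D' M where D': "C11_field (%(t, x). divergence (V t) x) D' M" by auto
 have invD: "inv_under time_lattice (%(t, x). divergence (V t) x)"
  unfolding divF using invd by (auto simp: inv_under_def)
 have perD: "periodic (divergence (V t))" for t unfolding periodic_def
 proof (intro allI)
  fix x :: "real ^ 'n" and i
  have "axis i (2 * pi) \<in> (lattice :: (real ^ 'n) set)"
  proof -
   have "axis i (2 * pi) $ j = 2 * pi * real_of_int (if j = i then 1 else 0)" for j by (simp add: axis_def)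
   then show ?thesis unfolding lattice_def by blast
  qed
  then have "(2 * pi * real_of_int 0, axis i (2 * pi)) \<in> (time_lattice :: (real \<times> (real ^ 'n)) set)"
   unfolding time_lattice_def by blast
  then show "divergence (V t) (x + axis i (2 * pi)) = divergence (V t) x" using invD by (force simp: inv_under_def)
 qed
 have cV: "continuous_on UNIV ?F" using Ck[of 0] by simp
 have cD: "continuous_on UNIV (%(t, x). divergence (V t) x)"
  using D' has_derivative_continuous unfolding C11_field_def by (blast intro: continuous_at_imp_continuous_on)
 obtain B1 where B1: "!!p. norm (?F p) <= B1" using bounded_of_invariant[OF cocompact_time_lattice inv cV] by blast
 obtain B2 where B2: "!!p. norm ((%(t, x). divergence (V t) x) p) <= B2" using bounded_of_invariant[OF cocompact_time_lattice invD cD] by blast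
 have "norm (V t x) <= max B1 B2" "\<bar>divergence (V t) x\<bar> <= max B1 B2" for t x
  using B1[of "(t, x)"] B2[of "(t, x)"] by auto
 then show thesis using that[OF V'(1) D' div perD dV] by blast
qed

text \<open>Differentiation under the integral sign. The trace formula is the link by which
  contraction of volume under the averaged flow turns into growth of the accumulated
  divergence.\<close>

lemma average_regularity:
 fixes V :: "real => real ^ 'n => real ^ 'n"
 assumes V: "C11_field (%(t, x). V t x) V' L" and px: "!!t. periodic (V t)"
  and div: "!!t x. divergence (V t) x = (\<Sum>i\<in>UNIV. V' (t, x) (0, axis i 1) $ i)"
 obtains Y' M where "C11_field (%x. - average \<nu> V x) Y' M" "periodic (%x. - average \<nu> V x)"
  "!!x. trace_of (Y' x) = - (1 / (2 * pi)) * integral {0..2 * pi} (%t. divergence (V t) (x - t *\<^sub>R nat_vec \<nu>))"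
proof -
 define inr where "inr = Blinfun (%h :: real ^ 'n. (0 :: real, h))"
 have inr_bl: "bounded_linear (%h :: real ^ 'n. (0 :: real, h))"
  by (intro bounded_linear_Pair bounded_linear_zero bounded_linear_ident)
 have inr: "inr h = (0, h)" for h unfolding inr_def by (simp add: bounded_linear_Blinfun_apply[OF inr_bl])
 have ninr: "norm inr <= 1" by (rule norm_blinfun_bound) (auto simp: inr)
 have L: "L > 0" and d: "((%(t, x). V t x) has_derivative V' p) (at p)" and n: "norm (V' p) <= L"
  and l: "norm (V' p - V' q) <= L * norm (p - q)" for p q using V unfolding C11_field_def by blast+
 define sh where "sh t x = (t, x - t *\<^sub>R nat_vec \<nu>)" for t :: real and x :: "real ^ 'n"
 define A where "A x t = V' (sh t x) o\<^sub>L inr" for x t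
 have cV': "continuous_on UNIV V'" by (rule continuous_on_lipschitz[OF l])
 have cV: "continuous_on UNIV (%(t, x). V t x)"
  using d has_derivative_continuous by (blast intro: continuous_at_imp_continuous_on)
 have cA: "continuous_on S (%(x, t). A x t)" for S unfolding A_def sh_def split_beta
  by (intro continuous_intros continuous_on_compose2[OF cV']) auto
 have cAt: "continuous_on S (A x)" for S x
  unfolding A_def[abs_def] sh_def by (intro continuous_intros continuous_on_compose2[OF cV']) auto
 have cVt: "continuous_on S (%t. V t (x - t *\<^sub>R nat_vec \<nu>))" for S x

 proof -
  have "continuous_on S (%t. (t, x - t *\<^sub>R nat_vec \<nu>))" by (intro continuous_intros)
  from continuous_on_compose2[OF cV this] show ?thesis by simp
 qed
 have dA: "((%x. V t (x - t *\<^sub>R nat_vec \<nu>)) has_derivative A x t) (at x)" for x t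
 proof -
  have "((%x. sh t x) has_derivative (%h. (0, h))) (at x)" unfolding sh_def by (auto intro!: derivative_eq_intros)
  from has_derivative_compose[OF this d] have "((%x. V t (x - t *\<^sub>R nat_vec \<nu>)) has_derivative (%h. V' (sh t x) (0, h))) (at x)"
   by (simp add: sh_def)
  moreover have "blinfun_apply (A x t) = (%h. V' (sh t x) (0, h))" by (rule ext) (simp add: A_def inr)
  ultimately show ?thesis by simp
 qed
 define Y' where "Y' x = (- 1 / (2 * pi)) *\<^sub>R integral {0..2 * pi} (A x)" for x
 have nA: "norm (A x t) <= L" for x t
 proof -
  have "norm (A x t) <= norm (V' (sh t x)) * norm inr" unfolding A_def by (rule norm_blinfun_compose)
  also have "... <= L * 1" using n ninr L by (intro mult_mono) auto
  finally show ?thesis by simp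
 qed
 have lA: "norm (A x t - A y t) <= L * norm (x - y)" for x y t
 proof -
  have "A x t - A y t = (V' (sh t x) - V' (sh t y)) o\<^sub>L inr"
   unfolding A_def by (rule blinfun_eqI) (simp add: blinfun.diff_left)
  then have "norm (A x t - A y t) <= norm (V' (sh t x) - V' (sh t y)) * norm inr" by (simp add: norm_blinfun_compose)
  also have "... <= (L * norm (sh t x - sh t y)) * 1" using l ninr L by (intro mult_mono) auto
  also have "norm (sh t x - sh t y) = norm (x - y)" by (simp add: sh_def norm_Pair)
  finally show ?thesis by simp
 qed
 have scale: "norm ((- 1 / (2 * pi)) *\<^sub>R integral {0..2 * pi} f) <= b"
  if "continuous_on {0..2 * pi} f" "!!t. norm (f t) <= b" for f :: "real => (real ^ 'n) \<Rightarrow>\<^sub>L (real ^ 'n)" and b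
 proof -
  have "norm (integral {0..2 * pi} f) <= b * (2 * pi - 0)" by (rule integral_bound) (use that in auto)
  then show ?thesis by (simp add: divide_le_eq)
 qed
 have C11: "C11_field (%x. - average \<nu> V x) Y' L" unfolding C11_field_def
 proof (intro conjI allI L)
  fix x y :: "real ^ 'n"
  have "((%x. integral (cbox 0 (2 * pi)) (%t. V t (x - t *\<^sub>R nat_vec \<nu>))) has_derivative integral (cbox 0 (2 * pi)) (A x)) (at x within UNIV)"
   by (rule leibniz_rule) (use dA cA cVt in \<open>auto intro!: integrable_continuous_real\<close>)
  then have "((%x. (- 1 / (2 * pi)) *\<^sub>R integral {0..2 * pi} (%t. V t (x - t *\<^sub>R nat_vec \<nu>))) has_derivative (%h. (- 1 / (2 * pi)) *\<^sub>R integral {0..2 * pi} (A x) h)) (at x)"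
   by (auto intro!: derivative_eq_intros)
  moreover have "(%x. - average \<nu> V x) = (%x. (- 1 / (2 * pi)) *\<^sub>R integral {0..2 * pi} (%t. V t (x - t *\<^sub>R nat_vec \<nu>)))"
   by (rule ext) (simp add: average_def)
  moreover have "blinfun_apply (Y' x) = (%h. (- 1 / (2 * pi)) *\<^sub>R integral {0..2 * pi} (A x) h)"
   unfolding Y'_def scaleR_blinfun.rep_eq ..
  ultimately show "((%x. - average \<nu> V x) has_derivative Y' x) (at x)" by metis
  show "norm (Y' x) <= L" unfolding Y'_def by (rule scale[OF cAt nA])
  have "Y' x - Y' y = (- 1 / (2 * pi)) *\<^sub>R integral {0..2 * pi} (%t. A x t - A y t)"
   unfolding Y'_def scaleR_diff_right[symmetric]
   by (subst integral_diff) (auto intro!: integrable_continuous_real cAt)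
  moreover have "norm ((- 1 / (2 * pi)) *\<^sub>R integral {0..2 * pi} (%t. A x t - A y t)) <= L * norm (x - y)"
   by (rule scale) (auto intro!: continuous_intros cAt lA)
  ultimately show "norm (Y' x - Y' y) <= L * norm (x - y)" by simp
 qed
 have per: "periodic (%x. - average \<nu> V x)" unfolding periodic_def
 proof (intro allI)
  fix x :: "real ^ 'n" and i
  have "V t (x + axis i (2 * pi) - t *\<^sub>R nat_vec \<nu>) = V t (x - t *\<^sub>R nat_vec \<nu>)" for t
  proof -
   have "x + axis i (2 * pi) - t *\<^sub>R nat_vec \<nu> = (x - t *\<^sub>R nat_vec \<nu>) + axis i (2 * pi)" by simp
   then show ?thesis using px[of t] by (simp only: periodic_def)
  qed
  then show "- average \<nu> V (x + axis i (2 * pi)) = - average \<nu> V x" by (simp add: average_def)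
 qed
 have "trace_of (Y' x) = - (1 / (2 * pi)) * integral {0..2 * pi} (%t. divergence (V t) (x - t *\<^sub>R nat_vec \<nu>))" for x
 proof -
  have "integral {0..2 * pi} (trace_of \<circ> A x) = trace_of (integral {0..2 * pi} (A x))"
   by (rule integral_linear[OF integrable_continuous_real[OF cAt] bounded_linear_trace_of])
  moreover have "(trace_of \<circ> A x) = (%t. divergence (V t) (x - t *\<^sub>R nat_vec \<nu>))"
   by (rule ext) (simp add: trace_of_def div A_def inr sh_def)
  ultimately show ?thesis unfolding Y'_def linear_cmul[OF bounded_linear.linear[OF bounded_linear_trace_of]] by simp
 qed
 then show thesis using that[OF C11 per] by blast
qed

section \<open>Comparison with the averaged flow\<close>

lemma norm_fst_le_norm: "norm (fst p) <= norm p" and norm_snd_le_norm: "norm (snd p) <= norm p"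
 using norm_fst_le[of "fst p" "snd p"] norm_snd_le[of "snd p" "fst p"] by simp_all

lemma vderiv_bound:
 fixes y :: "real => 'b::real_inner"
 assumes "!!s. 0 <= s ==> s <= t ==> (y has_vector_derivative y' s) (at s)"
  and "!!s. 0 <= s ==> s <= t ==> norm (y' s) <= c" and "0 <= t" "0 <= c"
 shows "norm (y t - y 0) <= c * t"
proof -
 have "norm (y t - y 0) <= exp (0 * t) * (norm (y 0 - y 0) + c * t)"
 proof (rule gronwall[where y="%s. y s - y 0" and y'=y'])
  show "((%s. y s - y 0) has_vector_derivative y' s) (at s)" if "0 <= s" "s <= t" for s
   using has_vector_derivative_diff[OF assms(1)[OF that] has_vector_derivative_const[of "y 0"]] by simp
 qed (use assms in auto)
 then show ?thesis by simp
qed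

lemma vderiv_zero_const:
 assumes "!!t. (H has_vector_derivative 0) (at t)"
 shows "H s = H t" using has_derivative_zero_unique[of UNIV H s t] assms by (auto simp: has_vector_derivative_def)

lemma vderiv_compose_shift:
 assumes "!!t. (y has_vector_derivative y' t) (at t)"
 shows "((%r. y (t + r)) has_vector_derivative y' (t + r)) (at r)"
proof -
 have "((%r. t + r) has_vector_derivative 1) (at r)" by (auto intro!: derivative_eq_intros)
 from vector_diff_chain_at[OF this assms] show ?thesis by (simp add: o_def)
qed

lemma integral_period_shift:
 fixes g :: "real => 'b::euclidean_space"
 assumes c: "continuous_on UNIV g" and per: "!!t. g (t + 2 * pi) = g t"
 shows "antider (%\<sigma>. g (t + \<sigma>)) (2 * pi) = integral {0..2 * pi} g"
proof -
 have A: "(antider g has_vector_derivative g s) (at s)" for s by (rule antider_has_vector_derivative[OF c])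
 define H where "H s = antider g (s + 2 * pi) - antider g s" for s
 have H0: "(H has_vector_derivative 0) (at s)" for s
 proof -
  have "((%r. antider g (2 * pi + r)) has_vector_derivative g (2 * pi + s)) (at s)" by (rule vderiv_compose_shift[OF A])
  from has_vector_derivative_diff[OF this A[of s]] show ?thesis
   unfolding H_def using per[of s] by (simp add: add.commute)
 qed
 have "H t = H 0" by (rule vderiv_zero_const[OF H0])
 moreover have "antider (%\<sigma>. g (t + \<sigma>)) (2 * pi) = H t"
 proof -
  have cs: "continuous_on UNIV (%\<sigma>. g (t + \<sigma>))" by (intro continuous_on_compose2[OF c] continuous_intros) auto
  define D where "D r = antider (%\<sigma>. g (t + \<sigma>)) r - antider g (t + r)" for r
  have "(D has_vector_derivative 0) (at r)" for r
   using has_vector_derivative_diff[OF antider_has_vector_derivative[OF cs, of r] vderiv_compose_shift[OF A, of t r]]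
   unfolding D_def by simp
  then have "D (2 * pi) = D 0" by (rule vderiv_zero_const)
  then show ?thesis unfolding D_def H_def by (metis (no_types, lifting) add_diff_cancel_left antider_0 diff_add_cancel diff_zero)
 qed
 ultimately show ?thesis by (simp add: H_def antider_def)
qed

text \<open>The running mean over one period satisfies the averaged equation up to an error of second order.\<close>

lemma running_mean:
 fixes G :: "real => 'a::euclidean_space => 'a \<times> real"
 assumes cont: "continuous_on UNIV (%(t, x). G t x)" and per: "!!t x. G (t + 2 * pi) x = G t x"
  and lip: "!!t x y. norm (G t x - G t y) <= K * norm (x - y)" and K: "0 <= K"
  and bnd: "!!t x. norm (G t x) <= M"
  and avg: "!!x. integral {0..2 * pi} (%t. G t x) = (2 * pi) *\<^sub>R Gb x"
  and s: "!!t. (s has_vector_derivative \<epsilon> *\<^sub>R G t (fst (s t))) (at t)" and "0 <= \<epsilon>"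
 obtains w w' where "!!t. norm (w t - s t) <= 2 * pi * M * \<epsilon>"
  "!!t. (w has_vector_derivative w' t) (at t)"
  "!!t. norm (w' t - \<epsilon> *\<^sub>R Gb (fst (w t))) <= 4 * pi * K * M * \<epsilon>\<^sup>2"
proof -
 have M: "0 <= M" using order_trans[OF norm_ge_zero bnd] .
 have cs: "continuous_on UNIV s" using s has_vector_derivative_continuous by (blast intro: continuous_at_imp_continuous_on)
 have A: "(antider s has_vector_derivative s t) (at t)" for t by (rule antider_has_vector_derivative[OF cs])
 \<comment> \<open>How far \<open>s\<close> can move within one period.\<close>
 define c1 where "c1 = 2 * pi * M * \<epsilon>"
 have c1: "0 <= c1" using M \<open>0 <= \<epsilon>\<close> by (simp add: c1_def)
 have near: "norm (s (t + r) - s t) <= c1" if r: "0 <= r" "r <= 2 * pi" for t r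
 proof -
  have "norm (s (t + r) - s (t + 0)) <= (\<epsilon> * M) * r"
  proof (rule vderiv_bound[where y="%r. s (t + r)"])
   show "((%r. s (t + r)) has_vector_derivative \<epsilon> *\<^sub>R G (t + q) (fst (s (t + q)))) (at q)" for q
    by (rule vderiv_compose_shift[OF s])
   show "norm (\<epsilon> *\<^sub>R G (t + q) (fst (s (t + q)))) <= \<epsilon> * M" for q
    using bnd \<open>0 <= \<epsilon>\<close> by (simp add: mult_left_mono)
  qed (use r M \<open>0 <= \<epsilon>\<close> in auto)
  also have "... <= (\<epsilon> * M) * (2 * pi)" using r M \<open>0 <= \<epsilon>\<close> by (intro mult_left_mono) auto
  finally show ?thesis by (simp add: c1_def mult_ac)
 qed
 \<comment> \<open>The mean of \<open>s\<close> over \<open>{t..t + 2 * pi}\<close>. Its derivative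
   is an increment of \<open>s\<close> over a whole period, in which the oscillation of
   \<open>G\<close> has averaged out.\<close>
 define w where "w t = (1 / (2 * pi)) *\<^sub>R (antider s (t + 2 * pi) - antider s t)" for t
 define w' where "w' t = (1 / (2 * pi)) *\<^sub>R (s (t + 2 * pi) - s t)" for t
 have dw: "(w has_vector_derivative w' t) (at t)" for t
 proof -
  have "((%r. antider s (2 * pi + r)) has_vector_derivative s (2 * pi + t)) (at t)" by (rule vderiv_compose_shift[OF A])
  from has_vector_derivative_diff[OF this A[of t]]
  have "((%r. antider s (r + 2 * pi) - antider s r) has_vector_derivative s (t + 2 * pi) - s t) (at t)" by (simp add: add.commute)
  then show ?thesis unfolding w_def w'_def by (rule bounded_linear.has_vector_derivative[OF bounded_linear_scaleR_right])
 qed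
 have ws: "norm (w t - s t) <= c1" for t
 proof -
  have "norm ((antider s (t + 2 * pi) - (2 * pi) *\<^sub>R s t) - (antider s (t + 0) - 0 *\<^sub>R s t)) <= c1 * (2 * pi)"
  proof (rule vderiv_bound[where y="%r. antider s (t + r) - r *\<^sub>R s t" and y'="%r. s (t + r) - s t"])
   show "((%r. antider s (t + r) - r *\<^sub>R s t) has_vector_derivative s (t + r) - s t) (at r)" for r
    by (rule has_vector_derivative_diff[OF vderiv_compose_shift[OF A]]) (auto intro!: derivative_eq_intros)
  qed (use near c1 in auto)
  moreover have "w t - s t = (1 / (2 * pi)) *\<^sub>R ((antider s (t + 2 * pi) - (2 * pi) *\<^sub>R s t) - (antider s (t + 0) - 0 *\<^sub>R s t))"
   unfolding w_def by (simp add: scaleR_diff_right)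
  ultimately show ?thesis by (simp add: divide_le_eq)
 qed
 have err: "norm (w' t - \<epsilon> *\<^sub>R Gb (fst (w t))) <= 4 * pi * K * M * \<epsilon>\<^sup>2" for t
 proof -
  define x where "x = fst (w t)"
  have cG: "continuous_on UNIV (%t. G t x)"

  proof -
   have "continuous_on UNIV (%t::real. (t, x))" by (intro continuous_intros)
   from continuous_on_compose2[OF cont this] show ?thesis by simp
  qed
  have cGs: "continuous_on UNIV (%r. G (t + r) x)" by (intro continuous_on_compose2[OF cG] continuous_intros) auto
  have m: "antider (%r. G (t + r) x) (2 * pi) = (2 * pi) *\<^sub>R Gb x"
   using integral_period_shift[OF cG per, of t] avg by simp
  have "norm ((s (t + 2 * pi) - \<epsilon> *\<^sub>R antider (%r. G (t + r) x) (2 * pi)) - (s (t + 0) - \<epsilon> *\<^sub>R antider (%r. G (t + r) x) 0)) <= (\<epsilon> * (K * (2 * c1))) * (2 * pi)"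
  proof (rule vderiv_bound[where y="%r. s (t + r) - \<epsilon> *\<^sub>R antider (%r. G (t + r) x) r"
     and y'="%r. \<epsilon> *\<^sub>R G (t + r) (fst (s (t + r))) - \<epsilon> *\<^sub>R G (t + r) x"])
   show "((%r. s (t + r) - \<epsilon> *\<^sub>R antider (%r. G (t + r) x) r) has_vector_derivative
     \<epsilon> *\<^sub>R G (t + r) (fst (s (t + r))) - \<epsilon> *\<^sub>R G (t + r) x) (at r)" for r
    by (rule has_vector_derivative_diff[OF vderiv_compose_shift[OF s]
      bounded_linear.has_vector_derivative[OF bounded_linear_scaleR_right antider_has_vector_derivative[OF cGs]]])
   fix r assume r: "0 <= r" "r <= 2 * pi"
   have "norm (fst (s (t + r)) - x) <= norm (s (t + r) - w t)"
    unfolding x_def using norm_fst_le_norm[of "s (t + r) - w t"] by simp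
   also have "... <= norm (s (t + r) - s t) + norm (s t - w t)" using norm_triangle_ineq[of "s (t + r) - s t" "s t - w t"] by simp
   also have "... <= 2 * c1" using near[OF r, of t] ws[of t] by (simp add: norm_minus_commute)
   finally have "K * norm (fst (s (t + r)) - x) <= K * (2 * c1)" using K by (intro mult_left_mono) auto
   then have "norm (G (t + r) (fst (s (t + r))) - G (t + r) x) <= K * (2 * c1)"
    using lip[of "t + r" "fst (s (t + r))" x] by linarith
   then show "norm (\<epsilon> *\<^sub>R G (t + r) (fst (s (t + r))) - \<epsilon> *\<^sub>R G (t + r) x) <= \<epsilon> * (K * (2 * c1))"
    using \<open>0 <= \<epsilon>\<close> by (simp add: scaleR_diff_right[symmetric] mult_left_mono)
  qed (use K c1 \<open>0 <= \<epsilon>\<close> in auto)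
  moreover have "w' t - \<epsilon> *\<^sub>R Gb x = (1 / (2 * pi)) *\<^sub>R ((s (t + 2 * pi) - \<epsilon> *\<^sub>R antider (%r. G (t + r) x) (2 * pi)) - (s (t + 0) - \<epsilon> *\<^sub>R antider (%r. G (t + r) x) 0))"
   unfolding w'_def m by (simp add: scaleR_diff_right)
  ultimately have "norm (w' t - \<epsilon> *\<^sub>R Gb x) <= \<epsilon> * (K * (2 * c1))" by (simp add: divide_le_eq)
  also have "... = 4 * pi * K * M * \<epsilon>\<^sup>2" by (simp add: c1_def power2_eq_square)
  finally show ?thesis by (simp add: x_def)
 qed
 show thesis using that[OF _ dw err] ws by (simp add: c1_def)
qed

context torus_field
begin

lemma flow_scaled_vderiv: "((%t. flow (\<epsilon> * t) x) has_vector_derivative \<epsilon> *\<^sub>R Y (flow (\<epsilon> * t) x)) (at t)"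
proof -
 have "((%t. \<epsilon> * t) has_vector_derivative \<epsilon>) (at t)" by (auto intro!: derivative_eq_intros)
 from vector_diff_chain_at[OF this flow_vderiv] show ?thesis by (simp add: o_def)
qed

text \<open>Errors of order \<epsilon>^2 accumulate to order \<epsilon> over times of order
  1/\<epsilon>. The reference point \<open>x\<close> is free: positions will be compared with the
  averaged orbit of the curve's own starting point, the gain with the closed orbit.\<close>

lemma shadowing:
 fixes w :: "real => (real ^ 'n) \<times> real" and dbar :: "real ^ 'n => real"
 assumes lipd: "!!x y. \<bar>dbar x - dbar y\<bar> <= K * norm (x - y)" and K: "0 <= K"
  and w: "!!t. (w has_vector_derivative w' t) (at t)"
  and err: "!!t. norm (w' t - \<epsilon> *\<^sub>R (Y (fst (w t)), dbar (fst (w t)))) <= C * \<epsilon>\<^sup>2" and C: "0 <= C" and "0 <= \<epsilon>"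
  and t: "0 <= t" "\<epsilon> * t <= T1"
 shows "norm (fst (w (t0 + t)) - flow (\<epsilon> * t) x) <= exp (L * T1) * (norm (fst (w t0) - x) + C * T1 * \<epsilon>)"
  "\<bar>snd (w (t0 + t)) - snd (w t0) - antider (%s. dbar (flow s x)) (\<epsilon> * t)\<bar>
   <= T1 * (C * \<epsilon> + K * (exp (L * T1) * (norm (fst (w t0) - x) + C * T1 * \<epsilon>)))"
proof -
 define \<delta> where "\<delta> = norm (fst (w t0) - x)"
 have T1: "0 <= T1" using t \<open>0 <= \<epsilon>\<close> by (meson mult_nonneg_nonneg order_trans)
 have ws: "((%r. w (t0 + r)) has_vector_derivative w' (t0 + r)) (at r)" for r by (rule vderiv_compose_shift[OF w])
 have dfst: "((%r. fst (w (t0 + r))) has_vector_derivative fst (w' (t0 + r))) (at r)" for r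
  by (rule bounded_linear.has_vector_derivative[OF bounded_linear_fst ws])
 have dsnd: "((%r. snd (w (t0 + r))) has_vector_derivative snd (w' (t0 + r))) (at r)" for r
  by (rule bounded_linear.has_vector_derivative[OF bounded_linear_snd ws])
 have e1: "norm (fst (w' r) - \<epsilon> *\<^sub>R Y (fst (w r))) <= C * \<epsilon>\<^sup>2" for r
  using norm_fst_le_norm[of "w' r - \<epsilon> *\<^sub>R (Y (fst (w r)), dbar (fst (w r)))"] err[of r] by simp
 have e2: "\<bar>snd (w' r) - \<epsilon> * dbar (fst (w r))\<bar> <= C * \<epsilon>\<^sup>2" for r
  using norm_snd_le_norm[of "w' r - \<epsilon> *\<^sub>R (Y (fst (w r)), dbar (fst (w r)))"] err[of r] by simp
 have pos: "norm (fst (w (t0 + r)) - flow (\<epsilon> * r) x) <= exp (L * T1) * (\<delta> + C * T1 * \<epsilon>)" if r: "0 <= r" "r <= t" for r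
 proof -
  have er: "\<epsilon> * r <= T1" using t r \<open>0 <= \<epsilon>\<close> by (meson mult_left_mono order_trans)
  have "norm (fst (w (t0 + r)) - flow (\<epsilon> * r) x) <= exp (\<epsilon> * L * r) * (norm (fst (w (t0 + 0)) - flow (\<epsilon> * 0) x) + C * \<epsilon>\<^sup>2 * r)"
  proof (rule gronwall[where y="%r. fst (w (t0 + r)) - flow (\<epsilon> * r) x"
     and y'="%r. fst (w' (t0 + r)) - \<epsilon> *\<^sub>R Y (flow (\<epsilon> * r) x)"])
   show "((%r. fst (w (t0 + r)) - flow (\<epsilon> * r) x) has_vector_derivative fst (w' (t0 + q)) - \<epsilon> *\<^sub>R Y (flow (\<epsilon> * q) x)) (at q)" for q
    by (rule has_vector_derivative_diff[OF dfst flow_scaled_vderiv])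
   show "norm (fst (w' (t0 + q)) - \<epsilon> *\<^sub>R Y (flow (\<epsilon> * q) x)) <= \<epsilon> * L * norm (fst (w (t0 + q)) - flow (\<epsilon> * q) x) + C * \<epsilon>\<^sup>2" for q
   proof -
    have "norm (fst (w' (t0 + q)) - \<epsilon> *\<^sub>R Y (flow (\<epsilon> * q) x)) <=
     norm (fst (w' (t0 + q)) - \<epsilon> *\<^sub>R Y (fst (w (t0 + q)))) + norm (\<epsilon> *\<^sub>R Y (fst (w (t0 + q))) - \<epsilon> *\<^sub>R Y (flow (\<epsilon> * q) x))"
     using norm_triangle_ineq[of "fst (w' (t0 + q)) - \<epsilon> *\<^sub>R Y (fst (w (t0 + q)))" "\<epsilon> *\<^sub>R Y (fst (w (t0 + q))) - \<epsilon> *\<^sub>R Y (flow (\<epsilon> * q) x)"] by simp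
    also have "norm (\<epsilon> *\<^sub>R Y (fst (w (t0 + q))) - \<epsilon> *\<^sub>R Y (flow (\<epsilon> * q) x)) <= \<epsilon> * (L * norm (fst (w (t0 + q)) - flow (\<epsilon> * q) x))"
     using \<open>0 <= \<epsilon>\<close> X_lip by (simp add: scaleR_diff_right[symmetric] mult_left_mono)
    finally show ?thesis using e1[of "t0 + q"] by simp
   qed
  qed (use r C Lpos \<open>0 <= \<epsilon>\<close> in auto)
  also have "... = exp (L * (\<epsilon> * r)) * (\<delta> + C * (\<epsilon> * r) * \<epsilon>)" by (simp add: \<delta>_def power2_eq_square mult_ac)
  also have "... <= exp (L * T1) * (\<delta> + C * T1 * \<epsilon>)"
   using er C Lpos \<open>0 <= \<epsilon>\<close> r T1 by (intro mult_mono add_mono mult_left_mono mult_right_mono) (auto simp: \<delta>_def)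
  finally show ?thesis .
 qed
 show "norm (fst (w (t0 + t)) - flow (\<epsilon> * t) x) <= exp (L * T1) * (norm (fst (w t0) - x) + C * T1 * \<epsilon>)"
  using pos[of t] t by (simp add: \<delta>_def)
 define R where "R = exp (L * T1) * (\<delta> + C * T1 * \<epsilon>)"
 have R: "0 <= R" using C T1 \<open>0 <= \<epsilon>\<close> by (simp add: R_def \<delta>_def)
 have cd: "continuous_on UNIV (%s. dbar (flow s x))"
 proof (rule continuous_on_compose2[of UNIV dbar])
  show "continuous_on UNIV dbar" using lipd by (intro continuous_on_lipschitz[of dbar K]) simp
 qed (auto intro: continuous_flow_time)
 have da: "((%r. antider (%s. dbar (flow s x)) (\<epsilon> * r)) has_vector_derivative \<epsilon> *\<^sub>R dbar (flow (\<epsilon> * r) x)) (at r)" for r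
 proof -
  have "((%t. \<epsilon> * t) has_vector_derivative \<epsilon>) (at r)" by (auto intro!: derivative_eq_intros)
  from vector_diff_chain_at[OF this antider_has_vector_derivative[OF cd]] show ?thesis by (simp add: o_def)
 qed
 have "norm ((snd (w (t0 + t)) - antider (%s. dbar (flow s x)) (\<epsilon> * t)) - (snd (w (t0 + 0)) - antider (%s. dbar (flow s x)) (\<epsilon> * 0))) <= (C * \<epsilon>\<^sup>2 + \<epsilon> * (K * R)) * t"
 proof (rule vderiv_bound[where y="%r. snd (w (t0 + r)) - antider (%s. dbar (flow s x)) (\<epsilon> * r)"
    and y'="%r. snd (w' (t0 + r)) - \<epsilon> *\<^sub>R dbar (flow (\<epsilon> * r) x)"])
  show "((%r. snd (w (t0 + r)) - antider (%s. dbar (flow s x)) (\<epsilon> * r)) has_vector_derivative snd (w' (t0 + r)) - \<epsilon> *\<^sub>R dbar (flow (\<epsilon> * r) x)) (at r)" for r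
   by (rule has_vector_derivative_diff[OF dsnd da])
  fix r assume r: "0 <= r" "r <= t"
  have "K * norm (fst (w (t0 + r)) - flow (\<epsilon> * r) x) <= K * R" using pos[OF r] K by (simp add: R_def mult_left_mono)
  then have "\<bar>dbar (fst (w (t0 + r))) - dbar (flow (\<epsilon> * r) x)\<bar> <= K * R" using lipd[of "fst (w (t0 + r))" "flow (\<epsilon> * r) x"] by linarith
  then have "\<epsilon> * \<bar>dbar (fst (w (t0 + r))) - dbar (flow (\<epsilon> * r) x)\<bar> <= \<epsilon> * (K * R)" using \<open>0 <= \<epsilon>\<close> by (rule mult_left_mono)
  moreover have "\<epsilon> * \<bar>dbar (fst (w (t0 + r))) - dbar (flow (\<epsilon> * r) x)\<bar> = \<bar>\<epsilon> * dbar (fst (w (t0 + r))) - \<epsilon> * dbar (flow (\<epsilon> * r) x)\<bar>"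
   using \<open>0 <= \<epsilon>\<close> by (simp add: right_diff_distrib[symmetric] abs_mult)
  ultimately show "norm (snd (w' (t0 + r)) - \<epsilon> *\<^sub>R dbar (flow (\<epsilon> * r) x)) <= C * \<epsilon>\<^sup>2 + \<epsilon> * (K * R)"
   using e2[of "t0 + r"] by simp
 qed (use t C K R \<open>0 <= \<epsilon>\<close> in auto)
 also have "(C * \<epsilon>\<^sup>2 + \<epsilon> * (K * R)) * t = (\<epsilon> * t) * (C * \<epsilon> + K * R)" by (simp add: algebra_simps power2_eq_square)
 also have "... <= T1 * (C * \<epsilon> + K * R)" using t C K R \<open>0 <= \<epsilon>\<close> by (intro mult_right_mono) auto
 finally show "\<bar>snd (w (t0 + t)) - snd (w t0) - antider (%s. dbar (flow s x)) (\<epsilon> * t)\<bar>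
   <= T1 * (C * \<epsilon> + K * (exp (L * T1) * (norm (fst (w t0) - x) + C * T1 * \<epsilon>)))"
  by (simp add: R_def \<delta>_def)
qed

text \<open>Following the averaged flow for the return time brings a curve back into the ball around the
 attracting orbit, while the second component gains a definite amount.\<close>

lemma source_growth:
 fixes dbar :: "real ^ 'n => real"
 assumes lipd: "!!x y. \<bar>dbar x - dbar y\<bar> <= K * norm (x - y)" and K: "0 <= K"
  and perd: "periodic dbar" and bd: "!!x. \<bar>dbar x\<bar> <= M" and C: "0 <= C"
  and pp: "periodic_point p T k" and ret: "!!h. norm (ret p T h) <= norm h / 4"
  and gain: "0 < antider (%s. dbar (flow s p)) T"
 obtains \<rho> c C' \<epsilon>0 where "0 < \<rho>" "0 < c" "0 < \<epsilon>0"
  "!!\<epsilon> w w' t. [|0 < \<epsilon>; \<epsilon> <= \<epsilon>0; !!t. (w has_vector_derivative w' t) (at t);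
   !!t. norm (w' t - \<epsilon> *\<^sub>R (Y (fst (w t)), dbar (fst (w t)))) <= C * \<epsilon>\<^sup>2;
   \<exists>q\<in>lattice. norm (fst (w 0) - q - p) <= \<rho>; 0 <= t|] ==> c * \<epsilon> * t - C' <= snd (w t) - snd (w 0)"
proof -
 have T: "T > 0" and k: "k \<in> lattice" "flow T p + k = p" using pp by (auto simp: periodic_point_def)
 have M: "0 <= M" using order_trans[OF abs_ge_zero bd] .
 \<comment> \<open>Half of the gain along the exact orbit; the other half is spent on
   errors.\<close>
 define a where "a = antider (%s. dbar (flow s p)) T / 2"
 have a: "a > 0" using gain by (simp add: a_def)
 \<comment> \<open>An upper bound for the resynchronized return time.\<close>
 define T1 where "T1 = T + 1"
 define E where "E = exp (L * T1)"
 have T1: "T1 > 0" "T <= T1" and E: "E > 0" using T by (simp_all add: T1_def E_def)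
 \<comment> \<open>Collects the constants of \<open>shadowing\<close>: over one return the gain is
   off by at most \<open>B * (\<rho> + \<epsilon>)\<close> and the position by at most
   \<open>B * \<epsilon>\<close>.\<close>
 define B where "B = T1 * (C + K * (E * (1 + C * T1))) + E * C * T1 + 1"
 have B1: "0 <= T1 * (C + K * (E * (1 + C * T1)))" "0 <= E * C * T1" using T1 E C K by simp_all
 then have B: "B > 0" by (simp add: B_def)
 define b where "b = norm (beta p) * exp (L * T) + 1"
 have b: "b > 0" by (simp add: b_def add_nonneg_pos)
 obtain \<rho>1 where \<rho>1: "\<rho>1 > 0" "!!x y. x \<in> cball p \<rho>1 ==> y \<in> cball p \<rho>1 ==>
  norm (Fmap p T k x - Fmap p T k y - bmat (ret p T) *v (x - y)) <= (1/4) * norm (x - y)"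
  using Fmap_strict[OF pp, of "1/4"] by auto
 \<comment> \<open>Within this radius \<open>Fmap\<close> contracts by 1/2, return times lie between
   \<open>T / 2\<close> and \<open>T1\<close>, and the errors caused by \<rho> cost at most
   \<open>a / 2\<close>.\<close>
 define \<rho> where "\<rho> = min \<rho>1 (min (min (T / 2) 1 / b) (a / (2 * (B + M * b))))"
 have BM: "B + M * b > 0" using B M b by (simp add: add_pos_nonneg)
 have \<rho>: "\<rho> > 0" "\<rho> <= \<rho>1" "b * \<rho> <= T / 2" "b * \<rho> <= 1" "(B + M * b) * \<rho> <= a / 2"
 proof -
  show "\<rho> > 0" using \<rho>1 T b a BM by (simp add: \<rho>_def)
  show "\<rho> <= \<rho>1" by (simp add: \<rho>_def)
  have 1: "\<rho> <= min (T / 2) 1 / b" "\<rho> <= a / (2 * (B + M * b))" unfolding \<rho>_def by linarith+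
  have "b * \<rho> <= b * (min (T / 2) 1 / b)" using 1(1) b by (intro mult_left_mono) auto
  then have "b * \<rho> <= min (T / 2) 1" using b by simp
  then show "b * \<rho> <= T / 2" "b * \<rho> <= 1" by linarith+
  have "(B + M * b) * \<rho> <= (B + M * b) * (a / (2 * (B + M * b)))" using 1(2) BM by (intro mult_left_mono) auto
  also have "... = a / 2"
  proof -
   have "Q * (a / (2 * Q)) = a / 2" if "Q > 0" for Q using that by simp
   then show ?thesis using BM by blast
  qed
  finally show "(B + M * b) * \<rho> <= a / 2" .
 qed
 \<comment> \<open>Keeps the errors caused by \<epsilon> below \<open>a / 2\<close> in the gain and
   \<open>\<rho> / 2\<close> in position; the bound \<open>T / 2\<close> makes every return last at
   least one unit of the original time.\<close>
 define \<epsilon>0 where "\<epsilon>0 = min (min (a / (2 * B)) (\<rho> / (2 * B))) (T / 2)"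
 have \<epsilon>0: "\<epsilon>0 > 0" "B * \<epsilon>0 <= a / 2" "B * \<epsilon>0 <= \<rho> / 2" "\<epsilon>0 <= T / 2"
 proof -
  show "\<epsilon>0 > 0" using a B \<rho> T by (simp add: \<epsilon>0_def)
  have 1: "\<epsilon>0 <= a / (2 * B)" "\<epsilon>0 <= \<rho> / (2 * B)" "\<epsilon>0 <= T / 2" unfolding \<epsilon>0_def by linarith+
  show "\<epsilon>0 <= T / 2" by (rule 1)
  have "B * \<epsilon>0 <= B * (a / (2 * B))" by (rule mult_left_mono[OF 1(1)]) (use B in simp)
  moreover have "B * \<epsilon>0 <= B * (\<rho> / (2 * B))" by (rule mult_left_mono[OF 1(2)]) (use B in simp)
  ultimately show "B * \<epsilon>0 <= a / 2" "B * \<epsilon>0 <= \<rho> / 2" using B by auto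
 qed
 \<comment> \<open>A return gains at least \<open>a\<close> and takes at most the slow time
   \<open>T1\<close>.\<close>
 define c where "c = a / T1"
 have c: "c > 0" "c * T1 = a" using a T1 by (auto simp: c_def)
 \<comment> \<open>Pays for the last, incomplete return.\<close>
 define C' where "C' = (M + C * T1) * T1 + c * T1"
 have C'1: "0 <= (M + C * T1) * T1" using M C T1 by simp
 have Fp: "Fmap p T k p = p" by (simp add: Fmap_def k resync_def)
 have key: "c * \<epsilon> * (t - t0) - C' <= snd (w t) - snd (w t0)"
  if \<epsilon>: "0 < \<epsilon>" "\<epsilon> <= \<epsilon>0" and w: "!!t. (w has_vector_derivative w' t) (at t)"
   and err: "!!t. norm (w' t - \<epsilon> *\<^sub>R (Y (fst (w t)), dbar (fst (w t)))) <= C * \<epsilon>\<^sup>2"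
   and "\<exists>q\<in>lattice. norm (fst (w t0) - q - p) <= \<rho>" "t0 <= t" "t <= t0 + real N" for \<epsilon> w w' t t0 N
  using that(5-)
 \<comment> \<open>\<open>N\<close> bounds the remaining time. Each return uses up at least one unit
   of it and ends in the ball around a translate of \<open>p\<close>.\<close>
 proof (induction N arbitrary: t0)
  case 0
  then have "t = t0" by simp
  moreover have "0 <= C'" unfolding C'_def using C'1 c(2) a by linarith
  ultimately show ?case by simp
 next
  case (Suc N)
  obtain q where q: "q \<in> lattice" "norm (fst (w t0) - q - p) <= \<rho>" using Suc.prems(1) by blast
  have \<epsilon>1: "\<epsilon> <= T / 2" "B * \<epsilon> <= a / 2" "B * \<epsilon> <= \<rho> / 2"
   using \<epsilon> \<epsilon>0 mult_left_mono[OF \<epsilon>(2), of B] B by linarith+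
  define y where "y = fst (w t0) - q"
  define R where "R = beta p \<bullet> (flow T y + k - p)"
  have R: "\<bar>R\<bar> <= b * \<rho>"
  proof -
   have "flow T y + k - p = flow T y - flow T p" using k(2) by (simp add: algebra_simps)
   then have "\<bar>R\<bar> <= norm (beta p) * norm (flow T y - flow T p)" unfolding R_def using Cauchy_Schwarz_ineq2 by metis
   also have "... <= norm (beta p) * (exp (L * T) * norm (y - p))"
    using flow_lip[of T y p] T by (intro mult_left_mono) auto
   also have "... <= norm (beta p) * (exp (L * T) * \<rho>)" using q(2) by (intro mult_left_mono) (auto simp: y_def)
   also have "... <= b * \<rho>" using \<rho>(1) by (simp add: b_def distrib_right)
   finally show ?thesis .
  qed
  \<comment> \<open>\<open>Fmap\<close> fixes its own return time depending on \<open>y\<close>;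
    following the averaged flow for exactly this time lands on a translate of
    \<open>Fmap p T k y\<close>.\<close>
  define \<tau> where "\<tau> = T - R"
  have \<tau>: "T / 2 <= \<tau>" "\<tau> <= T1" "0 < \<tau>" using R \<rho>(3,4) T unfolding \<tau>_def T1_def by linarith+
  define h where "h = \<tau> / \<epsilon>"
  have h: "\<epsilon> * h = \<tau>" "h >= 1" using \<epsilon> \<epsilon>1(1) \<tau> by (auto simp: h_def le_divide_eq)
  note sh = shadowing[OF lipd K w err C less_imp_le[OF \<epsilon>(1)]]
  show ?case
  proof (cases "t - t0 <= h")
   case True
   have te: "0 <= \<epsilon> * (t - t0)" "\<epsilon> * (t - t0) <= T1"
   proof -
    show "0 <= \<epsilon> * (t - t0)" using \<epsilon> Suc.prems(2) by simp
    have "\<epsilon> * (t - t0) <= \<epsilon> * h" using True \<epsilon> by (intro mult_left_mono) auto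
    then show "\<epsilon> * (t - t0) <= T1" using h \<tau> by simp
   qed
   have "norm (snd (w (t0 + (t - t0))) - snd (w (t0 + 0))) <= (\<epsilon> * M + C * \<epsilon>\<^sup>2) * (t - t0)"
   proof (rule vderiv_bound[where y="%r. snd (w (t0 + r))"])
    show "((%r. snd (w (t0 + r))) has_vector_derivative snd (w' (t0 + r))) (at r)" for r
     by (rule bounded_linear.has_vector_derivative[OF bounded_linear_snd vderiv_compose_shift[OF w]])
    show "norm (snd (w' (t0 + r))) <= \<epsilon> * M + C * \<epsilon>\<^sup>2" for r
    proof -
     have "\<bar>snd (w' (t0 + r)) - \<epsilon> * dbar (fst (w (t0 + r)))\<bar> <= C * \<epsilon>\<^sup>2"
      using norm_snd_le_norm[of "w' (t0 + r) - \<epsilon> *\<^sub>R (Y (fst (w (t0 + r))), dbar (fst (w (t0 + r))))"] err[of "t0 + r"] by simp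
     moreover have "\<bar>\<epsilon> * dbar (fst (w (t0 + r)))\<bar> <= \<epsilon> * M" using bd \<epsilon> by (simp add: abs_mult)
     ultimately show ?thesis by simp
    qed
   qed (use Suc.prems(2) \<epsilon> M C in auto)
   moreover have "(\<epsilon> * M + C * \<epsilon>\<^sup>2) * (t - t0) = (M + C * \<epsilon>) * (\<epsilon> * (t - t0))" by (simp add: algebra_simps power2_eq_square)
   moreover have "(M + C * \<epsilon>) * (\<epsilon> * (t - t0)) <= (M + C * T1) * T1"
    using te M C T1 \<epsilon> \<epsilon>1(1) T by (intro mult_mono add_mono mult_left_mono) (auto simp: T1_def)
   ultimately have 1: "- ((M + C * T1) * T1) <= snd (w t) - snd (w t0)" by simp
   have 2: "c * \<epsilon> * (t - t0) <= c * T1" using mult_left_mono[OF te(2), of c] c(1) by (simp add: mult.assoc)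
   show ?thesis using 1 2 unfolding C'_def by linarith
  next
   case False
   have q': "q - k \<in> lattice" using q k lattice_diff by blast
   have yb: "y \<in> cball p \<rho>1" "p \<in> cball p \<rho>1" using q(2) \<rho> \<rho>1 by (auto simp: y_def dist_norm norm_minus_commute)
   have "norm (Fmap p T k y - p) <= norm (y - p) / 2"
   proof -
    have "norm (Fmap p T k y - p) <= norm (Fmap p T k y - Fmap p T k p - ret p T (y - p)) + norm (ret p T (y - p))"
     using norm_triangle_ineq[of "Fmap p T k y - Fmap p T k p - ret p T (y - p)" "ret p T (y - p)"] by (simp add: Fp)
    also have "... <= (1/4) * norm (y - p) + norm (y - p) / 4" using \<rho>1(2)[OF yb] ret[of "y - p"] by simp
    finally show ?thesis by simp
   qed
   then have F2: "norm (Fmap p T k y - p) <= \<rho> / 2" using q(2) by (simp add: y_def)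
   have Fy: "Fmap p T k y = flow \<tau> y + k" using Fmap_orbit[OF k(1)] by (simp add: \<tau>_def R_def)
   have fl: "flow \<tau> (fst (w t0)) = flow \<tau> y + q"
    using flow_lattice[OF q(1), of \<tau> y] by (simp add: y_def)
   have h0: "0 <= h" "\<epsilon> * h <= T1" using h \<tau> by auto
   have "norm (fst (w (t0 + h)) - flow \<tau> (fst (w t0))) <= E * (C * T1 * \<epsilon>)"
    using sh(1)[OF h0, of t0 "fst (w t0)"] by (simp add: h E_def)
   also have "... <= B * \<epsilon>"
   proof -
    have "E * C * T1 <= B" using B1 by (simp add: B_def)
    then have "E * C * T1 * \<epsilon> <= B * \<epsilon>" using \<epsilon> by (intro mult_right_mono) auto
    then show ?thesis by (simp add: mult.assoc)
   qed
   finally have g: "norm (fst (w (t0 + h)) - (flow \<tau> y + q)) <= \<rho> / 2" using \<epsilon>1(3) fl by simp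
   have e: "fst (w (t0 + h)) - (q - k) - p = (fst (w (t0 + h)) - (flow \<tau> y + q)) + (Fmap p T k y - p)" by (simp add: Fy)
   have "norm (fst (w (t0 + h)) - (q - k) - p) <= \<rho>"
    unfolding e using norm_triangle_ineq[of "fst (w (t0 + h)) - (flow \<tau> y + q)" "Fmap p T k y - p"] F2 g by linarith
   then have "\<exists>q\<in>lattice. norm (fst (w (t0 + h)) - q - p) <= \<rho>" using q' by blast
   from Suc.IH[OF this] have IH: "c * \<epsilon> * (t - (t0 + h)) - C' <= snd (w t) - snd (w (t0 + h))"
    using False Suc.prems h(2) by simp
   have dq: "dbar (flow s (p + q)) = dbar (flow s p)" for s
    using flow_lattice[OF q(1), of s p] periodic_lattice[OF perd q(1)] by simp
   have pq: "norm (fst (w t0) - (p + q)) <= \<rho>" using q(2) by (simp add: algebra_simps)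
   have "\<bar>snd (w (t0 + h)) - snd (w t0) - antider (%s. dbar (flow s p)) \<tau>\<bar>
    <= T1 * (C * \<epsilon> + K * (E * (norm (fst (w t0) - (p + q)) + C * T1 * \<epsilon>)))"
    using sh(2)[OF h0, of t0 "p + q"] by (simp add: h E_def dq)
   also have "... <= T1 * (C * (\<rho> + \<epsilon>) + K * (E * ((\<rho> + \<epsilon>) + C * T1 * (\<rho> + \<epsilon>))))"
    using pq T1 C K E \<rho>(1) \<epsilon> by (intro mult_left_mono add_mono) auto
   also have "... = (T1 * (C + K * (E * (1 + C * T1)))) * (\<rho> + \<epsilon>)" by (simp add: algebra_simps)
   also have "... <= B * (\<rho> + \<epsilon>)" using B1 \<rho>(1) \<epsilon> by (intro mult_right_mono) (auto simp: B_def)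
   finally have g1: "\<bar>snd (w (t0 + h)) - snd (w t0) - antider (%s. dbar (flow s p)) \<tau>\<bar> <= B * (\<rho> + \<epsilon>)" .
   have cd: "continuous_on UNIV (%s. dbar (flow s p))"
   proof (rule continuous_on_compose2[of UNIV dbar])
    show "continuous_on UNIV dbar" using lipd by (intro continuous_on_lipschitz[of dbar K]) simp
   qed (auto intro: continuous_flow_time)
   have "norm (antider (%s. dbar (flow s p)) \<tau> - antider (%s. dbar (flow s p)) T) <= M * norm (\<tau> - T)"
   proof (rule differentiable_bound[of UNIV _ "%s h. h *\<^sub>R dbar (flow s p)"])
    show "(antider (%s. dbar (flow s p)) has_derivative (%h. h *\<^sub>R dbar (flow s p))) (at s within UNIV)" for s
     using antider_has_vector_derivative[OF cd] by (simp add: has_vector_derivative_def)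
    show "onorm (%h. h *\<^sub>R dbar (flow s p)) <= M" for s
    proof (rule onorm_le)
     show "norm (h *\<^sub>R dbar (flow s p)) <= M * norm h" for h
      using mult_right_mono[OF bd, of "\<bar>h\<bar>" "flow s p"] by (simp add: abs_mult mult.commute)
    qed
   qed auto
   then have g2: "\<bar>antider (%s. dbar (flow s p)) \<tau> - 2 * a\<bar> <= M * \<bar>R\<bar>" by (simp add: \<tau>_def a_def)
   have g3: "M * \<bar>R\<bar> <= M * (b * \<rho>)" using R M by (rule mult_left_mono)
   have "B * (\<rho> + \<epsilon>) + M * (b * \<rho>) = (B + M * b) * \<rho> + B * \<epsilon>" by (simp add: algebra_simps)
   then have "a <= snd (w (t0 + h)) - snd (w t0)" using g1 g2 g3 \<rho>(5) \<epsilon>1(2) by linarith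
   moreover have "c * \<epsilon> * h <= a"
   proof -
    have "c * \<tau> <= c * T1" using c \<tau> by (intro mult_left_mono) auto
    then show ?thesis using c h by (simp add: mult.assoc)
   qed
   moreover have "c * \<epsilon> * (t - t0) = c * \<epsilon> * (t - (t0 + h)) + c * \<epsilon> * h" by (simp add: algebra_simps)
   ultimately show ?thesis using IH by linarith
  qed
 qed
 have "c * \<epsilon> * t - C' <= snd (w t) - snd (w 0)"
  if "0 < \<epsilon>" "\<epsilon> <= \<epsilon>0" "!!t. (w has_vector_derivative w' t) (at t)"
   "!!t. norm (w' t - \<epsilon> *\<^sub>R (Y (fst (w t)), dbar (fst (w t)))) <= C * \<epsilon>\<^sup>2"
   "\<exists>q\<in>lattice. norm (fst (w 0) - q - p) <= \<rho>" "0 <= t" for \<epsilon> w w' t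
  using key[OF that(1-4), of 0 t "nat \<lceil>t\<rceil>"] that(5,6) by (simp add: of_nat_nat) 
 then show thesis using that[OF \<rho>(1) c(1) \<epsilon>0(1)] by blast
qed

end

section \<open>The transport equation\<close>

lemma Ck_trig: "Ck m (%x :: real ^ 'n. a * cos (\<xi> \<bullet> x) + b * sin (\<xi> \<bullet> x))"
proof (induction m arbitrary: a b)
 case 0
 show ?case by (simp add: continuous_intros)
next
 case (Suc m)
 have d: "((%x :: real ^ 'n. a * cos (\<xi> \<bullet> x) + b * sin (\<xi> \<bullet> x)) has_derivative
   (%h. (b * (\<xi> \<bullet> h)) * cos (\<xi> \<bullet> x) + (- a * (\<xi> \<bullet> h)) * sin (\<xi> \<bullet> x))) (at x)" for x
  by (auto intro!: derivative_eq_intros simp: algebra_simps)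
 have f: "frechet_derivative (%x :: real ^ 'n. a * cos (\<xi> \<bullet> x) + b * sin (\<xi> \<bullet> x)) (at x) v
   = (b * (\<xi> \<bullet> v)) * cos (\<xi> \<bullet> x) + (- a * (\<xi> \<bullet> v)) * sin (\<xi> \<bullet> x)" for x v
  using fun_cong[OF frechet_derivative_at[OF d[of x]], of v] by simp
 show ?case unfolding Ck.simps f
 proof (intro conjI allI)
  show "(%x :: real ^ 'n. a * cos (\<xi> \<bullet> x) + b * sin (\<xi> \<bullet> x)) differentiable (at x)" for x
   using d[of x] unfolding differentiable_def by blast
 qed (rule Suc.IH)
qed

lemma smooth_character: "smooth (%x. Re (character k x))" "smooth (%x. Im (character k x))"
 using Ck_trig[of _ 1 "frequency k" 0] Ck_trig[of _ 0 "frequency k" 1] by (simp_all add: smooth_def character_def)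

text \<open>Test functions of the weak equation are real, characters are complex; integrals are
  split accordingly.\<close>

lemma cell_integral_complex:
 fixes u :: "real ^ 'n => complex"
 assumes u: "u \<in> L2_torus" and h: "continuous_on UNIV h" "periodic h"
 shows "set_integrable lebesgue cell (%x. u x * h x)"
  "cell_integral (%x. u x * h x) = pairing u (%x. Re (h x)) + \<i> * pairing u (%x. Im (h x))"
proof -
 have c: "continuous_on UNIV (%x. Re (h x))" "continuous_on UNIV (%x. Im (h x))" by (intro continuous_intros h)+
 have p: "periodic (%x. Re (h x))" "periodic (%x. Im (h x))"
  using periodic_comp[OF h(2), of Re] periodic_comp[OF h(2), of Im] by simp_all
 obtain B1 where B1: "!!x. \<bar>Re (h x)\<bar> <= B1" using continuous_periodic_bounded[OF c(1) p(1)] by blast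
 obtain B2 where B2: "!!x. \<bar>Im (h x)\<bar> <= B2" using continuous_periodic_bounded[OF c(2) p(2)] by blast
 have i: "set_integrable lebesgue cell (%x. u x * of_real (Re (h x)))" "set_integrable lebesgue cell (%x. \<i> * (u x * of_real (Im (h x))))"
  by (intro norm_pairing_le(1)[OF u c(1) B1] set_integrable_mult_right norm_pairing_le(1)[OF u c(2) B2])+
 have e: "u x * h x = u x * of_real (Re (h x)) + \<i> * (u x * of_real (Im (h x)))" for x
  using complex_eq[of "h x"] by (metis distrib_left mult.left_commute)
 show "set_integrable lebesgue cell (%x. u x * h x)" unfolding e by (rule set_integral_add(1)[OF i])
 have "cell_integral (%x. u x * h x) = cell_integral (%x. u x * of_real (Re (h x))) + cell_integral (%x. \<i> * (u x * of_real (Im (h x))))"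
  unfolding e by (rule set_integral_add(2)[OF i])
 then show "cell_integral (%x. u x * h x) = pairing u (%x. Re (h x)) + \<i> * pairing u (%x. Im (h x))"
  by (simp add: pairing_def)
qed

lemma divergence_scaled:
 assumes a: "(a has_derivative a') (at x)" and f: "(f has_derivative f') (at x)"
 shows "divergence (%y. f y *\<^sub>R a y) x = f x * divergence a x + (\<Sum>i\<in>UNIV. f' (axis i 1) * a x $ i)"
proof -
 have "((%y. f y *\<^sub>R a y) has_derivative (%h. f x *\<^sub>R a' h + f' h *\<^sub>R a x)) (at x)"
  by (rule has_derivative_scaleR[OF f a])
 from frechet_derivative_at[OF this]
 have 1: "frechet_derivative (%y. f y *\<^sub>R a y) (at x) h = f x *\<^sub>R a' h + f' h *\<^sub>R a x" for h
  by (metis (no_types, lifting))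
 have 2: "frechet_derivative a (at x) h = a' h" for h using frechet_derivative_at[OF a] by simp
 show ?thesis unfolding divergence_def 1 2 by (simp add: sum.distrib sum_distrib_left)
qed

text \<open>Weights are transported by a flow known to be once differentiable, so they are C1 and
  are not themselves admissible as test functions. \<open>w'\<close> is the joint derivative in time
  and space.\<close>

locale C1_weight =
 fixes w :: "real => real ^ 'n => real" and w' :: "real \<times> (real ^ 'n) => real \<times> (real ^ 'n) => real"
 assumes w: "((%(t, x). w t x) has_derivative w' p) (at p)"
  and cont_w': "continuous_on UNIV (%p. w' p v)" and periodic_w: "periodic (w t)"
begin

definition "wt t x = w' (t, x) (1, 0)"
definition "wx i t x = w' (t, x) (0, axis i 1)"

lemma cont_w: "continuous_on UNIV (%(t, x). w t x)"
 using w has_derivative_continuous by (blast intro: continuous_at_imp_continuous_on)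

lemma continuous_slice: "continuous_on UNIV (%(t, x). f t x) ==> continuous_on UNIV (f t)"
proof -
 assume f: "continuous_on UNIV (%(t, x). f t x)"
 have "continuous_on UNIV (%x. (t, x))" by (intro continuous_intros)
 from continuous_on_compose2[OF f this] show ?thesis by simp
qed

lemma cont_wt: "continuous_on UNIV (%(t, x). wt t x)" and cont_wx: "continuous_on UNIV (%(t, x). wx i t x)"
 using cont_w'[of "(1, 0)"] cont_w'[of "(0, axis i 1)"] by (simp_all add: wt_def wx_def split_beta)

lemma w'_lattice:
 assumes "c \<in> lattice" shows "w' (t, x + c) = w' (t, x)"
proof -
 have "((%p. p + (0, c)) has_derivative (%h. h)) (at (t, x))" by (auto intro!: derivative_eq_intros)
 moreover have "((%(t, x). w t x) has_derivative w' ((t, x) + (0, c))) (at ((t, x) + (0, c)))" by (rule w)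
 ultimately have "((%p. (%(t, x). w t x) (p + (0, c))) has_derivative (%h. w' ((t, x) + (0, c)) h)) (at (t, x))"
  by (rule has_derivative_compose)
 moreover have "(%p. (%(t, x). w t x) (p + (0, c))) = (%(t, x). w t x)"
  using periodic_lattice[OF periodic_w assms] by auto
 ultimately have "((%(t, x). w t x) has_derivative w' (t, x + c)) (at (t, x))" by simp
 then show ?thesis by (rule has_derivative_unique[OF _ w])
qed

lemma periodic_wt: "periodic (wt t)" and periodic_wx: "periodic (wx i t)"
 by (simp_all add: periodic_def wt_def wx_def w'_lattice axis_lattice)

lemma w_x_derivative: "(w t has_derivative (%h. w' (t, x) (0, h))) (at x)"
proof -
 have "((%x. (t, x)) has_derivative (%h. (0, h))) (at x)" by (auto intro!: derivative_eq_intros)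
 from has_derivative_compose[OF this w] show ?thesis by simp
qed

lemma w_t_derivative: "((%t. w t x) has_vector_derivative wt t x) (at t)"
proof -
 have "((%t. (t, x)) has_derivative (%h. (h, 0))) (at t)" by (auto intro!: derivative_eq_intros)
 from has_derivative_compose[OF this w]
 have "((%t. w t x) has_derivative (%h. w' (t, x) (h, 0))) (at t)" by simp
 moreover have "w' (t, x) (h, 0) = h *\<^sub>R wt t x" for h
  using linear_scale[OF bounded_linear.linear[OF has_derivative_bounded_linear[OF w[of "(t, x)"]]], of h "(1, 0)"]
  by (simp add: wt_def)
 ultimately show ?thesis by (simp add: has_vector_derivative_def)
qed

lemma w'_split: "w' (t, x) (1, - v) = wt t x - (\<Sum>i\<in>UNIV. v $ i * wx i t x)"
proof -
 have lin: "linear (w' (t, x))" using bounded_linear.linear[OF has_derivative_bounded_linear[OF w]] .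
 have v: "(\<Sum>i\<in>UNIV. (v $ i) *\<^sub>R axis i (1::real)) = v"
  using basis_expansion[of v] by (simp add: scalar_mult_eq_scaleR)
 have "(1 :: real, - v) = (1, 0) - (\<Sum>i\<in>UNIV. (v $ i) *\<^sub>R (0, axis i 1))"
  by (simp add: prod_eq_iff fst_sum snd_sum v)
 then have "w' (t, x) (1, - v) = w' (t, x) (1, 0) - (\<Sum>i\<in>UNIV. (v $ i) *\<^sub>R w' (t, x) (0, axis i 1))"
  using linear_diff[OF lin] linear_sum[OF lin] linear_scale[OF lin] by (simp only: linear_scale[OF lin, symmetric] linear_sum[OF lin, symmetric])
 then show ?thesis by (simp add: wt_def wx_def)
qed

lemma integral_w_derivative:
 "((%t. integral cell (w t)) has_vector_derivative integral cell (wt t)) (at t)"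
proof -
 have "((%t. integral (cbox 0 (\<chi> i. 2 * pi)) (w t)) has_vector_derivative integral (cbox 0 (\<chi> i. 2 * pi)) (wt t)) (at t within UNIV)"
 proof (rule leibniz_rule_vector_derivative)
  show "w t integrable_on cbox 0 (\<chi> i. 2 * pi)" for t
   by (intro integrable_continuous continuous_on_subset[OF continuous_slice[OF cont_w]]) auto
  show "continuous_on (UNIV \<times> cbox 0 (\<chi> i. 2 * pi)) (%(t, x). wt t x)"
   by (rule continuous_on_subset[OF cont_wt]) auto
 qed (use w_t_derivative in auto)
 then show ?thesis by (simp add: cell_def)
qed

text \<open>The equation says that the time derivative of \<open>w\<close> is the divergence of the
  field \<open>w a\<close>, whose integral over the cell vanishes.\<close>

lemma integral_conserved:
 fixes a :: "real => real ^ 'n => real ^ 'n"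
 assumes a: "!!t x. (a t has_derivative a' t x) (at x)" and pa: "!!t. periodic (a t)"
  and ca': "!!t h. continuous_on UNIV (%x. a' t x h)"
  and pde: "!!t x. w' (t, x) (1, - a t x) = divergence (a t) x * w t x"
 shows "integral cell (w t) = integral cell (w 0)"
proof -
 have ca: "continuous_on UNIV (a t)" for t
  using a has_derivative_continuous by (blast intro: continuous_at_imp_continuous_on)
 have "integral cell (wt t) = 0" for t
 proof -
  define g where "g i x = a t x $ i * w t x" for i x
  define g' where "g' i x h = a t x $ i * w' (t, x) (0, h) + (a' t x h $ i) * w t x" for i x h
  have dg: "(g i has_derivative g' i x) (at x)" for i x unfolding g_def g'_def
   by (rule has_derivative_mult[OF bounded_linear.has_derivative[OF bounded_linear_vec_nth a] w_x_derivative])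
  have cg: "continuous_on UNIV (%x. g' i x (axis i 1))" for i unfolding g'_def wx_def[symmetric]
   by (intro continuous_intros ca ca' continuous_slice[OF cont_wx] continuous_slice[OF cont_w])
  have pg: "periodic (g i)" for i using pa[of t] periodic_w[of t] by (simp add: g_def periodic_def)
  have 0: "integral cell (%x. g' i x (axis i 1)) = 0" for i by (rule integral_cell_derivative_eq_0[OF dg pg cg])
  have "wt t x = (\<Sum>i\<in>UNIV. g' i x (axis i 1))" for x
  proof -
   have "frechet_derivative (a t) (at x) = a' t x" using frechet_derivative_at[OF a] by simp
   then have "divergence (a t) x * w t x = (\<Sum>i\<in>UNIV. (a' t x (axis i 1) $ i) * w t x)"
    by (simp add: divergence_def sum_distrib_right)
   then show ?thesis using pde[of t x] unfolding w'_split g'_def by (simp add: sum.distrib wx_def)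
  qed
  then have "integral cell (wt t) = integral cell (%x. \<Sum>i\<in>UNIV. g' i x (axis i 1))" by presburger
  also have "... = (\<Sum>i\<in>UNIV. integral cell (%x. g' i x (axis i 1)))"
   by (rule integral_sum) (use integrable_cell(2)[OF cg] in auto)
  finally show ?thesis using 0 by simp
 qed
 then have "((%t. integral cell (w t)) has_vector_derivative 0) (at t)" for t
  using integral_w_derivative[of t] by simp
 then show ?thesis by (rule vderiv_zero_const)
qed

definition "wc t k = fourier_coeff (%x. complex_of_real (w t x)) k"

lemma wc_integral:
 assumes "continuous_on UNIV f"
 shows "torus_vol TYPE('n) * fourier_coeff (%x :: real ^ 'n. complex_of_real (f x)) k = integral cell (%x. of_real (f x) * character (- k) x)"
proof -
 have "continuous_on UNIV (%x. complex_of_real (f x) * character (- k) x)"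
  by (intro continuous_on_mult continuous_on_of_real assms continuous_character)
 then show ?thesis by (simp add: fourier_coeff_character_integral(1)[symmetric] integrable_cell(3))
qed

lemma wc_derivative:
 "((%t. wc t k) has_vector_derivative fourier_coeff (%x. complex_of_real (wt t x)) k) (at t)"
proof -
 define v where "v = complex_of_real (torus_vol TYPE('n))"
 have v: "v ~= 0" using torus_vol_pos[where 'n='n] by (simp add: v_def)
 have "((%t. integral (cbox 0 (\<chi> i. 2 * pi)) (%x. of_real (w t x) * character (- k) x)) has_vector_derivative
   integral (cbox 0 (\<chi> i. 2 * pi)) (%x. of_real (wt t x) * character (- k) x)) (at t within UNIV)"
 proof (rule leibniz_rule_vector_derivative)
  show "((%t. of_real (w t x) * character (- k) x) has_vector_derivative of_real (wt t x) * character (- k) x) (at t within UNIV)" for t x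
   by (intro has_vector_derivative_mult_left has_vector_derivative_of_real)
    (use w_t_derivative in \<open>simp add: has_real_derivative_iff_has_vector_derivative\<close>)
  show "(%x. of_real (w t x) * character (- k) x) integrable_on cbox 0 (\<chi> i. 2 * pi)" for t
   by (intro integrable_continuous continuous_on_mult continuous_on_of_real continuous_character
     continuous_on_subset[OF continuous_slice[OF cont_w]]) auto
  show "continuous_on (UNIV \<times> cbox 0 (\<chi> i. 2 * pi)) (%(t, x). of_real (wt t x) * character (- k) x)"
   unfolding split_beta
   by (intro continuous_on_mult continuous_on_of_real continuous_on_compose2[OF continuous_character[of UNIV]] continuous_intros
     continuous_on_subset[OF cont_wt[unfolded split_beta]]) auto
 qed auto
 then have "((%t. v * wc t k) has_vector_derivative v * fourier_coeff (%x. complex_of_real (wt t x)) k) (at t)"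
  unfolding v_def wc_def wc_integral[OF continuous_slice[OF cont_w]] wc_integral[OF continuous_slice[OF cont_wt]]
  by (simp add: cell_def)
 from has_vector_derivative_mult_right[OF this, of "1 / v"] show ?thesis using v by simp
qed

lemma wc_wx: "fourier_coeff (%x. complex_of_real (wx i t x)) k = \<i> * of_int (k $ i) * wc t k"
proof -
 define v where "v = complex_of_real (torus_vol TYPE('n))"
 have v: "v ~= 0" using torus_vol_pos[where 'n='n] by (simp add: v_def)
 define g where "g x = complex_of_real (w t x) * character (- k) x" for x
 define g' where "g' x h = of_real (w t x) * (\<i> * of_real (frequency (- k) \<bullet> h) * character (- k) x) + of_real (w' (t, x) (0, h)) * character (- k) x" for x h
 have cw: "continuous_on UNIV (w t)" "continuous_on UNIV (wx i t)"
  by (intro continuous_slice[OF cont_w] continuous_slice[OF cont_wx])+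
 have dg: "(g has_derivative g' x) (at x)" for x unfolding g_def g'_def
  by (rule has_derivative_mult[OF has_derivative_of_real[OF w_x_derivative] character_has_derivative])
 have fk: "frequency (- k) \<bullet> axis i 1 = - of_int (k $ i)" by (simp add: inner_axis frequency_def)
 have ge: "g' x (axis i 1) = of_real (wx i t x) * character (- k) x - (\<i> * of_int (k $ i)) * (of_real (w t x) * character (- k) x)" for x
  unfolding g'_def fk wx_def by (simp add: algebra_simps)
 have "periodic g" using periodic_w[of t] periodic_character[of "- k"] by (simp add: g_def periodic_def)
 moreover have "continuous_on UNIV (%x. g' x (axis i 1))"
  unfolding ge by (intro continuous_intros cw continuous_character)
 ultimately have "integral cell (%x. g' x (axis i 1)) = 0" by (rule integral_cell_derivative_eq_0[OF dg])
 moreover have "integral cell (%x. g' x (axis i 1)) = integral cell (%x. of_real (wx i t x) * character (- k) x)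
   - (\<i> * of_int (k $ i)) * integral cell (%x. of_real (w t x) * character (- k) x)"
  unfolding ge by (subst integral_diff) (auto intro!: integrable_cell(2) continuous_intros cw continuous_character)
 ultimately have "v * fourier_coeff (%x. complex_of_real (wx i t x)) k = v * (\<i> * of_int (k $ i) * wc t k)"
  unfolding wc_def v_def mult.left_commute[of "complex_of_real (torus_vol TYPE('n))"] wc_integral[OF cw(1)] wc_integral[OF cw(2)] by simp
 then show ?thesis using v by simp
qed

text \<open>Duality: a weak solution is tested against the mollified weight, a trigonometric polynomial whose
 coefficients depend on time; the defect in the adjoint equation tends to zero uniformly.\<close>

lemma transport_duality:
 fixes u :: "real => real ^ 'n => complex" and a :: "real => real ^ 'n => real ^ 'n"
 assumes u: "continuous_in_sobolev \<sigma> u" and \<sigma>: "0 <= \<sigma>" and sol: "solves_transport a (%t x. 1 / 2 * D t x) u"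
  and a: "!!t x. (a t has_derivative a' t x) (at x)" and D: "!!t x. divergence (a t) x = D t x"
  and ca: "continuous_on UNIV (%(t, x). a t x)" and pa: "!!t. periodic (a t)"
  and cD: "continuous_on UNIV (%(t, x). D t x)" and pD: "!!t. periodic (D t)"
  and pde: "!!t x. w' (t, x) (1, - a t x) = 1 / 2 * D t x * w t x" and T: "0 <= T"
 shows "pairing (u T) (w T) = pairing (u 0) (w 0)"
proof -
 have mem: "u s \<in> sobolev \<sigma>" for s using u by (simp add: continuous_in_sobolev_def)
 have uL: "u s \<in> L2_torus" for s using mem by (simp add: sobolev_def)
 \<comment> \<open>The adjoint of the transport operator applied to a character e: this is -div (e
   a) + D e / 2, where the divergence of \<open>a\<close> is \<open>D\<close>.\<close>
 define q where "q k t x = - (\<i> * of_real (frequency k \<bullet> a t x) + of_real (1 / 2 * D t x)) * character k x" for k t x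
 define U where "U k s = cell_integral (%x. u s x * character k x)" for k s
 have sl: "continuous_on UNIV (a t)" "continuous_on UNIV (D t)" "continuous_on UNIV (w t)" "continuous_on UNIV (wt t)" "continuous_on UNIV (wx i t)" for t i
  by (rule continuous_slice[OF ca] continuous_slice[OF cD] continuous_slice[OF cont_w]
    continuous_slice[OF cont_wt] continuous_slice[OF cont_wx])+
 have cq: "continuous_on UNIV (q k t)" and pq: "periodic (q k t)" for k t
 proof -
  show "continuous_on UNIV (q k t)" unfolding q_def by (intro continuous_intros sl continuous_character)
  show "periodic (q k t)" using pa[of t] pD[of t] periodic_character[of k] by (simp add: q_def periodic_def)
 qed
 have dU: "(U k has_vector_derivative cell_integral (%x. u t x * q k t x)) (at t)" for k t
 proof -
  have U: "U k = (%s. pairing (u s) (%x. Re (character k x)) + \<i> * pairing (u s) (%x. Im (character k x)))"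
   unfolding U_def by (intro ext cell_integral_complex(2) uL continuous_character periodic_character)
  \<comment> \<open>Stated for a real linear functional, to be used with \<open>Re\<close> and
    \<open>Im\<close>.\<close>
  have ad: "- divergence (%y. h (character k y) *\<^sub>R a t y) x + 1 / 2 * D t x * h (character k x) = h (q k t x)"
   if h: "bounded_linear h" for h :: "complex => real" and x
  proof -
   have lh: "linear h" by (rule bounded_linear.linear[OF h])
   have f': "((%y. h (character k y)) has_derivative (%v. h (\<i> * of_real (frequency k \<bullet> v) * character k x))) (at x)"
    by (rule bounded_linear.has_derivative[OF h character_has_derivative])
   have hv: "h (\<i> * of_real r * character k x) = r * h (\<i> * character k x)" for r
    using linear_scale[OF lh, of r "\<i> * character k x"] by (simp add: scaleR_conv_of_real mult_ac)
   have "(\<Sum>i\<in>UNIV. h (\<i> * of_real (frequency k \<bullet> axis i 1) * character k x) * a t x $ i) = (frequency k \<bullet> a t x) * h (\<i> * character k x)"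
   proof -
    have "frequency k \<bullet> axis i 1 = frequency k $ i" for i by (simp add: inner_axis)
    then show ?thesis unfolding hv by (simp add: inner_vec_def sum_distrib_left sum_distrib_right mult_ac)
   qed
   then have dv: "divergence (%y. h (character k y) *\<^sub>R a t y) x = h (character k x) * D t x + (frequency k \<bullet> a t x) * h (\<i> * character k x)"
    unfolding divergence_scaled[OF a f'] D by simp
   have "q k t x = - ((frequency k \<bullet> a t x) *\<^sub>R (\<i> * character k x) + (1 / 2 * D t x) *\<^sub>R character k x)"
    by (simp add: q_def scaleR_conv_of_real algebra_simps)
   then have "h (q k t x) = - ((frequency k \<bullet> a t x) * h (\<i> * character k x) + (1 / 2 * D t x) * h (character k x))"
    by (simp only: linear_neg[OF lh] linear_add[OF lh] linear_scale[OF lh] real_scaleR_def)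
   then show ?thesis unfolding dv by (simp add: algebra_simps)
  qed
  have "((%s. pairing (u s) (%x. Re (character k x))) has_vector_derivative pairing (u t) (%x. Re (q k t x))) (at t)"
   using sol smooth_character(1)[of k] periodic_comp[OF periodic_character, of Re k]
   unfolding solves_transport_def ad[OF bounded_linear_Re, symmetric] by blast
  moreover have "((%s. pairing (u s) (%x. Im (character k x))) has_vector_derivative pairing (u t) (%x. Im (q k t x))) (at t)"
   using sol smooth_character(2)[of k] periodic_comp[OF periodic_character, of Im k]
   unfolding solves_transport_def ad[OF bounded_linear_Im, symmetric] by blast
  ultimately show ?thesis unfolding U cell_integral_complex(2)[OF uL cq pq]
   by (intro has_vector_derivative_add has_vector_derivative_mult_right)
 qed
 \<comment> \<open>The defect of the mollified weight in the adjoint equation: mollification does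
   not commute with multiplication by \<open>a\<close> and \<open>D\<close>.\<close>
 define e where "e j s x = mol j (wt s) x - (\<Sum>i\<in>UNIV. a s x $ i * mol j (wx i s) x) - 1 / 2 * D s x * mol j (w s) x" for j s x
 have ce: "continuous_on UNIV (e j s)" for j s unfolding e_def by (intro continuous_intros sl continuous_mol)
 define P where "P j s = pairing (u s) (mol j (w s))" for j s
 have pe: "periodic (e j s)" and dP: "(P j has_vector_derivative pairing (u s) (e j s)) (at s)" for j s
 proof -
  obtain F \<mu> where F: "finite F"
   "!!f x. continuous_on UNIV f ==> complex_of_real (mol j f x) =
    (\<Sum>k\<in>F. of_real (\<mu> k) * fourier_coeff (%y. of_real (f y)) k * character k (x :: real ^ 'n))"
   using mol_expansion[of j, where 'n='n] by blast
  define z where "z k s = fourier_coeff (%x. complex_of_real (wt s x)) k" for k s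
  have P: "P j s = (\<Sum>k\<in>F. of_real (\<mu> k) * (wc s k * U k s))" for s
  proof -
   have "P j s = cell_integral (%x. \<Sum>k\<in>F. of_real (\<mu> k) * (wc s k * (u s x * character k x)))"
    unfolding P_def pairing_def F(2)[OF sl(3)] wc_def by (simp add: sum_distrib_left mult_ac)
   also have "... = (\<Sum>k\<in>F. cell_integral (%x. of_real (\<mu> k) * (wc s k * (u s x * character k x))))"
    by (rule cell_integral_sum[THEN conjunct2])
     (intro set_integrable_mult_right cell_integral_complex(1) uL continuous_character periodic_character)
   finally show ?thesis by (simp add: U_def)
  qed
  \<comment> \<open>The coefficients are those that appear when \<open>P\<close> is differentiated
    termwise, so the derivative of \<open>P\<close> is the pairing of \<open>u\<close> with the
    defect.\<close>
  have ee: "complex_of_real (e j s x) = (\<Sum>k\<in>F. of_real (\<mu> k) * (z k s * character k x + wc s k * q k s x))" for x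
  proof -
   have "(\<Sum>i\<in>UNIV. of_real (a s x $ i) * complex_of_real (mol j (wx i s) x)) =
    (\<Sum>i\<in>UNIV. \<Sum>k\<in>F. of_real (\<mu> k) * wc s k * character k x * (\<i> * (of_int (k $ i) * of_real (a s x $ i))))"
    unfolding F(2)[OF sl(5)] wc_wx by (simp add: sum_distrib_left mult_ac)
   also have "... = (\<Sum>k\<in>F. \<Sum>i\<in>UNIV. of_real (\<mu> k) * wc s k * character k x * (\<i> * (of_int (k $ i) * of_real (a s x $ i))))"
    by (rule sum.swap)
   also have "... = (\<Sum>k\<in>F. of_real (\<mu> k) * wc s k * character k x * (\<i> * of_real (frequency k \<bullet> a s x)))"
    by (simp add: sum_distrib_left[symmetric] inner_vec_def frequency_def)
   finally have 1: "(\<Sum>i\<in>UNIV. of_real (a s x $ i) * complex_of_real (mol j (wx i s) x)) =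
    (\<Sum>k\<in>F. of_real (\<mu> k) * wc s k * character k x * (\<i> * of_real (frequency k \<bullet> a s x)))" .
   have "complex_of_real (e j s x) = complex_of_real (mol j (wt s) x) - (\<Sum>i\<in>UNIV. of_real (a s x $ i) * complex_of_real (mol j (wx i s) x))
     - of_real (1 / 2 * D s x) * complex_of_real (mol j (w s) x)" by (simp add: e_def)
   also have "... = (\<Sum>k\<in>F. of_real (\<mu> k) * z k s * character k x) - (\<Sum>k\<in>F. of_real (\<mu> k) * wc s k * character k x * (\<i> * of_real (frequency k \<bullet> a s x)))
     - of_real (1 / 2 * D s x) * (\<Sum>k\<in>F. of_real (\<mu> k) * wc s k * character k x)"
    unfolding 1 unfolding F(2)[OF sl(3)] F(2)[OF sl(4)] z_def wc_def ..
   also have "... = (\<Sum>k\<in>F. of_real (\<mu> k) * (z k s * character k x + wc s k * q k s x))"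
    unfolding sum_distrib_left sum_subtractf[symmetric] q_def by (intro sum.cong refl) (simp add: algebra_simps)
   finally show ?thesis .
  qed
  have "complex_of_real (e j s (x + axis i (2 * pi))) = complex_of_real (e j s x)" for x i
  proof -
   have "character k (x + axis i (2 * pi)) = character k x" "q k s (x + axis i (2 * pi)) = q k s x" for k :: "int ^ 'n"
    using periodic_character[of k] pq[of k s] by (simp_all add: periodic_def)
   then show ?thesis unfolding ee by (simp only:)
  qed
  then show "periodic (e j s)" by (simp add: periodic_def)
  have "((%s. \<Sum>k\<in>F. of_real (\<mu> k) * (wc s k * U k s)) has_vector_derivative
    (\<Sum>k\<in>F. of_real (\<mu> k) * (wc s k * cell_integral (%x. u s x * q k s x) + z k s * U k s))) (at s)"
   unfolding z_def
   by (intro has_vector_derivative_sum has_vector_derivative_mult_right has_vector_derivative_mult wc_derivative dU)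
  moreover have "(\<Sum>k\<in>F. of_real (\<mu> k) * (wc s k * cell_integral (%x. u s x * q k s x) + z k s * U k s)) = pairing (u s) (e j s)"
  proof -
   have i1: "set_integrable lebesgue cell (%x. wc s k * (u s x * q k s x))" "set_integrable lebesgue cell (%x. z k s * (u s x * character k x))" for k
    by (intro set_integrable_mult_right cell_integral_complex(1) uL continuous_character periodic_character cq pq)+
   have "pairing (u s) (e j s) = cell_integral (%x. \<Sum>k\<in>F. of_real (\<mu> k) * (wc s k * (u s x * q k s x) + z k s * (u s x * character k x)))"
    unfolding pairing_def ee by (simp add: sum_distrib_left algebra_simps)
   also have "... = (\<Sum>k\<in>F. cell_integral (%x. of_real (\<mu> k) * (wc s k * (u s x * q k s x) + z k s * (u s x * character k x))))"
    by (rule cell_integral_sum[THEN conjunct2]) (intro set_integrable_mult_right set_integral_add(1) i1)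
   also have "... = (\<Sum>k\<in>F. of_real (\<mu> k) * (wc s k * cell_integral (%x. u s x * q k s x) + z k s * U k s))"
    by (simp add: set_integral_add(2)[OF i1] U_def)
   finally show ?thesis by simp
  qed
  ultimately show "(P j has_vector_derivative pairing (u s) (e j s)) (at s)" unfolding P[abs_def] by simp
 qed
 obtain N where N: "!!s. s \<in> {0..T} ==> sobolev_norm \<sigma> (u s) <= N" using sobolev_norm_bounded[OF u, of 0 T] by blast
 have N0: "0 <= N" using N[of 0] T sobolev_norm_nonneg[OF mem[of 0]] by simp
 define v where "v = torus_vol TYPE('n)"
 have v: "v > 0" by (simp add: v_def torus_vol_pos)
 \<comment> \<open>The mollified first derivatives of \<open>w\<close> converge uniformly on the
   compact time interval, and the limit of the defect is 0 by the equation for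
   \<open>w\<close>.\<close>
 have small: "\<forall>\<^sub>F j in sequentially. \<forall>s\<in>{0..T}. \<forall>x. \<bar>e j s x\<bar> <= \<eta>" if \<eta>: "\<eta> > 0" for \<eta>
 proof -
  have S: "compact {0..T}" by simp
  note sub = continuous_on_subset[OF _ subset_UNIV, of _ "{0..T} \<times> UNIV"]
  have cai: "continuous_on UNIV (%(t, x). a t x $ i)" for i
   using continuous_on_component[OF ca, of i] by (simp add: split_beta)
  have "\<exists>B. \<forall>t\<in>{0..T}. \<forall>x. \<bar>a t x $ i\<bar> <= B" for i
   by (rule periodic_compact_bounds(1)[OF S sub[OF cai]]) (use pa in \<open>simp add: periodic_def\<close>)
  then obtain A where A: "!!i t x. t \<in> {0..T} ==> \<bar>a t x $ i\<bar> <= A i" by metis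
  obtain A' where A': "!!t x. t \<in> {0..T} ==> \<bar>D t x\<bar> <= A'"
   using periodic_compact_bounds(1)[OF S sub[OF cD] pD] by blast
  define Q where "Q = 1 + (\<Sum>i\<in>UNIV. A i) + A'"
  have A0: "0 <= A i" "0 <= A'" for i using A[of 0 0 i] A'[of 0 0] T by auto
  have Q: "Q > 0" unfolding Q_def using A0 by (intro add_pos_nonneg sum_nonneg) auto
  define \<theta> where "\<theta> = \<eta> / Q"
  have \<theta>: "\<theta> > 0" "\<theta> * Q = \<eta>" using \<eta> Q by (auto simp: \<theta>_def)
  have "\<forall>\<^sub>F j in sequentially. \<forall>i. \<forall>s\<in>{0..T}. \<forall>x. \<bar>mol j (wx i s) x - wx i s x\<bar> <= \<theta>"
   by (intro eventually_all_finite mol_family_uniform[OF S sub[OF cont_wx] periodic_wx \<theta>(1)])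
  moreover have "\<forall>\<^sub>F j in sequentially. \<forall>s\<in>{0..T}. \<forall>x. \<bar>mol j (wt s) x - wt s x\<bar> <= \<theta>"
   by (rule mol_family_uniform[OF S sub[OF cont_wt] periodic_wt \<theta>(1)])
  moreover have "\<forall>\<^sub>F j in sequentially. \<forall>s\<in>{0..T}. \<forall>x. \<bar>mol j (w s) x - w s x\<bar> <= \<theta>"
   by (rule mol_family_uniform[OF S sub[OF cont_w] periodic_w \<theta>(1)])
  ultimately show ?thesis
  proof (eventually_elim, intro ballI allI)
   fix j s x
   assume j: "\<forall>i. \<forall>s\<in>{0..T}. \<forall>x. \<bar>mol j (wx i s) x - wx i s x\<bar> <= \<theta>"
    "\<forall>s\<in>{0..T}. \<forall>x. \<bar>mol j (wt s) x - wt s x\<bar> <= \<theta>" "\<forall>s\<in>{0..T}. \<forall>x. \<bar>mol j (w s) x - w s x\<bar> <= \<theta>"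
    and s: "s \<in> {0..T}"
   have "wt s x - (\<Sum>i\<in>UNIV. a s x $ i * wx i s x) - 1 / 2 * D s x * w s x = 0"
    using pde[of s x] unfolding w'_split by simp
   then have "e j s x = (mol j (wt s) x - wt s x) - (\<Sum>i\<in>UNIV. a s x $ i * (mol j (wx i s) x - wx i s x)) - 1 / 2 * (D s x * (mol j (w s) x - w s x))"
    unfolding e_def by (simp add: right_diff_distrib sum_subtractf)
   moreover have "\<bar>\<Sum>i\<in>UNIV. a s x $ i * (mol j (wx i s) x - wx i s x)\<bar> <= (\<Sum>i\<in>UNIV. A i * \<theta>)"
    by (rule order_trans[OF sum_abs sum_mono]) (use A[OF s] A0 j(1) s in \<open>auto simp: abs_mult intro!: mult_mono\<close>)
   moreover have "\<bar>D s x * (mol j (w s) x - w s x)\<bar> <= A' * \<theta>"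
    unfolding abs_mult by (rule mult_mono) (use A'[OF s] A0 j(3) s in auto)
   moreover have "\<bar>mol j (wt s) x - wt s x\<bar> <= \<theta>" using j(2) s by blast
   moreover have "0 <= A' * \<theta>" using A0 \<theta> by simp
   moreover have "\<theta> + (\<Sum>i\<in>UNIV. A i * \<theta>) + A' * \<theta> = \<eta>"
    unfolding \<theta>(2)[symmetric] Q_def by (simp add: algebra_simps sum_distrib_left)
   ultimately show "\<bar>e j s x\<bar> <= \<eta>" by linarith
  qed
 qed
 have pb: "cmod (pairing (u s) (e j s)) <= N * (sqrt v * \<eta>)" if s: "s \<in> {0..T}" and b: "!!x. \<bar>e j s x\<bar> <= \<eta>" for j s \<eta>
 proof -
  obtain g where g: "is_bessel \<sigma> (u s) g" "sobolev_norm \<sigma> (u s) = L2_norm_torus g" using sobolevE[OF mem[of s]] by metis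
  have \<eta>: "0 <= \<eta>" using b[of 0] by linarith
  have "integral cell (%x. (e j s x)\<^sup>2) <= integral cell (%x :: real ^ 'n. \<eta>\<^sup>2)"
   by (intro integral_le integrable_cell(2) continuous_intros ce) (use b \<eta> in \<open>auto simp: abs_le_square_iff[symmetric]\<close>)
  also have "... = v * \<eta>\<^sup>2"
   using integral_mult_right[of cell "\<eta>\<^sup>2" "%y::real^'n. 1"] by (simp add: measure_cell torus_vol_def v_def)
  finally have "sqrt (integral cell (%x. (e j s x)\<^sup>2)) <= sqrt (v * \<eta>\<^sup>2)" by simp
  also have "... = sqrt v * \<eta>" using \<eta> by (simp add: real_sqrt_mult)
  finally have 1: "sqrt (integral cell (%x. (e j s x)\<^sup>2)) <= sqrt v * \<eta>" .
  have "cmod (pairing (u s) (e j s)) <= sobolev_norm \<sigma> (u s) * sqrt (integral cell (%x. (e j s x)\<^sup>2))"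
   unfolding g(2) by (rule sobolev_duality_L2[OF uL g(1) ce pe \<sigma>])
  also have "... <= N * (sqrt v * \<eta>)" using N[OF s] N0 1 v \<eta>
   by (intro mult_mono) (auto intro!: integral_nonneg integrable_cell(2) continuous_intros ce)
  finally show ?thesis .
 qed
 have "(%j. P j T - P j 0) \<longlonglongrightarrow> 0"
 proof (rule LIMSEQ_I)
  fix r :: real assume r: "r > 0"
  \<comment> \<open>Limits the change of \<open>P\<close> over the time \<open>T\<close> to
    \<open>r / 2\<close>; the summand 1 keeps the denominator positive.\<close>
  define \<eta> where "\<eta> = r / (2 * (N * sqrt v * T + 1))"
  have den: "N * sqrt v * T + 1 > 0" using N0 v T by (simp add: add_nonneg_pos)
  have \<eta>: "\<eta> > 0" using r den by (simp add: \<eta>_def)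
  obtain J where J: "!!j s x. j >= J ==> s \<in> {0..T} ==> \<bar>e j s x\<bar> <= \<eta>"
   using small[OF \<eta>] unfolding eventually_sequentially by blast
  have "norm (P j T - P j 0 - 0) < r" if j: "j >= J" for j
  proof -
   have "norm (P j T - P j 0) <= (N * (sqrt v * \<eta>)) * T"
    by (rule vderiv_bound[OF dP]) (use pb J[OF j] T N0 v \<eta> in auto)
   also have "... = (N * sqrt v * T) * \<eta>" by (simp add: mult_ac)
   also have "... <= (N * sqrt v * T + 1) * \<eta>" using \<eta> by (intro mult_right_mono) auto
   also have "... = r / 2"
   proof -
    have "d * (r / (2 * d)) = r / 2" if "d > 0" for d :: real using that by simp
    then show ?thesis unfolding \<eta>_def using den by blast
   qed
   finally show ?thesis using r by simp
  qed
  then show "\<exists>J. \<forall>j\<ge>J. norm (P j T - P j 0 - 0) < r" by blast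
 qed
 moreover have "(%j. P j T - P j 0) \<longlonglongrightarrow> pairing (u T) (w T) - pairing (u 0) (w 0)"
  unfolding P_def by (intro tendsto_diff pairing_mol_tendsto uL sl periodic_w)
 ultimately have "pairing (u T) (w T) - pairing (u 0) (w 0) = 0" using LIMSEQ_unique by blast
 then show ?thesis by simp
qed

end

context flow_field
begin

text \<open>Translations along \<open>v\<close> commute with the flow. This will be applied to the
  coordinate that accumulates the divergence.\<close>

lemma Dflow_invariant_direction:
 assumes "!!x r. X (x + r *\<^sub>R v) = X x"
 shows "Dflow t x v = v"
proof -
 have f: "flow t (x + r *\<^sub>R v) = flow t x + r *\<^sub>R v" for r by (rule flow_equivariant) (rule assms)
 have "((%r. x + r *\<^sub>R v) has_derivative (%h. h *\<^sub>R v)) (at 0)" by (auto intro!: derivative_eq_intros)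
 moreover have "(flow t has_derivative Dflow t x) (at (x + 0 *\<^sub>R v))" using flow_has_derivative by simp
 ultimately have "((%r. flow t (x + r *\<^sub>R v)) has_derivative (%h. Dflow t x (h *\<^sub>R v))) (at 0)"
  by (rule has_derivative_compose)
 moreover have "((%r. flow t (x + r *\<^sub>R v)) has_derivative (%h. h *\<^sub>R v)) (at 0)"
  unfolding f by (auto intro!: derivative_eq_intros)
 ultimately have "(%h. Dflow t x (h *\<^sub>R v)) = (%h. h *\<^sub>R v)" by (rule has_derivative_unique)
 from fun_cong[OF this, of 1] show ?thesis by simp
qed

end

text \<open>The solution of w_t - a . grad w = \<kappa> (div a) w with initial value
  \<open>w0\<close>, when \<open>\<Phi>\<close> gives the feet of the characteristics and
  \<open>m\<close> minus the divergence accumulated along them. \<kappa> = 1/2 gives the adjoint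
  equation, \<kappa> = 1 a density of constant mass.\<close>

definition transport_weight :: "(real => real ^ 'n => real ^ 'n) => (real => real ^ 'n => real) => real => (real ^ 'n => real) => real => real ^ 'n => real" where
 "transport_weight \<Phi> m \<kappa> w0 t x = exp (- \<kappa> * m t x) * w0 (\<Phi> t x)"

text \<open>The characteristics and the accumulated divergence form an autonomous flow on
 time, space and one more real coordinate.\<close>

lemma transport_weights:
 fixes V :: "real => real ^ 'n => real ^ 'n" and d :: "real => real ^ 'n => real" and b :: "real ^ 'n"
 assumes V: "C11_field (%(t, x). V t x) V' L" and d: "C11_field (%(t, x). d t x) D' M"
  and pV: "!!t. periodic (V t)" and pd: "!!t. periodic (d t)"
 obtains \<Phi> m where "!!x. \<Phi> 0 x = x" "!!x. m 0 x = 0"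
  "!!t x. \<exists>y. y 0 = \<Phi> t x & (\<forall>s. (y has_vector_derivative - (b + \<epsilon> *\<^sub>R V s (y s))) (at s)) &
   m t x = - antider (%s. \<epsilon> * d s (y s)) t"
  "!!\<kappa> w0 g. [|!!x. (w0 has_derivative (%h. g x \<bullet> h)) (at x); continuous_on UNIV g; periodic w0|] ==>
   \<exists>w'. C1_weight (transport_weight \<Phi> m \<kappa> w0) w' &
   (\<forall>t x. w' (t, x) (1, - (b + \<epsilon> *\<^sub>R V t x)) = \<kappa> * (\<epsilon> * d t x) * transport_weight \<Phi> m \<kappa> w0 t x)"
proof -
 define Z where "Z s = (1 :: real, - (b + \<epsilon> *\<^sub>R V (fst s) (fst (snd s))), \<epsilon> * d (fst s) (fst (snd s)))" for s :: "real \<times> (real ^ 'n) \<times> real"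
 define A1 where "A1 v = (0 :: real, - (\<epsilon> *\<^sub>R v), 0 :: real)" for v :: "real ^ 'n"
 define A2 where "A2 r = (0 :: real, 0 :: real ^ 'n, \<epsilon> * r)" for r :: real
 define pr where "pr s = (fst s, fst (snd s))" for s :: "real \<times> (real ^ 'n) \<times> real"
 have bl: "bounded_linear A1" "bounded_linear A2" "bounded_linear pr" unfolding A1_def A2_def pr_def
  by (intro bounded_linear_Pair bounded_linear_zero bounded_linear_minus bounded_linear_scaleR_right bounded_linear_mult_right
    bounded_linear_fst bounded_linear_compose[OF bounded_linear_fst bounded_linear_snd])+
 obtain L1 where 1: "C11_field (%s. A1 ((%(t, x). V t x) (pr s)) + (1, - b, 0)) (%s. Blinfun A1 o\<^sub>L V' (pr s) o\<^sub>L Blinfun pr) L1"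
  using C11_linear[OF V bl(1) bl(3)] by blast
 obtain L2 where 2: "C11_field (%s. A2 ((%(t, x). d t x) (pr s)) + 0) (%s. Blinfun A2 o\<^sub>L D' (pr s) o\<^sub>L Blinfun pr) L2"
  using C11_linear[OF d bl(2) bl(3)] by blast
 have Z: "(%s. (A1 ((%(t, x). V t x) (pr s)) + (1, - b, 0)) + (A2 ((%(t, x). d t x) (pr s)) + 0)) = Z"
  by (rule ext) (simp add: Z_def A1_def A2_def pr_def)
 obtain Z' LZ where "C11_field Z Z' LZ" using C11_add[OF 1 2] unfolding Z by blast
 then interpret flow_field Z Z' LZ by unfold_locales
 have ZL: "Z (s + (0, c, r)) = Z s" if "c \<in> lattice" for s c r
  unfolding Z_def using periodic_lattice[OF pV that] periodic_lattice[OF pd that] by simp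
 have fl: "flow r (s + (0, c, l)) = flow r s + (0, c, l)" if "c \<in> lattice" for r s c l
  by (rule flow_equivariant) (rule ZL[OF that])
 have fst_flow: "fst (flow r s) = fst s + r" for r s
 proof -
  have "((%r. fst (flow r s) - r) has_vector_derivative fst (Z (flow q s)) - 1) (at q)" for q
   by (intro has_vector_derivative_diff bounded_linear.has_vector_derivative[OF bounded_linear_fst flow_vderiv])
    (auto intro!: derivative_eq_intros)
  then have "((%r. fst (flow r s) - r) has_vector_derivative 0) (at q)" for q by (simp add: Z_def)
  from vderiv_zero_const[OF this, of r 0] show ?thesis by simp
 qed
 \<comment> \<open>Flows back from time t to time 0: the second component is the foot of the
   characteristic through (t, x), the third is minus the divergence accumulated from the foot to (t,
   x).\<close>
 define \<Theta> where "\<Theta> p = flow (- fst p) (fst p, snd p, 0)" for p :: "real \<times> (real ^ 'n)"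
 define \<Phi> where "\<Phi> t x = fst (snd (\<Theta> (t, x)))" for t x
 define m where "m t x = snd (snd (\<Theta> (t, x)))" for t x
 have orbit: "\<exists>y. y 0 = \<Phi> t x & (\<forall>s. (y has_vector_derivative - (b + \<epsilon> *\<^sub>R V s (y s))) (at s)) &
   m t x = - antider (%s. \<epsilon> * d s (y s)) t" for t x
 proof -
  define \<sigma> where "\<sigma> s = flow (s - t) (t, x, 0)" for s
  have d\<sigma>: "(\<sigma> has_vector_derivative Z (\<sigma> s)) (at s)" for s
   using vderiv_compose_shift[OF flow_vderiv, of "- t" "(t, x, 0)" s] unfolding \<sigma>_def by simp
  have f\<sigma>: "fst (\<sigma> s) = s" for s by (simp add: \<sigma>_def fst_flow)
  define y where "y s = fst (snd (\<sigma> s))" for s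
  define l where "l s = snd (snd (\<sigma> s))" for s
  have dy: "(y has_vector_derivative - (b + \<epsilon> *\<^sub>R V s (y s))) (at s)" for s
   using bounded_linear.has_vector_derivative[OF bounded_linear_compose[OF bounded_linear_fst bounded_linear_snd] d\<sigma>[of s]]
   unfolding y_def Z_def f\<sigma> by simp
  have dl: "(l has_vector_derivative \<epsilon> * d s (y s)) (at s)" for s
   using bounded_linear.has_vector_derivative[OF bounded_linear_compose[OF bounded_linear_snd bounded_linear_snd] d\<sigma>[of s]]
   unfolding l_def y_def Z_def f\<sigma> by simp
  have cd: "continuous_on UNIV (%(t, x). d t x)"
   using d has_derivative_continuous unfolding C11_field_def by (blast intro: continuous_at_imp_continuous_on)
  have cy: "continuous_on UNIV y"
   using dy has_vector_derivative_continuous by (blast intro: continuous_at_imp_continuous_on)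
  have "continuous_on UNIV (%s. (s, y s))" by (intro continuous_intros cy)
  from continuous_on_compose2[OF cd this] have "continuous_on UNIV (%s. d s (y s))" by simp
  then have c: "continuous_on UNIV (%s. \<epsilon> * d s (y s))" by (intro continuous_intros)
  have "((%s. l s - antider (%s. \<epsilon> * d s (y s)) s) has_vector_derivative 0) (at s)" for s
   using has_vector_derivative_diff[OF dl antider_has_vector_derivative[OF c], of s] by simp
  from vderiv_zero_const[OF this, of 0 t] have "l 0 - antider (%s. \<epsilon> * d s (y s)) 0 = l t - antider (%s. \<epsilon> * d s (y s)) t" .
  moreover have "l t = 0" by (simp add: l_def \<sigma>_def)
  moreover have "l 0 = m t x" "y 0 = \<Phi> t x" by (simp_all add: l_def y_def \<sigma>_def m_def \<Phi>_def \<Theta>_def)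
  ultimately show ?thesis using dy by (intro exI[of _ y]) simp
 qed
 define D\<Theta> where "D\<Theta> p v = (- fst v) *\<^sub>R Z (\<Theta> p) + Dflow (- fst p) (fst p, snd p, 0) (fst v, snd v, 0)" for p v :: "real \<times> (real ^ 'n)"
 have d\<Theta>: "(\<Theta> has_derivative D\<Theta> p) (at p)" for p
 proof -
  have "((%p :: real \<times> (real ^ 'n). (- fst p, (fst p, snd p, 0 :: real))) has_derivative (%v. (- fst v, (fst v, snd v, 0)))) (at p)"
   by (auto intro!: derivative_eq_intros)
  from has_derivative_compose[OF this flow_joint_derivative] show ?thesis
   unfolding \<Theta>_def[abs_def] D\<Theta>_def[abs_def] by simp
 qed
 have cont\<Theta>: "continuous_on UNIV \<Theta>" using d\<Theta> has_derivative_continuous by (blast intro: continuous_at_imp_continuous_on)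
 have contD\<Theta>: "continuous_on UNIV (%p. D\<Theta> p v)" for v
 proof -
  have 1: "continuous_on UNIV (%p :: real \<times> (real ^ 'n). (- fst p, (fst p, snd p, 0 :: real)))" by (intro continuous_intros)
  have "continuous_on UNIV (%p :: real \<times> (real ^ 'n). Dflow (- fst p) (fst p, snd p, 0))"
   using continuous_on_compose2[OF continuous_Dflow 1] by simp
  then show ?thesis unfolding D\<Theta>_def
   by (intro continuous_intros continuous_on_compose2[OF continuous_X[of UNIV] cont\<Theta>]) auto
 qed
 \<comment> \<open>Along a characteristic the foot does not move. The direction (1, -a, 0) differs
   from \<open>Z\<close> by a multiple of the last coordinate vector, which the linearized flow
   leaves fixed, and \<open>Z\<close> is cancelled by the change of the flow time.\<close>
 have D\<Theta>: "D\<Theta> (t, x) (1, - (b + \<epsilon> *\<^sub>R V t x)) = (0, 0, - (\<epsilon> * d t x))" for t x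
 proof -
  have inv: "Dflow r s (0, 0, 1) = (0, 0, 1)" for r s
   by (rule Dflow_invariant_direction) (use ZL[OF lattice_0] in simp)
  have "(1, - (b + \<epsilon> *\<^sub>R V t x), 0) = Z (t, x, 0) - (\<epsilon> * d t x) *\<^sub>R (0, 0, 1)" by (simp add: Z_def)
  then have "Dflow (- t) (t, x, 0) (1, - (b + \<epsilon> *\<^sub>R V t x), 0) = Z (flow (- t) (t, x, 0)) - (\<epsilon> * d t x) *\<^sub>R (0, 0, 1)"
   by (simp only: blinfun.diff_right blinfun.scaleR_right inv Dflow_field)
  then show ?thesis by (simp add: D\<Theta>_def \<Theta>_def)
 qed
 have weight: "\<exists>w'. C1_weight (transport_weight \<Phi> m \<kappa> w0) w' &
   (\<forall>t x. w' (t, x) (1, - (b + \<epsilon> *\<^sub>R V t x)) = \<kappa> * (\<epsilon> * d t x) * transport_weight \<Phi> m \<kappa> w0 t x)"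
  if w0: "!!x. (w0 has_derivative (%h. g x \<bullet> h)) (at x)" and g: "continuous_on UNIV g" and pw: "periodic w0" for \<kappa> w0 g
 proof -
  let ?P = "%p. fst (snd (\<Theta> p))" and ?m = "%p. snd (snd (\<Theta> p))"
  define w' where "w' p v = exp (- \<kappa> * ?m p) * (g (?P p) \<bullet> fst (snd (D\<Theta> p v))) + (exp (- \<kappa> * ?m p) * (- \<kappa> * snd (snd (D\<Theta> p v)))) * w0 (?P p)" for p v
  have dP: "(?P has_derivative (%v. fst (snd (D\<Theta> p v)))) (at p)" and dm: "(?m has_derivative (%v. snd (snd (D\<Theta> p v)))) (at p)" for p
   using bounded_linear.has_derivative[OF bounded_linear_compose[OF bounded_linear_fst bounded_linear_snd] d\<Theta>[of p]]
    bounded_linear.has_derivative[OF bounded_linear_compose[OF bounded_linear_snd bounded_linear_snd] d\<Theta>[of p]] by simp_all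
  have eq: "(%(t, x). transport_weight \<Phi> m \<kappa> w0 t x) = (%p. exp (- \<kappa> * ?m p) * w0 (?P p))"
   by (auto simp: transport_weight_def \<Phi>_def m_def)
  have de: "((%p. exp (- \<kappa> * ?m p)) has_derivative (%v. exp (- \<kappa> * ?m p) * (- \<kappa> * snd (snd (D\<Theta> p v))))) (at p)" for p
  proof -
   have "((%p. - \<kappa> * ?m p) has_derivative (%v. - \<kappa> * snd (snd (D\<Theta> p v)))) (at p)"
    by (rule has_derivative_mult_right[OF dm])
   from DERIV_compose_FDERIV[OF DERIV_exp this] show ?thesis by (simp only: mult.commute)
  qed
  have cw0: "continuous_on UNIV w0" using w0 has_derivative_continuous by (blast intro: continuous_at_imp_continuous_on)
  have "C1_weight (transport_weight \<Phi> m \<kappa> w0) w'"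
  proof
   show "((%(t, x). transport_weight \<Phi> m \<kappa> w0 t x) has_derivative w' p) (at p)" for p
    unfolding eq w'_def by (rule has_derivative_mult[OF de has_derivative_compose[OF dP w0]])
   show "continuous_on UNIV (%p. w' p v)" for v unfolding w'_def
    by (intro continuous_intros cont\<Theta> contD\<Theta> continuous_on_compose2[OF g] continuous_on_compose2[OF cw0]) auto
   show "periodic (transport_weight \<Phi> m \<kappa> w0 t)" for t unfolding periodic_def
   proof (intro allI)
    fix x :: "real ^ 'n" and i
    have "\<Theta> (t, x + axis i (2 * pi)) = \<Theta> (t, x) + (0, axis i (2 * pi), 0)"
     using fl[OF axis_lattice, of "- t" "(t, x, 0)" i 0] by (simp add: \<Theta>_def)
    then have "\<Phi> t (x + axis i (2 * pi)) = \<Phi> t x + axis i (2 * pi)" "m t (x + axis i (2 * pi)) = m t x"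
     by (simp_all add: \<Phi>_def m_def)
    then show "transport_weight \<Phi> m \<kappa> w0 t (x + axis i (2 * pi)) = transport_weight \<Phi> m \<kappa> w0 t x"
     using periodic_lattice[OF pw axis_lattice] by (simp add: transport_weight_def)
   qed
  qed
  moreover have "w' (t, x) (1, - (b + \<epsilon> *\<^sub>R V t x)) = \<kappa> * (\<epsilon> * d t x) * transport_weight \<Phi> m \<kappa> w0 t x" for t x
   unfolding w'_def D\<Theta> by (simp add: transport_weight_def \<Phi>_def m_def)
  ultimately show ?thesis by blast
 qed
 have "\<Phi> 0 x = x" "m 0 x = 0" for x by (simp_all add: \<Phi>_def m_def \<Theta>_def)
 then show thesis using that orbit weight by blast
qed

text \<open>The square of a positive part is C1, which supplies cutoffs with just the regularity of
  the weights.\<close>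

lemma pos_square_derivative: "((%r :: real. (max 0 r)\<^sup>2) has_real_derivative 2 * max 0 r) (at r)"
proof -
 have b: "\<bar>((max 0 (r + h))\<^sup>2 - (max 0 r)\<^sup>2) / h - 2 * max 0 r\<bar> <= \<bar>h\<bar>" if "h ~= 0" for h :: real
 proof -
  have "\<bar>(max 0 (r + h))\<^sup>2 - (max 0 r)\<^sup>2 - 2 * max 0 r * h\<bar> <= h\<^sup>2"
  proof (cases "r <= 0")
   case True
   have "max 0 (r + h) <= \<bar>h\<bar>" using True by simp
   then have "(max 0 (r + h))\<^sup>2 <= \<bar>h\<bar>\<^sup>2" by (intro power_mono) auto
   then show ?thesis using True by simp
  next
   case r: False
   show ?thesis
   proof (cases "0 <= r + h")
    case True
    then show ?thesis using r by (simp add: power2_eq_square algebra_simps)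
   next
    case False
    have "r * (r + h) <= 0" using r False by (intro mult_nonneg_nonpos) auto
    then have 1: "r * r + r * h <= 0" by (simp add: distrib_left)
    have 2: "0 <= r * r + 2 * (r * h) + h * h" using zero_le_power2[of "r + h"] by (simp add: power2_eq_square algebra_simps)
    have 3: "0 <= r * r" "0 <= h * h" by simp_all
    have e: "max 0 (r + h) = 0" "max 0 r = r" using r False by auto
    show ?thesis unfolding e power2_eq_square abs_le_iff using 1 2 3 by (intro conjI; linarith)
   qed
  qed
  then have "\<bar>((max 0 (r + h))\<^sup>2 - (max 0 r)\<^sup>2 - 2 * max 0 r * h) / h\<bar> <= \<bar>h\<bar>"
   using that by (simp add: abs_divide divide_le_eq power2_eq_square)
  then show ?thesis using that by (simp add: diff_divide_distrib)
 qed
 have "((%h. ((max 0 (r + h))\<^sup>2 - (max 0 r)\<^sup>2) / h - 2 * max 0 r) \<longlongrightarrow> 0) (at 0)"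
 proof (rule Lim_null_comparison[of _ "%h. \<bar>h\<bar>"])
  show "\<forall>\<^sub>F h in at 0. norm (((max 0 (r + h))\<^sup>2 - (max 0 r)\<^sup>2) / h - 2 * max 0 r) <= \<bar>h\<bar>"
   using b by (simp add: eventually_at_filter)
  show "((%h::real. \<bar>h\<bar>) \<longlongrightarrow> 0) (at 0)" by (auto intro!: tendsto_eq_intros)
 qed
 then show ?thesis by (simp add: DERIV_def LIM_zero_iff)
qed

lemma bump_exists:
 fixes p :: "real ^ 'n"
 assumes "0 < \<rho>"
 obtains w0 g where "!!x. (w0 has_derivative (%h. g x \<bullet> h)) (at x)" "continuous_on UNIV g" "periodic w0"
  "!!x. 0 <= w0 x" "w0 p > 0" "!!x. w0 x ~= 0 ==> \<exists>q\<in>lattice. norm (x - q - p) <= \<rho>"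
proof -
 define s where "s = min (\<rho> / CARD('n)) 1"
 have n0: "real CARD('n) > 0" by simp
 have "s <= \<rho> / CARD('n)" by (simp add: s_def)
 then have s3: "s * CARD('n) <= \<rho>" using n0 by (simp only: pos_le_divide_eq)
 have s: "0 < s" "s <= 1" using assms n0 by (simp_all add: s_def)
 \<comment> \<open>The threshold is such that \<open>f x > 0\<close> forces
   \<open>cos s < cos (x $ i - p $ i)\<close> in every coordinate, because the other cosines are at
   most 1.\<close>
 define f where "f x = (\<Sum>i\<in>UNIV. cos (x $ i - p $ i)) - (real CARD('n) - (1 - cos s))" for x :: "real ^ 'n"
 define w0 where "w0 x = (max 0 (f x))\<^sup>2" for x
 define g where "g x = (\<chi> i. 2 * max 0 (f x) * - sin (x $ i - p $ i))" for x :: "real ^ 'n"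
 have cs: "cos s < 1" using cos_monotone_0_pi[of 0 s] s pi_gt3 by simp
 have cf: "continuous_on UNIV f" unfolding f_def by (intro continuous_intros)
 have df: "(f has_derivative (%h. \<Sum>i\<in>UNIV. - sin (x $ i - p $ i) * h $ i)) (at x)" for x unfolding f_def
  by (auto intro!: derivative_eq_intros bounded_linear_imp_has_derivative[OF bounded_linear_vec_nth] simp: sum_negf mult.commute)
 have "(w0 has_derivative (%h. g x \<bullet> h)) (at x)" for x
 proof -
  have "((%r. (max 0 r)\<^sup>2) has_derivative (%h. h * (2 * max 0 (f x)))) (at (f x))"
   using pos_square_derivative[of "f x"] by (simp add: has_field_derivative_def mult.commute[of _ "2 * max 0 (f x)"])
  note d = has_derivative_compose[OF df this]
  have "(%h. g x \<bullet> h) = (%h. (\<Sum>i\<in>UNIV. - sin (x $ i - p $ i) * h $ i) * (2 * max 0 (f x)))"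
   by (rule ext, simp only: g_def inner_vec_def sum_distrib_right vec_lambda_beta inner_real_def) (intro sum.cong refl, simp)
  with d show ?thesis unfolding w0_def[abs_def] by metis
 qed
 moreover have "continuous_on UNIV g" unfolding g_def by (intro continuous_intros cf)
 moreover have "periodic w0"
 proof -
  have "cos ((x + axis j (2 * pi)) $ i - p $ i) = cos (x $ i - p $ i)" for x :: "real ^ 'n" and i j
  proof (cases "i = j")
   case True
   have "(x + axis j (2 * pi)) $ i - p $ i = (x $ i - p $ i) + 2 * pi" using True by (simp add: axis_def)
   then show ?thesis by (simp only: cos_periodic)
  qed (simp add: axis_def)
  then show ?thesis by (simp add: periodic_def w0_def f_def)
 qed
 moreover have "0 <= w0 x" for x by (simp add: w0_def)
 moreover have "w0 p > 0"
 proof -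
  have "f p = 1 - cos s" by (simp add: f_def)
  then show ?thesis using cs by (simp add: w0_def)
 qed
 moreover have "\<exists>q\<in>lattice. norm (x - q - p) <= \<rho>" if x: "w0 x ~= 0" for x
 proof -
  have fx: "f x > 0" using x by (auto simp: w0_def max_def split: if_splits)
  have "cos s < cos (x $ i - p $ i)" for i
  proof -
   have "(\<Sum>j\<in>UNIV. cos (x $ j - p $ j)) = cos (x $ i - p $ i) + (\<Sum>j\<in>UNIV - {i}. cos (x $ j - p $ j))"
    by (rule sum.remove) auto
   also have "(\<Sum>j\<in>UNIV - {i}. cos (x $ j - p $ j)) <= (\<Sum>j\<in>UNIV - {i}. 1)" by (intro sum_mono cos_le_one)
   also have "(\<Sum>j\<in>UNIV - {i}. 1) = real CARD('n) - 1"
   proof -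
    have "card (UNIV - {i}) = CARD('n) - 1" "0 < CARD('n)" by simp_all
    then show ?thesis by (simp add: of_nat_diff Suc_leI)
   qed
   finally show ?thesis using fx by (simp add: f_def)
  qed
  then have "\<exists>m::int. \<bar>(x $ i - p $ i) - 2 * pi * m\<bar> < s" for i by (rule cos_gt_near[OF s])
  then obtain m :: "'n => int" where m: "!!i. \<bar>(x $ i - p $ i) - 2 * pi * m i\<bar> < s" by metis
  define e where "e = (\<chi> i. 2 * pi * real_of_int (m i))"
  have "e \<in> lattice" by (auto simp: e_def lattice_def)
  have "norm (x - e - p) <= (\<Sum>i\<in>UNIV. \<bar>(x - e - p) $ i\<bar>)" by (rule norm_le_l1_cart)
  also have "... <= (\<Sum>i\<in>(UNIV::'n set). s)"
   by (intro sum_mono) (use m in \<open>auto simp: e_def diff_diff_eq add.commute less_imp_le\<close>)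
  also have "... <= \<rho>" using s3 by (simp add: mult.commute)
  finally show ?thesis using \<open>e \<in> lattice\<close> by blast
 qed
 ultimately show thesis using that by blast
qed

lemma integral_pos:
 fixes f :: "real ^ 'n => real"
 assumes f: "continuous_on UNIV f" "periodic f" "!!x. 0 <= f x" and p: "f p > 0"
 shows "0 < integral cell f"
proof -
 obtain c where c: "c \<in> lattice" "p + c \<in> cell" using lattice_translate_to_cell by blast
 have ne: "box 0 (\<chi> i::'n. 2 * pi) ~= {}"
 proof -
  have "(\<chi> i::'n. pi) \<in> box 0 (\<chi> i. 2 * pi)" by (simp add: mem_box_cart)
  then show ?thesis by blast
 qed
 have "integral cell f ~= 0"
 proof
  assume "integral cell f = 0"
  then have "f (p + c) = 0"
   using integral_cbox_eq_0_iff[OF continuous_on_subset[OF f(1) subset_UNIV] ne] f(3) c(2) unfolding cell_def by blast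
  then show False using periodic_lattice[OF f(2) c(1), of p] p by simp
 qed
 moreover have "0 <= integral cell f" by (intro integral_nonneg integrable_cell(2) f)
 ultimately show ?thesis by linarith
qed

lemma C11_continuous: "C11_field f f' L ==> continuous_on S f"
 by (rule continuous_on_lipschitz[OF C11_field_lipschitz])

text \<open>In the frame moving with \<nu>, position and accumulated divergence form a slow system
  with velocities of order \<epsilon>. Its running mean satisfies the averaged equation up to order
  \<epsilon>^2, which is what \<open>source_growth\<close> asks for.\<close>

lemma divergence_growth:
 fixes \<nu> :: "nat ^ 'n" and V :: "real => real ^ 'n => real ^ 'n"
 assumes sm: "smooth (%(t, x). V t x)" and pt: "!!t x. V (t + 2 * pi) x = V t x" and px: "!!t. periodic (V t)"
  and ms: "morse_smale (average \<nu> V)" and one: "CARD('n) = 1 ==> \<exists>x. average \<nu> V x = 0"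
 obtains p \<rho> c C \<epsilon>0 where "0 < \<rho>" "0 < c" "0 <= C" "0 < \<epsilon>0"
  "!!\<epsilon> y t. [|0 <= \<epsilon>; \<epsilon> <= \<epsilon>0; !!s. (y has_vector_derivative - (nat_vec \<nu> + \<epsilon> *\<^sub>R V s (y s))) (at s);
   \<exists>q\<in>lattice. norm (y 0 - q - p) <= \<rho>; 0 <= t|] ==> c * \<epsilon> * t - C <= antider (%s. \<epsilon> * divergence (V s) (y s)) t"
proof -
 define b where "b = nat_vec \<nu>"
 define d where "d t x = divergence (V t) x" for t x
 obtain V' L D' M B where regV: "C11_field (%(t, x). V t x) V' L" and regD: "C11_field (%(t, x). d t x) D' M"
  and dV': "!!t x. divergence (V t) x = (\<Sum>i\<in>UNIV. V' (t, x) (0, axis i 1) $ i)"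
  and perD: "!!t. periodic (d t)"
  and BV: "!!t x. norm (V t x) <= B" and BD: "!!t x. \<bar>d t x\<bar> <= B"
  unfolding d_def by (rule field_regularity[OF sm pt px]) blast
 have B0: "0 <= B" using order_trans[OF norm_ge_zero BV] .
 obtain Y' LY where YC: "C11_field (%x. - average \<nu> V x) Y' LY" and Yper: "periodic (%x. - average \<nu> V x)"
  and tr: "!!x. trace_of (Y' x) = - (1 / (2 * pi)) * integral {0..2 * pi} (%t. divergence (V t) (x - t *\<^sub>R nat_vec \<nu>))"
  by (rule average_regularity[OF regV px dV', of \<nu>]) blast
 define Y where "Y = (%x. - average \<nu> V x)"
 interpret torus_field Y Y' LY by unfold_locales (use YC Yper in \<open>simp_all add: Y_def\<close>)
 have X: "X = average \<nu> V" by (rule ext) (unfold X_def, simp add: Y_def)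
 obtain Dc where Dc: "crit_data Dc" using morse_smale_crit_data ms unfolding X[symmetric] by blast
 have "\<exists>z. Y z = 0" if "CARD('n) = 1" using one[OF that] by (simp add: Y_def)
 then obtain p T k where pp: "periodic_point p T k" and ret: "!!h. norm (ret p T h) <= norm h / 4"
  and neg: "antider (%s. trace_of (Y' (flow s p))) T < 0" using source_exists[OF Dc] by blast
 define dbar where "dbar x = - trace_of (Y' x)" for x
 have dbar: "(2 * pi) * dbar x = integral {0..2 * pi} (%t. d t (x - t *\<^sub>R b))" for x
  unfolding dbar_def tr by (simp add: d_def b_def)
 obtain K0 where K0: "0 <= K0" "!!A :: (real ^ 'n) \<Rightarrow>\<^sub>L (real ^ 'n). norm (trace_of A) <= norm A * K0"
  using bounded_linear.nonneg_bounded[OF bounded_linear_trace_of] by blast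
 have lipd: "\<bar>dbar x - dbar y\<bar> <= (LY * K0) * norm (x - y)" for x y
 proof -
  have "dbar x - dbar y = - trace_of (Y' x - Y' y)"
   by (simp add: dbar_def linear_diff[OF bounded_linear.linear[OF bounded_linear_trace_of]])
  then have "\<bar>dbar x - dbar y\<bar> <= norm (Y' x - Y' y) * K0" using K0(2)[of "Y' x - Y' y"] by simp
  also have "... <= (LY * norm (x - y)) * K0" by (intro mult_right_mono X'_lip K0)
  finally show ?thesis by (simp add: mult_ac)
 qed
 have bd: "\<bar>dbar x\<bar> <= LY * K0" for x
 proof -
  have "\<bar>dbar x\<bar> <= norm (Y' x) * K0" using K0(2)[of "Y' x"] by (simp add: dbar_def)
  also have "... <= LY * K0" by (intro mult_right_mono norm_X' K0)
  finally show ?thesis .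
 qed
 have dl: "d t (x + c) = d t x" "V t (x + c) = V t x" if "c \<in> lattice" for t x c
  using periodic_lattice[OF perD that] periodic_lattice[OF px that] by auto
 have perd: "periodic dbar"
 proof -
  have "(2 * pi) * dbar (x + axis i (2 * pi)) = (2 * pi) * dbar x" for x i
  proof -
   have "d t (x + axis i (2 * pi) - t *\<^sub>R b) = d t (x - t *\<^sub>R b)" for t
   proof -
    have "x + axis i (2 * pi) - t *\<^sub>R b = (x - t *\<^sub>R b) + axis i (2 * pi)" by simp
    then show ?thesis by (simp only: dl(1)[OF axis_lattice])
   qed
   then show ?thesis unfolding dbar by simp
  qed
  then show ?thesis by (simp add: periodic_def)
 qed
 have gain: "0 < antider (%s. dbar (flow s p)) T" using neg pp by (simp add: antider_def dbar_def periodic_point_def)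
 \<comment> \<open>The field in the moving frame. It keeps the period \<open>2 * pi\<close> in time
   because \<nu> is an integer vector, so that the frame moves by a lattice vector in one
   period.\<close>
 define G where "G t x = (- V t (x - t *\<^sub>R b), d t (x - t *\<^sub>R b))" for t x
 have LM: "L > 0" "M > 0" using regV regD by (auto simp: C11_field_def)
 have lipG: "norm (G t x - G t y) <= (L + M) * norm (x - y)" for t x y
 proof -
  have 1: "norm (V t (x - t *\<^sub>R b) - V t (y - t *\<^sub>R b)) <= L * norm (x - y)"
   using C11_field_lipschitz[OF regV, of "(t, x - t *\<^sub>R b)" "(t, y - t *\<^sub>R b)"] by (simp add: norm_Pair)
  have 2: "norm (d t (x - t *\<^sub>R b) - d t (y - t *\<^sub>R b)) <= M * norm (x - y)"
   using C11_field_lipschitz[OF regD, of "(t, x - t *\<^sub>R b)" "(t, y - t *\<^sub>R b)"] by (simp add: norm_Pair)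
  have "norm (G t x - G t y) <= norm (- V t (x - t *\<^sub>R b) + V t (y - t *\<^sub>R b)) + norm (d t (x - t *\<^sub>R b) - d t (y - t *\<^sub>R b))"
   unfolding G_def using norm_Pair_le[of "- V t (x - t *\<^sub>R b) + V t (y - t *\<^sub>R b)" "d t (x - t *\<^sub>R b) - d t (y - t *\<^sub>R b)"] by simp
  also have "norm (- V t (x - t *\<^sub>R b) + V t (y - t *\<^sub>R b)) = norm (V t (x - t *\<^sub>R b) - V t (y - t *\<^sub>R b))"
   by (simp add: norm_minus_commute)
  finally show ?thesis using 1 2 by (simp add: distrib_right)
 qed
 have bG: "norm (G t x) <= 2 * B" for t x
  using norm_Pair_le[of "- V t (x - t *\<^sub>R b)" "d t (x - t *\<^sub>R b)"] BV[of t "x - t *\<^sub>R b"] BD[of t "x - t *\<^sub>R b"] by (simp add: G_def)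
 have cV: "continuous_on UNIV (%(t, x). V t x)" and cD: "continuous_on UNIV (%(t, x). d t x)"
  by (rule C11_continuous[OF regV] C11_continuous[OF regD])+
 have cG: "continuous_on UNIV (%(t, x). G t x)"
 proof -
  have 1: "continuous_on UNIV (%q :: real \<times> (real ^ 'n). (fst q, snd q - fst q *\<^sub>R b))" by (intro continuous_intros)
  have "continuous_on UNIV (%q. V (fst q) (snd q - fst q *\<^sub>R b))" "continuous_on UNIV (%q. d (fst q) (snd q - fst q *\<^sub>R b))"
   using continuous_on_compose2[OF cV 1] continuous_on_compose2[OF cD 1] by simp_all
  then show ?thesis unfolding G_def split_beta by (intro continuous_intros)
 qed
 have pG: "G (t + 2 * pi) x = G t x" for t x
 proof -
  have "(2 * pi) *\<^sub>R b \<in> lattice"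
  proof -
   have "((2 * pi) *\<^sub>R b) $ i = 2 * pi * real_of_int (int (\<nu> $ i))" for i by (simp add: b_def nat_vec_def)
   then show ?thesis unfolding lattice_def by blast
  qed
  then have m: "- ((2 * pi) *\<^sub>R b) \<in> lattice" by (rule lattice_minus)
  have e: "x - (t + 2 * pi) *\<^sub>R b = (x - t *\<^sub>R b) + - ((2 * pi) *\<^sub>R b)" by (simp add: algebra_simps)
  have "V (t + 2 * pi) = V t" by (rule ext) (rule pt)
  then show ?thesis unfolding G_def e dl[OF m] by (simp add: d_def)
 qed
 have avg: "integral {0..2 * pi} (%t. G t x) = (2 * pi) *\<^sub>R (Y x, dbar x)" for x
 proof -
  have "continuous_on UNIV (%t::real. (t, x))" by (intro continuous_intros)
  from continuous_on_compose2[OF cG this] have "continuous_on UNIV (%t. G t x)" by simp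
  then have i: "(%t. G t x) integrable_on {0..2 * pi}" using continuous_on_subset integrable_continuous_real by blast
  have 1: "fst (integral {0..2 * pi} (%t. G t x)) = integral {0..2 * pi} (%t. - V t (x - t *\<^sub>R b))"
   using integral_linear[OF i bounded_linear_fst] by (simp add: o_def G_def)
  have 2: "snd (integral {0..2 * pi} (%t. G t x)) = integral {0..2 * pi} (%t. d t (x - t *\<^sub>R b))"
   using integral_linear[OF i bounded_linear_snd] by (simp add: o_def G_def)
  have "integral {0..2 * pi} (%t. - V t (x - t *\<^sub>R b)) = (2 * pi) *\<^sub>R Y x"
   by (simp add: Y_def average_def b_def)
  then show ?thesis using 1 2 by (simp add: prod_eq_iff dbar)
 qed
 define CC where "CC = 4 * pi * (L + M) * (2 * B)"
 have CC: "0 <= CC" using LM B0 by (simp add: CC_def)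
 have K1: "0 <= LY * K0" using K0 Lpos by simp
 obtain \<rho> c C' \<epsilon>1 where g: "0 < \<rho>" "0 < c" "0 < \<epsilon>1" and grow:
  "!!\<epsilon> w w' t. [|0 < \<epsilon>; \<epsilon> <= \<epsilon>1; !!t. (w has_vector_derivative w' t) (at t);
   !!t. norm (w' t - \<epsilon> *\<^sub>R (Y (fst (w t)), dbar (fst (w t)))) <= CC * \<epsilon>\<^sup>2;
   \<exists>q\<in>lattice. norm (fst (w 0) - q - p) <= \<rho>; 0 <= t|] ==> c * \<epsilon> * t - C' <= snd (w t) - snd (w 0)"
  by (rule source_growth[OF lipd K1 perd bd CC pp ret gain]) blast
 \<comment> \<open>The running mean differs from the solution by at most
   \<open>4 * pi * B * \<epsilon>\<close>; this is kept below half the radius of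
   \<open>source_growth\<close>, and the solution itself starts in the other half.\<close>
 define \<epsilon>0 where "\<epsilon>0 = min \<epsilon>1 (min 1 (\<rho> / (2 * (4 * pi * B + 1))))"
 \<comment> \<open>The second summand accounts for the difference between running mean and solution
   at both ends of the time interval.\<close>
 define C where "C = max 0 C' + 8 * pi * B"
 have pB: "0 <= pi * B" using B0 by simp
 have den: "4 * pi * B + 1 > 0" using pB by linarith
 have \<epsilon>0: "0 < \<epsilon>0" "\<epsilon>0 <= \<epsilon>1" "\<epsilon>0 <= 1" "(4 * pi * B + 1) * \<epsilon>0 <= \<rho> / 2"
 proof -
  show "0 < \<epsilon>0" using g den by (simp add: \<epsilon>0_def)
  show "\<epsilon>0 <= \<epsilon>1" "\<epsilon>0 <= 1" unfolding \<epsilon>0_def by linarith+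
  have "\<epsilon>0 <= \<rho> / (2 * (4 * pi * B + 1))" unfolding \<epsilon>0_def by linarith
  then have "(4 * pi * B + 1) * \<epsilon>0 <= (4 * pi * B + 1) * (\<rho> / (2 * (4 * pi * B + 1)))" using den by (intro mult_left_mono) auto
  also have "... = \<rho> / 2"
  proof -
   have "Q * (\<rho> / (2 * Q)) = \<rho> / 2" if "Q > 0" for Q using that by simp
   then show ?thesis using den by blast
  qed
  finally show "(4 * pi * B + 1) * \<epsilon>0 <= \<rho> / 2" .
 qed
 have "c * \<epsilon> * t - C <= antider (%s. \<epsilon> * divergence (V s) (y s)) t"
  if \<epsilon>: "0 <= \<epsilon>" "\<epsilon> <= \<epsilon>0" and y: "!!s. (y has_vector_derivative - (nat_vec \<nu> + \<epsilon> *\<^sub>R V s (y s))) (at s)"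
   and y0: "\<exists>q\<in>lattice. norm (y 0 - q - p) <= \<rho> / 2" and t: "0 <= t" for \<epsilon> y t
 proof (cases "\<epsilon> = 0")
  case True
  have "antider (%s. 0 :: real) t = 0" by (simp add: antider_def)
  then show ?thesis using True pB by (simp add: C_def)
 next
  case False
  then have \<epsilon>p: "0 < \<epsilon>" using \<epsilon> by simp
  define l where "l = antider (%s. \<epsilon> * d s (y s))"
  have cy: "continuous_on UNIV y"
   using y has_vector_derivative_continuous by (blast intro: continuous_at_imp_continuous_on)
  have "continuous_on UNIV (%s. (s, y s))" by (intro continuous_intros cy)
  from continuous_on_compose2[OF cD this] have "continuous_on UNIV (%s. d s (y s))" by simp
  then have dl: "(l has_vector_derivative \<epsilon> * d s (y s)) (at s)" for s
   unfolding l_def by (intro antider_has_vector_derivative continuous_intros)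
  define s where "s r = (y r + r *\<^sub>R b, l r)" for r
  have ds: "(s has_vector_derivative \<epsilon> *\<^sub>R G r (fst (s r))) (at r)" for r
  proof -
   have "((%r. y r + r *\<^sub>R b) has_vector_derivative - (nat_vec \<nu> + \<epsilon> *\<^sub>R V r (y r)) + b) (at r)"
    by (intro has_vector_derivative_add y) (auto intro!: derivative_eq_intros)
   from has_vector_derivative_Pair[OF this dl[of r]] show ?thesis unfolding s_def by (simp add: G_def b_def)
  qed
  obtain w w' where w: "!!t. norm (w t - s t) <= 2 * pi * (2 * B) * \<epsilon>" "!!t. (w has_vector_derivative w' t) (at t)"
   "!!t. norm (w' t - \<epsilon> *\<^sub>R (Y (fst (w t)), dbar (fst (w t)))) <= 4 * pi * (L + M) * (2 * B) * \<epsilon>\<^sup>2"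
   by (rule running_mean[OF cG pG lipG _ bG avg ds \<epsilon>(1)]) (use LM in auto)
  have near: "norm (fst (w t) - fst (s t)) <= 4 * pi * B * \<epsilon>" "\<bar>snd (w t) - snd (s t)\<bar> <= 4 * pi * B * \<epsilon>" for t
   using norm_fst_le_norm[of "w t - s t"] norm_snd_le_norm[of "w t - s t"] w(1)[of t] by simp_all
  have small: "4 * pi * B * \<epsilon> <= \<rho> / 2" "4 * pi * B * \<epsilon> <= 4 * pi * B"
  proof -
   have "4 * pi * B * \<epsilon> <= (4 * pi * B + 1) * \<epsilon>0" using \<epsilon> pB by (intro mult_mono) auto
   then show "4 * pi * B * \<epsilon> <= \<rho> / 2" using \<epsilon>0(4) by linarith
   have "(pi * B) * \<epsilon> <= (pi * B) * 1" by (rule mult_left_mono[OF _ pB]) (use \<epsilon> \<epsilon>0(3) in linarith)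
   then show "4 * pi * B * \<epsilon> <= 4 * pi * B" by linarith
  qed
  obtain q where q: "q \<in> lattice" "norm (y 0 - q - p) <= \<rho> / 2" using y0 by blast
  have "fst (w 0) - q - p = (fst (w 0) - fst (s 0)) + (y 0 - q - p)" by (simp add: s_def)
  then have "norm (fst (w 0) - q - p) <= norm (fst (w 0) - fst (s 0)) + norm (y 0 - q - p)" by (simp only: norm_triangle_ineq)
  then have "norm (fst (w 0) - q - p) <= \<rho>" using near(1)[of 0] small(1) q(2) by linarith
  then have "\<exists>q\<in>lattice. norm (fst (w 0) - q - p) <= \<rho>" using q(1) by blast
  from grow[OF \<epsilon>p _ w(2) _ this t] have "c * \<epsilon> * t - C' <= snd (w t) - snd (w 0)"
   using \<epsilon>(2) \<epsilon>0(2) w(3) by (simp add: CC_def)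
  moreover have "snd (s t) = l t" "snd (s 0) = 0" by (simp_all add: s_def l_def)
  moreover have "l t = antider (%s. \<epsilon> * divergence (V s) (y s)) t" by (simp add: l_def d_def)
  moreover have "C' + 8 * pi * B <= C" by (simp add: C_def)
  ultimately show ?thesis using near(2)[of t] near(2)[of 0] small(2) by linarith
 qed
 moreover have "0 <= C" "0 < \<rho> / 2" using pB g by (simp_all add: C_def)
 ultimately show thesis using that[of "\<rho> / 2" c C \<epsilon>0 p] g(2) \<epsilon>0(1) by blast
qed

theorem theorem5p5:
  fixes \<nu> :: "nat ^ 'n" and V :: "real \<Rightarrow> real ^ 'n \<Rightarrow> real ^ 'n"
  assumes "\<nu> \<noteq> 0"
    and "smooth (\<lambda>(t, x). V t x)"
    and "\<And>t x. V (t + 2 * pi) x = V t x"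
    and "\<And>t. periodic (V t)"
    and "morse_smale (average \<nu> V)"
    and "CARD('n) = 1 \<Longrightarrow> \<exists>x. average \<nu> V x = 0"
  shows "\<exists>\<delta>0>0. \<forall>\<sigma> \<epsilon>. 0 \<le> \<sigma> \<and> \<sigma> \<le> \<delta>0 \<and> 0 \<le> \<epsilon> \<and> \<epsilon> \<le> \<delta>0 * \<sigma>\<^sup>2 \<longrightarrow>
    (\<exists>v\<in>sobolev \<sigma>. \<exists>r>0. \<forall>u. is_solution \<nu> V \<epsilon> \<sigma> u \<and>
        sobolev_norm \<sigma> (\<lambda>x. u 0 x - v x) \<le> r \<longrightarrow>
        (\<forall>t>0. sobolev_norm \<sigma> (u t) \<ge> \<delta>0 * exp (\<delta>0 * \<sigma> * t * \<epsilon>) * sobolev_norm \<sigma> (u 0)))"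
proof -
 define b where "b = nat_vec \<nu>"
 define d where "d t x = divergence (V t) x" for t x
 obtain V' L D' M B where regV: "C11_field (%(t, x). V t x) V' L" and regD: "C11_field (%(t, x). d t x) D' M"
  and perD: "!!t. periodic (d t)" and derV: "!!t x. (V t has_derivative (%h. V' (t, x) (0, h))) (at x)"
  unfolding d_def by (rule field_regularity[OF assms(2,3,4)]) blast
 obtain p \<rho> c C \<epsilon>0 where g: "0 < \<rho>" "0 < c" "0 <= C" "0 < \<epsilon>0" and growth:
  "!!\<epsilon> y t. [|0 <= \<epsilon>; \<epsilon> <= \<epsilon>0; !!s. (y has_vector_derivative - (b + \<epsilon> *\<^sub>R V s (y s))) (at s);
   \<exists>q\<in>lattice. norm (y 0 - q - p) <= \<rho>; 0 <= t|] ==> c * \<epsilon> * t - C <= antider (%s. \<epsilon> * d s (y s)) t"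
  unfolding d_def b_def by (rule divergence_growth[OF assms(2-5)]) (erule assms(6), blast)
 obtain w0 gr where w0: "!!x. (w0 has_derivative (%h. gr x \<bullet> h)) (at x)" "continuous_on UNIV gr" "periodic w0"
  "!!x. 0 <= w0 x" "w0 p > 0" "!!x. w0 x ~= 0 ==> \<exists>q\<in>lattice. norm (x - q - p) <= \<rho>"
  by (rule bump_exists[OF g(1), of p]) blast
 have cw0: "continuous_on UNIV w0" using w0(1) has_derivative_continuous by (blast intro: continuous_at_imp_continuous_on)
 have dw2: "((%x. (w0 x)\<^sup>2) has_derivative (%h. ((2 * w0 x) *\<^sub>R gr x) \<bullet> h)) (at x)" for x
  using has_derivative_power[OF w0(1), of 2 x] by (simp add: mult_ac)
 have cg2: "continuous_on UNIV (%x. (2 * w0 x) *\<^sub>R gr x)" by (intro continuous_intros cw0 w0(2))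
 have pw2: "periodic (%x. (w0 x)\<^sup>2)" using w0(3) by (simp add: periodic_def)
 define n where "n = real CARD('n)"
 have n: "n >= 1" unfolding n_def by (simp add: Suc_leI)
 define vol where "vol = torus_vol TYPE('n)"
 have vol: "vol > 0" by (simp add: vol_def torus_vol_pos)
 define I where "I = integral cell w0"
 define J where "J = integral cell (%x. (w0 x)\<^sup>2)"
 have I: "I > 0" unfolding I_def by (rule integral_pos[OF cw0 w0(3,4,5)])
 have J: "J >= 0" unfolding J_def by (intro integral_nonneg integrable_cell(2) continuous_intros cw0) auto
 define C1 where "C1 = exp (C / 2) * I"
 define Dn where "Dn = sqrt (5 ^ CARD('n) * C1\<^sup>2 / vol + J) + 1"
 have Dn: "Dn > 0" using vol J by (simp add: Dn_def add_nonneg_pos)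
 \<comment> \<open>The constant 1 has pairing \<open>I\<close> with \<open>w0\<close>; a
   perturbation of this size changes it by at most \<open>I / 2\<close>.\<close>
 define r where "r = I / (2 * (sqrt J + 1))"
 have sJ: "sqrt J + 1 > 0" using J by (simp add: add_nonneg_pos)
 have r: "r > 0" using I sJ by (simp add: r_def)
 have rJ: "r * sqrt J <= I / 2"
 proof -
  have "r * sqrt J <= r * (sqrt J + 1)" using r by (intro mult_left_mono) auto
  also have "... = I / 2"
  proof -
   have "I / (2 * q) * q = I / 2" if "q > 0" for q using that by simp
   then show ?thesis unfolding r_def using sJ by blast
  qed
  finally show ?thesis .
 qed
 define Q where "Q = r + sqrt vol"
 have Q: "Q > 0" using r vol by (simp add: Q_def add_pos_pos)
 \<comment> \<open>The bound 1/2 gives \<open>2 * \<sigma> <= 1\<close> and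
   \<open>\<sigma>\<^sup>2 <= 1\<close>, the next one \<open>\<epsilon> <= \<epsilon>0\<close>. The
   third fits the exponent and the last the prefactor, where \<open>Q\<close> bounds the initial
   norm.\<close>
 define \<delta>0 where "\<delta>0 = min (min (1 / 2) \<epsilon>0) (min (c / (2 * n)) (I / (2 * Dn * Q)))"
 have \<delta>0: "\<delta>0 > 0" "\<delta>0 <= 1 / 2" "\<delta>0 <= \<epsilon>0" "\<delta>0 <= c / (2 * n)" "\<delta>0 <= I / (2 * Dn * Q)"
 proof -
  show "\<delta>0 > 0" unfolding \<delta>0_def using g n I Dn Q by simp
  show "\<delta>0 <= 1 / 2" "\<delta>0 <= \<epsilon>0" "\<delta>0 <= c / (2 * n)" "\<delta>0 <= I / (2 * Dn * Q)" unfolding \<delta>0_def by linarith+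
 qed
 have "\<exists>v\<in>sobolev \<sigma>. \<exists>r>0. \<forall>u. is_solution \<nu> V \<epsilon> \<sigma> u & sobolev_norm \<sigma> (%x. u 0 x - v x) <= r -->
    (\<forall>t>0. sobolev_norm \<sigma> (u t) >= \<delta>0 * exp (\<delta>0 * \<sigma> * t * \<epsilon>) * sobolev_norm \<sigma> (u 0))"
  if \<sigma>: "0 <= \<sigma>" "\<sigma> <= \<delta>0" and \<epsilon>: "0 <= \<epsilon>" "\<epsilon> <= \<delta>0 * \<sigma>\<^sup>2" for \<sigma> \<epsilon>
 proof -
  have \<epsilon>1: "\<epsilon> <= \<epsilon>0"
  proof -
   have "\<sigma>\<^sup>2 <= 1" using \<sigma> \<delta>0(2) by (intro power_le_one) auto
   then have "\<delta>0 * \<sigma>\<^sup>2 <= \<delta>0 * 1" using \<delta>0(1) by (intro mult_left_mono) auto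
   then show ?thesis using \<epsilon>(2) \<delta>0(3) by linarith
  qed
  obtain \<Phi> m where init: "!!x. \<Phi> 0 x = x" "!!x. m 0 x = 0"
   and orbit: "!!t x. \<exists>y. y 0 = \<Phi> t x & (\<forall>s. (y has_vector_derivative - (b + \<epsilon> *\<^sub>R V s (y s))) (at s)) &
    m t x = - antider (%s. \<epsilon> * d s (y s)) t"
   and weight: "!!\<kappa> w0 g. [|!!x. (w0 has_derivative (%h. g x \<bullet> h)) (at x); continuous_on UNIV g; periodic w0|] ==>
    \<exists>w'. C1_weight (transport_weight \<Phi> m \<kappa> w0) w' &
    (\<forall>t x. w' (t, x) (1, - (b + \<epsilon> *\<^sub>R V t x)) = \<kappa> * (\<epsilon> * d t x) * transport_weight \<Phi> m \<kappa> w0 t x)"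
   by (rule transport_weights[OF regV regD assms(4) perD, of b \<epsilon>]) blast
  define a where "a t x = b + \<epsilon> *\<^sub>R V t x" for t x
  define a' where "a' t x h = \<epsilon> *\<^sub>R V' (t, x) (0, h)" for t x h
  have da: "(a t has_derivative a' t x) (at x)" for t x unfolding a_def a'_def
   using has_derivative_add[OF has_derivative_const[of b] has_derivative_scaleR_right[OF derV[of t x], of \<epsilon>]] by simp
  have diva: "divergence (a t) x = \<epsilon> * d t x" for t x
  proof -
   have "frechet_derivative (a t) (at x) = a' t x" using frechet_derivative_at[OF da] by simp
   moreover have "frechet_derivative (V t) (at x) = (%h. V' (t, x) (0, h))" using frechet_derivative_at[OF derV] by simp
   ultimately show ?thesis by (simp add: divergence_def d_def a'_def sum_distrib_left)
  qed
  have cV: "continuous_on UNIV (%(t, x). V t x)" and cD: "continuous_on UNIV (%(t, x). d t x)"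
   by (rule C11_continuous[OF regV] C11_continuous[OF regD])+
  have ca: "continuous_on UNIV (%(t, x). a t x)" and cED: "continuous_on UNIV (%(t, x). \<epsilon> * d t x)"
   using cV cD unfolding a_def split_beta by (auto intro!: continuous_intros)
  have pa: "periodic (a t)" and pED: "periodic (%x. \<epsilon> * d t x)" for t
   using assms(4)[of t] perD[of t] by (simp_all add: periodic_def a_def)
  have ca': "continuous_on UNIV (%x. a' t x h)" for t h
  proof -
   have "norm (V' x - V' y) <= L * norm (x - y)" for x y using regV unfolding C11_field_def by blast
   then have cV': "continuous_on UNIV V'" by (rule continuous_on_lipschitz)
   have "continuous_on UNIV (%x. (t, x))" by (intro continuous_intros)
   from continuous_on_compose2[OF cV' this] have "continuous_on UNIV (%x. V' (t, x))" by simp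
   then show ?thesis unfolding a'_def by (intro continuous_intros)
  qed
  \<comment> \<open>\<open>w\<close> solves the adjoint equation. The integrals of \<open>w1\<close>
    and \<open>w2\<close> are constant in time; since \<open>w2\<close> is the square of
    \<open>w\<close>, this bounds the L2 norm of \<open>w\<close>, and the L1 norm follows by
    writing \<open>w\<close> as exp (m/2) times \<open>w1\<close>.\<close>
  define w where "w = transport_weight \<Phi> m (1 / 2) w0"
  define w1 where "w1 = transport_weight \<Phi> m 1 w0"
  define w2 where "w2 = transport_weight \<Phi> m 1 (%x. (w0 x)\<^sup>2)"
  obtain w' where w': "C1_weight w w'" "!!t x. w' (t, x) (1, - a t x) = 1 / 2 * (\<epsilon> * d t x) * w t x"
   using weight[OF w0(1-3), of "1 / 2"] unfolding w_def a_def by blast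
  obtain w1' where w1': "C1_weight w1 w1'" "!!t x. w1' (t, x) (1, - a t x) = divergence (a t) x * w1 t x"
   using weight[OF w0(1-3), of 1] unfolding diva w1_def unfolding a_def mult_1 by blast
  obtain w2' where w2': "C1_weight w2 w2'" "!!t x. w2' (t, x) (1, - a t x) = divergence (a t) x * w2 t x"
   using weight[OF dw2 cg2 pw2, of 1] unfolding diva w2_def unfolding a_def mult_1 by blast
  have I1: "integral cell (w1 t) = I" for t using C1_weight.integral_conserved[OF w1'(1) da pa ca' w1'(2), of t]
   by (simp add: I_def w1_def transport_weight_def[abs_def] init)
  have J1: "integral cell (w2 t) = J" for t using C1_weight.integral_conserved[OF w2'(1) da pa ca' w2'(2), of t]
   by (simp add: J_def w2_def transport_weight_def[abs_def] init)
  have w_0: "w 0 = w0" by (rule ext) (simp add: w_def transport_weight_def init)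
  have cw: "continuous_on UNIV (w t)" "periodic (w t)" "continuous_on UNIV (w1 t)" for t
   by (rule C1_weight.continuous_slice[OF w'(1) C1_weight.cont_w[OF w'(1)]] C1_weight.periodic_w[OF w'(1)]
     C1_weight.continuous_slice[OF w1'(1) C1_weight.cont_w[OF w1'(1)]])+
  have wsq: "(w t x)\<^sup>2 = w2 t x" for t x
   by (simp add: w_def w2_def transport_weight_def power_mult_distrib power2_eq_square exp_add[symmetric])
  \<comment> \<open>Where \<open>w\<close> does not vanish, the foot of the characteristic lies near
    the attracting orbit. There the accumulated divergence \<open>- m t x\<close> grows at least
    like \<open>c * \<epsilon> * t - C\<close>, and half of it appears in the exponent.\<close>
  have wle: "\<bar>w t x\<bar> <= exp (C / 2) * exp (- (c * \<epsilon> * t / 2)) * w1 t x" if t: "0 <= t" for t x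
  proof (cases "w0 (\<Phi> t x) = 0")
   case True
   then show ?thesis by (simp add: w_def w1_def transport_weight_def)
  next
   case False
   obtain y where y: "y 0 = \<Phi> t x" "!!s. (y has_vector_derivative - (b + \<epsilon> *\<^sub>R V s (y s))) (at s)"
    "m t x = - antider (%s. \<epsilon> * d s (y s)) t" using orbit[of t x] by blast
   have "c * \<epsilon> * t - C <= antider (%s. \<epsilon> * d s (y s)) t"
    using growth[OF \<epsilon>(1) \<epsilon>1 y(2) _ t] w0(6)[OF False] unfolding y(1) by blast
   then have mt: "m t x / 2 <= C / 2 + - (c * \<epsilon> * t / 2)" using y(3) by simp
   have "\<bar>w t x\<bar> = exp (m t x / 2) * w1 t x"
    using w0(4)[of "\<Phi> t x"] by (simp add: w_def w1_def transport_weight_def abs_mult exp_add[symmetric])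
   also have "... <= (exp (C / 2) * exp (- (c * \<epsilon> * t / 2))) * w1 t x"
   proof (rule mult_right_mono)
    show "exp (m t x / 2) <= exp (C / 2) * exp (- (c * \<epsilon> * t / 2))" using mt by (simp only: exp_add[symmetric] exp_le_cancel_iff)
    show "0 <= w1 t x" using w0(4) by (simp add: w1_def transport_weight_def)
   qed
   finally show ?thesis .
  qed
  have main: "\<delta>0 * exp (\<delta>0 * \<sigma> * t * \<epsilon>) * sobolev_norm \<sigma> (u 0) <= sobolev_norm \<sigma> (u t)"
   if sol: "is_solution \<nu> V \<epsilon> \<sigma> u" and close: "sobolev_norm \<sigma> (%x. u 0 x - 1) <= r" and t: "0 < t" for u t
  proof -
   have u: "continuous_in_sobolev \<sigma> u" and mem: "u s \<in> sobolev \<sigma>" for s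
    using sol by (auto simp: is_solution_def continuous_in_sobolev_def)
   have tr: "solves_transport a (%t x. 1 / 2 * (\<epsilon> * d t x)) u"
    using sol unfolding is_solution_def by (simp add: a_def[abs_def] b_def d_def)
   have dual: "pairing (u t) (w t) = pairing (u 0) (w 0)"
    by (rule C1_weight.transport_duality[OF w'(1) u \<sigma>(1) tr da diva ca pa cED pED w'(2) less_imp_le[OF t]])
   \<comment> \<open>The decay exponent of the L1 norm of \<open>w (t)\<close>, halved by the weight
     1/2.\<close>
   define \<gamma> where "\<gamma> = c * \<epsilon> * t / 2"
   have \<gamma>: "0 <= \<gamma>" using g \<epsilon> t by (simp add: \<gamma>_def)
   have L1: "integral cell (%x. \<bar>w t x\<bar>) <= C1 * exp (- \<gamma>)"
   proof -
    have "integral cell (%x. \<bar>w t x\<bar>) <= integral cell (%x. (exp (C / 2) * exp (- \<gamma>)) * w1 t x)"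
     using wle[of t] t by (intro integral_le integrable_cell(2) continuous_intros cw) (auto simp: \<gamma>_def)
    also have "... = exp (C / 2) * exp (- \<gamma>) * I" by (simp add: I1)
    finally show ?thesis by (simp add: C1_def mult_ac)
   qed
   have L2: "integral cell (%x. (w t x)\<^sup>2) <= J" by (simp add: wsq J1)
   have s2: "2 * \<sigma> <= real CARD('n)" using \<sigma> \<delta>0(2) n unfolding n_def by linarith
   have up: "cmod (pairing (u t) (w t)) <= sqrt (5 ^ CARD('n) * C1\<^sup>2 / vol + J) * sobolev_norm \<sigma> (u t) * exp (- \<sigma> * \<gamma> / CARD('n))"
    unfolding vol_def by (rule sobolev_decay[OF mem cw(1,2) \<sigma>(1) s2 \<gamma> L1 L2])
   define N where "N = sobolev_norm \<sigma> (u t)"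
   have N: "N >= 0" using sobolev_norm_nonneg[OF mem] by (simp add: N_def)
   have "cmod (pairing (u t) (w t)) <= Dn * N * exp (- \<sigma> * \<gamma> / n)"
    using up N by (simp add: Dn_def N_def n_def) (smt (verit) exp_ge_zero mult_nonneg_nonneg mult_right_mono)
   moreover have low: "I / 2 <= cmod (pairing (u 0) w0)"
   proof -
    obtain bw where bw: "!!x. \<bar>w0 x\<bar> <= bw" using continuous_periodic_bounded[OF cw0 w0(3)] by blast
    have uL: "u 0 \<in> L2_torus" using mem by (simp add: sobolev_def)
    have p1: "pairing (%x. 1) w0 = of_real I" unfolding pairing_def I_def of_real_cell_integral[OF cw0] by simp
    have "pairing (%x. u 0 x - 1) w0 = pairing (u 0) w0 - pairing (%x. 1) w0" unfolding pairing_def left_diff_distrib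
     by (rule set_integral_diff(2)[OF norm_pairing_le(1)[OF uL cw0 bw] norm_pairing_le(1)[OF const_L2 cw0 bw]])
    moreover have "cmod (pairing (%x. u 0 x - 1) w0) <= r * sqrt J"
    proof -
     have "(%x. u 0 x - 1) \<in> sobolev \<sigma>" by (rule sobolev_norm_le_diff(3)[OF mem sobolev_one(1)])
     then obtain h where h: "(%x. u 0 x - 1) \<in> L2_torus" "is_bessel \<sigma> (%x. u 0 x - 1) h"
      "sobolev_norm \<sigma> (%x. u 0 x - 1) = L2_norm_torus h" using sobolevE by blast
     have "cmod (pairing (%x. u 0 x - 1) w0) <= L2_norm_torus h * sqrt J"
      unfolding J_def by (rule sobolev_duality_L2[OF h(1,2) cw0 w0(3) \<sigma>(1)])
     also have "... <= r * sqrt J" using close h(3) J by (intro mult_right_mono) auto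
     finally show ?thesis .
    qed
    moreover have "cmod (pairing (%x. 1) w0) = I" using p1 I by simp
    moreover have "cmod (pairing (%x. 1) w0) <= cmod (pairing (u 0) w0) + cmod (pairing (u 0) w0 - pairing (%x. 1) w0)"
     using norm_triangle_ineq4[of "pairing (u 0) w0" "pairing (u 0) w0 - pairing (%x. 1) w0"] by simp
    ultimately show ?thesis using rJ by simp
   qed
   ultimately have 1: "I / 2 <= Dn * N * exp (- \<sigma> * \<gamma> / n)" using dual w_0 by simp
   have e1: "exp (- \<sigma> * \<gamma> / n) * exp (\<sigma> * \<gamma> / n) = 1" by (simp add: exp_add[symmetric])
   have "I / 2 * exp (\<sigma> * \<gamma> / n) <= Dn * N * exp (- \<sigma> * \<gamma> / n) * exp (\<sigma> * \<gamma> / n)" using 1 by (intro mult_right_mono) auto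
   also have "... = Dn * N" using e1 by (simp add: mult.assoc)
   finally have "I / 2 * exp (\<sigma> * \<gamma> / n) / Dn <= N" by (metis Dn mult.commute pos_divide_le_eq)
   moreover have "\<delta>0 * exp (\<delta>0 * \<sigma> * t * \<epsilon>) * sobolev_norm \<sigma> (u 0) <= I / 2 * exp (\<sigma> * \<gamma> / n) / Dn"
   proof -
    have u0: "sobolev_norm \<sigma> (u 0) <= Q"
     using sobolev_norm_le_diff(1)[OF mem[of 0] sobolev_one(1)] close by (simp add: Q_def vol_def sobolev_one(2))
    have ex: "exp (\<delta>0 * \<sigma> * t * \<epsilon>) <= exp (\<sigma> * \<gamma> / n)"
    proof -
     have "\<delta>0 * (\<sigma> * t * \<epsilon>) <= c / (2 * n) * (\<sigma> * t * \<epsilon>)" using \<delta>0(4) \<sigma> t \<epsilon> by (intro mult_right_mono) auto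
     then show ?thesis by (simp add: \<gamma>_def mult_ac)
    qed
    have "\<delta>0 * exp (\<delta>0 * \<sigma> * t * \<epsilon>) * sobolev_norm \<sigma> (u 0) <= (I / (2 * Dn * Q)) * exp (\<sigma> * \<gamma> / n) * Q"
     using \<delta>0 ex u0 I Dn Q sobolev_norm_nonneg[OF mem] by (intro mult_mono) auto
    also have "... = I / 2 * exp (\<sigma> * \<gamma> / n) / Dn" using Q Dn by simp
    finally show ?thesis .
   qed
   ultimately show ?thesis by (simp add: N_def)
  qed
  show ?thesis by (rule bexI[OF _ sobolev_one(1)], rule exI[of _ r]) (use r main in auto)
 qed
 then show ?thesis using \<delta>0(1) by blast
qed

end
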